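(* Let $Y=(Y_1,\dots,Y_s)^\top$ be a random vector with $E\,Y=0$, covariance matrix $\boldsymbol\Sigma_0$ and precision matrix $\boldsymbol\Omega_0=\boldsymbol\Sigma_0^{-1}$. Parametrize $s\times s$ positive definite matrices $\boldsymbol\Omega$ by the vectorized upper triangle (including the diagonal) $\theta\in\mathbb R^p$, $p=s(s+1)/2$, with $\theta_0$ corresponding to $\boldsymbol\Omega_0$, and consider the stacked moment function $g(Y,\theta)=(g_{ij}(Y,\theta))_{1\le i\le j\le s}$ with $$g_{ij}(Y,\theta)=Y_iY_j-(\boldsymbol\Omega^{-1})_{ij}.$$ Let $\mathbf V_n=n^{-1}\sum_{i=1}^n(g(D_i,\tilde\theta)-\bar g(\mathbf D,\tilde\theta))(g(D_i,\tilde\theta)-\bar g(\mathbf D,\tilde\theta))^\top$, where $D_1,\dots,D_n$ are the observations of $Y$ and $\tilde\theta$ is the parameter obtained by inverting the empirical covariance matrix. Suppose conditions (A1), (A2), (A3), (A7), (A8) listed in the context hold with $p=s(s+1)/2$ (and $\alpha=1$ in (A2)). In addition, suppose: (1) uniformly for all $\theta\in\Theta$, the corresponding $\boldsymbol\Omega$ has eigenvalues bounded above and below by (positive) constants; (2) $\sup_{1\le j\le s}E(Y_j^8)<\infty$; (3) the eigenvalues of $\mathbf V=\mathrm{Var}(g(D,\theta_0))$ are bounded from above and below by (positive) constants. Then conditions (A4), (A5), (A6) listed in the context hold with $\alpha=1$. Therefore the Bayesian oracle property holds: w.p.a.1 as $n\to\infty$, $q(\mathcal M_0\mid\mathbf D)\to1$,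 and $$\sup_{A\subseteq\Theta}\left|\int_A q(\theta\mid\mathbf D)\,d\theta-\int_{A\cap\Theta(\mathcal M_0)}\phi\left(\theta_1;\bar\theta_{\mathcal M_0,1},(\mathbf G_{\mathcal M_0}^\top\mathbf V_n^{-1}\mathbf G_{\mathcal M_0})^{-1}/n\right)d\theta_1\right|\to0,$$ where $\phi(\cdot;\mu,\boldsymbol\Sigma)$ is the normal density with mean $\mu$ and covariance $\boldsymbol\Sigma$, and $\bar\theta_{\mathcal M_0,1}=\theta_{0,\mathcal M_0,1}-(\mathbf G_{\mathcal M_0}^\top\mathbf V_n^{-1}\mathbf G_{\mathcal M_0})^{-1}\mathbf G_{\mathcal M_0}^\top\mathbf V_n^{-1}\bar g(\mathbf D,\theta_0)$.
   Context: Here $D=Y$ and $m=p=s(s+1)/2$. Setting. All objects may depend on the sample size $n$; "constant" means a number not depending on $n$; limits are as $n\to\infty$. $\mathbf D=\{D_1,\dots,D_n\}$ is the sample with law $P_{\mathbf D}$, and $D$ is a generic observation with law $P_D$. $o_p$, $O_p$ and "w.p.a.1" (with probability approaching 1) refer to $P_{\mathbf D}$. The parameter is $\theta\in\Theta\subseteq\mathbb R^p$; $g(D,\theta)\in\mathbb R^m$; $\bar g(\mathbf D,\theta)=n^{-1}\sum_{i=1}^n g(D_i,\theta)$. $\epsilon_n=\sqrt{p/n}$; $B_0(\epsilon)=\{\theta\in\Theta:\|\theta-\theta_0\|<\epsilon\}$. $\|\cdot\|$ is the Euclidean norm (operator norm for matrices). $a_n\prec b_n$ means $a_n=o(b_n)$,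 $a_n\preceq b_n$ means $a_n=O(b_n)$, and $a_n\asymp b_n$ means same order; $a\wedge b=\min(a,b)$. Models. A model $\mathcal M$ is a subset of the $p$ coordinates, of size $|\mathcal M|$ ($2^p$ models in total); $\Theta(\mathcal M)$ is the set of $\theta\in\Theta$ whose coordinates outside $\mathcal M$ vanish. Given $\mathcal M$, write $\theta=(\theta_1^\top,\theta_2^\top)^\top$ with $\theta_1\in\mathbb R^{|\mathcal M|}$ the coordinates in $\mathcal M$ and $\theta_2$ those outside (in the displayed integral, according to $\mathcal M_0$). $\theta_{0,(j)}$ is the $j$th coordinate of $\theta_0$, $\mathcal M_0=\{j:\theta_{0,(j)}\ne0\}$ is the true model, and $\theta_{0,\mathcal M,1}$ is the subvector of $\theta_0$ with coordinates in $\mathcal M$. The prior consists of model probabilities $\pi(\mathcal M)$ and, for each $\mathcal M$, a density $\pi(\theta\mid\mathcal M)$ (also written $\pi(\theta_1\mid\mathcal M)$) on $\Theta(\mathcal M)$ with respect to $|\mathcal M|$-dimensional Lebesgue measure; integrals over subsets of $\Theta(\mathcal M)$ are with respect to $\theta_1$. $\mathbf G_{\mathcal M}$ is the submatrix of $\mathbf G$ (defined in (A5)) of derivatives with respect to the coordinates in $\mathcal M$. Quasi-posterior. $q(\mathbf D\mid\theta)=\det(2\pi\mathbf V_n/n)^{-1/2}\exp\{-\tfrac n2\bar g(\mathbf D,\theta)^\top\mathbf V_n^{-1}\bar g(\mathbf D,\theta)\}$; $q(\mathbf D\mid\mathcal M)=\int_{\Theta(\mathcal M)}q(\mathbf D\mid\theta)\pi(\theta\mid\mathcal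 M)d\theta$; $q(\mathcal M\mid\mathbf D)=\pi(\mathcal M)q(\mathbf D\mid\mathcal M)/\sum_{\mathcal M'}\pi(\mathcal M')q(\mathbf D\mid\mathcal M')$; for measurable $A\subseteq\Theta$, $\int_A q(\theta\mid\mathbf D)d\theta=\sum_{\mathcal M}\pi(\mathcal M)\int_{A\cap\Theta(\mathcal M)}q(\mathbf D\mid\theta)\pi(\theta\mid\mathcal M)d\theta\big/\sum_{\mathcal M}\pi(\mathcal M)q(\mathbf D\mid\mathcal M)$. Conditions. (A1) $D_1,\dots,D_n$ are i.i.d.; $E\,g(D,\theta_0)=0$ for some $\theta_0\in\Theta$; $\Theta$ is compact and connected with $\sup_{\theta\in\Theta}\|\theta\|=R$ for some large constant $R>0$, and contains an open neighborhood of $\theta_0$. (A2) $p\le m$, $p\asymp m$, $p^4\ln^2n/n\to0$ and $p^{2+\alpha}\ln n/n^\alpha\to0$, with $\alpha$ from (A4). (A3) $\sqrt{\ln n}\,\epsilon_n\prec\min_{j\in\mathcal M_0}|\theta_{0,(j)}|\preceq1$. (A4) (i) For some constant $\alpha\in(0,1]$, uniformly in $\theta\in\Theta$, $\sup_{\eta\in\mathbb R^m,\|\eta\|=1}[E\{(\eta^\top(g(D,\theta)-g(D,\theta_0)))^2\}]^{1/2}\le O((\sqrt p\,\|\theta-\theta_0\|)^\alpha)$. (ii) The class $\mathcal F=\{\eta^\top(g(D,\theta)-g(D,\theta_0)):\theta\in\Theta,\eta\in\mathbb R^m,\|\eta\|=1\}$ has an envelope $F$ whose $L_2$ norm $\|F\|_{P_D,2}$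 is $O(\sqrt p)$, and its $L_2$ uniform covering number satisfies, for any small $\epsilon>0$, $\ln N(\epsilon\|F\|_{P_D,2},\mathcal F,L_2(P_D))=O(p\ln(n/\epsilon))$. (A5) (i) $\|E\,g(D,\theta)\|\ge\delta_0\wedge(\delta_1\|\theta-\theta_0\|)$ uniformly on $\Theta$ for positive constants $\delta_0,\delta_1$. (ii) $\mathbf G:=\nabla_\theta E\,g(D,\theta_0)$ exists and the eigenvalues of $\mathbf G^\top\mathbf G$ are bounded from below and above (by positive constants). (iii) $\mathbf H(\theta):=\nabla^2_{\theta\theta^\top}E\,g(D,\theta)$ exists for $\theta\in B_0(C\epsilon_n)$ and, uniformly over $B_0(C\epsilon_n)$ for any fixed $C>0$, $\sup_{\|u\|=\|v\|=1,\,u,v\in\mathbb R^p}\|\mathbf H(\theta)(u,v)\|=O(\sqrt p)$. (A6) $\mathbf V_n$ is positive definite for all $n$ and converges (in probability) in operator norm to $\mathbf V=\mathrm{Var}\{g(D,\theta_0)\}$; w.p.a.1 the eigenvalues of $\mathbf V_n$ and $\mathbf V$ lie between positive constants $\underline\lambda$ and $\bar\lambda$. (A7) (i) $\pi(\theta\mid\mathcal M)$ is a density restricted to $\Theta$, bounded above by a constant $c_\pi$ uniformly over all $\mathcal M$. (ii) Uniformly over all $\mathcal M\supseteq\mathcal M_0$, for any given $C>0$, $|\ln\pi(\theta_1\mid\mathcal M)-\ln\pi(\theta_{0,\mathcal M,1}\mid\mathcal M)|=o(1)$ if $\theta=(\theta_1^\top,0^\top)^\top\in\Theta(\mathcal M)\cap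 B_0(C\epsilon_n)$. (iii) There are constants $c_0,c_1>0$ such that, uniformly for all $\mathcal M\supseteq\mathcal M_0$, $\pi(\theta_0\mid\mathcal M)\ge e^{-c_0|\mathcal M|}$ and $|\ln\pi(\theta_{0,\mathcal M,1}\mid\mathcal M)-\ln\pi(\theta_0\mid\mathcal M_0)|\le c_1(|\mathcal M|-|\mathcal M_0|)$. (A8) (i) $\lim_{n\to\infty}\sup_{\mathcal M\supsetneq\mathcal M_0}\frac{\pi(\mathcal M)}{\pi(\mathcal M_0)}(p/\sqrt n)^{|\mathcal M|-|\mathcal M_0|}=0$. (ii) $\sup_{\mathcal M:\,\mathcal M_0\setminus\mathcal M\ne\emptyset}\pi(\mathcal M)/\pi(\mathcal M_0)\preceq e^{r_1p\ln n}$ for some constant $r_1>0$.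
   Formalization: In (A6), V_n is shown positive definite w.p.a.1, not for all n (a sample covariance has V_1 = 0); in (A1), the open neighborhood of θ_0 in Θ has radius not depending on n, since the normal limit fails for radius 1/n. *)

theory Defs
  imports
    "HOL-Probability.Probability"
    "HOL-Library.Landau_Symbols"
    "HOL-Library.Nat_Bijection"
    "Jordan_Normal_Form.Matrix"
    "Jordan_Normal_Form.Determinant"
    "Jordan_Normal_Form.Char_Poly"
    "Jordan_Normal_Form.Gauss_Jordan_Elimination"
    "Jordan_Normal_Form.DL_Submatrix"
begin

hide_const (open) Finite_Cartesian_Product.vec Finite_Cartesian_Product.mat
  Finite_Cartesian_Product.row Finite_Cartesian_Product.column
  Determinants.det Finite_Cartesian_Product.transpose
no_notation inner (infix "\<bullet>" 70)

text \<open>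
  Dimensions vary with the sample size \<open>n\<close>, so all objects are sequences indexed by \<open>n\<close>, and linear
  algebra uses vectors and matrices with dynamic dimension. A point of \<open>\<real>\<^sup>p\<close> used as a \<^emph>\<open>parameter\<close> is
  instead a function \<open>nat \<Rightarrow> real\<close> vanishing at all indices \<open>\<ge> p\<close> (see \<open>par_space\<close>): this type carries
  the product topology and its Borel sets, which on \<open>par_space p\<close> are the usual ones of \<open>\<real>\<^sup>p\<close>.
  Coordinates are numbered from 0 and a model is a subset of \<open>{..<p}\<close>. The expression \<open>vec p \<theta>\<close> turns
  a parameter into a vector.
\<close>

section \<open>Linear algebra\<close>

definition vnorm :: "real vec \<Rightarrow> real" where
  "vnorm v = sqrt (v \<bullet> v)"

definition unit_sphere :: "nat \<Rightarrow> real vec set" where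
  "unit_sphere k = {v \<in> carrier_vec k. vnorm v = 1}"

definition opnorm :: "real mat \<Rightarrow> real" where
  "opnorm A = (SUP v\<in>unit_sphere (dim_col A). vnorm (A *\<^sub>v v))"

text \<open>The inverse of a matrix; unspecified for singular matrices.\<close>
definition minv :: "real mat \<Rightarrow> real mat" where
  "minv A = the (mat_inverse A)"

definition pos_def :: "real mat \<Rightarrow> bool" where
  "pos_def A \<longleftrightarrow> square_mat A \<and> A\<^sup>T = A \<and>
     (\<forall>v\<in>carrier_vec (dim_row A). v \<noteq> 0\<^sub>v (dim_row A) \<longrightarrow> 0 < v \<bullet> (A *\<^sub>v v))"

text \<open>Only used for real symmetric matrices, all of whose eigenvalues are real.\<close>
definition eigenvalues_in :: "real mat \<Rightarrow> real set \<Rightarrow> bool" where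
  "eigenvalues_in A I \<longleftrightarrow> (\<forall>k. eigenvalue A k \<longrightarrow> k \<in> I)"

definition mvn_density :: "real vec \<Rightarrow> real mat \<Rightarrow> real vec \<Rightarrow> real" where
  "mvn_density \<mu> S x =
     det ((2 * pi) \<cdot>\<^sub>m S) powr (-1/2) * exp (- ((x - \<mu>) \<bullet> (minv S *\<^sub>v (x - \<mu>))) / 2)"

section \<open>Parameters and models\<close>

definition par_space :: "nat \<Rightarrow> (nat \<Rightarrow> real) set" where
  "par_space p = {\<theta>. \<forall>k\<ge>p. \<theta> k = 0}"

definition par_dist :: "nat \<Rightarrow> (nat \<Rightarrow> real) \<Rightarrow> (nat \<Rightarrow> real) \<Rightarrow> real" where
  "par_dist p \<theta> \<theta>' = vnorm (vec p \<theta> - vec p \<theta>')"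

definition par_ball :: "nat \<Rightarrow> (nat \<Rightarrow> real) set \<Rightarrow> (nat \<Rightarrow> real) \<Rightarrow> real \<Rightarrow> (nat \<Rightarrow> real) set" where
  "par_ball p Par \<theta>0 r = {\<theta>\<in>Par. par_dist p \<theta> \<theta>0 < r}"

text \<open>\<open>\<Theta>(\<M>)\<close>\<close>
definition par_model :: "(nat \<Rightarrow> real) set \<Rightarrow> nat set \<Rightarrow> (nat \<Rightarrow> real) set" where
  "par_model Par M = {\<theta>\<in>Par. \<forall>k. k \<notin> M \<longrightarrow> \<theta> k = 0}"

definition true_model :: "nat \<Rightarrow> (nat \<Rightarrow> real) \<Rightarrow> nat set" where
  "true_model p \<theta>0 = {k. k < p \<and> \<theta>0 k \<noteq> 0}"

text \<open>The coordinates of \<open>\<theta>\<close> in \<open>M\<close>, in increasing order (\<open>\<theta>\<^sub>1\<close>). The same order is used by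
  \<^const>\<open>submatrix\<close>.\<close>
definition subvec :: "nat set \<Rightarrow> (nat \<Rightarrow> real) \<Rightarrow> real vec" where
  "subvec M \<theta> = vec (card M) (\<lambda>i. \<theta> (pick M i))"

text \<open>\<open>|M|\<close>-dimensional Lebesgue measure in the coordinates \<open>\<theta>\<^sub>1\<close>, transported to parameters whose
  coordinates outside \<open>M\<close> vanish. For \<open>M = {}\<close> it is the unit mass at the zero parameter.\<close>
definition leb_model :: "nat set \<Rightarrow> (nat \<Rightarrow> real) measure" where
  "leb_model M =
     distr (Pi\<^sub>M M (\<lambda>_. lborel)) borel (\<lambda>x k. if k \<in> M then x k else 0)"

section \<open>Probability\<close>

text \<open>With probability approaching 1. For measurable \<open>{\<omega>. Q n \<omega>}\<close> this says that the
  probability tends to 1; in general it refers to inner probability.\<close>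
definition wpa1 :: "(nat \<Rightarrow> 'w measure) \<Rightarrow> (nat \<Rightarrow> 'w \<Rightarrow> bool) \<Rightarrow> bool" where
  "wpa1 Pr Q \<longleftrightarrow> (\<exists>E. (\<forall>n. E n \<in> sets (Pr n)) \<and> (\<lambda>n. measure (Pr n) (E n)) \<longlonglongrightarrow> 1 \<and>
     (\<forall>n. \<forall>\<omega>\<in>E n. Q n \<omega>))"

definition in_L2 :: "'d measure \<Rightarrow> ('d \<Rightarrow> real) \<Rightarrow> bool" where
  "in_L2 P f \<longleftrightarrow> f \<in> borel_measurable P \<and> integrable P (\<lambda>y. (f y)\<^sup>2)"

definition L2norm :: "'d measure \<Rightarrow> ('d \<Rightarrow> real) \<Rightarrow> real" where
  "L2norm P f = sqrt (\<integral>y. (f y)\<^sup>2 \<partial>P)"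

text \<open>\<open>N(\<epsilon>, F, L\<^sub>2(P))\<close>: the minimal number of \<open>L\<^sub>2(P)\<close>-balls of radius \<open>\<epsilon>\<close> covering \<open>F\<close>; the centres
  need not belong to \<open>F\<close>. It is infinite if there is no finite cover.\<close>
definition covering_number :: "real \<Rightarrow> ('d \<Rightarrow> real) set \<Rightarrow> 'd measure \<Rightarrow> enat" where
  "covering_number \<epsilon> F P =
     (INF C\<in>{C. finite C \<and> (\<forall>c\<in>C. in_L2 P c) \<and>
               (\<forall>f\<in>F. \<exists>c\<in>C. in_L2 P (\<lambda>y. f y - c y) \<and> L2norm P (\<lambda>y. f y - c y) < \<epsilon>)}. enat (card C))"

definition mean_vec :: "nat \<Rightarrow> 'd measure \<Rightarrow> ('d \<Rightarrow> real vec) \<Rightarrow> real vec" where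
  "mean_vec m P h = vec m (\<lambda>k. \<integral>y. h y $ k \<partial>P)"

definition var_mat :: "nat \<Rightarrow> 'd measure \<Rightarrow> ('d \<Rightarrow> real vec) \<Rightarrow> real mat" where
  "var_mat m P h = mat m m (\<lambda>(k, l).
     \<integral>y. (h y $ k - mean_vec m P h $ k) * (h y $ l - mean_vec m P h $ l) \<partial>P)"

text \<open>A sample of size \<open>n\<close> is given by \<open>X 0, \<dots>, X (n-1)\<close>.\<close>
definition sample_mean :: "nat \<Rightarrow> nat \<Rightarrow> ('d \<Rightarrow> real vec) \<Rightarrow> (nat \<Rightarrow> 'd) \<Rightarrow> real vec" where
  "sample_mean m n h X = vec m (\<lambda>k. (\<Sum>i<n. h (X i) $ k) / real n)"

definition sample_var :: "nat \<Rightarrow> nat \<Rightarrow> ('d \<Rightarrow> real vec) \<Rightarrow> (nat \<Rightarrow> 'd) \<Rightarrow> real mat" where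
  "sample_var m n h X = mat m m (\<lambda>(k, l).
     (\<Sum>i<n. (h (X i) $ k - sample_mean m n h X $ k) *
            (h (X i) $ l - sample_mean m n h X $ l)) / real n)"

section \<open>Derivatives of functions from \<open>\<real>\<^sup>p\<close> to \<open>\<real>\<^sup>m\<close>\<close>

text \<open>Total (Frechet) differentiability at \<open>\<theta>\<close>, with Jacobian matrix \<open>J\<close>.\<close>
definition has_jacobian ::
    "nat \<Rightarrow> nat \<Rightarrow> ((nat \<Rightarrow> real) \<Rightarrow> real vec) \<Rightarrow> (nat \<Rightarrow> real) \<Rightarrow> real mat \<Rightarrow> bool" where
  "has_jacobian p m f \<theta> J \<longleftrightarrow> J \<in> carrier_mat m p \<and>
     (\<forall>e>0. \<exists>d>0. \<forall>\<theta>'\<in>par_space p. par_dist p \<theta>' \<theta> < d \<longrightarrow>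
        vnorm (f \<theta>' - f \<theta> - J *\<^sub>v (vec p \<theta>' - vec p \<theta>)) \<le> e * par_dist p \<theta>' \<theta>)"

definition jacobian ::
    "nat \<Rightarrow> nat \<Rightarrow> ((nat \<Rightarrow> real) \<Rightarrow> real vec) \<Rightarrow> (nat \<Rightarrow> real) \<Rightarrow> real mat" where
  "jacobian p m f \<theta> = (THE J. has_jacobian p m f \<theta> J)"

text \<open>\<open>f\<close> is differentiable around \<open>\<theta>\<close> and its derivative is differentiable at \<open>\<theta>\<close>; \<open>H k\<close> is the
  Hessian matrix of the \<open>k\<close>-th component.\<close>
definition has_hessian ::
    "nat \<Rightarrow> nat \<Rightarrow> ((nat \<Rightarrow> real) \<Rightarrow> real vec) \<Rightarrow> (nat \<Rightarrow> real) \<Rightarrow> (nat \<Rightarrow> real mat) \<Rightarrow> bool" where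
  "has_hessian p m f \<theta> H \<longleftrightarrow> (\<exists>J.
     (\<exists>d>0. \<forall>\<theta>'\<in>par_space p. par_dist p \<theta>' \<theta> < d \<longrightarrow> has_jacobian p m f \<theta>' (J \<theta>')) \<and>
     (\<forall>k<m. has_jacobian p p (\<lambda>\<theta>'. row (J \<theta>') k) \<theta> (H k)))"

definition hessian_form :: "nat \<Rightarrow> (nat \<Rightarrow> real mat) \<Rightarrow> real vec \<Rightarrow> real vec \<Rightarrow> real vec" where
  "hessian_form m H u v = vec m (\<lambda>k. u \<bullet> (H k *\<^sub>v v))"

section \<open>The quasi-posterior\<close>

text \<open>\<open>q(D | \<theta>)\<close> as a function of the weighting matrix \<open>V\<close> and of the value \<open>b\<close> of the averaged
  moment function at \<open>\<theta>\<close>.\<close>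
definition quasi_lik :: "nat \<Rightarrow> real mat \<Rightarrow> real vec \<Rightarrow> real" where
  "quasi_lik n V b =
     det ((2 * pi / real n) \<cdot>\<^sub>m V) powr (-1/2) * exp (- (real n / 2) * (b \<bullet> (minv V *\<^sub>v b)))"

text \<open>Below, \<open>L\<close> stands for the quasi-likelihood function, \<open>pM\<close> for the model probabilities and
  \<open>pT M \<theta>\<close> for the conditional prior density \<open>\<pi>(\<theta> | M)\<close>.\<close>
definition model_lik ::
    "(nat \<Rightarrow> real) set \<Rightarrow> ((nat \<Rightarrow> real) \<Rightarrow> real) \<Rightarrow> (nat set \<Rightarrow> (nat \<Rightarrow> real) \<Rightarrow> real) \<Rightarrow> nat set \<Rightarrow> real" where
  "model_lik Par L pT M = (LINT \<theta>:par_model Par M|leb_model M. L \<theta> * pT M \<theta>)"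

definition model_post ::
    "nat \<Rightarrow> (nat \<Rightarrow> real) set \<Rightarrow> ((nat \<Rightarrow> real) \<Rightarrow> real) \<Rightarrow> (nat set \<Rightarrow> real) \<Rightarrow>
     (nat set \<Rightarrow> (nat \<Rightarrow> real) \<Rightarrow> real) \<Rightarrow> nat set \<Rightarrow> real" where
  "model_post p Par L pM pT M =
     pM M * model_lik Par L pT M / (\<Sum>M'\<in>Pow {..<p}. pM M' * model_lik Par L pT M')"

definition par_post ::
    "nat \<Rightarrow> (nat \<Rightarrow> real) set \<Rightarrow> ((nat \<Rightarrow> real) \<Rightarrow> real) \<Rightarrow> (nat set \<Rightarrow> real) \<Rightarrow>
     (nat set \<Rightarrow> (nat \<Rightarrow> real) \<Rightarrow> real) \<Rightarrow> (nat \<Rightarrow> real) set \<Rightarrow> real" where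
  "par_post p Par L pM pT A =
     (\<Sum>M\<in>Pow {..<p}. pM M * (LINT \<theta>:A \<inter> par_model Par M|leb_model M. L \<theta> * pT M \<theta>)) /
     (\<Sum>M\<in>Pow {..<p}. pM M * model_lik Par L pT M)"

section \<open>Conditions\<close>

text \<open>
  In all conditions the arguments are sequences indexed by the sample size \<open>n\<close>: \<open>p n\<close> and \<open>m n\<close> are
  the numbers of parameters and moments, \<open>Par n\<close> the parameter set \<open>\<Theta>\<close>, \<open>\<theta>0 n\<close> the true
  parameter, \<open>g n\<close> the moment function, \<open>PD n\<close> the law of one observation, and \<open>D n i \<omega>\<close> for \<open>i < n\<close>
  the observations, defined on the probability space \<open>Pr n\<close>. ``Constants'' do not depend on \<open>n\<close>.
\<close>

definition eps :: "(nat \<Rightarrow> nat) \<Rightarrow> nat \<Rightarrow> real" where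
  "eps p n = sqrt (real (p n) / real n)"

definition iid_sample ::
    "(nat \<Rightarrow> 'w measure) \<Rightarrow> (nat \<Rightarrow> nat \<Rightarrow> 'w \<Rightarrow> 'd) \<Rightarrow> (nat \<Rightarrow> 'd measure) \<Rightarrow> bool" where
  "iid_sample Pr D PD \<longleftrightarrow> (\<forall>n. prob_space (Pr n) \<and> prob_space (PD n) \<and>
     prob_space.indep_vars (Pr n) (\<lambda>_. PD n) (D n) {..<n} \<and>
     (\<forall>i<n. D n i \<in> measurable (Pr n) (PD n) \<and> distr (Pr n) (PD n) (D n i) = PD n))"

text \<open>Both the bound \<open>R\<close> and the radius \<open>r\<close> of the neighborhood of \<open>\<theta>0 n\<close> are constants.\<close>
definition cond_A1 where
  "cond_A1 Pr D PD p m g Par \<theta>0 \<longleftrightarrow>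
     iid_sample Pr D PD \<and>
     (\<forall>n. Par n \<subseteq> par_space (p n) \<and> \<theta>0 n \<in> Par n \<and>
        (\<forall>k<m n. integrable (PD n) (\<lambda>y. g n y (\<theta>0 n) $ k)) \<and>
        mean_vec (m n) (PD n) (\<lambda>y. g n y (\<theta>0 n)) = 0\<^sub>v (m n) \<and>
        compact (Par n) \<and> connected (Par n)) \<and>
     (\<exists>R>0. \<forall>n. (SUP \<theta>\<in>Par n. vnorm (vec (p n) \<theta>)) = R) \<and>
     (\<exists>r>0. \<forall>n. {\<theta>\<in>par_space (p n). par_dist (p n) \<theta> (\<theta>0 n) < r} \<subseteq> Par n)"

definition cond_A2 :: "real \<Rightarrow> (nat \<Rightarrow> nat) \<Rightarrow> (nat \<Rightarrow> nat) \<Rightarrow> bool" where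
  "cond_A2 \<alpha> p m \<longleftrightarrow>
     (\<forall>n. p n \<le> m n) \<and> (\<lambda>n. real (p n)) \<in> \<Theta>(\<lambda>n. real (m n)) \<and>
     (\<lambda>n. real (p n) ^ 4 * (ln (real n))\<^sup>2 / real n) \<longlonglongrightarrow> 0 \<and>
     (\<lambda>n. real (p n) powr (2 + \<alpha>) * ln (real n) / real n powr \<alpha>) \<longlonglongrightarrow> 0"

definition cond_A3 :: "(nat \<Rightarrow> nat) \<Rightarrow> (nat \<Rightarrow> nat \<Rightarrow> real) \<Rightarrow> bool" where
  "cond_A3 p \<theta>0 \<longleftrightarrow>
     (let \<theta>min = (\<lambda>n. Min ((\<lambda>j. \<bar>\<theta>0 n j\<bar>) ` true_model (p n) (\<theta>0 n))) in
      (\<lambda>n. sqrt (ln (real n)) * eps p n) \<in> o(\<theta>min) \<and> \<theta>min \<in> O(\<lambda>_. 1))"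

definition cond_A4 where
  "cond_A4 \<alpha> PD p m g Par \<theta>0 \<longleftrightarrow>
     (let h = (\<lambda>n \<theta> \<eta> y. \<eta> \<bullet> (g n y \<theta> - g n y (\<theta>0 n)) :: real);
          F = (\<lambda>n. {h n \<theta> \<eta> |\<theta> \<eta>. \<theta> \<in> Par n \<and> \<eta> \<in> unit_sphere (m n)}) in
      0 < \<alpha> \<and> \<alpha> \<le> (1::real) \<and>
      (\<exists>C. \<forall>\<^sub>F n in sequentially. \<forall>\<theta>\<in>Par n. \<forall>\<eta>\<in>unit_sphere (m n).
         in_L2 (PD n) (h n \<theta> \<eta>) \<and>
         L2norm (PD n) (h n \<theta> \<eta>) \<le> C * (sqrt (real (p n)) * par_dist (p n) \<theta> (\<theta>0 n)) powr \<alpha>) \<and>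
      (\<exists>Fenv.
         (\<forall>n. in_L2 (PD n) (Fenv n) \<and> (\<forall>f\<in>F n. \<forall>y\<in>space (PD n). \<bar>f y\<bar> \<le> Fenv n y)) \<and>
         (\<lambda>n. L2norm (PD n) (Fenv n)) \<in> O(\<lambda>n. sqrt (real (p n))) \<and>
         (\<exists>C. \<exists>\<epsilon>0>0. \<forall>\<^sub>F n in sequentially. \<forall>\<epsilon>. 0 < \<epsilon> \<and> \<epsilon> < \<epsilon>0 \<longrightarrow>
            (\<exists>N. covering_number (\<epsilon> * L2norm (PD n) (Fenv n)) (F n) (PD n) = enat N \<and>
                 ln (real N) \<le> C * (real (p n) * ln (real n / \<epsilon>))))))"

definition cond_A5 where
  "cond_A5 PD p m g Par \<theta>0 \<longleftrightarrow>
     (let Eg = (\<lambda>n \<theta>. mean_vec (m n) (PD n) (\<lambda>y. g n y \<theta>));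
          G = (\<lambda>n. jacobian (p n) (m n) (Eg n) (\<theta>0 n)) in
      (\<exists>\<delta>0>0. \<exists>\<delta>1>0. \<forall>n. \<forall>\<theta>\<in>Par n.
         min \<delta>0 (\<delta>1 * par_dist (p n) \<theta> (\<theta>0 n)) \<le> vnorm (Eg n \<theta>)) \<and>
      (\<forall>n. \<exists>J. has_jacobian (p n) (m n) (Eg n) (\<theta>0 n) J) \<and>
      (\<exists>lo>0. \<exists>hi. \<forall>n. eigenvalues_in ((G n)\<^sup>T * G n) {lo..hi}) \<and>
      (\<forall>C>0. \<exists>K. \<forall>\<^sub>F n in sequentially. \<forall>\<theta>\<in>par_ball (p n) (Par n) (\<theta>0 n) (C * eps p n).
         \<exists>H. has_hessian (p n) (m n) (Eg n) \<theta> H \<and>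
             (\<forall>u\<in>unit_sphere (p n). \<forall>v\<in>unit_sphere (p n).
                vnorm (hessian_form (m n) H u v) \<le> K * sqrt (real (p n)))))"

text \<open>Here \<open>Vn n X\<close> is the weighting matrix computed from a sample \<open>X\<close> of size \<open>n\<close>. Positive
  definiteness is required with probability approaching 1: a sample covariance matrix is singular
  for small \<open>n\<close>.\<close>
definition cond_A6 where
  "cond_A6 Pr D PD m g \<theta>0 Vn \<longleftrightarrow>
     (let V = (\<lambda>n. var_mat (m n) (PD n) (\<lambda>y. g n y (\<theta>0 n)));
          Vhat = (\<lambda>n \<omega>. Vn n (\<lambda>i. D n i \<omega>)) in
      wpa1 Pr (\<lambda>n \<omega>. pos_def (Vhat n \<omega>)) \<and>
      (\<forall>e>0. wpa1 Pr (\<lambda>n \<omega>. opnorm (Vhat n \<omega> - V n) < e)) \<and>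
      (\<exists>lo>0. \<exists>hi. wpa1 Pr (\<lambda>n \<omega>.
         eigenvalues_in (Vhat n \<omega>) {lo..hi} \<and> eigenvalues_in (V n) {lo..hi})))"

text \<open>The conditional prior \<open>\<pi>(\<cdot> | M)\<close> has to be normalised only if \<open>M\<close> has positive prior
  probability, since \<open>\<Theta>(M)\<close> may be a null set, or empty, and then carries no density.\<close>
definition is_prior ::
    "nat \<Rightarrow> (nat \<Rightarrow> real) set \<Rightarrow> (nat set \<Rightarrow> real) \<Rightarrow> (nat set \<Rightarrow> (nat \<Rightarrow> real) \<Rightarrow> real) \<Rightarrow> bool" where
  "is_prior p Par pM pT \<longleftrightarrow>
     (\<forall>M\<subseteq>{..<p}. 0 \<le> pM M) \<and> (\<Sum>M\<in>Pow {..<p}. pM M) = 1 \<and>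
     (\<forall>M\<subseteq>{..<p}. pT M \<in> borel_measurable borel \<and>
        (\<forall>\<theta>. 0 \<le> pT M \<theta>) \<and> (\<forall>\<theta>. \<theta> \<notin> par_model Par M \<longrightarrow> pT M \<theta> = 0) \<and>
        (0 < pM M \<longrightarrow> integrable (leb_model M) (pT M) \<and> (\<integral>\<theta>. pT M \<theta> \<partial>leb_model M) = 1))"

text \<open>Since \<open>ln 0 = 0\<close> here, positivity of the density is stated explicitly where its logarithm is
  compared.\<close>
definition cond_A7 where
  "cond_A7 p Par \<theta>0 pM pT \<longleftrightarrow>
     (let M0 = (\<lambda>n. true_model (p n) (\<theta>0 n)) in
      (\<forall>n. is_prior (p n) (Par n) (pM n) (pT n)) \<and>
      (\<exists>c\<pi>::real. \<forall>n. \<forall>M\<subseteq>{..<p n}. \<forall>\<theta>. pT n M \<theta> \<le> c\<pi>) \<and>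
      (\<forall>C>0. \<forall>e>0. \<forall>\<^sub>F n in sequentially. \<forall>M. M0 n \<subseteq> M \<and> M \<subseteq> {..<p n} \<longrightarrow>
         (\<forall>\<theta>\<in>par_model (Par n) M \<inter> par_ball (p n) (Par n) (\<theta>0 n) (C * eps p n).
            0 < pT n M \<theta> \<and> \<bar>ln (pT n M \<theta>) - ln (pT n M (\<theta>0 n))\<bar> < e)) \<and>
      (\<exists>c0>0. \<exists>c1>0. \<forall>n M. M0 n \<subseteq> M \<and> M \<subseteq> {..<p n} \<longrightarrow>
         exp (- c0 * real (card M)) \<le> pT n M (\<theta>0 n) \<and>
         \<bar>ln (pT n M (\<theta>0 n)) - ln (pT n (M0 n) (\<theta>0 n))\<bar> \<le> c1 * (real (card M) - real (card (M0 n)))))"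

text \<open>The supremum is taken in \<^typ>\<open>ennreal\<close>, where the supremum of the empty set is 0.\<close>
definition cond_A8 where
  "cond_A8 p \<theta>0 pM \<longleftrightarrow>
     (let M0 = (\<lambda>n. true_model (p n) (\<theta>0 n)) in
      (\<forall>n. 0 < pM n (M0 n)) \<and>
      (\<lambda>n. SUP M\<in>{M. M0 n \<subset> M \<and> M \<subseteq> {..<p n}}.
         ennreal (pM n M / pM n (M0 n) * (real (p n) / sqrt (real n)) ^ (card M - card (M0 n)))) \<longlonglongrightarrow> 0 \<and>
      (\<exists>r1>0. \<exists>K. \<forall>\<^sub>F n in sequentially. \<forall>M\<subseteq>{..<p n}. M0 n - M \<noteq> {} \<longrightarrow>
         pM n M / pM n (M0 n) \<le> K * exp (r1 * real (p n) * ln (real n))))"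

section \<open>The Bayesian oracle property\<close>

text \<open>The supremum ranges over the Borel subsets \<open>A\<close> of \<open>\<Theta>\<close>. Both convergences are in
  probability.\<close>
definition bayesian_oracle where
  "bayesian_oracle Pr D PD p m g Par \<theta>0 Vn pM pT \<longleftrightarrow>
     (let M0 = (\<lambda>n. true_model (p n) (\<theta>0 n));
          G0 = (\<lambda>n. submatrix
                  (jacobian (p n) (m n) (\<lambda>\<theta>. mean_vec (m n) (PD n) (\<lambda>y. g n y \<theta>)) (\<theta>0 n)) UNIV (M0 n));
          gbar = (\<lambda>n \<omega> \<theta>. sample_mean (m n) n (\<lambda>y. g n y \<theta>) (\<lambda>i. D n i \<omega>));
          Vhat = (\<lambda>n \<omega>. Vn n (\<lambda>i. D n i \<omega>));
          L = (\<lambda>n \<omega> \<theta>. quasi_lik n (Vhat n \<omega>) (gbar n \<omega> \<theta>));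
          S = (\<lambda>n \<omega>. minv ((G0 n)\<^sup>T * minv (Vhat n \<omega>) * G0 n));
          \<mu> = (\<lambda>n \<omega>. subvec (M0 n) (\<theta>0 n)
                  - S n \<omega> *\<^sub>v ((G0 n)\<^sup>T *\<^sub>v (minv (Vhat n \<omega>) *\<^sub>v gbar n \<omega> (\<theta>0 n)))) in
      (\<forall>e>0. wpa1 Pr (\<lambda>n \<omega>.
         \<bar>model_post (p n) (Par n) (L n \<omega>) (pM n) (pT n) (M0 n) - 1\<bar> < e)) \<and>
      (\<forall>e>0. wpa1 Pr (\<lambda>n \<omega>.
         (SUP A\<in>{A \<in> sets borel. A \<subseteq> Par n}. ennreal
            \<bar>par_post (p n) (Par n) (L n \<omega>) (pM n) (pT n) A
             - (LINT \<theta>:A \<inter> par_model (Par n) (M0 n)|leb_model (M0 n).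
                  mvn_density (\<mu> n \<omega>) ((1 / real n) \<cdot>\<^sub>m S n \<omega>) (subvec (M0 n) \<theta>))\<bar>) < ennreal e)))"

section \<open>Precision matrices\<close>

definition tri_dim :: "nat \<Rightarrow> nat" where
  "tri_dim s = s * (s + 1) div 2"

text \<open>The position \<open>(i, j)\<close>, \<open>i \<le> j\<close>, of the upper triangle (columns stacked) has index
  \<open>j (j + 1) / 2 + i = prod_encode (i, j - i)\<close>, so that \<open>j < s\<close> iff the index is below
  \<open>s (s + 1) / 2\<close>.\<close>
definition tri_index :: "nat \<Rightarrow> nat \<Rightarrow> nat" where
  "tri_index i j = prod_encode (min i j, max i j - min i j)"

definition tri_row :: "nat \<Rightarrow> nat" where
  "tri_row k = fst (prod_decode k)"

definition tri_col :: "nat \<Rightarrow> nat" where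
  "tri_col k = fst (prod_decode k) + snd (prod_decode k)"

lemma tri_index_eq: "i \<le> j \<Longrightarrow> tri_index i j = j * (j + 1) div 2 + i"
  by (simp add: tri_index_def prod_encode_def triangle_def)

lemma tri_index_row_col: "tri_index (tri_row k) (tri_col k) = k"
  by (simp add: tri_index_def tri_row_def tri_col_def)

lemma tri_row_index: "i \<le> j \<Longrightarrow> tri_row (tri_index i j) = i"
  and tri_col_index: "i \<le> j \<Longrightarrow> tri_col (tri_index i j) = j"
  by (simp_all add: tri_index_def tri_row_def tri_col_def)

definition sym_of_par :: "nat \<Rightarrow> (nat \<Rightarrow> real) \<Rightarrow> real mat" where
  "sym_of_par s \<theta> = mat s s (\<lambda>(i, j). \<theta> (tri_index i j))"

definition par_of_sym :: "nat \<Rightarrow> real mat \<Rightarrow> nat \<Rightarrow> real" where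
  "par_of_sym s A k = (if k < tri_dim s then A $$ (tri_row k, tri_col k) else 0)"

definition prec_moment :: "nat \<Rightarrow> (nat \<Rightarrow> real) \<Rightarrow> (nat \<Rightarrow> real) \<Rightarrow> real vec" where
  "prec_moment s y \<theta> = vec (tri_dim s)
     (\<lambda>k. y (tri_row k) * y (tri_col k) - minv (sym_of_par s \<theta>) $$ (tri_row k, tri_col k))"

text \<open>The mean of \<open>Y\<close> is known to be zero, so the empirical covariance matrix is not centred.
  Its singular case is harmless: the value of \<open>\<theta>\<close> cancels in \<open>prec_weight\<close>.\<close>
definition emp_cov :: "nat \<Rightarrow> nat \<Rightarrow> (nat \<Rightarrow> nat \<Rightarrow> real) \<Rightarrow> real mat" where
  "emp_cov s n X = mat s s (\<lambda>(i, j). (\<Sum>l<n. X l i * X l j) / real n)"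

definition prec_weight :: "nat \<Rightarrow> nat \<Rightarrow> (nat \<Rightarrow> nat \<Rightarrow> real) \<Rightarrow> real mat" where
  "prec_weight s n X =
     (let \<theta>t = par_of_sym s (minv (emp_cov s n X))
      in sample_var (tri_dim s) n (\<lambda>y. prec_moment s y \<theta>t) X)"

end

theory Submission
  imports Defs
begin

text \<open>
  The proof rests on an observation about the hypotheses: they force the dimension to stay bounded.
  A prior density on a model with k coordinates is bounded by a constant and lives in a ball of fixed
  radius R, and such a ball has volume at most exp (4 pi R^2) / 2^k; as the density integrates to one
  over every model of positive prior mass, k is bounded (bounded_prior_model_size).  The true model
  has positive mass and contains all s diagonal entries of the true precision matrix, because these
  are positive (prec_dim_le_model_size).  Hence s and p stay bounded, and every constant below may
  depend on them in a crude way.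

  The conditions on the moment function are deterministic facts about matrix inversion.  The
  difference of the moment function at \<theta> and at \<theta>0 does not depend on the observation:
  it is the half-vectorised matrix minv \<Omega>0 - minv \<Omega>, called prec_map.  The resolvent
  identity minv \<Omega>0 - minv \<Omega> = minv \<Omega>0 (\<Omega> - \<Omega>0) minv \<Omega>, used once
  or twice, shows that prec_map is bi-Lipschitz and has first and second derivatives with quadratic
  remainder (prec_map_upper, prec_map_lower, prec_map_quadratic, prec_jac_quadratic).  The class of
  functions whose covering numbers are required consists of constant functions.  The sample
  covariance of the moments does not change under the shift by the estimated parameter, so it
  converges to V by Chebyshev's inequality applied to the fourth moments of the moment function,
  which the eighth moments of the observations control.

  For the quasi-posterior the sample matters only through b, the mean of the moments at \<theta>0, and
  through the weight matrix.  On an event of probability at least 1 - \<eta>, norm b is at most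
  T / sqrt n with T fixed, and the weight matrix has its spectrum in a fixed interval
  (prec_typical_sample_likely); letting \<eta> be arbitrary gives statements with probability tending
  to one (wpa1I).  For such b and weight matrices everything is deterministic.  The likelihood is at
  most a constant times exp (- 2 c n d^2), where d is the distance to \<theta>0, and for d of order
  1 / sqrt n it differs from its Gaussian counterpart by a factor close to one.  Integration bounds
  the distance, in total variation, of the posterior in the true model to the normal density
  (total_variation_bound).  Each superfluous coordinate costs a factor of order 1 / sqrt n, which
  the prior odds do not compensate (superset_model_bound).  A model that misses a coordinate of
  \<theta>0 keeps d above the smallest nonzero coordinate of \<theta>0, which is much larger than
  sqrt (ln n / n), so its likelihood decays faster than any power of n (other_model_bound).  The
  at most 2^p models are added up in oracle_single, and oracle_eventually chooses the constants
  uniformly in b and the weight matrix.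
\<close>

section \<open>Euclidean norm and bounds on quadratic forms\<close>

no_notation Finite_Cartesian_Product.vec_nth (infixl "$" 90)
lemma vnorm_eq_L2_set: "vnorm v = L2_set (\<lambda>i. v $ i) {0..<dim_vec v}"
  by (simp add: vnorm_def L2_set_def scalar_prod_def power2_eq_square)

lemma vnorm_nonneg [simp]: "0 \<le> vnorm v"
  by (simp add: vnorm_eq_L2_set)

lemma vnorm_sq: "(vnorm v)\<^sup>2 = v \<bullet> v"
  by (simp add: vnorm_def scalar_prod_def sum_nonneg)

lemma sprod_self_nonneg: "0 \<le> (v :: real vec) \<bullet> v"
  by (metis vnorm_sq zero_le_power2)

lemma vnorm_triangle: "dim_vec v = dim_vec w \<Longrightarrow> vnorm (v + w) \<le> vnorm v + vnorm w"
  using L2_set_triangle_ineq[of "\<lambda>i. v $ i" "\<lambda>i. w $ i" "{0..<dim_vec w}"]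
    L2_set_cong[of "{0..<dim_vec w}" "{0..<dim_vec w}" "\<lambda>i. (v + w) $ i" "\<lambda>i. v $ i + w $ i"]
  by (simp add: vnorm_eq_L2_set)

lemma vnorm_smult: "vnorm (c \<cdot>\<^sub>v v) = \<bar>c\<bar> * vnorm v"
  by (simp add: vnorm_def real_sqrt_mult mult.assoc[symmetric])

lemma vnorm_uminus: "vnorm (- v) = vnorm v"
  unfolding vnorm_eq_L2_set L2_set_def by (intro arg_cong[where f=sqrt] sum.cong) auto

lemma vnorm_diff_ge: 
  assumes "dim_vec v = dim_vec w"
  shows "vnorm v - vnorm w \<le> vnorm (v + w)"
proof -
  have "v = (v + w) + (- w)" using assms by (intro eq_vecI) auto
  then have "vnorm v \<le> vnorm (v + w) + vnorm (- w)"
    using vnorm_triangle[of "v + w" "- w"] assms by simp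
  then show ?thesis by (simp add: vnorm_uminus)
qed

lemma abs_sprod_le: "dim_vec v = dim_vec w \<Longrightarrow> \<bar>v \<bullet> w\<bar> \<le> vnorm v * vnorm w"
proof -
  assume a: "dim_vec v = dim_vec w"
  have "\<bar>v \<bullet> w\<bar> \<le> (\<Sum>i\<in>{0..<dim_vec w}. \<bar>v $ i\<bar> * \<bar>w $ i\<bar>)"
    unfolding scalar_prod_def by (rule order_trans[OF sum_abs]) (simp add: abs_mult)
  also have "\<dots> \<le> vnorm v * vnorm w"
    unfolding vnorm_eq_L2_set a by (rule L2_set_mult_ineq)
  finally show ?thesis .
qed

lemma abs_index_le_vnorm: "i < dim_vec v \<Longrightarrow> \<bar>v $ i\<bar> \<le> vnorm v"
  using member_le_L2_set[of "{0..<dim_vec v}" i "\<lambda>i. \<bar>v $ i\<bar>"]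
  by (simp add: vnorm_eq_L2_set L2_set_def)

lemma vnorm_eq_0: "vnorm v = 0 \<Longrightarrow> v \<in> carrier_vec n \<Longrightarrow> v = 0\<^sub>v n"
  using abs_index_le_vnorm[of _ v] by (intro eq_vecI) fastforce+

lemma vnorm_le_card:
  assumes "\<And>i. i < dim_vec v \<Longrightarrow> \<bar>v $ i\<bar> \<le> c"
  shows "vnorm v \<le> real (dim_vec v) * c"
proof -
  have "vnorm v \<le> (\<Sum>i\<in>{0..<dim_vec v}. \<bar>v $ i\<bar>)"
    unfolding vnorm_eq_L2_set by (rule L2_set_le_sum_abs)
  also have "\<dots> \<le> (\<Sum>i\<in>{0..<dim_vec v}. c)" by (intro sum_mono assms) auto
  finally show ?thesis by simp
qed

text \<open>
  The Loewner bounds lo I \<le> A \<le> hi I of a symmetric matrix.  In contrast to bounds on the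
  eigenvalues, this form of them passes directly to inverses, compressions and perturbations.
\<close>
definition form_bounds :: "nat \<Rightarrow> real mat \<Rightarrow> real \<Rightarrow> real \<Rightarrow> bool" where
  "form_bounds n A lo hi \<longleftrightarrow> A \<in> carrier_mat n n \<and> A\<^sup>T = A \<and>
     (\<forall>v\<in>carrier_vec n. lo * (v \<bullet> v) \<le> v \<bullet> (A *\<^sub>v v) \<and> v \<bullet> (A *\<^sub>v v) \<le> hi * (v \<bullet> v))"

lemma form_boundsD:
  assumes "form_bounds n A lo hi"
  shows "A \<in> carrier_mat n n" "A\<^sup>T = A"
    "v \<in> carrier_vec n \<Longrightarrow> lo * (v \<bullet> v) \<le> v \<bullet> (A *\<^sub>v v)"
    "v \<in> carrier_vec n \<Longrightarrow> v \<bullet> (A *\<^sub>v v) \<le> hi * (v \<bullet> v)"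
  using assms by (auto simp: form_bounds_def)

lemma form_bounds_weaken:
  assumes fb: "form_bounds n A lo hi" and le: "lo' \<le> lo" "hi \<le> hi'"
  shows "form_bounds n A lo' hi'"
proof -
  have "lo' * (v \<bullet> v) \<le> lo * (v \<bullet> v)" "hi * (v \<bullet> v) \<le> hi' * (v \<bullet> v)" for v :: "real vec"
    using le by (auto intro!: mult_right_mono sprod_self_nonneg)
  then show ?thesis using fb unfolding form_bounds_def by (meson order_trans)
qed

lemma sym_form_commute:
  assumes "A \<in> carrier_mat n n" "A\<^sup>T = A" "x \<in> carrier_vec n" "y \<in> carrier_vec n"
  shows "x \<bullet> (A *\<^sub>v y) = y \<bullet> (A *\<^sub>v (x :: real vec))"
proof -
  have "(A *\<^sub>v x) \<bullet> y = x \<bullet> (A *\<^sub>v y)"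
    using transpose_vec_mult_scalar[of A n n y x] assms by simp
  then show ?thesis using assms comm_scalar_prod[of y n "A *\<^sub>v x"] by simp
qed

lemma form_add_smult:
  assumes A: "A \<in> carrier_mat n n" "A\<^sup>T = A" and x: "x \<in> carrier_vec n" "y \<in> carrier_vec n"
  shows "(x + t \<cdot>\<^sub>v y) \<bullet> (A *\<^sub>v (x + t \<cdot>\<^sub>v y)) =
     x \<bullet> (A *\<^sub>v x) + 2 * t * (x \<bullet> (A *\<^sub>v y)) + t\<^sup>2 * (y \<bullet> (A *\<^sub>v (y :: real vec)))"
proof -
  have *: "A *\<^sub>v (x + t \<cdot>\<^sub>v y) = A *\<^sub>v x + t \<cdot>\<^sub>v (A *\<^sub>v y)"
    using assms by (simp add: mult_add_distrib_mat_vec[of A n n] mult_mat_vec[of A n n])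
  have "(x + t \<cdot>\<^sub>v y) \<bullet> (A *\<^sub>v x + t \<cdot>\<^sub>v (A *\<^sub>v y)) =
     (x \<bullet> (A *\<^sub>v x) + t * (x \<bullet> (A *\<^sub>v y))) + t * (y \<bullet> (A *\<^sub>v x)) + t * (t * (y \<bullet> (A *\<^sub>v y)))"
    using assms by (simp add: add_scalar_prod_distrib[of _ n] scalar_prod_add_distrib[of _ n] algebra_simps)
  then show ?thesis unfolding * using sym_form_commute[OF A x]
    by (simp add: power2_eq_square algebra_simps)
qed

lemma quadratic_nonneg_discriminant:
  fixes a b c :: real
  assumes "\<And>t. 0 \<le> a + 2 * t * b + t\<^sup>2 * c" "0 \<le> c"
  shows "b\<^sup>2 \<le> a * c"
proof (cases "c = 0")
  case True
  have "b = 0"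
  proof (rule ccontr)
    assume "b \<noteq> 0"
    then show False using assms(1)[of "- (a + 1) / (2 * b)"] True by (simp add: field_simps)
  qed
  then show ?thesis by (simp add: True)
next
  case False
  then have "0 < c" using assms by simp
  then show ?thesis using assms(1)[of "- b / c"]
    by (simp add: field_simps power2_eq_square)
qed

lemma psd_Cauchy_Schwarz:
  assumes A: "A \<in> carrier_mat n n" "A\<^sup>T = A" and psd: "\<And>v. v \<in> carrier_vec n \<Longrightarrow> 0 \<le> v \<bullet> (A *\<^sub>v v)"
    and x: "x \<in> carrier_vec n" "y \<in> carrier_vec n"
  shows "(x \<bullet> (A *\<^sub>v y))\<^sup>2 \<le> (x \<bullet> (A *\<^sub>v x)) * (y \<bullet> (A *\<^sub>v (y :: real vec)))"
  using form_add_smult[OF A x] psd x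
  by (intro quadratic_nonneg_discriminant) (metis add_carrier_vec smult_carrier_vec, blast)

lemma continuous_on_form: "continuous_on S (\<lambda>x. vec n x \<bullet> (A *\<^sub>v (vec n x)) :: real)" if "A \<in> carrier_mat n n"
proof -
  have "vec n x \<bullet> (A *\<^sub>v (vec n x)) = (\<Sum>i<n. x i * (\<Sum>j<n. A $$ (i,j) * x j))" for x
    using that unfolding scalar_prod_def lessThan_atLeast0
    by (intro sum.cong) (auto simp: scalar_prod_def intro!: sum.cong)
  then show ?thesis
    by (auto intro!: continuous_intros continuous_on_subset[OF continuous_on_product_coordinates])
qed

text \<open>Vectors are encoded as functions on all natural numbers with a zero tail, so compactness comes
  from Tychonoff's theorem for a product of intervals and singletons.\<close>
lemma compact_sphere_par: "compact {x \<in> par_space n. (\<Sum>i<n. (x i)\<^sup>2) = 1}"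
proof -
  let ?K = "PiE UNIV (\<lambda>k. if k < n then {-1..1::real} else {0})"
  have "compact ?K"
    using compactin_PiE[of "\<lambda>_. euclidean" UNIV "\<lambda>k. if k < n then {-1..1::real} else {0}"]
    by (simp add: euclidean_product_topology)
  moreover have "closed {x :: nat \<Rightarrow> real. (\<Sum>i<n. (x i)\<^sup>2) = 1}"
    by (intro closed_Collect_eq continuous_intros continuous_on_product_coordinates)
  moreover have "{x \<in> par_space n. (\<Sum>i<n. (x i)\<^sup>2) = 1} = {x :: nat \<Rightarrow> real. (\<Sum>i<n. (x i)\<^sup>2) = 1} \<inter> ?K"
  proof -
    have "- 1 \<le> x k \<and> x k \<le> 1" if "(\<Sum>i<n. (x i)\<^sup>2) = 1" "k < n" for x :: "nat \<Rightarrow> real" and k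
    proof -
      have "(x k)\<^sup>2 \<le> 1"
        using member_le_sum[of k "{..<n}" "\<lambda>i. (x i)\<^sup>2"] that by simp
      then show ?thesis using abs_square_le_1[of "x k"] by linarith
    qed
    then show ?thesis by (auto simp: par_space_def PiE_def Pi_def split: if_splits)
  qed
  ultimately show ?thesis by (simp add: closed_Int_compact)
qed

lemma transpose_one_smult: "(m \<cdot>\<^sub>m 1\<^sub>m n)\<^sup>T = m \<cdot>\<^sub>m 1\<^sub>m n"
  by (intro eq_matI) auto

text \<open>
  The quadratic form attains its minimum m over the unit sphere at some w.  Then A - m I is positive
  semidefinite and its form vanishes at w, so the Cauchy-Schwarz inequality for this form makes
  (A - m I) w vanish: m is an eigenvalue.
\<close>
lemma eigenvalues_form_lower:
  fixes A :: "real mat"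
  assumes A: "A \<in> carrier_mat n n" "A\<^sup>T = A" and ev: "\<And>k. eigenvalue A k \<Longrightarrow> lo \<le> k"
    and v: "v \<in> carrier_vec n"
  shows "lo * (v \<bullet> v) \<le> v \<bullet> (A *\<^sub>v v)"
proof (cases "n = 0")
  case True
  then show ?thesis using v A by (simp add: scalar_prod_def)
next
  case False
  let ?K = "{x \<in> par_space n. (\<Sum>i<n. (x i)\<^sup>2) = 1}"
  have "(\<lambda>k. if k = 0 then 1 else 0) \<in> ?K"
    using False by (auto simp: par_space_def if_distrib[where f="\<lambda>x. x\<^sup>2"] sum.delta' cong: if_cong)
  then obtain x0 where x0: "x0 \<in> ?K" and min: "\<And>x. x \<in> ?K \<Longrightarrow> vec n x0 \<bullet> (A *\<^sub>v (vec n x0)) \<le> vec n x \<bullet> (A *\<^sub>v (vec n x))"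
    using continuous_attains_inf[OF compact_sphere_par _ continuous_on_form[OF A(1)], of n] by blast
  define w where "w = vec n x0"
  define m where "m = w \<bullet> (A *\<^sub>v w)"
  have w: "w \<in> carrier_vec n" by (simp add: w_def)
  have ww: "w \<bullet> w = 1"
    using x0 by (simp add: w_def scalar_prod_def lessThan_atLeast0 power2_eq_square)
  have low: "m * (v \<bullet> v) \<le> v \<bullet> (A *\<^sub>v v)" if v: "v \<in> carrier_vec n" for v
  proof (cases "v = 0\<^sub>v n")
    case True
    then show ?thesis using A by simp
  next
    case False
    define r where "r = vnorm v"
    have r: "r \<noteq> 0" using vnorm_eq_0[OF _ v] False by (auto simp: r_def)
    define y where "y = (1 / r) \<cdot>\<^sub>v v"
    have y: "y \<in> carrier_vec n" using v by (simp add: y_def)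
    have vy: "v = r \<cdot>\<^sub>v y" using r by (simp add: y_def smult_smult_assoc)
    have yy: "y \<bullet> y = 1"
      using vnorm_smult[of "1 / r" v] r vnorm_nonneg[of v] unfolding y_def[symmetric] vnorm_sq[symmetric]
      by (simp add: r_def)
    define x where "x k = (if k < n then y $ k else 0)" for k
    have yx: "y = vec n x" using y by (intro eq_vecI) (auto simp: x_def)
    have "x \<in> ?K" using yy unfolding yx by (simp add: par_space_def x_def scalar_prod_def lessThan_atLeast0 power2_eq_square)
    from min[OF this] have "m \<le> y \<bullet> (A *\<^sub>v y)" by (simp add: m_def w_def yx)
    then have "m * r\<^sup>2 \<le> r\<^sup>2 * (y \<bullet> (A *\<^sub>v y))" by (simp add: mult_right_mono mult.commute[of "r\<^sup>2"])
    moreover have "v \<bullet> (A *\<^sub>v v) = r\<^sup>2 * (y \<bullet> (A *\<^sub>v y))"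
    proof -
      have Ay: "A *\<^sub>v y \<in> carrier_vec n" using A(1) y by simp
      have "A *\<^sub>v v = r \<cdot>\<^sub>v (A *\<^sub>v y)" unfolding vy by (rule mult_mat_vec[OF A(1) y])
      then have "v \<bullet> (A *\<^sub>v v) = (r \<cdot>\<^sub>v y) \<bullet> (r \<cdot>\<^sub>v (A *\<^sub>v y))" using vy by simp
      also have "\<dots> = r * (r * (y \<bullet> (A *\<^sub>v y)))"
        by (simp only: smult_scalar_prod_distrib[OF y smult_carrier_vec[THEN iffD2, OF Ay]] scalar_prod_smult_distrib[OF y Ay])
      finally show ?thesis by (simp add: power2_eq_square)
    qed
    moreover have "v \<bullet> v = r\<^sup>2" by (simp add: r_def vnorm_sq)
    ultimately show ?thesis by simp
  qed
  define B where "B = A - m \<cdot>\<^sub>m 1\<^sub>m n"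
  have B: "B \<in> carrier_mat n n" "B\<^sup>T = B"
    using A(1) transpose_minus[OF A(1), of "m \<cdot>\<^sub>m 1\<^sub>m n"] A(2)
    by (auto simp: B_def transpose_one_smult)
  have Bv: "B *\<^sub>v v = A *\<^sub>v v - m \<cdot>\<^sub>v v" if "v \<in> carrier_vec n" for v
  proof -
    have "(m \<cdot>\<^sub>m 1\<^sub>m n) *\<^sub>v v = m \<cdot>\<^sub>v v" using that by (intro eq_vecI) auto
    then show ?thesis using minus_mult_distrib_mat_vec[OF A(1), of "m \<cdot>\<^sub>m 1\<^sub>m n" v] that by (simp add: B_def)
  qed
  have Bf: "u \<bullet> (B *\<^sub>v v) = u \<bullet> (A *\<^sub>v v) - m * (u \<bullet> v)" if "u \<in> carrier_vec n" "v \<in> carrier_vec n" for u v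
    using that A by (simp add: Bv scalar_prod_minus_distrib[of _ n])
  define z where "z = B *\<^sub>v w"
  have z: "z \<in> carrier_vec n" using B w by (simp add: z_def)
  have "0 \<le> v \<bullet> (B *\<^sub>v v)" if "v \<in> carrier_vec n" for v
    using low[OF that] Bf[OF that that] by simp
  from psd_Cauchy_Schwarz[OF B this z w]
  have "(z \<bullet> z)\<^sup>2 \<le> (z \<bullet> (B *\<^sub>v z)) * (w \<bullet> (B *\<^sub>v w))"
    by (simp only: z_def)
  also have "w \<bullet> (B *\<^sub>v w) = 0" using w by (simp add: Bf m_def ww)
  finally have "vnorm z = 0" by (simp add: vnorm_def)
  then have "z = 0\<^sub>v n" by (rule vnorm_eq_0[OF _ z])
  then have "A *\<^sub>v w = m \<cdot>\<^sub>v w" unfolding z_def Bv[OF w]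
    using A(1) w by (auto simp: vec_eq_iff)
  moreover have "w \<noteq> 0\<^sub>v n" using ww by auto
  ultimately have "eigenvalue A m" using w A
    unfolding eigenvalue_def eigenvector_def by auto
  then have "lo \<le> m" by (rule ev)
  then have "lo * (v \<bullet> v) \<le> m * (v \<bullet> v)" using sprod_self_nonneg by (rule mult_right_mono)
  with low[OF v] show ?thesis by simp
qed

lemma eigenvalues_form_bounds:
  assumes A: "A \<in> carrier_mat n n" "A\<^sup>T = A" and ev: "eigenvalues_in A {lo..hi}"
  shows "form_bounds n A lo hi"
proof -
  have "v \<bullet> (A *\<^sub>v v) \<le> hi * (v \<bullet> v)" if v: "v \<in> carrier_vec n" for v
  proof -
    have "- hi \<le> k" if "eigenvalue (- A) k" for k
    proof -
      from that obtain x where x: "x \<in> carrier_vec n" "x \<noteq> 0\<^sub>v n" "(- A) *\<^sub>v x = k \<cdot>\<^sub>v x"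
        using A by (auto simp: eigenvalue_def eigenvector_def)
      have "A *\<^sub>v x = (- k) \<cdot>\<^sub>v x"
      proof (rule eq_vecI)
        fix i assume "i < dim_vec ((- k) \<cdot>\<^sub>v x)"
        then show "(A *\<^sub>v x) $ i = ((- k) \<cdot>\<^sub>v x) $ i"
          using arg_cong[OF x(3), of "\<lambda>v. v $ i"] x(1) A(1) by simp
      qed (use x A in simp)
      then have "eigenvalue A (- k)" using x A by (auto simp: eigenvalue_def eigenvector_def)
      then show ?thesis using ev by (auto simp: eigenvalues_in_def)
    qed
    then have "- hi * (v \<bullet> v) \<le> v \<bullet> ((- A) *\<^sub>v v)"
      using A v by (intro eigenvalues_form_lower) (auto simp: transpose_uminus)
    then show ?thesis using A v by simp
  qed
  moreover have "lo * (v \<bullet> v) \<le> v \<bullet> (A *\<^sub>v v)" if v: "v \<in> carrier_vec n" for v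
    using ev by (intro eigenvalues_form_lower[OF A _ v]) (auto simp: eigenvalues_in_def)
  ultimately show ?thesis using A by (auto simp: form_bounds_def)
qed

lemma form_bounds_eigenvalues:
  assumes fb: "form_bounds n A lo hi"
  shows "eigenvalues_in A {lo..hi}"
  unfolding eigenvalues_in_def
proof (intro allI impI)
  fix k assume "eigenvalue A k"
  then obtain x where x: "x \<in> carrier_vec n" "x \<noteq> 0\<^sub>v n" "A *\<^sub>v x = k \<cdot>\<^sub>v x"
    using form_boundsD(1)[OF fb] by (auto simp: eigenvalue_def eigenvector_def)
  have "x \<bullet> x \<noteq> 0" using vnorm_eq_0[of x n] x(1,2) by (auto simp: vnorm_def)
  then have pos: "0 < x \<bullet> x" using sprod_self_nonneg[of x] by linarith
  have "lo * (x \<bullet> x) \<le> k * (x \<bullet> x)" "k * (x \<bullet> x) \<le> hi * (x \<bullet> x)"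
    using form_boundsD(3,4)[OF fb x(1)] x by simp_all
  then show "k \<in> {lo..hi}" using pos by simp
qed

text \<open>Cauchy-Schwarz for the form of A, applied to the pair A v and v.\<close>
lemma form_bounds_vnorm_mult:
  assumes fb: "form_bounds n A lo hi" "0 \<le> lo" and v: "v \<in> carrier_vec n"
  shows "(vnorm (A *\<^sub>v v))\<^sup>2 \<le> hi * (v \<bullet> (A *\<^sub>v v))"
proof -
  note A = form_boundsD(1,2)[OF fb(1)]
  have psd: "0 \<le> v \<bullet> (A *\<^sub>v v)" if "v \<in> carrier_vec n" for v
    using form_boundsD(3)[OF fb(1) that] mult_nonneg_nonneg[OF fb(2) sprod_self_nonneg[of v]] by linarith
  define z where "z = A *\<^sub>v v"
  have z: "z \<in> carrier_vec n" using A v by (simp add: z_def)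
  have "(z \<bullet> z)\<^sup>2 \<le> (z \<bullet> (A *\<^sub>v z)) * (v \<bullet> (A *\<^sub>v v))"
    using psd_Cauchy_Schwarz[OF A psd z v] by (simp only: z_def)
  also have "\<dots> \<le> (hi * (z \<bullet> z)) * (v \<bullet> (A *\<^sub>v v))"
    by (intro mult_right_mono form_boundsD(4)[OF fb(1)] z psd v)
  finally have "(z \<bullet> z) * (z \<bullet> z) \<le> (z \<bullet> z) * (hi * (v \<bullet> (A *\<^sub>v v)))" by (simp add: power2_eq_square ac_simps)
  moreover have "0 \<le> hi * (v \<bullet> (A *\<^sub>v v))" 
  proof (cases "v \<bullet> v = 0")
    case True
    then show ?thesis using form_boundsD(4)[OF fb(1) v] psd[OF v] by simp
  next
    case False
    then have "0 < v \<bullet> v" using sprod_self_nonneg[of v] by simp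
    moreover have "lo * (v \<bullet> v) \<le> hi * (v \<bullet> v)" using form_boundsD(3,4)[OF fb(1) v] by simp
    ultimately show ?thesis using fb(2) psd[OF v] by simp
  qed
  ultimately have "z \<bullet> z \<le> hi * (v \<bullet> (A *\<^sub>v v))"
    using sprod_self_nonneg[of z] by (cases "z \<bullet> z = 0") auto
  then show ?thesis by (simp add: vnorm_sq z_def)
qed

lemma minv_eqI:
  assumes A: "A \<in> carrier_mat n n" and B: "B \<in> carrier_mat n n" "A * B = 1\<^sub>m n"
  shows "minv A = (B :: real mat)"
proof -
  have BA: "B * A = 1\<^sub>m n" using mat_mult_left_right_inverse[OF A B] .
  have "A \<in> Units (ring_mat TYPE(real) n ())"
    using A B BA by (auto simp: Units_def ring_mat_def)
  then obtain C where C: "mat_inverse A = Some C" using mat_inverse(1)[OF A, of "()"] by (cases "mat_inverse A") auto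
  from mat_inverse(2)[OF A C] have C': "A * C = 1\<^sub>m n" "C * A = 1\<^sub>m n" "C \<in> carrier_mat n n" by auto
  have "C = C * (A * B)" using C' B by simp
  also have "\<dots> = (C * A) * B" by (rule assoc_mult_mat[symmetric, OF C'(3) A B(1)])
  also have "\<dots> = B" unfolding C'(2) using B(1) by simp
  finally have "C = B" .
  then show ?thesis by (simp add: minv_def C)
qed

lemma minv_props:
  assumes A: "A \<in> carrier_mat n n" and d: "det A \<noteq> (0 :: real)"
  shows "minv A \<in> carrier_mat n n" "A * minv A = 1\<^sub>m n" "minv A * A = 1\<^sub>m n"
proof -
  obtain C where C: "mat_inverse A = Some C"
    using det_non_zero_imp_unit[OF A d, of "()"] mat_inverse(1)[OF A, of "()"] by (cases "mat_inverse A") auto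
  from mat_inverse(2)[OF A C] show "minv A \<in> carrier_mat n n" "A * minv A = 1\<^sub>m n" "minv A * A = 1\<^sub>m n"
    by (auto simp: minv_def C)
qed

lemma form_bounds_det:
  assumes fb: "form_bounds n A lo hi" "0 < lo"
  shows "det A \<noteq> 0"
proof
  assume "det A = 0"
  then obtain v where v: "v \<in> carrier_vec n" "v \<noteq> 0\<^sub>v n" "A *\<^sub>v v = 0\<^sub>v n"
    using det_0_iff_vec_prod_zero[OF form_boundsD(1)[OF fb(1)]] by auto
  then have "lo * (v \<bullet> v) \<le> 0" using form_boundsD(3)[OF fb(1) v(1)] by simp
  then have "v \<bullet> v = 0" using fb(2) sprod_self_nonneg[of v] by (simp add: mult_le_0_iff)
  then show False using v vnorm_eq_0[of v n] by (simp add: vnorm_def)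
qed

lemmas form_bounds_minv = minv_props[OF form_boundsD(1) form_bounds_det]

text \<open>With w = minv A v the form of the inverse at v is the inner product of w and v = A w.  The lower
  bound of A controls norm w, and form_bounds_vnorm_mult controls norm (A w).\<close>
lemma form_bounds_inverse:
  assumes fb: "form_bounds n A lo hi" "0 < lo" and hi: "0 < hi"
  shows "form_bounds n (minv A) (1 / hi) (1 / lo)"
    and "v \<in> carrier_vec n \<Longrightarrow> vnorm (minv A *\<^sub>v v) \<le> vnorm v / lo"
proof -
  note A = form_boundsD(1,2)[OF fb(1)]
  note W = form_bounds_minv[OF fb(1) fb]
  have T: "(minv A)\<^sup>T = minv A"
  proof -
    have "A * (minv A)\<^sup>T = (minv A * A)\<^sup>T" using transpose_mult[OF W(1) A(1)] A(2) by simp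
    then have "A * (minv A)\<^sup>T = 1\<^sub>m n" using W by simp
    then show ?thesis using minv_eqI[OF A(1), of "(minv A)\<^sup>T"] W(1) by simp
  qed
  have *: "vnorm (minv A *\<^sub>v v) \<le> vnorm v / lo \<and> v \<bullet> (minv A *\<^sub>v v) \<le> (1 / lo) * (v \<bullet> v)
      \<and> (1 / hi) * (v \<bullet> v) \<le> v \<bullet> (minv A *\<^sub>v v)" if v: "v \<in> carrier_vec n" for v
  proof -
    define w where "w = minv A *\<^sub>v v"
    have w: "w \<in> carrier_vec n" using W v by (simp add: w_def)
    have Aw: "A *\<^sub>v w = v" using A W v by (simp add: w_def flip: assoc_mult_mat_vec)
    have 1: "lo * (vnorm w)\<^sup>2 \<le> w \<bullet> v" using form_boundsD(3)[OF fb(1) w] by (simp add: Aw vnorm_sq)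
    have 2: "w \<bullet> v \<le> vnorm w * vnorm v" using abs_sprod_le[of w v] w v by auto
    have 3: "vnorm w \<le> vnorm v / lo"
    proof (cases "vnorm w = 0")
      case False
      then have "0 < vnorm w" using vnorm_nonneg[of w] by linarith
      moreover have "vnorm w * (lo * vnorm w) \<le> vnorm w * vnorm v" using 1 2 by (simp add: power2_eq_square ac_simps)
      ultimately show ?thesis using fb(2) by (simp add: field_simps)
    qed (use fb(2) in simp)
    have 4: "v \<bullet> w = w \<bullet> v" using v w by (simp add: comm_scalar_prod)
    have 5: "vnorm w * vnorm v \<le> vnorm v / lo * vnorm v" by (intro mult_right_mono 3) simp
    have 6: "v \<bullet> v \<le> hi * (w \<bullet> v)" using form_bounds_vnorm_mult[OF fb(1) _ w] fb(2) by (simp add: Aw vnorm_sq)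
    from 2 5 have "v \<bullet> w \<le> (1 / lo) * (v \<bullet> v)" unfolding 4 vnorm_sq[symmetric] by (simp add: power2_eq_square)
    then show ?thesis using 3 6 hi unfolding w_def[symmetric] 4 by (simp add: field_simps)
  qed
  then show "form_bounds n (minv A) (1 / hi) (1 / lo)" using W(1) T by (auto simp: form_bounds_def)
  show "v \<in> carrier_vec n \<Longrightarrow> vnorm (minv A *\<^sub>v v) \<le> vnorm v / lo" using * by blast
qed

section \<open>An entrywise matrix norm\<close>

text \<open>
  The sum of the moduli of the entries is submultiplicative for rectangular matrices as well, so
  products can be estimated factor by factor.  The dimension factors lost against the operator norm
  do no harm, as the dimension is bounded.
\<close>
definition mnorm1 :: "real mat \<Rightarrow> real" where
  "mnorm1 A = (\<Sum>i<dim_row A. \<Sum>j<dim_col A. \<bar>A $$ (i, j)\<bar>)"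

lemma mnorm1_nonneg [simp]: "0 \<le> mnorm1 A"
  by (simp add: mnorm1_def sum_nonneg)

lemma abs_index_le_mnorm1:
  assumes "i < dim_row A" "j < dim_col A"
  shows "\<bar>A $$ (i, j)\<bar> \<le> mnorm1 A"
proof -
  have "\<bar>A $$ (i, j)\<bar> \<le> (\<Sum>j<dim_col A. \<bar>A $$ (i, j)\<bar>)"
    using assms by (intro member_le_sum) auto
  also have "\<dots> \<le> mnorm1 A" unfolding mnorm1_def
    using assms by (intro member_le_sum[of i _ "\<lambda>i. \<Sum>j<dim_col A. \<bar>A $$ (i, j)\<bar>"]) (auto simp: sum_nonneg)
  finally show ?thesis .
qed

lemma mnorm1_le:
  assumes "A \<in> carrier_mat m n" "\<And>i j. i < m \<Longrightarrow> j < n \<Longrightarrow> \<bar>A $$ (i, j)\<bar> \<le> c"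
  shows "mnorm1 A \<le> real m * real n * c"
proof -
  have "mnorm1 A \<le> (\<Sum>i<m. \<Sum>j<n. c)" unfolding mnorm1_def using assms by (simp only: carrier_matD[OF assms(1)]) (intro sum_mono, auto)
  then show ?thesis by simp
qed

lemma mnorm1_add: "A \<in> carrier_mat m n \<Longrightarrow> B \<in> carrier_mat m n \<Longrightarrow> mnorm1 (A + B) \<le> mnorm1 A + mnorm1 B"
  unfolding mnorm1_def by (auto simp: sum.distrib[symmetric] intro!: sum_mono)

lemma mnorm1_minus: "A \<in> carrier_mat m n \<Longrightarrow> B \<in> carrier_mat m n \<Longrightarrow> mnorm1 (A - B) = mnorm1 (B - A)"
  unfolding mnorm1_def by (auto intro!: sum.cong)

lemma mnorm1_mult:
  assumes A: "A \<in> carrier_mat m k" and B: "B \<in> carrier_mat k n"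
  shows "mnorm1 (A * B) \<le> mnorm1 A * mnorm1 B"
proof -
  define r where "r l = (\<Sum>j<n. \<bar>B $$ (l, j)\<bar>)" for l
  have r0: "0 \<le> r l" for l by (simp add: r_def sum_nonneg)
  have rB: "mnorm1 B = (\<Sum>l<k. r l)" using B by (simp add: mnorm1_def r_def)
  have "mnorm1 (A * B) = (\<Sum>i<m. \<Sum>j<n. \<bar>\<Sum>l<k. A $$ (i, l) * B $$ (l, j)\<bar>)"
    unfolding mnorm1_def using A B by (auto intro!: sum.cong simp: scalar_prod_def lessThan_atLeast0)
  also have "\<dots> \<le> (\<Sum>i<m. \<Sum>j<n. \<Sum>l<k. \<bar>A $$ (i, l)\<bar> * \<bar>B $$ (l, j)\<bar>)"
    by (intro sum_mono order_trans[OF sum_abs]) (simp add: abs_mult)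
  also have "\<dots> = (\<Sum>i<m. \<Sum>l<k. \<bar>A $$ (i, l)\<bar> * r l)"
    unfolding r_def sum_distrib_left by (intro sum.cong refl sum.swap)
  also have "\<dots> \<le> (\<Sum>i<m. \<Sum>l<k. \<bar>A $$ (i, l)\<bar> * mnorm1 B)"
    unfolding rB by (intro sum_mono mult_left_mono member_le_sum) (auto simp: r0)
  also have "\<dots> = mnorm1 A * mnorm1 B" using A by (simp add: mnorm1_def sum_distrib_right)
  finally show ?thesis .
qed

lemma mnorm1_mult3:
  assumes "A \<in> carrier_mat n n" "B \<in> carrier_mat n n" "C \<in> carrier_mat n n"
    and "mnorm1 A \<le> a" "mnorm1 B \<le> b" "mnorm1 C \<le> c"
  shows "mnorm1 (A * B * C) \<le> a * b * c"
proof -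
  have "mnorm1 (A * B * C) \<le> mnorm1 (A * B) * mnorm1 C" using assms by (intro mnorm1_mult) auto
  also have "\<dots> \<le> (mnorm1 A * mnorm1 B) * mnorm1 C"
    using assms by (intro mult_right_mono mnorm1_mult) auto
  also have "\<dots> \<le> a * b * c"
    using assms(4-6) mnorm1_nonneg[of A] mnorm1_nonneg[of B] mnorm1_nonneg[of C]
      order_trans[OF mnorm1_nonneg assms(4)] order_trans[OF mnorm1_nonneg assms(5)]
    by (intro mult_mono mult_nonneg_nonneg) auto
  finally show ?thesis .
qed

lemma form_bounds_index_le:
  assumes fb: "form_bounds n A lo hi" "0 \<le> lo" "0 \<le> hi" and ij: "i < n" "j < n"
  shows "\<bar>A $$ (i, j)\<bar> \<le> hi"
proof -
  note A = form_boundsD(1)[OF fb(1)]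
  let ?e = "unit_vec n j :: real vec"
  have e: "?e \<in> carrier_vec n" "?e \<bullet> ?e = 1" using ij by auto
  have "(vnorm (A *\<^sub>v ?e))\<^sup>2 \<le> hi * (?e \<bullet> (A *\<^sub>v ?e))" by (rule form_bounds_vnorm_mult[OF fb(1,2) e(1)])
  also have "\<dots> \<le> hi * (hi * (?e \<bullet> ?e))" by (intro mult_left_mono form_boundsD(4)[OF fb(1) e(1)] fb)
  finally have "(vnorm (A *\<^sub>v ?e))\<^sup>2 \<le> hi\<^sup>2" using e(2) by (simp add: power2_eq_square)
  then have "vnorm (A *\<^sub>v ?e) \<le> hi" using fb(3) by (rule power2_le_imp_le)
  moreover have "\<bar>A $$ (i, j)\<bar> \<le> vnorm (A *\<^sub>v ?e)"
    using abs_index_le_vnorm[of i "A *\<^sub>v ?e"] A ij by simp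
  ultimately show ?thesis by simp
qed

section \<open>Symmetric matrices and their upper triangles\<close>

lemma tri_dim_mono: "a \<le> b \<Longrightarrow> tri_dim a \<le> tri_dim b"
  unfolding tri_dim_def by (intro div_le_mono mult_le_mono) auto

lemma tri_dim_Suc: "tri_dim (Suc j) = tri_dim j + Suc j"
  by (simp add: tri_dim_def)

lemma le_tri_dim: "s \<le> tri_dim s"
  by (induction s) (auto simp: tri_dim_Suc)

lemma tri_index_less: "i < s \<Longrightarrow> j < s \<Longrightarrow> tri_index i j < tri_dim s"
proof (induction i j rule: linorder_wlog)
  case (le i j)
  have "tri_index i j = tri_dim j + i" using le by (simp add: tri_index_eq tri_dim_def)
  also have "\<dots> < tri_dim (Suc j)" using le by (simp add: tri_dim_Suc)
  also have "\<dots> \<le> tri_dim s" using le by (intro tri_dim_mono) auto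
  finally show ?case .
qed (simp add: tri_index_def min.commute max.commute)

lemma tri_row_le_col: "tri_row k \<le> tri_col k"
  by (simp add: tri_row_def tri_col_def)

lemma tri_col_less: "k < tri_dim s \<Longrightarrow> tri_col k < s"
proof (rule ccontr)
  assume k: "k < tri_dim s" "\<not> tri_col k < s"
  have "tri_dim s \<le> tri_dim (tri_col k)" using k by (intro tri_dim_mono) auto
  also have "\<dots> \<le> tri_index (tri_row k) (tri_col k)"
    using tri_index_eq[OF tri_row_le_col] by (simp add: tri_dim_def)
  also have "\<dots> = k" by (rule tri_index_row_col)
  finally show False using k by simp
qed

lemma tri_row_less: "k < tri_dim s \<Longrightarrow> tri_row k < s"
  using tri_col_less tri_row_le_col le_less_trans by blast

lemma tri_index_commute: "tri_index i j = tri_index j i"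
  by (simp add: tri_index_def min.commute max.commute)

lemma sym_of_par_carrier [simp]: "sym_of_par s \<theta> \<in> carrier_mat s s"
  by (simp add: sym_of_par_def)

lemma sym_of_par_dim [simp]: "dim_row (sym_of_par s \<theta>) = s" "dim_col (sym_of_par s \<theta>) = s"
  by (simp_all add: sym_of_par_def)

lemma sym_of_par_transpose: "(sym_of_par s \<theta>)\<^sup>T = sym_of_par s \<theta>"
  by (intro eq_matI) (auto simp: sym_of_par_def tri_index_commute)

lemma sym_of_par_diff: "sym_of_par s (\<lambda>k. \<theta> k - \<theta>' k) = sym_of_par s \<theta> - sym_of_par s \<theta>'"
  by (intro eq_matI) (auto simp: sym_of_par_def)

text \<open>Half-vectorisation, the inverse of sym_of_par on symmetric matrices.\<close>
definition tri_vec :: "nat \<Rightarrow> real mat \<Rightarrow> real vec" where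
  "tri_vec s A = vec (tri_dim s) (\<lambda>k. A $$ (tri_row k, tri_col k))"

lemma tri_vec_carrier [simp]: "tri_vec s A \<in> carrier_vec (tri_dim s)" "dim_vec (tri_vec s A) = tri_dim s"
  by (simp_all add: tri_vec_def)

lemma tri_vec_index: "k < tri_dim s \<Longrightarrow> tri_vec s A $ k = A $$ (tri_row k, tri_col k)"
  by (simp add: tri_vec_def)

lemma vnorm_tri_vec_le:
  assumes "A \<in> carrier_mat s s"
  shows "vnorm (tri_vec s A) \<le> real (tri_dim s) * mnorm1 A"
  using vnorm_le_card[of "tri_vec s A" "mnorm1 A"] assms
  by (simp add: tri_vec_index abs_index_le_mnorm1 tri_row_less tri_col_less)

lemma mnorm1_le_tri_vec:
  assumes A: "A \<in> carrier_mat s s" "A\<^sup>T = A"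
  shows "mnorm1 A \<le> real s * real s * vnorm (tri_vec s A)"
proof (rule mnorm1_le[OF A(1)])
  fix i j assume "i < s" "j < s"
  then show "\<bar>A $$ (i, j)\<bar> \<le> vnorm (tri_vec s A)"
  proof (induction i j rule: linorder_wlog)
    case (le i j)
    then show ?case
      using abs_index_le_vnorm[of "tri_index i j" "tri_vec s A"]
      by (simp add: tri_index_less tri_vec_index tri_row_index tri_col_index)
  next
    case (sym i j)
    have "A $$ (i, j) = A\<^sup>T $$ (i, j)" using A by simp
    also have "\<dots> = A $$ (j, i)" using A(1) sym by simp
    finally show ?case using sym by (simp add: A)
  qed
qed

lemma mnorm1_sym_of_par:
  "mnorm1 (sym_of_par s h) \<le> real s * real s * vnorm (vec (tri_dim s) h)"
proof (rule mnorm1_le)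
  fix i j assume "i < s" "j < s"
  then show "\<bar>sym_of_par s h $$ (i, j)\<bar> \<le> vnorm (vec (tri_dim s) h)"
    using abs_index_le_vnorm[of "tri_index i j" "vec (tri_dim s) h"]
    by (simp add: tri_index_less sym_of_par_def)
qed simp

lemma vnorm_le_sym_of_par:
  "vnorm (vec (tri_dim s) h) \<le> real (tri_dim s) * mnorm1 (sym_of_par s h)"
proof -
  have "vec (tri_dim s) h = tri_vec s (sym_of_par s h)"
    by (intro eq_vecI) (auto simp: tri_vec_index sym_of_par_def tri_row_less tri_col_less tri_index_row_col)
  then show ?thesis using vnorm_tri_vec_le[of "sym_of_par s h" s] by simp
qed

lemma triple_index:
  fixes P Q H :: "real mat"
  assumes "P \<in> carrier_mat s s" "Q \<in> carrier_mat s s" "H \<in> carrier_mat s s" "a < s" "b < s"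
  shows "(P * H * Q) $$ (a, b) = (\<Sum>i<s. \<Sum>j<s. P $$ (a, i) * Q $$ (j, b) * H $$ (i, j))"
proof -
  have "P * H * Q = P * (H * Q)" using assms by simp
  also have "\<dots> $$ (a, b) = (\<Sum>i<s. P $$ (a, i) * (\<Sum>j<s. H $$ (i, j) * Q $$ (j, b)))"
    using assms by (auto simp: scalar_prod_def lessThan_atLeast0 intro!: sum.cong)
  finally show ?thesis by (simp add: sum_distrib_left mult.assoc mult.commute[of "H $$ _"])
qed

text \<open>The basis of the symmetric matrices that is dual to the upper-triangular coordinates.\<close>
definition tri_unit :: "nat \<Rightarrow> nat \<Rightarrow> real mat" where
  "tri_unit s l = sym_of_par s (\<lambda>k. if k = l then 1 else 0)"

lemma tri_unit_carrier [simp]: "tri_unit s l \<in> carrier_mat s s"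
  by (simp add: tri_unit_def)

lemma mnorm1_tri_unit: "mnorm1 (tri_unit s l) \<le> real s * real s"
  using mnorm1_le[of "tri_unit s l" s s 1] by (simp add: tri_unit_def sym_of_par_def)

text \<open>Linearity of H \<mapsto> P H Q in the coordinates of H.  It turns the coordinate sums of Jacobians
  and Hessians back into matrix products.\<close>
lemma triple_sym_of_par:
  assumes P: "P \<in> carrier_mat s s" "Q \<in> carrier_mat s s" "a < s" "b < s"
  shows "(\<Sum>l<tri_dim s. (P * tri_unit s l * Q) $$ (a, b) * h l) = (P * sym_of_par s h * Q) $$ (a, b)"
proof -
  have "(\<Sum>l<tri_dim s. (P * tri_unit s l * Q) $$ (a, b) * h l)
     = (\<Sum>l<tri_dim s. \<Sum>i<s. \<Sum>j<s. P $$ (a, i) * Q $$ (j, b) * (tri_unit s l $$ (i, j) * h l))"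
    unfolding triple_index[OF P(1,2) tri_unit_carrier P(3,4)] by (simp add: sum_distrib_right mult.assoc)
  also have "\<dots> = (\<Sum>i<s. \<Sum>j<s. \<Sum>l<tri_dim s. P $$ (a, i) * Q $$ (j, b) * (tri_unit s l $$ (i, j) * h l))"
    by (subst sum.swap) (intro sum.cong refl sum.swap)
  also have "\<dots> = (\<Sum>i<s. \<Sum>j<s. P $$ (a, i) * Q $$ (j, b) * sym_of_par s h $$ (i, j))"
  proof (intro sum.cong refl)
    fix i j assume ij: "i \<in> {..<s}" "j \<in> {..<s}"
    have "(\<Sum>l<tri_dim s. tri_unit s l $$ (i, j) * h l) = (\<Sum>l<tri_dim s. if l = tri_index i j then h l else 0)"
      using ij by (intro sum.cong) (auto simp: tri_unit_def sym_of_par_def)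
    also have "\<dots> = sym_of_par s h $$ (i, j)" using ij by (simp add: sym_of_par_def tri_index_less)
    finally show "(\<Sum>l<tri_dim s. P $$ (a, i) * Q $$ (j, b) * (tri_unit s l $$ (i, j) * h l)) = P $$ (a, i) * Q $$ (j, b) * sym_of_par s h $$ (i, j)"
      by (simp add: sum_distrib_left[symmetric])
  qed
  also have "\<dots> = (P * sym_of_par s h * Q) $$ (a, b)"
    by (rule triple_index[symmetric, OF P(1,2) sym_of_par_carrier P(3,4)])
  finally show ?thesis .
qed

section \<open>Matrix inversion to second order\<close>

text \<open>The resolvent identity.\<close>
lemma inverse_diff:
  assumes A: "A \<in> carrier_mat n n" "X \<in> carrier_mat n n" "A * X = 1\<^sub>m n"
    and B: "B \<in> carrier_mat n n" "Y \<in> carrier_mat n n" "Y * B = (1\<^sub>m n :: real mat)"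
  shows "Y * (A - B) * X = Y - X"
proof -
  have "Y * (A - B) * X = (Y * A - Y * B) * X" using A B by (simp add: mult_minus_distrib_mat[of Y n n])
  also have "\<dots> = Y * A * X - X" using A B minus_mult_distrib_mat[of "Y * A" n n "1\<^sub>m n" X n] by simp
  also have "Y * A * X = Y * (A * X)" using A B by (intro assoc_mult_mat) auto
  also have "\<dots> = Y" using A B(2) by simp
  finally show ?thesis .
qed

text \<open>Replacing X by Y on the right of the resolvent identity leaves an error that contains the
  difference twice, hence is quadratic.\<close>
lemma inverse_expansion_index:
  assumes A: "A \<in> carrier_mat n n" "X \<in> carrier_mat n n" "A * X = 1\<^sub>m n"
    and B: "B \<in> carrier_mat n n" "Y \<in> carrier_mat n n" "Y * B = (1\<^sub>m n :: real mat)"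
  shows "Y * (A - B) * Y - (Y - X) = Y * (A - B) * (Y - X)"
  using inverse_diff[OF A B] A B minus_carrier_mat[OF B(1), of A]
    mult_minus_distrib_mat[of "Y * (A - B)" n n Y n X]
  by simp

text \<open>One constant bounds both matrices and both inverses, so the estimates can be applied with the
  roles of the matrices and their inverses exchanged.\<close>
locale bounded_inverse_pair =
  fixes n A B X Y K
  assumes A: "A \<in> carrier_mat n n" "X \<in> carrier_mat n n" "A * X = 1\<^sub>m n" "X * A = 1\<^sub>m n"
    and B: "B \<in> carrier_mat n n" "Y \<in> carrier_mat n n" "B * Y = 1\<^sub>m n" "Y * B = (1\<^sub>m n :: real mat)"
    and K: "mnorm1 A \<le> K" "mnorm1 X \<le> K" "mnorm1 B \<le> K" "mnorm1 Y \<le> K"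
begin

lemma K0: "0 \<le> K" using K(1) mnorm1_nonneg[of A] by linarith

lemma AB [simp]: "A - B \<in> carrier_mat n n" "X - Y \<in> carrier_mat n n" "Y - X \<in> carrier_mat n n" using A B by auto

lemma diff_le: "mnorm1 (Y - X) \<le> K * mnorm1 (A - B) * K"
  unfolding inverse_diff[OF A(1-3) B(1,2,4), symmetric]
  using A B K by (intro mnorm1_mult3[of _ n]) auto

lemma diff_ge: "mnorm1 (A - B) \<le> K * mnorm1 (Y - X) * K"
proof -
  have "mnorm1 (B - A) \<le> K * mnorm1 (X - Y) * K"
    unfolding inverse_diff[OF A(2,1,4) B(2,1,3), symmetric]
    using A B K by (intro mnorm1_mult3[of _ n]) auto
  then show ?thesis using A B by (simp add: mnorm1_minus[of _ n n])
qed

lemma expansion_le: "mnorm1 (Y * (A - B) * Y - (Y - X)) \<le> K ^ 3 * (mnorm1 (A - B))\<^sup>2"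
proof -
  have "mnorm1 (Y * (A - B) * Y - (Y - X)) \<le> K * mnorm1 (A - B) * (K * mnorm1 (A - B) * K)"
    unfolding inverse_expansion_index[OF A(1-3) B(1,2,4)]
    using A B K diff_le by (intro mnorm1_mult3[of _ n]) auto
  then show ?thesis by (simp add: power2_eq_square power3_eq_cube mult_ac)
qed

text \<open>
  With X = Y - d the product X E X has linear part - d E Y - Y E d and quadratic part d E d.
  Replacing d by its own linear part Y H Y costs only another quadratic error.  This is the
  derivative of the Jacobian E \<mapsto> X E X, with remainder.
\<close>
lemma sandwich_expansion_le:
  assumes E: "E \<in> carrier_mat n n"
  defines "H \<equiv> A - B"
  shows "mnorm1 (X * E * X - Y * E * Y + (Y * H * (Y * E * Y) + Y * E * Y * H * Y)) \<le> 3 * K ^ 4 * mnorm1 E * (mnorm1 (A - B))\<^sup>2"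
proof -
  define R where "R = Y * H * Y - (Y - X)"
  define S where "S = Y * H * Y"
  define d where "d = Y - X"
  have H: "H \<in> carrier_mat n n" by (simp add: H_def)
  have c: "R \<in> carrier_mat n n" "S \<in> carrier_mat n n" "d \<in> carrier_mat n n" using A B H by (auto simp: R_def S_def d_def)
  have X: "X = Y - d" using A B by (intro eq_matI) (auto simp: d_def)
  have R: "d = S - R" using A B H by (intro eq_matI) (auto simp: d_def R_def S_def)
  have 1: "X * E * X = Y * E * Y - d * E * Y - Y * E * d + d * E * d"
  proof -
    have "X * E * X = (Y * E - d * E) * Y - (Y * E - d * E) * d"
    proof -
      have "Y * E - d * E \<in> carrier_mat n n" using E c by (intro minus_carrier_mat) auto
      then show ?thesis unfolding X
        using B E c mult_minus_distrib_mat[of "Y * E - d * E" n n Y n d] by (simp add: minus_mult_distrib_mat[of _ n n])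
    qed
    also have "\<dots> = Y * E * Y - d * E * Y - (Y * E * d - d * E * d)"
      using B E c by (simp add: minus_mult_distrib_mat[of _ n n])
    finally show ?thesis using B E c
      by (intro eq_matI) (auto simp del: assoc_mult_mat index_mult_mat(1))
  qed
  have 2: "d * E * Y = S * E * Y - R * E * Y" unfolding R using B E c by (simp add: minus_mult_distrib_mat[of _ n n])
  have 3: "Y * E * d = Y * E * S - Y * E * R" unfolding R using B E c by (simp add: mult_minus_distrib_mat[of _ n n])
  have 4: "Y * H * (Y * E * Y) = S * E * Y" "Y * E * Y * H * Y = Y * E * S"
    unfolding S_def using B E H by (simp_all add: assoc_mult_mat[of _ n n _ n _ n])
  have "X * E * X - Y * E * Y + (Y * H * (Y * E * Y) + Y * E * Y * H * Y) = R * E * Y + Y * E * R + d * E * d"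
    unfolding 1 2 3 4 using B E c
    by (intro eq_matI) (auto simp del: assoc_mult_mat index_mult_mat(1))
  moreover have "mnorm1 (R * E * Y + Y * E * R + d * E * d) \<le> mnorm1 (R * E * Y) + mnorm1 (Y * E * R) + mnorm1 (d * E * d)"
    using B E c mnorm1_add[of "R * E * Y + Y * E * R" n n "d * E * d"] mnorm1_add[of "R * E * Y" n n "Y * E * R"] by simp
  moreover have "mnorm1 (R * E * Y) \<le> (K ^ 3 * (mnorm1 (A - B))\<^sup>2) * mnorm1 E * K"
    using B E c K expansion_le by (intro mnorm1_mult3[of _ n]) (auto simp: R_def H_def)
  moreover have "mnorm1 (Y * E * R) \<le> K * mnorm1 E * (K ^ 3 * (mnorm1 (A - B))\<^sup>2)"
    using B E c K expansion_le by (intro mnorm1_mult3[of _ n]) (auto simp: R_def H_def)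
  moreover have "mnorm1 (d * E * d) \<le> (K * mnorm1 (A - B) * K) * mnorm1 E * (K * mnorm1 (A - B) * K)"
    using B E c K diff_le by (intro mnorm1_mult3[of _ n]) (auto simp: d_def)
  ultimately show ?thesis by (simp add: power2_eq_square power3_eq_cube power4_eq_xxxx mult_ac)
qed

end

section \<open>Jacobians from quadratic remainders\<close>

lemma par_dist_eq: "par_dist p \<theta> \<theta>' = vnorm (vec p (\<lambda>k. \<theta> k - \<theta>' k))"
  unfolding par_dist_def by (intro arg_cong[where f=vnorm] eq_vecI) auto

lemma par_dist_nonneg [simp]: "0 \<le> par_dist p \<theta> \<theta>'" by (simp add: par_dist_def)

lemma par_dist_self [simp]: "par_dist p \<theta> \<theta> = 0"
  by (simp add: par_dist_eq vnorm_def scalar_prod_def)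

lemma par_dist_triangle: "par_dist p \<theta> \<theta>'' \<le> par_dist p \<theta> \<theta>' + par_dist p \<theta>' \<theta>''"
proof -
  have "vec p \<theta> - vec p \<theta>'' = (vec p \<theta> - vec p \<theta>') + (vec p \<theta>' - vec p \<theta>'')" by (intro eq_vecI) auto
  then show ?thesis unfolding par_dist_def by (simp add: vnorm_triangle)
qed

lemma par_dist_sq: "(par_dist p \<theta> \<theta>')\<^sup>2 = (\<Sum>k<p. (\<theta> k - \<theta>' k)\<^sup>2)"
  unfolding par_dist_eq vnorm_sq by (simp add: scalar_prod_def power2_eq_square lessThan_atLeast0)

lemma has_jacobianI_quadratic:
  assumes J: "J \<in> carrier_mat m p" and r: "0 < r" and C: "0 \<le> C"
    and q: "\<And>\<theta>'. \<theta>' \<in> par_space p \<Longrightarrow> par_dist p \<theta>' \<theta> < r \<Longrightarrow>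
      vnorm (f \<theta>' - f \<theta> - J *\<^sub>v (vec p \<theta>' - vec p \<theta>)) \<le> C * (par_dist p \<theta>' \<theta>)\<^sup>2"
  shows "has_jacobian p m f \<theta> J"
  unfolding has_jacobian_def
proof (intro conjI J allI impI)
  fix e :: real assume e: "0 < e"
  show "\<exists>d>0. \<forall>\<theta>'\<in>par_space p. par_dist p \<theta>' \<theta> < d \<longrightarrow>
     vnorm (f \<theta>' - f \<theta> - J *\<^sub>v (vec p \<theta>' - vec p \<theta>)) \<le> e * par_dist p \<theta>' \<theta>"
  proof (intro exI[of _ "min r (e / (C + 1))"] conjI ballI impI)
    fix \<theta>' assume t: "\<theta>' \<in> par_space p" "par_dist p \<theta>' \<theta> < min r (e / (C + 1))"
    then have "(C + 1) * par_dist p \<theta>' \<theta> < e" using C by (simp add: field_simps)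
    then have "C * par_dist p \<theta>' \<theta> + par_dist p \<theta>' \<theta> < e" by (simp add: algebra_simps)
    then have "C * par_dist p \<theta>' \<theta> \<le> e" using par_dist_nonneg[of p \<theta>' \<theta>] by linarith
    from mult_right_mono[OF this par_dist_nonneg[of p \<theta>' \<theta>]]
    show "vnorm (f \<theta>' - f \<theta> - J *\<^sub>v (vec p \<theta>' - vec p \<theta>)) \<le> e * par_dist p \<theta>' \<theta>"
      using q[of \<theta>'] t by (simp add: power2_eq_square mult.assoc)
  qed (use r e C in auto)
qed

text \<open>Moving a single coordinate by a small t within the parameter space compares the two candidates in
  one column: their difference times t is at most twice the remainder, which is o(t).\<close>
lemma has_jacobian_unique:
  assumes J: "has_jacobian p m f \<theta> J" "has_jacobian p m f \<theta> J'" and th: "\<theta> \<in> par_space p"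
  assumes f: "\<And>\<theta>. f \<theta> \<in> carrier_vec m"
  shows "J = J'"
proof (rule eq_matI)
  have c: "J \<in> carrier_mat m p" "J' \<in> carrier_mat m p" using J by (auto simp: has_jacobian_def)
  then show "dim_row J = dim_row J'" "dim_col J = dim_col J'" by auto
  fix i l assume "i < dim_row J'" "l < dim_col J'"
  then have il: "i < m" "l < p" using c by auto
  have "\<bar>J $$ (i, l) - J' $$ (i, l)\<bar> \<le> 2 * e" if e: "0 < e" for e
  proof -
    obtain d where d: "0 < d" and dJ: "\<And>\<theta>'. \<theta>' \<in> par_space p \<Longrightarrow> par_dist p \<theta>' \<theta> < d \<Longrightarrow>
       vnorm (f \<theta>' - f \<theta> - J *\<^sub>v (vec p \<theta>' - vec p \<theta>)) \<le> e * par_dist p \<theta>' \<theta>"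
      using J(1) e unfolding has_jacobian_def by blast
    obtain d' where d': "0 < d'" and dJ': "\<And>\<theta>'. \<theta>' \<in> par_space p \<Longrightarrow> par_dist p \<theta>' \<theta> < d' \<Longrightarrow>
       vnorm (f \<theta>' - f \<theta> - J' *\<^sub>v (vec p \<theta>' - vec p \<theta>)) \<le> e * par_dist p \<theta>' \<theta>"
      using J(2) e unfolding has_jacobian_def by blast
    define t where "t = min d d' / 2"
    have t: "0 < t" "t < d" "t < d'" using d d' by (auto simp: t_def)
    define \<theta>' where "\<theta>' k = (if k = l then \<theta> k + t else \<theta> k)" for k
    have sp: "\<theta>' \<in> par_space p" using th il by (auto simp: par_space_def \<theta>'_def)
    have h: "vec p \<theta>' - vec p \<theta> = t \<cdot>\<^sub>v unit_vec p l" using il by (intro eq_vecI) (auto simp: \<theta>'_def)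
    have dist: "par_dist p \<theta>' \<theta> = t"
      using il t by (simp add: par_dist_def h vnorm_smult) (simp add: vnorm_def)
    let ?v = "f \<theta>' - f \<theta> - J *\<^sub>v (vec p \<theta>' - vec p \<theta>)" and ?w = "f \<theta>' - f \<theta> - J' *\<^sub>v (vec p \<theta>' - vec p \<theta>)"
    have Ju: "(J *\<^sub>v (t \<cdot>\<^sub>v unit_vec p l)) $ i = t * J $$ (i, l)" "(J' *\<^sub>v (t \<cdot>\<^sub>v unit_vec p l)) $ i = t * J' $$ (i, l)"
      using c il by auto
    have di: "dim_vec (f x) = m" for x using f[of x] by auto
    have dv: "dim_vec ?v = m" "dim_vec ?w = m" using c by auto
    have "?w $ i - ?v $ i = t * (J $$ (i, l) - J' $$ (i, l))"
      using c il Ju unfolding h by (simp add: di algebra_simps)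
    moreover have "\<bar>?v $ i\<bar> \<le> e * t" using abs_index_le_vnorm[of i ?v] dJ[OF sp] dist t dv il by simp
    moreover have "\<bar>?w $ i\<bar> \<le> e * t" using abs_index_le_vnorm[of i ?w] dJ'[OF sp] dist t dv il by simp
    ultimately have "\<bar>t * (J $$ (i, l) - J' $$ (i, l))\<bar> \<le> t * (2 * e)" by (simp add: abs_le_iff algebra_simps)
    then show ?thesis using t by (simp add: abs_mult)
  qed
  from this[of "\<bar>J $$ (i, l) - J' $$ (i, l)\<bar> / 4"] show "J $$ (i, l) = J' $$ (i, l)"
    by (cases "J $$ (i, l) = J' $$ (i, l)") auto
qed

lemma jacobian_eqI:
  assumes "has_jacobian p m f \<theta> J" "\<theta> \<in> par_space p" "\<And>\<theta>. f \<theta> \<in> carrier_vec m"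
  shows "jacobian p m f \<theta> = J"
  unfolding jacobian_def using assms has_jacobian_unique by blast

section \<open>The mean moment map of a precision matrix\<close>

abbreviation prec_inv :: "nat \<Rightarrow> (nat \<Rightarrow> real) \<Rightarrow> real mat" where
  "prec_inv s \<theta> \<equiv> minv (sym_of_par s \<theta>)"

definition prec_ok :: "nat \<Rightarrow> real \<Rightarrow> real \<Rightarrow> (nat \<Rightarrow> real) \<Rightarrow> bool" where
  "prec_ok s lo hi \<theta> \<longleftrightarrow> 0 < lo \<and> 0 < hi \<and> form_bounds s (sym_of_par s \<theta>) lo hi"

text \<open>Entries of \<Omega> are at most hi and entries of its inverse at most 1 / lo, so this bounds the
  entrywise norms of both.\<close>
definition prec_const :: "nat \<Rightarrow> real \<Rightarrow> real \<Rightarrow> real" where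
  "prec_const s lo hi = real s * real s * (hi + 1 / lo)"

lemma prec_ok_props:
  assumes "prec_ok s lo hi \<theta>"
  shows "prec_inv s \<theta> \<in> carrier_mat s s" "(prec_inv s \<theta>)\<^sup>T = prec_inv s \<theta>"
    "sym_of_par s \<theta> * prec_inv s \<theta> = 1\<^sub>m s" "prec_inv s \<theta> * sym_of_par s \<theta> = 1\<^sub>m s"
    "mnorm1 (sym_of_par s \<theta>) \<le> prec_const s lo hi" "mnorm1 (prec_inv s \<theta>) \<le> prec_const s lo hi"
proof -
  from assms have fb: "form_bounds s (sym_of_par s \<theta>) lo hi" and pos: "0 < lo" "0 < hi" by (auto simp: prec_ok_def)
  note fi = form_bounds_inverse(1)[OF fb pos]
  show "prec_inv s \<theta> \<in> carrier_mat s s" "sym_of_par s \<theta> * prec_inv s \<theta> = 1\<^sub>m s" "prec_inv s \<theta> * sym_of_par s \<theta> = 1\<^sub>m s"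
    using form_bounds_minv[OF fb fb pos(1)] by auto
  show "(prec_inv s \<theta>)\<^sup>T = prec_inv s \<theta>" by (rule form_boundsD(2)[OF fi])
  have "mnorm1 (sym_of_par s \<theta>) \<le> real s * real s * (hi + 1 / lo)"
  proof (rule mnorm1_le)
    fix i j assume "i < s" "j < s"
    then show "\<bar>sym_of_par s \<theta> $$ (i, j)\<bar> \<le> hi + 1 / lo"
      using form_bounds_index_le[OF fb, of i j] pos by (simp add: add_increasing2)
  qed simp
  then show "mnorm1 (sym_of_par s \<theta>) \<le> prec_const s lo hi" by (simp add: prec_const_def)
  have "mnorm1 (prec_inv s \<theta>) \<le> real s * real s * (hi + 1 / lo)"
  proof (rule mnorm1_le)
    fix i j assume "i < s" "j < s"
    then show "\<bar>prec_inv s \<theta> $$ (i, j)\<bar> \<le> hi + 1 / lo"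
      using form_bounds_index_le[OF fi, of i j] pos by (simp add: add_increasing)
  qed (rule form_boundsD(1)[OF fi])
  then show "mnorm1 (prec_inv s \<theta>) \<le> prec_const s lo hi" by (simp add: prec_const_def)
qed

lemma prec_pair:
  assumes "prec_ok s lo hi \<theta>'" "prec_ok s lo hi \<theta>"
  shows "bounded_inverse_pair s (sym_of_par s \<theta>') (sym_of_par s \<theta>) (prec_inv s \<theta>') (prec_inv s \<theta>) (prec_const s lo hi)"
  unfolding bounded_inverse_pair_def
  by (intro conjI prec_ok_props[OF assms(1)] prec_ok_props[OF assms(2)] sym_of_par_carrier)

lemma prec_const_nonneg: "0 < lo \<Longrightarrow> 0 < hi \<Longrightarrow> 0 \<le> prec_const s lo hi"
  by (simp add: prec_const_def)

text \<open>
  Both the increment of the moment function from \<theta>0 to \<theta>, for any fixed observation, and its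
  expectation at \<theta>, as the expectation at \<theta>0 vanishes.
\<close>
definition prec_map :: "nat \<Rightarrow> (nat \<Rightarrow> real) \<Rightarrow> (nat \<Rightarrow> real) \<Rightarrow> real vec" where
  "prec_map s \<theta>0 \<theta> = tri_vec s (prec_inv s \<theta>0) - tri_vec s (prec_inv s \<theta>)"

text \<open>The negative inverse has the derivative H \<mapsto> X H X with X = minv \<Omega>; the columns list its values
  on the basis of the symmetric matrices.\<close>
definition prec_jac :: "nat \<Rightarrow> (nat \<Rightarrow> real) \<Rightarrow> real mat" where
  "prec_jac s \<theta> = mat (tri_dim s) (tri_dim s)
     (\<lambda>(k, l). (prec_inv s \<theta> * tri_unit s l * prec_inv s \<theta>) $$ (tri_row k, tri_col k))"

definition lip_const :: "nat \<Rightarrow> real \<Rightarrow> real \<Rightarrow> real" where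
  "lip_const s lo hi = real (tri_dim s) * (prec_const s lo hi * prec_const s lo hi) * (real s * real s)"

lemma mnorm1_sym_diff:
  "mnorm1 (sym_of_par s \<theta> - sym_of_par s \<theta>') \<le> real s * real s * par_dist (tri_dim s) \<theta> \<theta>'"
  using mnorm1_sym_of_par[of s "\<lambda>k. \<theta> k - \<theta>' k"] by (simp add: sym_of_par_diff par_dist_eq)

lemma par_dist_le_mnorm1:
  "par_dist (tri_dim s) \<theta> \<theta>' \<le> real (tri_dim s) * mnorm1 (sym_of_par s \<theta> - sym_of_par s \<theta>')"
  using vnorm_le_sym_of_par[of s "\<lambda>k. \<theta> k - \<theta>' k"] by (simp add: sym_of_par_diff par_dist_eq)

lemma prec_map_carrier [simp]: "prec_map s \<theta>0 \<theta> \<in> carrier_vec (tri_dim s)" "dim_vec (prec_map s \<theta>0 \<theta>) = tri_dim s"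
  by (simp_all add: prec_map_def)

lemma prec_map_eq:
  assumes "prec_ok s lo hi \<theta>" "prec_ok s lo hi \<theta>0"
  shows "prec_map s \<theta>0 \<theta> = tri_vec s (prec_inv s \<theta>0 - prec_inv s \<theta>)"
  using prec_ok_props(1)[OF assms(1)] prec_ok_props(1)[OF assms(2)]
  by (intro eq_vecI) (auto simp: prec_map_def tri_vec_index tri_row_less tri_col_less)

text \<open>The resolvent identity, with the change of norms absorbed in the constant.\<close>
lemma prec_map_upper:
  assumes ok: "prec_ok s lo hi \<theta>" "prec_ok s lo hi \<theta>0"
  shows "vnorm (prec_map s \<theta>0 \<theta>) \<le> lip_const s lo hi * par_dist (tri_dim s) \<theta> \<theta>0"
proof -
  interpret bounded_inverse_pair s "sym_of_par s \<theta>" "sym_of_par s \<theta>0" "prec_inv s \<theta>" "prec_inv s \<theta>0" "prec_const s lo hi"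
    by (rule prec_pair[OF ok])
  have "vnorm (prec_map s \<theta>0 \<theta>) \<le> real (tri_dim s) * mnorm1 (prec_inv s \<theta>0 - prec_inv s \<theta>)"
    unfolding prec_map_eq[OF ok] by (rule vnorm_tri_vec_le) simp
  also have "\<dots> \<le> real (tri_dim s) * (prec_const s lo hi * (real s * real s * par_dist (tri_dim s) \<theta> \<theta>0) * prec_const s lo hi)"
    using K0 by (intro mult_left_mono order_trans[OF diff_le] mult_right_mono mnorm1_sym_diff) auto
  finally show ?thesis by (simp add: lip_const_def mult_ac)
qed

text \<open>Identifiability: inversion is an involution, so the Lipschitz estimate also holds with matrices and
  inverses exchanged.\<close>
lemma prec_map_lower:
  assumes ok: "prec_ok s lo hi \<theta>" "prec_ok s lo hi \<theta>0"
  shows "par_dist (tri_dim s) \<theta> \<theta>0 \<le> lip_const s lo hi * vnorm (prec_map s \<theta>0 \<theta>)"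
proof -
  interpret bounded_inverse_pair s "sym_of_par s \<theta>" "sym_of_par s \<theta>0" "prec_inv s \<theta>" "prec_inv s \<theta>0" "prec_const s lo hi"
    by (rule prec_pair[OF ok])
  have sy: "(prec_inv s \<theta>0 - prec_inv s \<theta>)\<^sup>T = prec_inv s \<theta>0 - prec_inv s \<theta>"
    using transpose_minus[OF B(2) A(2)] prec_ok_props(2)[OF ok(1)] prec_ok_props(2)[OF ok(2)] by simp
  have "par_dist (tri_dim s) \<theta> \<theta>0 \<le> real (tri_dim s) * mnorm1 (sym_of_par s \<theta> - sym_of_par s \<theta>0)"
    by (rule par_dist_le_mnorm1)
  also have "\<dots> \<le> real (tri_dim s) * (prec_const s lo hi * (real s * real s * vnorm (prec_map s \<theta>0 \<theta>)) * prec_const s lo hi)"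
    using K0 unfolding prec_map_eq[OF ok]
    by (intro mult_left_mono order_trans[OF diff_ge] mult_right_mono mnorm1_le_tri_vec sy) auto
  finally show ?thesis by (simp add: lip_const_def mult_ac)
qed

lemma prec_jac_carrier [simp]: "prec_jac s \<theta> \<in> carrier_mat (tri_dim s) (tri_dim s)"
  by (simp add: prec_jac_def)

lemma prec_jac_mult:
  assumes ok: "prec_ok s lo hi \<theta>"
  shows "prec_jac s \<theta> *\<^sub>v vec (tri_dim s) h = tri_vec s (prec_inv s \<theta> * sym_of_par s h * prec_inv s \<theta>)"
proof (rule eq_vecI)
  fix k assume "k < dim_vec (tri_vec s (prec_inv s \<theta> * sym_of_par s h * prec_inv s \<theta>))"
  then have k: "k < tri_dim s" by simp
  note X = prec_ok_props(1)[OF ok]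
  have "(prec_jac s \<theta> *\<^sub>v vec (tri_dim s) h) $ k
     = (\<Sum>l<tri_dim s. (prec_inv s \<theta> * tri_unit s l * prec_inv s \<theta>) $$ (tri_row k, tri_col k) * h l)"
    using k by (simp add: prec_jac_def scalar_prod_def lessThan_atLeast0)
  also have "\<dots> = (prec_inv s \<theta> * sym_of_par s h * prec_inv s \<theta>) $$ (tri_row k, tri_col k)"
    by (rule triple_sym_of_par[OF X X tri_row_less[OF k] tri_col_less[OF k]])
  finally show "(prec_jac s \<theta> *\<^sub>v vec (tri_dim s) h) $ k = tri_vec s (prec_inv s \<theta> * sym_of_par s h * prec_inv s \<theta>) $ k"
    using k by (simp add: tri_vec_index)
qed (simp add: prec_jac_def)

lemma prec_jac_upper:
  assumes ok: "prec_ok s lo hi \<theta>"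
  shows "vnorm (prec_jac s \<theta> *\<^sub>v vec (tri_dim s) h) \<le> lip_const s lo hi * vnorm (vec (tri_dim s) h)"
proof -
  note X = prec_ok_props[OF ok]
  have K0: "0 \<le> prec_const s lo hi" using ok by (auto simp: prec_ok_def prec_const_nonneg)
  have "vnorm (prec_jac s \<theta> *\<^sub>v vec (tri_dim s) h) \<le> real (tri_dim s) * mnorm1 (prec_inv s \<theta> * sym_of_par s h * prec_inv s \<theta>)"
    unfolding prec_jac_mult[OF ok] using X by (intro vnorm_tri_vec_le) auto
  also have "\<dots> \<le> real (tri_dim s) * (prec_const s lo hi * (real s * real s * vnorm (vec (tri_dim s) h)) * prec_const s lo hi)"
    using X by (intro mult_left_mono mnorm1_mult3[of _ s] mnorm1_sym_of_par) auto
  finally show ?thesis by (simp add: lip_const_def mult_ac)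
qed

text \<open>H is recovered from X H X by multiplication with \<Omega> on both sides.\<close>
lemma prec_jac_lower:
  assumes ok: "prec_ok s lo hi \<theta>"
  shows "vnorm (vec (tri_dim s) h) \<le> lip_const s lo hi * vnorm (prec_jac s \<theta> *\<^sub>v vec (tri_dim s) h)"
proof -
  note X = prec_ok_props[OF ok]
  have K0: "0 \<le> prec_const s lo hi" using ok by (auto simp: prec_ok_def prec_const_nonneg)
  let ?O = "sym_of_par s \<theta>" and ?X = "prec_inv s \<theta>" and ?H = "sym_of_par s h"
  let ?Z = "?X * ?H * ?X"
  have cZ: "?Z \<in> carrier_mat s s" using X by auto
  have cP: "?X * ?H \<in> carrier_mat s s" using X(1) by auto
  have "?O * ?Z * ?O = ?O * (?Z * ?O)" by (rule assoc_mult_mat[OF sym_of_par_carrier cZ sym_of_par_carrier])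
  also have "?Z * ?O = ?X * ?H * (?X * ?O)" by (rule assoc_mult_mat[OF cP X(1) sym_of_par_carrier])
  also have "\<dots> = ?X * ?H" unfolding X(4) using cP by (rule right_mult_one_mat)
  also have "?O * (?X * ?H) = ?O * ?X * ?H"
    by (rule assoc_mult_mat[symmetric, OF sym_of_par_carrier X(1) sym_of_par_carrier])
  also have "\<dots> = ?H" unfolding X(3) by (rule left_mult_one_mat[OF sym_of_par_carrier])
  finally have H: "?H = ?O * ?Z * ?O" ..
  have "?Z\<^sup>T = ?X * (?H * ?X)"
    using X transpose_mult[of "?X * ?H" s s ?X s] transpose_mult[of ?X s s ?H s] by (simp add: sym_of_par_transpose)
  then have sy: "?Z\<^sup>T = ?Z" using assoc_mult_mat[OF X(1) sym_of_par_carrier X(1), of h] by (simp only:)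
  have "vnorm (vec (tri_dim s) h) \<le> real (tri_dim s) * mnorm1 ?H" by (rule vnorm_le_sym_of_par)
  also have "\<dots> \<le> real (tri_dim s) * (prec_const s lo hi * (real s * real s * vnorm (tri_vec s ?Z)) * prec_const s lo hi)"
    by (subst H) (intro mult_left_mono mnorm1_mult3[of _ s] mnorm1_le_tri_vec X sy cZ sym_of_par_carrier of_nat_0_le_iff)
  finally show ?thesis by (simp add: lip_const_def mult_ac prec_jac_mult[OF ok])
qed

definition quad_const :: "nat \<Rightarrow> real \<Rightarrow> real \<Rightarrow> real" where
  "quad_const s lo hi = real (tri_dim s) * (prec_const s lo hi ^ 3 * (real s * real s)\<^sup>2)"

lemma prec_map_quadratic:
  assumes ok: "prec_ok s lo hi \<theta>'" "prec_ok s lo hi \<theta>"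
  shows "vnorm (prec_map s \<theta>0 \<theta>' - prec_map s \<theta>0 \<theta> - prec_jac s \<theta> *\<^sub>v (vec (tri_dim s) \<theta>' - vec (tri_dim s) \<theta>))
     \<le> quad_const s lo hi * (par_dist (tri_dim s) \<theta>' \<theta>)\<^sup>2"
proof -
  interpret bounded_inverse_pair s "sym_of_par s \<theta>'" "sym_of_par s \<theta>" "prec_inv s \<theta>'" "prec_inv s \<theta>" "prec_const s lo hi"
    by (rule prec_pair[OF ok])
  let ?H = "sym_of_par s \<theta>' - sym_of_par s \<theta>" and ?Y = "prec_inv s \<theta>" and ?X = "prec_inv s \<theta>'"
  have h: "vec (tri_dim s) \<theta>' - vec (tri_dim s) \<theta> = vec (tri_dim s) (\<lambda>k. \<theta>' k - \<theta> k)" by (intro eq_vecI) auto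
  have c: "?Y * ?H * ?Y \<in> carrier_mat s s" using B AB by auto
  have "prec_map s \<theta>0 \<theta>' - prec_map s \<theta>0 \<theta> - prec_jac s \<theta> *\<^sub>v (vec (tri_dim s) \<theta>' - vec (tri_dim s) \<theta>)
     = - tri_vec s (?Y * ?H * ?Y - (?Y - ?X))"
    unfolding h prec_jac_mult[OF ok(2)] sym_of_par_diff
    using c A B by (intro eq_vecI) (auto simp: tri_vec_index prec_map_def tri_row_less tri_col_less simp del: assoc_mult_mat index_mult_mat(1))
  then have "vnorm (prec_map s \<theta>0 \<theta>' - prec_map s \<theta>0 \<theta> - prec_jac s \<theta> *\<^sub>v (vec (tri_dim s) \<theta>' - vec (tri_dim s) \<theta>))
     = vnorm (tri_vec s (?Y * ?H * ?Y - (?Y - ?X)))" by (simp add: vnorm_uminus)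
  also have "\<dots> \<le> real (tri_dim s) * mnorm1 (?Y * ?H * ?Y - (?Y - ?X))"
    by (intro vnorm_tri_vec_le minus_carrier_mat AB)
  also have "\<dots> \<le> real (tri_dim s) * (prec_const s lo hi ^ 3 * (real s * real s * par_dist (tri_dim s) \<theta>' \<theta>)\<^sup>2)"
    using K0 by (intro mult_left_mono order_trans[OF expansion_le] power_mono mnorm1_sym_diff) auto
  finally show ?thesis by (simp add: quad_const_def power_mult_distrib mult_ac)
qed

text \<open>Differentiating X E X in the direction E' gives two terms, since each factor X contributes
  - X E' X.\<close>
definition prec_hess :: "nat \<Rightarrow> (nat \<Rightarrow> real) \<Rightarrow> nat \<Rightarrow> real mat" where
  "prec_hess s \<theta> k = mat (tri_dim s) (tri_dim s) (\<lambda>(l, l'). let X = prec_inv s \<theta> in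
     - ((X * tri_unit s l' * (X * tri_unit s l * X)) $$ (tri_row k, tri_col k)
        + (X * tri_unit s l * X * tri_unit s l' * X) $$ (tri_row k, tri_col k)))"

lemma prec_hess_carrier [simp]: "prec_hess s \<theta> k \<in> carrier_mat (tri_dim s) (tri_dim s)"
  by (simp add: prec_hess_def)

lemma prec_hess_mult_index:
  assumes ok: "prec_ok s lo hi \<theta>" and k: "k < tri_dim s" and l: "l < tri_dim s"
  shows "(prec_hess s \<theta> k *\<^sub>v vec (tri_dim s) h) $ l =
    - ((prec_inv s \<theta> * sym_of_par s h * (prec_inv s \<theta> * tri_unit s l * prec_inv s \<theta>)) $$ (tri_row k, tri_col k)
     + (prec_inv s \<theta> * tri_unit s l * prec_inv s \<theta> * sym_of_par s h * prec_inv s \<theta>) $$ (tri_row k, tri_col k))"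
proof -
  note X = prec_ok_props(1)[OF ok]
  let ?X = "prec_inv s \<theta>"
  let ?Z = "?X * tri_unit s l * ?X"
  have Z: "?Z \<in> carrier_mat s s" using X by auto
  have "(prec_hess s \<theta> k *\<^sub>v vec (tri_dim s) h) $ l
     = (\<Sum>l'<tri_dim s. - ((?X * tri_unit s l' * ?Z) $$ (tri_row k, tri_col k) * h l'
          + (?Z * tri_unit s l' * ?X) $$ (tri_row k, tri_col k) * h l'))"
    using l by (simp add: prec_hess_def scalar_prod_def lessThan_atLeast0 Let_def algebra_simps del: assoc_mult_mat index_mult_mat(1))
  also have "\<dots> = - ((\<Sum>l'<tri_dim s. (?X * tri_unit s l' * ?Z) $$ (tri_row k, tri_col k) * h l')
          + (\<Sum>l'<tri_dim s. (?Z * tri_unit s l' * ?X) $$ (tri_row k, tri_col k) * h l'))"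
    by (simp only: sum_negf sum.distrib)
  also have "\<dots> = - ((?X * sym_of_par s h * ?Z) $$ (tri_row k, tri_col k) + (?Z * sym_of_par s h * ?X) $$ (tri_row k, tri_col k))"
    using tri_row_less[OF k] tri_col_less[OF k] by (simp only: triple_sym_of_par[OF X Z] triple_sym_of_par[OF Z X])
  finally show ?thesis .
qed

definition hess_const :: "nat \<Rightarrow> real \<Rightarrow> real \<Rightarrow> real" where
  "hess_const s lo hi = real (tri_dim s) * (3 * prec_const s lo hi ^ 4 * (real s * real s) * (real s * real s)\<^sup>2)"

text \<open>Each entry of the row is an instance of sandwich_expansion_le.\<close>
lemma prec_jac_quadratic:
  assumes ok: "prec_ok s lo hi \<theta>'" "prec_ok s lo hi \<theta>" and k: "k < tri_dim s"
  shows "vnorm (row (prec_jac s \<theta>') k - row (prec_jac s \<theta>) k - prec_hess s \<theta> k *\<^sub>v (vec (tri_dim s) \<theta>' - vec (tri_dim s) \<theta>))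
     \<le> hess_const s lo hi * (par_dist (tri_dim s) \<theta>' \<theta>)\<^sup>2" (is "vnorm ?v \<le> _")
proof -
  interpret bounded_inverse_pair s "sym_of_par s \<theta>'" "sym_of_par s \<theta>" "prec_inv s \<theta>'" "prec_inv s \<theta>" "prec_const s lo hi"
    by (rule prec_pair[OF ok])
  let ?H = "sym_of_par s \<theta>' - sym_of_par s \<theta>" and ?Y = "prec_inv s \<theta>" and ?X = "prec_inv s \<theta>'"
  have h: "vec (tri_dim s) \<theta>' - vec (tri_dim s) \<theta> = vec (tri_dim s) (\<lambda>k. \<theta>' k - \<theta> k)" by (intro eq_vecI) auto
  have dimv: "dim_vec ?v = tri_dim s" by (simp add: prec_hess_def)
  have "\<bar>?v $ l\<bar> \<le> 3 * prec_const s lo hi ^ 4 * (real s * real s) * (real s * real s * par_dist (tri_dim s) \<theta>' \<theta>)\<^sup>2"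
    if l: "l < tri_dim s" for l
  proof -
    let ?E = "tri_unit s l"
    let ?R = "?X * ?E * ?X - ?Y * ?E * ?Y + (?Y * ?H * (?Y * ?E * ?Y) + ?Y * ?E * ?Y * ?H * ?Y)"
    have c: "?X * ?E * ?X \<in> carrier_mat s s" "?Y * ?E * ?Y \<in> carrier_mat s s" "?Y * ?H * (?Y * ?E * ?Y) \<in> carrier_mat s s"
      "?Y * ?E * ?Y * ?H * ?Y \<in> carrier_mat s s" using A B AB by auto
    have rj: "row (prec_jac s \<theta>'') k $ l = (prec_inv s \<theta>'' * ?E * prec_inv s \<theta>'') $$ (tri_row k, tri_col k)" for \<theta>''
      using k l by (simp add: prec_jac_def del: assoc_mult_mat index_mult_mat(1))
    have vR: "?v $ l = ?R $$ (tri_row k, tri_col k)"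
    proof -
      have "?v $ l = row (prec_jac s \<theta>') k $ l - row (prec_jac s \<theta>) k $ l - (prec_hess s \<theta> k *\<^sub>v (vec (tri_dim s) \<theta>' - vec (tri_dim s) \<theta>)) $ l"
        using l k by (simp add: prec_hess_def prec_jac_def del: index_mult_mat_vec)
      also have "\<dots> = ?R $$ (tri_row k, tri_col k)"
        unfolding rj h prec_hess_mult_index[OF ok(2) k l] sym_of_par_diff
        using carrier_matD[OF A(2)] carrier_matD[OF B(2)] tri_row_less[OF k] tri_col_less[OF k]
        by (simp del: assoc_mult_mat index_mult_mat(1))
      finally show ?thesis .
    qed
    have "\<bar>?v $ l\<bar> \<le> mnorm1 ?R" unfolding vR using c tri_row_less[OF k] tri_col_less[OF k] by (intro abs_index_le_mnorm1) auto
    also have "\<dots> \<le> 3 * prec_const s lo hi ^ 4 * mnorm1 ?E * (mnorm1 ?H)\<^sup>2" by (rule sandwich_expansion_le) simp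
    also have "\<dots> \<le> 3 * prec_const s lo hi ^ 4 * (real s * real s) * (real s * real s * par_dist (tri_dim s) \<theta>' \<theta>)\<^sup>2"
      using K0 by (intro mult_mono mult_left_mono power_mono mnorm1_sym_diff mnorm1_tri_unit) auto
    finally show ?thesis .
  qed
  then have "vnorm ?v \<le> real (dim_vec ?v) * (3 * prec_const s lo hi ^ 4 * (real s * real s) * (real s * real s * par_dist (tri_dim s) \<theta>' \<theta>)\<^sup>2)"
    using dimv by (intro vnorm_le_card) auto
  then show ?thesis unfolding dimv by (simp add: hess_const_def power_mult_distrib mult_ac)
qed

lemma prec_hess_bound:
  assumes ok: "prec_ok s lo hi \<theta>" and uv: "u \<in> unit_sphere (tri_dim s)" "v \<in> unit_sphere (tri_dim s)"
  defines "B \<equiv> real (tri_dim s) * (real (tri_dim s) * real (tri_dim s) * (2 * prec_const s lo hi ^ 3 * (real s * real s)\<^sup>2))"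
  shows "vnorm (hessian_form (tri_dim s) (prec_hess s \<theta>) u v) \<le> B"
proof -
  note X = prec_ok_props[OF ok]
  let ?X = "prec_inv s \<theta>" and ?K = "prec_const s lo hi"
  define c where "c = 2 * ?K ^ 3 * (real s * real s)\<^sup>2"
  have K0: "0 \<le> ?K" using ok by (auto simp: prec_ok_def prec_const_nonneg)
  have c0: "0 \<le> c" using K0 by (simp add: c_def)
  have u: "u \<in> carrier_vec (tri_dim s)" "v \<in> carrier_vec (tri_dim s)" "vnorm u = 1" "vnorm v = 1"
    using uv by (auto simp: unit_sphere_def)
  have en: "\<bar>prec_hess s \<theta> k $$ (l, l')\<bar> \<le> c" if "k < tri_dim s" "l < tri_dim s" "l' < tri_dim s" for k l l'
  proof -
    let ?A = "?X * tri_unit s l' * (?X * tri_unit s l * ?X)" and ?B = "?X * tri_unit s l * ?X * tri_unit s l' * ?X"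
    let ?m = "real s * real s"
    have "mnorm1 (?X * tri_unit s l * ?X) \<le> ?K * ?m * ?K"
      using X by (intro mnorm1_mult3[of _ s] mnorm1_tri_unit) auto
    then have "mnorm1 ?A \<le> ?K * ?m * (?K * ?m * ?K)" "mnorm1 ?B \<le> (?K * ?m * ?K) * ?m * ?K"
      using X by (auto intro!: mnorm1_mult3[of _ s] mnorm1_tri_unit simp del: assoc_mult_mat)
    moreover have "\<bar>?A $$ (tri_row k, tri_col k)\<bar> \<le> mnorm1 ?A" "\<bar>?B $$ (tri_row k, tri_col k)\<bar> \<le> mnorm1 ?B"
      using X tri_row_less[OF that(1)] tri_col_less[OF that(1)]
      by (auto intro!: abs_index_le_mnorm1 simp del: assoc_mult_mat index_mult_mat(1))
    ultimately have "\<bar>?A $$ (tri_row k, tri_col k)\<bar> + \<bar>?B $$ (tri_row k, tri_col k)\<bar> \<le> c"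
      by (simp add: c_def power2_eq_square power3_eq_cube mult_ac)
    then show ?thesis using that by (simp add: prec_hess_def Let_def del: assoc_mult_mat index_mult_mat(1))
  qed
  have "\<bar>u \<bullet> (prec_hess s \<theta> k *\<^sub>v v)\<bar> \<le> real (tri_dim s) * real (tri_dim s) * c" if k: "k < tri_dim s" for k
  proof -
    have i1: "\<bar>(prec_hess s \<theta> k *\<^sub>v v) $ l\<bar> \<le> real (tri_dim s) * c" if l: "l < tri_dim s" for l
    proof -
      have "\<bar>(prec_hess s \<theta> k *\<^sub>v v) $ l\<bar> = \<bar>\<Sum>l'<tri_dim s. prec_hess s \<theta> k $$ (l, l') * v $ l'\<bar>"
        using l u by (auto simp: scalar_prod_def lessThan_atLeast0 prec_hess_def intro!: arg_cong[where f=abs] sum.cong)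
      also have "\<dots> \<le> (\<Sum>l'<tri_dim s. c)"
      proof (intro order_trans[OF sum_abs] sum_mono)
        fix l' assume "l' \<in> {..<tri_dim s}"
        then have "\<bar>prec_hess s \<theta> k $$ (l, l')\<bar> \<le> c" "\<bar>v $ l'\<bar> \<le> 1"
          using en k l abs_index_le_vnorm[of l' v] u by auto
        then show "\<bar>prec_hess s \<theta> k $$ (l, l') * v $ l'\<bar> \<le> c"
          using mult_mono[of _ c "\<bar>v $ l'\<bar>" 1] c0 by (simp add: abs_mult)
      qed
      finally show ?thesis by simp
    qed
    have "vnorm (prec_hess s \<theta> k *\<^sub>v v) \<le> real (tri_dim s) * (real (tri_dim s) * c)"
      using vnorm_le_card[of "prec_hess s \<theta> k *\<^sub>v v" "real (tri_dim s) * c"] i1 by (simp add: prec_hess_def)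
    moreover have "\<bar>u \<bullet> (prec_hess s \<theta> k *\<^sub>v v)\<bar> \<le> vnorm u * vnorm (prec_hess s \<theta> k *\<^sub>v v)"
      using u by (intro abs_sprod_le) (auto simp: prec_hess_def)
    ultimately show ?thesis using u by (simp add: mult.assoc)
  qed
  then show ?thesis
    using vnorm_le_card[of "hessian_form (tri_dim s) (prec_hess s \<theta>) u v" "real (tri_dim s) * real (tri_dim s) * c"]
    by (simp add: hessian_form_def B_def c_def)
qed

section \<open>Entropy, identification and smoothness of the moments\<close>

text \<open>Turns constants that depend on the dimension into uniform ones once the dimension is bounded.\<close>
lemma bounded_on_initial_segment:
  fixes F :: "nat \<Rightarrow> real"
  obtains B where "0 < B" "\<And>s. s \<le> S \<Longrightarrow> F s \<le> B"
proof
  let ?B = "Max (F ` {..S})"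
  show "0 < max 1 ?B" by simp
  show "F s \<le> max 1 ?B" if "s \<le> S" for s
    using that by (intro max.coboundedI2 Max_ge) auto
qed

lemma prec_moment_carrier [simp]: "prec_moment s y \<theta> \<in> carrier_vec (tri_dim s)" "dim_vec (prec_moment s y \<theta>) = tri_dim s"
  by (simp_all add: prec_moment_def)

lemma prec_moment_diff: "prec_moment s y \<theta> - prec_moment s y \<theta>0 = prec_map s \<theta>0 \<theta>"
  by (intro eq_vecI) (auto simp: prec_moment_def prec_map_def tri_vec_index)

lemma mean_prec_moment:
  assumes "prob_space P" and i: "\<And>k. k < tri_dim s \<Longrightarrow> integrable P (\<lambda>y. prec_moment s y \<theta>0 $ k)"
    and m0: "mean_vec (tri_dim s) P (\<lambda>y. prec_moment s y \<theta>0) = 0\<^sub>v (tri_dim s)"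
  shows "mean_vec (tri_dim s) P (\<lambda>y. prec_moment s y \<theta>) = prec_map s \<theta>0 \<theta>"
proof (rule eq_vecI)
  fix k assume "k < dim_vec (prec_map s \<theta>0 \<theta>)"
  then have k: "k < tri_dim s" by simp
  interpret prob_space P by fact
  have "(\<integral>y. prec_moment s y \<theta>0 $ k \<partial>P) = 0"
    using arg_cong[OF m0, of "\<lambda>v. v $ k"] k by (simp add: mean_vec_def)
  moreover have "prec_moment s y \<theta> $ k = prec_moment s y \<theta>0 $ k + prec_map s \<theta>0 \<theta> $ k" for y
    using k by (simp add: prec_moment_def prec_map_def tri_vec_index)
  ultimately show "mean_vec (tri_dim s) P (\<lambda>y. prec_moment s y \<theta>) $ k = prec_map s \<theta>0 \<theta> $ k"
    using k i[OF k] by (simp add: mean_vec_def prob_space)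
qed (simp add: mean_vec_def)

lemma L2norm_const: "prob_space P \<Longrightarrow> L2norm P (\<lambda>_. c) = \<bar>c\<bar>"
  using prob_space.prob_space[of P] by (simp add: L2norm_def)

lemma in_L2_const: "prob_space P \<Longrightarrow> in_L2 P (\<lambda>_. c)"
  by (simp add: in_L2_def finite_measure.integrable_const prob_space.axioms(1))

text \<open>Constant functions with values in an interval are covered like the interval itself, by a grid.\<close>
lemma covering_number_constants:
  assumes P: "prob_space P" and F: "\<And>f. f \<in> F \<Longrightarrow> \<exists>c. f = (\<lambda>_. c) \<and> \<bar>c\<bar> \<le> B"
    and B: "0 < B" and e: "0 < \<epsilon>" "\<epsilon> < 1"
  shows "\<exists>N. covering_number (\<epsilon> * B) F P = enat N \<and> real N \<le> 4 / \<epsilon>"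
proof -
  define m where "m = nat \<lfloor>2 / \<epsilon>\<rfloor>"
  define C where "C = (\<lambda>k::nat. (\<lambda>_::'a. - B + real k * (\<epsilon> * B))) ` {..m}"
  have C: "finite C" "card C \<le> m + 1" using card_image_le[of "{..m}"] by (auto simp: C_def)
  have cov: "\<exists>c\<in>C. in_L2 P (\<lambda>y. f y - c y) \<and> L2norm P (\<lambda>y. f y - c y) < \<epsilon> * B" if f: "f \<in> F" for f
  proof -
    obtain c where c: "f = (\<lambda>_. c)" "\<bar>c\<bar> \<le> B" using F[OF f] by blast
    define q where "q = (c + B) / (\<epsilon> * B)"
    define k where "k = nat \<lfloor>q\<rfloor>"
    have eB: "0 < \<epsilon> * B" using e B by simp
    have q: "0 \<le> q" "q \<le> 2 / \<epsilon>" using c(2) e B by (auto simp: q_def field_simps abs_le_iff)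
    have k: "real k \<le> q" "q < real k + 1" using q(1) by (auto simp: k_def)
    have "k \<le> m" unfolding k_def m_def using q(2) by (intro nat_mono floor_mono)
    moreover have "\<bar>c - (- B + real k * (\<epsilon> * B))\<bar> < \<epsilon> * B"
    proof -
      have "c + B = q * (\<epsilon> * B)" using e B by (simp add: q_def)
      moreover have "real k * (\<epsilon> * B) \<le> q * (\<epsilon> * B)" "q * (\<epsilon> * B) < (real k + 1) * (\<epsilon> * B)"
        using k eB by (auto intro!: mult_right_mono mult_strict_right_mono)
      ultimately show ?thesis by (simp add: algebra_simps abs_less_iff)
    qed
    ultimately show ?thesis unfolding c(1) C_def using P
      by (intro bexI[of _ "\<lambda>_. - B + real k * (\<epsilon> * B)"]) (auto simp: L2norm_const in_L2_const)
  qed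
  have "covering_number (\<epsilon> * B) F P \<le> enat (card C)"
    unfolding covering_number_def
    by (rule INF_lower) (use C cov P in \<open>auto simp: C_def intro!: in_L2_const\<close>)
  then obtain N where N: "covering_number (\<epsilon> * B) F P = enat N" "N \<le> card C"
    by (cases "covering_number (\<epsilon> * B) F P") auto
  have "real N \<le> real m + 1" using N C by linarith
  also have "real m \<le> 2 / \<epsilon>" using e by (simp add: m_def)
  also have "2 / \<epsilon> + 1 \<le> 4 / \<epsilon>" using e by (simp add: field_simps)
  finally show ?thesis using N by auto
qed

text \<open>The increments of the moment function do not depend on the observation, so the function class
  consists of constants bounded by the Lipschitz constant times the diameter, and the constant
  function with this bound is an envelope.\<close>
lemma prec_cond_A4:
  assumes PD: "\<And>n. prob_space (PD n)" and p_eq: "\<And>n. p n = tri_dim (s n)" and s_pos: "\<And>n. 1 \<le> s n"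
    and g_eq: "\<And>n. g n = prec_moment (s n)"
    and ok: "\<And>n \<theta>. \<theta> \<in> Par n \<Longrightarrow> prec_ok (s n) lo hi \<theta>" and th0: "\<And>n. \<theta>0 n \<in> Par n"
    and R: "\<And>n \<theta>. \<theta> \<in> Par n \<Longrightarrow> par_dist (p n) \<theta> (\<theta>0 n) \<le> R" and S: "\<And>n. s n \<le> S"
  shows "cond_A4 1 PD p p g Par \<theta>0"
proof -
  obtain L where L: "0 < L" "\<And>s. s \<le> S \<Longrightarrow> lip_const s lo hi \<le> L"
    using bounded_on_initial_segment[of S "\<lambda>s. lip_const s lo hi"] by blast
  define B where "B = L * \<bar>R\<bar> + 1"
  have B: "0 < B" using L by (simp add: B_def add_nonneg_pos)
  have p1: "1 \<le> p n" for n using le_tri_dim[of "s n"] s_pos[of n] by (simp add: p_eq)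
  have h_eq: "\<eta> \<bullet> (g n y \<theta> - g n y (\<theta>0 n)) = \<eta> \<bullet> prec_map (s n) (\<theta>0 n) \<theta>" for n \<eta> y \<theta>
    by (simp add: g_eq prec_moment_diff)
  have hb: "\<bar>\<eta> \<bullet> prec_map (s n) (\<theta>0 n) \<theta>\<bar> \<le> L * par_dist (p n) \<theta> (\<theta>0 n)"
    if "\<theta> \<in> Par n" "\<eta> \<in> unit_sphere (p n)" for n \<theta> \<eta>
  proof -
    have "\<bar>\<eta> \<bullet> prec_map (s n) (\<theta>0 n) \<theta>\<bar> \<le> vnorm \<eta> * vnorm (prec_map (s n) (\<theta>0 n) \<theta>)"
      using that by (intro abs_sprod_le) (auto simp: unit_sphere_def p_eq)
    also have "\<dots> \<le> lip_const (s n) lo hi * par_dist (p n) \<theta> (\<theta>0 n)"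
      using prec_map_upper[OF ok[OF that(1)] ok[OF th0]] that(2) by (simp add: unit_sphere_def p_eq)
    also have "\<dots> \<le> L * par_dist (p n) \<theta> (\<theta>0 n)" using L(2)[OF S] by (intro mult_right_mono) auto
    finally show ?thesis .
  qed
  have hB: "\<bar>\<eta> \<bullet> prec_map (s n) (\<theta>0 n) \<theta>\<bar> \<le> B" if "\<theta> \<in> Par n" "\<eta> \<in> unit_sphere (p n)" for n \<theta> \<eta>
  proof -
    have "L * par_dist (p n) \<theta> (\<theta>0 n) \<le> L * \<bar>R\<bar>" using R[OF that(1)] L by (intro mult_left_mono) auto
    then show ?thesis using hb[OF that] by (simp add: B_def)
  qed
  have c1: "\<exists>C. \<forall>\<^sub>F n in sequentially. \<forall>\<theta>\<in>Par n. \<forall>\<eta>\<in>unit_sphere (p n).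
         in_L2 (PD n) (\<lambda>y. \<eta> \<bullet> (g n y \<theta> - g n y (\<theta>0 n))) \<and>
         L2norm (PD n) (\<lambda>y. \<eta> \<bullet> (g n y \<theta> - g n y (\<theta>0 n))) \<le> C * (sqrt (real (p n)) * par_dist (p n) \<theta> (\<theta>0 n)) powr 1"
  proof (intro exI[of _ L] always_eventually allI ballI conjI)
    fix n \<theta> \<eta> assume a: "\<theta> \<in> Par n" "\<eta> \<in> unit_sphere (p n)"
    show "in_L2 (PD n) (\<lambda>y. \<eta> \<bullet> (g n y \<theta> - g n y (\<theta>0 n)))" unfolding h_eq by (rule in_L2_const[OF PD])
    have "L * par_dist (p n) \<theta> (\<theta>0 n) \<le> L * (sqrt (real (p n)) * par_dist (p n) \<theta> (\<theta>0 n))"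
      using p1[of n] L mult_right_mono[of 1 "sqrt (real (p n))" "par_dist (p n) \<theta> (\<theta>0 n)"] by (intro mult_left_mono) auto
    then show "L2norm (PD n) (\<lambda>y. \<eta> \<bullet> (g n y \<theta> - g n y (\<theta>0 n))) \<le> L * (sqrt (real (p n)) * par_dist (p n) \<theta> (\<theta>0 n)) powr 1"
      unfolding h_eq L2norm_const[OF PD] using hb[OF a] by simp
  qed
  have c2: "\<exists>Fenv.
         (\<forall>n. in_L2 (PD n) (Fenv n) \<and> (\<forall>f\<in>{(\<lambda>y. \<eta> \<bullet> (g n y \<theta> - g n y (\<theta>0 n))) |\<theta> \<eta>. \<theta> \<in> Par n \<and> \<eta> \<in> unit_sphere (p n)}. \<forall>y\<in>space (PD n). \<bar>f y\<bar> \<le> Fenv n y)) \<and>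
         (\<lambda>n. L2norm (PD n) (Fenv n)) \<in> O(\<lambda>n. sqrt (real (p n))) \<and>
         (\<exists>C. \<exists>\<epsilon>0>0. \<forall>\<^sub>F n in sequentially. \<forall>\<epsilon>. 0 < \<epsilon> \<and> \<epsilon> < \<epsilon>0 \<longrightarrow>
            (\<exists>N. covering_number (\<epsilon> * L2norm (PD n) (Fenv n)) {(\<lambda>y. \<eta> \<bullet> (g n y \<theta> - g n y (\<theta>0 n))) |\<theta> \<eta>. \<theta> \<in> Par n \<and> \<eta> \<in> unit_sphere (p n)} (PD n) = enat N \<and>
                 ln (real N) \<le> C * (real (p n) * ln (real n / \<epsilon>))))"
    unfolding h_eq
  proof (intro exI[of _ "\<lambda>n _. B"] conjI allI)
    fix n show "in_L2 (PD n) (\<lambda>_. B)" by (rule in_L2_const[OF PD])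
    show "\<forall>f\<in>{(\<lambda>y. \<eta> \<bullet> prec_map (s n) (\<theta>0 n) \<theta>) |\<theta> \<eta>. \<theta> \<in> Par n \<and> \<eta> \<in> unit_sphere (p n)}. \<forall>y\<in>space (PD n). \<bar>f y\<bar> \<le> B"
      using hB by auto
  next
    show "(\<lambda>n. L2norm (PD n) (\<lambda>_. B)) \<in> O(\<lambda>n. sqrt (real (p n)))"
    proof (rule bigoI[of _ B], intro always_eventually allI)
      fix n show "norm (L2norm (PD n) (\<lambda>_. B)) \<le> B * norm (sqrt (real (p n)))"
        using p1[of n] B by (simp add: L2norm_const[OF PD])
    qed
  next
    show "\<exists>C. \<exists>\<epsilon>0>0. \<forall>\<^sub>F n in sequentially. \<forall>\<epsilon>. 0 < \<epsilon> \<and> \<epsilon> < \<epsilon>0 \<longrightarrow>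
            (\<exists>N. covering_number (\<epsilon> * L2norm (PD n) (\<lambda>_. B)) {(\<lambda>y. \<eta> \<bullet> prec_map (s n) (\<theta>0 n) \<theta>) |\<theta> \<eta>. \<theta> \<in> Par n \<and> \<eta> \<in> unit_sphere (p n)} (PD n) = enat N \<and>
                 ln (real N) \<le> C * (real (p n) * ln (real n / \<epsilon>)))"
    proof (intro exI[of _ "1 :: real"] conjI eventually_mono[OF eventually_ge_at_top[of 4]] allI impI)
      fix n :: nat and \<epsilon> :: real assume n: "4 \<le> n" and e: "0 < \<epsilon> \<and> \<epsilon> < 1"
      have "\<exists>N. covering_number (\<epsilon> * B) {(\<lambda>y. \<eta> \<bullet> prec_map (s n) (\<theta>0 n) \<theta>) |\<theta> \<eta>. \<theta> \<in> Par n \<and> \<eta> \<in> unit_sphere (p n)} (PD n) = enat N \<and> real N \<le> 4 / \<epsilon>"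
        by (rule covering_number_constants[OF PD _ B]) (use hB e in auto)
      then obtain N where N: "covering_number (\<epsilon> * B) {(\<lambda>y. \<eta> \<bullet> prec_map (s n) (\<theta>0 n) \<theta>) |\<theta> \<eta>. \<theta> \<in> Par n \<and> \<eta> \<in> unit_sphere (p n)} (PD n) = enat N"
         "real N \<le> 4 / \<epsilon>" by blast
      have "1 \<le> real n / \<epsilon>" using n e by (simp add: field_simps)
      then have l0: "0 \<le> ln (real n / \<epsilon>)" by simp
      have "ln (real N) \<le> ln (real n / \<epsilon>)"
      proof (cases "N = 0")
        case False
        have "4 / \<epsilon> \<le> real n / \<epsilon>" using n e by (intro divide_right_mono) auto
        then show ?thesis using N False by (intro ln_mono) auto
      qed (use l0 in simp)
      also have "\<dots> \<le> 1 * (real (p n) * ln (real n / \<epsilon>))"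
        using p1[of n] l0 mult_right_mono[of 1 "real (p n)" "ln (real n / \<epsilon>)"] by simp
      finally show "\<exists>N. covering_number (\<epsilon> * L2norm (PD n) (\<lambda>_. B)) {(\<lambda>y. \<eta> \<bullet> prec_map (s n) (\<theta>0 n) \<theta>) |\<theta> \<eta>. \<theta> \<in> Par n \<and> \<eta> \<in> unit_sphere (p n)} (PD n) = enat N \<and>
                 ln (real N) \<le> 1 * (real (p n) * ln (real n / \<epsilon>))"
        using N B by (auto simp: L2norm_const[OF PD])
    qed simp
  qed
  show ?thesis unfolding cond_A4_def Let_def using c1 c2 by simp
qed

lemma prec_has_jacobian:
  assumes ok: "prec_ok s lo hi \<theta>" and r: "0 < r"
    and nb: "\<And>\<theta>'. \<theta>' \<in> par_space (tri_dim s) \<Longrightarrow> par_dist (tri_dim s) \<theta>' \<theta> < r \<Longrightarrow> prec_ok s lo hi \<theta>'"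
  shows "has_jacobian (tri_dim s) (tri_dim s) (prec_map s \<theta>0) \<theta> (prec_jac s \<theta>)"
proof (rule has_jacobianI_quadratic[OF prec_jac_carrier r])
  show "0 \<le> quad_const s lo hi" using ok by (auto simp: quad_const_def prec_ok_def prec_const_nonneg)
qed (rule prec_map_quadratic[OF nb ok])

text \<open>On the ball of half the radius every point still has a neighbourhood of admissible parameters, so
  the Jacobian exists there and can be differentiated once more.\<close>
lemma prec_has_hessian:
  assumes ok: "prec_ok s lo hi \<theta>" and r: "0 < r"
    and nb: "\<And>\<theta>'. \<theta>' \<in> par_space (tri_dim s) \<Longrightarrow> par_dist (tri_dim s) \<theta>' \<theta> < r \<Longrightarrow> prec_ok s lo hi \<theta>'"
  shows "has_hessian (tri_dim s) (tri_dim s) (prec_map s \<theta>0) \<theta> (prec_hess s \<theta>)"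
  unfolding has_hessian_def
proof (intro exI[of _ "prec_jac s"] conjI exI[of _ "r / 2"] ballI impI allI)
  fix \<theta>' assume t: "\<theta>' \<in> par_space (tri_dim s)" "par_dist (tri_dim s) \<theta>' \<theta> < r / 2"
  show "has_jacobian (tri_dim s) (tri_dim s) (prec_map s \<theta>0) \<theta>' (prec_jac s \<theta>')"
  proof (rule prec_has_jacobian[of _ lo hi _ "r / 2"])
    show "prec_ok s lo hi \<theta>'" using t r by (intro nb) auto
    fix \<theta>'' assume t': "\<theta>'' \<in> par_space (tri_dim s)" "par_dist (tri_dim s) \<theta>'' \<theta>' < r / 2"
    then show "prec_ok s lo hi \<theta>''"
      using par_dist_triangle[of "tri_dim s" \<theta>'' \<theta> \<theta>'] t by (intro nb) auto
  qed (use r in simp)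
next
  fix k assume k: "k < tri_dim s"
  show "has_jacobian (tri_dim s) (tri_dim s) (\<lambda>\<theta>'. row (prec_jac s \<theta>') k) \<theta> (prec_hess s \<theta> k)"
  proof (rule has_jacobianI_quadratic[OF prec_hess_carrier r])
    show "0 \<le> hess_const s lo hi" using ok by (auto simp: hess_const_def prec_ok_def prec_const_nonneg)
  qed (rule prec_jac_quadratic[OF nb ok k])
qed (use r in simp)

lemma form_bounds_gram:
  assumes G: "G \<in> carrier_mat m k" and lo: "\<And>v. v \<in> carrier_vec k \<Longrightarrow> a * (v \<bullet> v) \<le> (G *\<^sub>v v) \<bullet> (G *\<^sub>v v)"
    and hi: "\<And>v. v \<in> carrier_vec k \<Longrightarrow> (G *\<^sub>v v) \<bullet> (G *\<^sub>v v) \<le> b * (v \<bullet> v)"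
  shows "form_bounds k (G\<^sup>T * G) a b"
proof -
  have GT: "G\<^sup>T \<in> carrier_mat k m" using G by simp
  have "v \<bullet> (G\<^sup>T * G *\<^sub>v v) = (G *\<^sub>v v) \<bullet> (G *\<^sub>v v)" if v: "v \<in> carrier_vec k" for v
  proof -
    have Gv: "G *\<^sub>v v \<in> carrier_vec m" using G v by simp
    have "v \<bullet> (G\<^sup>T * G *\<^sub>v v) = v \<bullet> (G\<^sup>T *\<^sub>v (G *\<^sub>v v))" using assoc_mult_mat_vec[OF GT G v] by simp
    also have "\<dots> = (G\<^sup>T *\<^sub>v (G *\<^sub>v v)) \<bullet> v" using GT Gv v by (intro comm_scalar_prod[of _ k]) auto
    also have "\<dots> = (G *\<^sub>v v) \<bullet> (G *\<^sub>v v)" by (rule transpose_vec_mult_scalar[OF G v Gv])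
    finally show ?thesis .
  qed
  moreover have "(G\<^sup>T * G)\<^sup>T = G\<^sup>T * G" using transpose_mult[OF GT G] by simp
  ultimately show ?thesis using lo hi G GT by (auto simp: form_bounds_def)
qed

lemma eps_tendsto_0: assumes "\<And>n. p n \<le> P" shows "eps p \<longlonglongrightarrow> 0"
proof (rule tendsto_sandwich[of "\<lambda>_. 0" _ _ "\<lambda>n. sqrt (real P / real n)"])
  show "\<forall>\<^sub>F n in sequentially. eps p n \<le> sqrt (real P / real n)"
    using assms by (auto simp: eps_def divide_right_mono)
  have "(\<lambda>n. sqrt (real P / real n)) \<longlonglongrightarrow> sqrt 0"
    by (intro tendsto_real_sqrt) real_asymp
  then show "(\<lambda>n. sqrt (real P / real n)) \<longlonglongrightarrow> 0" by simp
qed (auto simp: eps_def)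

text \<open>Identification and the spectrum of the Gram matrix of the Jacobian follow from the two-sided
  Lipschitz bounds.  The second derivative is needed on balls of radius O(eps), which eventually lie
  in the fixed neighbourhood of \<theta>0 inside the parameter space.\<close>
lemma prec_cond_A5:
  assumes p_eq: "\<And>n. p n = tri_dim (s n)" and s_pos: "\<And>n. 1 \<le> s n"
    and Eg: "\<And>n \<theta>. mean_vec (p n) (PD n) (\<lambda>y. g n y \<theta>) = prec_map (s n) (\<theta>0 n) \<theta>"
    and sub: "\<And>n. Par n \<subseteq> par_space (p n)"
    and ok: "\<And>n \<theta>. \<theta> \<in> Par n \<Longrightarrow> prec_ok (s n) lo hi \<theta>" and th0: "\<And>n. \<theta>0 n \<in> Par n"
    and r: "0 < r" "\<And>n \<theta>. \<theta> \<in> par_space (p n) \<Longrightarrow> par_dist (p n) \<theta> (\<theta>0 n) < r \<Longrightarrow> \<theta> \<in> Par n"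
    and S: "\<And>n. s n \<le> S"
  shows "cond_A5 PD p p g Par \<theta>0"
    and "\<And>n. jacobian (p n) (p n) (prec_map (s n) (\<theta>0 n)) (\<theta>0 n) = prec_jac (s n) (\<theta>0 n)"
proof -
  obtain L where L: "0 < L" "\<And>s. s \<le> S \<Longrightarrow> lip_const s lo hi \<le> L"
    using bounded_on_initial_segment[of S "\<lambda>s. lip_const s lo hi"] by blast
  have p1: "1 \<le> p n" for n using le_tri_dim[of "s n"] s_pos[of n] by (simp add: p_eq)
  have hj: "has_jacobian (p n) (p n) (prec_map (s n) (\<theta>0 n)) (\<theta>0 n) (prec_jac (s n) (\<theta>0 n))" for n
    unfolding p_eq by (rule prec_has_jacobian[OF ok[OF th0] r(1)]) (auto simp flip: p_eq intro!: ok r)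
  show jac: "jacobian (p n) (p n) (prec_map (s n) (\<theta>0 n)) (\<theta>0 n) = prec_jac (s n) (\<theta>0 n)" for n
    using sub th0 by (intro jacobian_eqI[OF hj]) (auto simp: p_eq)
  have c1: "\<exists>\<delta>0>0. \<exists>\<delta>1>0. \<forall>n. \<forall>\<theta>\<in>Par n. min \<delta>0 (\<delta>1 * par_dist (p n) \<theta> (\<theta>0 n)) \<le> vnorm (prec_map (s n) (\<theta>0 n) \<theta>)"
  \<comment> \<open>The bound is linear on the whole parameter space; the truncation level 1 is arbitrary.\<close>
  proof (rule exI[of _ 1], intro conjI exI[of _ "1 / L"] allI ballI)
    fix n \<theta> assume t: "\<theta> \<in> Par n"
    have "par_dist (p n) \<theta> (\<theta>0 n) \<le> L * vnorm (prec_map (s n) (\<theta>0 n) \<theta>)"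
      using prec_map_lower[OF ok[OF t] ok[OF th0]] mult_right_mono[OF L(2)[OF S], of "vnorm (prec_map (s n) (\<theta>0 n) \<theta>)" n]
      by (simp add: p_eq)
    then have "1 / L * par_dist (p n) \<theta> (\<theta>0 n) \<le> vnorm (prec_map (s n) (\<theta>0 n) \<theta>)" using L by (simp add: field_simps)
    then show "min 1 (1 / L * par_dist (p n) \<theta> (\<theta>0 n)) \<le> vnorm (prec_map (s n) (\<theta>0 n) \<theta>)" by simp
  qed (use L in auto)
  have c2: "\<exists>lo>0. \<exists>hi. \<forall>n. eigenvalues_in ((prec_jac (s n) (\<theta>0 n))\<^sup>T * prec_jac (s n) (\<theta>0 n)) {lo..hi}"
  proof (rule exI[of _ "1 / L\<^sup>2"], intro exI[of _ "L\<^sup>2"] conjI allI)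
    fix n
    let ?G = "prec_jac (s n) (\<theta>0 n)"
    have "1 / L\<^sup>2 * (v \<bullet> v) \<le> (?G *\<^sub>v v) \<bullet> (?G *\<^sub>v v) \<and> (?G *\<^sub>v v) \<bullet> (?G *\<^sub>v v) \<le> L\<^sup>2 * (v \<bullet> v)"
      if v: "v \<in> carrier_vec (tri_dim (s n))" for v
    proof -
      have vv: "v = vec (tri_dim (s n)) (\<lambda>k. v $ k)" using v by auto
      have "vnorm (?G *\<^sub>v v) \<le> lip_const (s n) lo hi * vnorm v" "vnorm v \<le> lip_const (s n) lo hi * vnorm (?G *\<^sub>v v)"
        using prec_jac_upper[OF ok[OF th0], of n "\<lambda>k. v $ k"] prec_jac_lower[OF ok[OF th0], of n "\<lambda>k. v $ k"] vv by auto
      then have "vnorm (?G *\<^sub>v v) \<le> L * vnorm v" "vnorm v \<le> L * vnorm (?G *\<^sub>v v)"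
        using L(2)[OF S, of n] by (meson mult_right_mono order_trans vnorm_nonneg)+
      then have "(vnorm (?G *\<^sub>v v))\<^sup>2 \<le> (L * vnorm v)\<^sup>2" "(vnorm v)\<^sup>2 \<le> (L * vnorm (?G *\<^sub>v v))\<^sup>2"
        by (auto intro!: power_mono)
      then show ?thesis using L by (simp add: power_mult_distrib vnorm_sq field_simps)
    qed
    then show "eigenvalues_in (?G\<^sup>T * ?G) {1 / L\<^sup>2..L\<^sup>2}"
      by (intro form_bounds_eigenvalues[of "tri_dim (s n)"] form_bounds_gram[of _ "tri_dim (s n)"]) auto
  qed (use L in auto)
  have c3: "\<forall>C>0. \<exists>K. \<forall>\<^sub>F n in sequentially. \<forall>\<theta>\<in>par_ball (p n) (Par n) (\<theta>0 n) (C * eps p n).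
         \<exists>H. has_hessian (p n) (p n) (prec_map (s n) (\<theta>0 n)) \<theta> H \<and>
             (\<forall>u\<in>unit_sphere (p n). \<forall>v\<in>unit_sphere (p n).
                vnorm (hessian_form (p n) H u v) \<le> K * sqrt (real (p n)))"
  proof (intro allI impI)
    fix C :: real assume C: "0 < C"
    let ?B = "\<lambda>s. real (tri_dim s) * (real (tri_dim s) * real (tri_dim s) * (2 * prec_const s lo hi ^ 3 * (real s * real s)\<^sup>2))"
    obtain B where B: "0 < B" "\<And>s. s \<le> S \<Longrightarrow> ?B s \<le> B"
      using bounded_on_initial_segment[of S ?B] by blast
    have "p n \<le> tri_dim S" for n using S tri_dim_mono by (simp add: p_eq)
    then have "(\<lambda>n. C * eps p n) \<longlonglongrightarrow> C * 0" by (intro tendsto_intros eps_tendsto_0)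
    then have ev: "\<forall>\<^sub>F n in sequentially. C * eps p n < r / 2" using r(1) by (intro order_tendstoD) auto
    show "\<exists>K. \<forall>\<^sub>F n in sequentially. \<forall>\<theta>\<in>par_ball (p n) (Par n) (\<theta>0 n) (C * eps p n).
         \<exists>H. has_hessian (p n) (p n) (prec_map (s n) (\<theta>0 n)) \<theta> H \<and>
             (\<forall>u\<in>unit_sphere (p n). \<forall>v\<in>unit_sphere (p n).
                vnorm (hessian_form (p n) H u v) \<le> K * sqrt (real (p n)))"
    proof (intro exI[of _ B] eventually_mono[OF ev] ballI)
      fix n \<theta> assume n: "C * eps p n < r / 2" and t: "\<theta> \<in> par_ball (p n) (Par n) (\<theta>0 n) (C * eps p n)"
      have tP: "\<theta> \<in> Par n" "par_dist (p n) \<theta> (\<theta>0 n) < r / 2" using t n by (auto simp: par_ball_def)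
      have "has_hessian (p n) (p n) (prec_map (s n) (\<theta>0 n)) \<theta> (prec_hess (s n) \<theta>)"
        unfolding p_eq
      proof (rule prec_has_hessian[OF ok[OF tP(1)], of "r / 2"])
        fix \<theta>' assume t': "\<theta>' \<in> par_space (tri_dim (s n))" "par_dist (tri_dim (s n)) \<theta>' \<theta> < r / 2"
        have "par_dist (p n) \<theta>' (\<theta>0 n) < r"
          using par_dist_triangle[of "p n" \<theta>' "\<theta>0 n" \<theta>] t' tP by (simp add: p_eq)
        then show "prec_ok (s n) lo hi \<theta>'" using t' by (intro ok r) (auto simp: p_eq)
      qed (use r in simp)
      moreover have "vnorm (hessian_form (p n) (prec_hess (s n) \<theta>) u v) \<le> B * sqrt (real (p n))"
        if uv: "u \<in> unit_sphere (p n)" "v \<in> unit_sphere (p n)" for u v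
      proof -
        have "vnorm (hessian_form (p n) (prec_hess (s n) \<theta>) u v) \<le> B"
          using prec_hess_bound[OF ok[OF tP(1)], of u v] uv B(2)[OF S, of n] by (simp add: p_eq)
        also have "\<dots> \<le> B * sqrt (real (p n))" using B p1[of n] by simp
        finally show ?thesis .
      qed
      ultimately show "\<exists>H. has_hessian (p n) (p n) (prec_map (s n) (\<theta>0 n)) \<theta> H \<and>
             (\<forall>u\<in>unit_sphere (p n). \<forall>v\<in>unit_sphere (p n). vnorm (hessian_form (p n) H u v) \<le> B * sqrt (real (p n)))"
        by blast
    qed
  qed
  show "cond_A5 PD p p g Par \<theta>0"
    unfolding cond_A5_def Let_def Eg jac using c1 c2 c3 hj by blast
qed


section \<open>Events of high probability\<close>

text \<open>The statement Q need not define a measurable set, so it is asked to hold on a measurable event.\<close>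
definition likely :: "(nat \<Rightarrow> 'w measure) \<Rightarrow> real \<Rightarrow> (nat \<Rightarrow> 'w \<Rightarrow> bool) \<Rightarrow> bool" where
  "likely Pr \<eta> Q \<longleftrightarrow> (\<exists>E. (\<forall>n. E n \<in> sets (Pr n)) \<and>
     (\<forall>\<^sub>F n in sequentially. 1 - \<eta> \<le> measure (Pr n) (E n)) \<and> (\<forall>\<^sub>F n in sequentially. \<forall>\<omega>\<in>E n. Q n \<omega>))"

lemma likely_mono:
  assumes "likely Pr \<eta> Q" "\<forall>\<^sub>F n in sequentially. \<forall>\<omega>. Q n \<omega> \<longrightarrow> Q' n \<omega>"
  shows "likely Pr \<eta> Q'"
proof -
  from assms(1) obtain E where E: "\<forall>n. E n \<in> sets (Pr n)" "\<forall>\<^sub>F n in sequentially. 1 - \<eta> \<le> measure (Pr n) (E n)"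
    "\<forall>\<^sub>F n in sequentially. \<forall>\<omega>\<in>E n. Q n \<omega>" by (auto simp: likely_def)
  from E(3) assms(2) have "\<forall>\<^sub>F n in sequentially. \<forall>\<omega>\<in>E n. Q' n \<omega>" by eventually_elim blast
  with E(1,2) show ?thesis by (auto simp: likely_def)
qed

text \<open>The events witnessing different \<eta> have to be merged into a single sequence: for each n an event
  inside Q is taken whose probability is within 1 / (n + 1) of the supremum.  This event has
  eventually almost as large a probability as each of the given ones.\<close>
lemma wpa1I:
  assumes ps: "\<And>n. prob_space (Pr n)"
    and ev: "\<And>\<eta>. 0 < \<eta> \<Longrightarrow> likely Pr \<eta> Q"
  shows "wpa1 Pr Q"
proof -
  define V where "V n = {measure (Pr n) A | A. A \<in> sets (Pr n) \<and> (\<forall>\<omega>\<in>A. Q n \<omega>)}" for n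
  have V0: "0 \<in> V n" for n unfolding V_def by (rule CollectI, rule exI[of _ "{}"]) simp
  have Vle: "v \<le> 1" if "v \<in> V n" for v n
    using that prob_space.prob_le_1[OF ps] by (auto simp: V_def)
  have bdd: "bdd_above (V n)" for n using Vle by (auto simp: bdd_above_def)
  have "\<exists>A. A \<in> sets (Pr n) \<and> (\<forall>\<omega>\<in>A. Q n \<omega>) \<and> Sup (V n) - 1 / (real n + 1) < measure (Pr n) A" for n
  proof -
    have "Sup (V n) - 1 / (real n + 1) < Sup (V n)" by simp
    then obtain v where "v \<in> V n" "Sup (V n) - 1 / (real n + 1) < v"
      using less_cSup_iff[OF _ bdd, of n] V0 by blast
    then show ?thesis by (auto simp: V_def)
  qed
  then obtain A where A: "\<And>n. A n \<in> sets (Pr n)" "\<And>n \<omega>. \<omega> \<in> A n \<Longrightarrow> Q n \<omega>"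
    "\<And>n. Sup (V n) - 1 / (real n + 1) < measure (Pr n) (A n)" by metis
  have "(\<lambda>n. measure (Pr n) (A n)) \<longlonglongrightarrow> 1"
  proof (rule order_tendstoI)
    fix a :: real assume a: "a < 1"
    then obtain E where E: "\<And>n. E n \<in> sets (Pr n)" "\<forall>\<^sub>F n in sequentially. 1 - (1 - a) / 2 \<le> measure (Pr n) (E n)"
      "\<forall>\<^sub>F n in sequentially. \<forall>\<omega>\<in>E n. Q n \<omega>"
      using ev[of "(1 - a) / 2"] by (auto simp: likely_def)
    have "(\<lambda>n. 1 / (real n + 1)) \<longlonglongrightarrow> 0" by real_asymp
    then have "\<forall>\<^sub>F n in sequentially. 1 / (real n + 1) < (1 - a) / 2" using a by (intro order_tendstoD) auto
    with E(2,3) show "\<forall>\<^sub>F n in sequentially. a < measure (Pr n) (A n)"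
    proof eventually_elim
      case (elim n)
      then have "measure (Pr n) (E n) \<in> V n" using E(1) by (auto simp: V_def)
      then have "measure (Pr n) (E n) \<le> Sup (V n)" using bdd by (rule cSup_upper)
      moreover have "a < A" if "S - x < A" "1 - (1 - a) / 2 \<le> E" "E \<le> S" "x < (1 - a) / 2" for S x A E :: real
        using that by (simp add: field_simps)
      ultimately show ?case using A(3)[of n] elim by blast
    qed
  next
    fix a :: real assume "1 < a"
    then show "\<forall>\<^sub>F n in sequentially. measure (Pr n) (A n) < a"
      using prob_space.prob_le_1[OF ps] le_less_trans by (intro always_eventually) blast
  qed
  then show ?thesis unfolding wpa1_def using A by blast
qed

section \<open>Empirical means of independent observations\<close>

definition emp_mean :: "nat \<Rightarrow> (nat \<Rightarrow> 'w \<Rightarrow> 'd) \<Rightarrow> ('d \<Rightarrow> real) \<Rightarrow> 'w \<Rightarrow> real" where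
  "emp_mean n D f \<omega> = (\<Sum>i<n. f (D i \<omega>)) / real n"

text \<open>Chebyshev's inequality for the sum of the centred summands: by independence the cross terms
  vanish, and the variance of a summand is at most its second moment.\<close>
lemma iid_mean_Chebyshev:
  fixes f :: "'d \<Rightarrow> real" and D :: "nat \<Rightarrow> 'w \<Rightarrow> 'd"
  assumes PM: "prob_space M" "prob_space N" and ind: "prob_space.indep_vars M (\<lambda>_. N) D {..<n}"
    and D: "\<And>i. i < n \<Longrightarrow> D i \<in> measurable M N" "\<And>i. i < n \<Longrightarrow> distr M N (D i) = N"
    and f: "f \<in> borel_measurable N" "integrable N (\<lambda>y. (f y)\<^sup>2)" "(\<integral>y. (f y)\<^sup>2 \<partial>N) \<le> B" and n: "0 < n" and a: "0 < a"
  shows "measure M {\<omega>\<in>space M. \<bar>emp_mean n D f \<omega> - (\<integral>y. f y \<partial>N)\<bar> \<ge> a} \<le> B / (real n * a\<^sup>2)"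
    and "emp_mean n D f \<in> borel_measurable M"
proof -
  interpret M: prob_space M by fact
  interpret N: prob_space N by fact
  define \<mu> where "\<mu> = (\<integral>y. f y \<partial>N)"
  have fi: "integrable N f" using N.square_integrable_imp_integrable f by blast
  define h where "h y = f y - \<mu>" for y
  have hm: "h \<in> borel_measurable N" using f by (simp add: h_def[abs_def])
  have hi: "integrable N h" using fi by (simp add: h_def[abs_def])
  have h0: "(\<integral>y. h y \<partial>N) = 0" using fi by (simp add: h_def \<mu>_def N.prob_space)
  have h2i: "integrable N (\<lambda>y. (h y)\<^sup>2)" using f fi by (simp add: h_def power2_diff)
  have h2: "(\<integral>y. (h y)\<^sup>2 \<partial>N) \<le> B"
  proof -
    have "(\<integral>y. (h y)\<^sup>2 \<partial>N) = (\<integral>y. (f y)\<^sup>2 \<partial>N) - \<mu>\<^sup>2"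
      using N.variance_eq[OF fi f(2)] by (simp add: h_def \<mu>_def)
    then show ?thesis using f(3) zero_le_power2[of \<mu>] by linarith
  qed
  define X where "X i \<omega> = h (D i \<omega>)" for i \<omega>
  have Xi: "integrable M (X i)" and X0: "(\<integral>\<omega>. X i \<omega> \<partial>M) = 0" and X2i: "integrable M (\<lambda>\<omega>. X i \<omega> * X i \<omega>)"
    and X2: "(\<integral>\<omega>. X i \<omega> * X i \<omega> \<partial>M) \<le> B" if "i < n" for i
  proof -
    note Di = D[OF that]
    show "integrable M (X i)" using integrable_distr_eq[OF Di(1) hm] hi unfolding Di(2) X_def by simp
    show "(\<integral>\<omega>. X i \<omega> \<partial>M) = 0" using integral_distr[OF Di(1) hm] h0 unfolding Di(2) X_def by simp
    have m2: "(\<lambda>y. (h y)\<^sup>2) \<in> borel_measurable N" using hm by simp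
    show "integrable M (\<lambda>\<omega>. X i \<omega> * X i \<omega>)"
      using integrable_distr_eq[OF Di(1) m2] h2i unfolding Di(2) X_def by (simp add: power2_eq_square)
    show "(\<integral>\<omega>. X i \<omega> * X i \<omega> \<partial>M) \<le> B"
      using integral_distr[OF Di(1) m2] h2 unfolding Di(2) X_def by (simp add: power2_eq_square)
  qed
  have indX: "M.indep_vars (\<lambda>_. borel) X {..<n}"
    unfolding X_def by (rule M.indep_vars_compose2[OF ind]) (rule hm)
  have cross: "integrable M (\<lambda>\<omega>. X i \<omega> * X j \<omega>)" "(\<integral>\<omega>. X i \<omega> * X j \<omega> \<partial>M) = 0" if "i < n" "j < n" "i \<noteq> j" for i j
  proof -
    have i2: "M.indep_vars (\<lambda>_. borel) X {i, j}" by (rule M.indep_vars_subset[OF indX]) (use that in auto)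
    show "integrable M (\<lambda>\<omega>. X i \<omega> * X j \<omega>)"
    proof -
      have "integrable M (\<lambda>\<omega>. \<Prod>k\<in>{i, j}. X k \<omega>)"
        by (rule M.indep_vars_integrable[OF _ i2]) (use Xi that in auto)
      then show ?thesis using that by simp
    qed
    show "(\<integral>\<omega>. X i \<omega> * X j \<omega> \<partial>M) = 0"
    proof -
      have "(\<integral>\<omega>. (\<Prod>k\<in>{i, j}. X k \<omega>) \<partial>M) = (\<Prod>k\<in>{i, j}. \<integral>\<omega>. X k \<omega> \<partial>M)"
        by (rule M.indep_vars_lebesgue_integral[OF _ i2]) (use Xi that in auto)
      then show ?thesis using that X0 by simp
    qed
  qed
  have ij: "integrable M (\<lambda>\<omega>. X i \<omega> * X j \<omega>)" if "i < n" "j < n" for i j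
    using cross X2i that by (cases "i = j") auto
  have em: "emp_mean n D f \<omega> = \<mu> + (\<Sum>i<n. X i \<omega>) / real n" for \<omega>
    using n by (simp add: emp_mean_def X_def h_def sum_subtractf field_simps)
  have mX: "X i \<in> borel_measurable M" if "i < n" for i using Xi[OF that] by simp
  have sm: "(\<lambda>\<omega>. \<Sum>i<n. X i \<omega>) \<in> borel_measurable M" using mX by (intro borel_measurable_sum) auto
  have sq: "(\<Sum>i<n. X i \<omega>)\<^sup>2 = (\<Sum>i<n. \<Sum>j<n. X i \<omega> * X j \<omega>)" for \<omega>
    by (simp add: power2_eq_square sum_product)
  show meas: "emp_mean n D f \<in> borel_measurable M" unfolding em[abs_def] using sm by simp
  have sqi: "integrable M (\<lambda>\<omega>. (\<Sum>i<n. X i \<omega>)\<^sup>2)" unfolding sq using ij by (intro Bochner_Integration.integrable_sum) auto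
  have "(\<integral>\<omega>. (\<Sum>i<n. X i \<omega>)\<^sup>2 \<partial>M) = (\<Sum>i<n. \<Sum>j<n. \<integral>\<omega>. X i \<omega> * X j \<omega> \<partial>M)"
    unfolding sq using ij by (subst Bochner_Integration.integral_sum) (auto intro!: Bochner_Integration.integrable_sum sum.cong)
  also have "\<dots> = (\<Sum>i<n. \<integral>\<omega>. X i \<omega> * X i \<omega> \<partial>M)"
  proof (intro sum.cong refl)
    fix i assume i: "i \<in> {..<n}"
    have "(\<Sum>j<n. \<integral>\<omega>. X i \<omega> * X j \<omega> \<partial>M) = (\<Sum>j<n. if j = i then \<integral>\<omega>. X i \<omega> * X i \<omega> \<partial>M else 0)"
      using i cross(2) by (intro sum.cong) auto
    then show "(\<Sum>j<n. \<integral>\<omega>. X i \<omega> * X j \<omega> \<partial>M) = (\<integral>\<omega>. X i \<omega> * X i \<omega> \<partial>M)" using i by simp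
  qed
  also have "\<dots> \<le> (\<Sum>i<n. B)" using X2 by (intro sum_mono) auto
  finally have var: "(\<integral>\<omega>. (\<Sum>i<n. X i \<omega>)\<^sup>2 \<partial>M) \<le> real n * B" by simp
  have e0: "(\<integral>\<omega>. (\<Sum>i<n. X i \<omega>) \<partial>M) = 0"
    using Xi X0 by (subst Bochner_Integration.integral_sum) auto
  have "measure M {\<omega>\<in>space M. \<bar>(\<Sum>i<n. X i \<omega>) - (\<integral>\<omega>. (\<Sum>i<n. X i \<omega>) \<partial>M)\<bar> \<ge> real n * a}
      \<le> M.variance (\<lambda>\<omega>. \<Sum>i<n. X i \<omega>) / (real n * a)\<^sup>2"
    using n a by (intro M.Chebyshev_inequality sm sqi) simp
  also have "M.variance (\<lambda>\<omega>. \<Sum>i<n. X i \<omega>) / (real n * a)\<^sup>2 \<le> real n * B / (real n * a)\<^sup>2"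
    unfolding e0 using var by (intro divide_right_mono) auto
  also have "\<dots> = B / (real n * a\<^sup>2)" using n by (simp add: power2_eq_square)
  also have "{\<omega>\<in>space M. \<bar>(\<Sum>i<n. X i \<omega>) - (\<integral>\<omega>. (\<Sum>i<n. X i \<omega>) \<partial>M)\<bar> \<ge> real n * a} =
     {\<omega>\<in>space M. \<bar>emp_mean n D f \<omega> - (\<integral>y. f y \<partial>N)\<bar> \<ge> a}"
    unfolding e0 em \<mu>_def[symmetric] using n by (auto simp: field_simps)
  finally show "measure M {\<omega>\<in>space M. \<bar>emp_mean n D f \<omega> - (\<integral>y. f y \<partial>N)\<bar> \<ge> a} \<le> B / (real n * a\<^sup>2)" .
qed

lemma (in prob_space) prob_finite_Inter_ge:
  assumes fin: "finite I" and A: "\<And>i. i \<in> I \<Longrightarrow> A i \<in> events" and b: "\<And>i. i \<in> I \<Longrightarrow> prob (A i) \<le> b"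
  shows "1 - real (card I) * b \<le> prob (space M - (\<Union>i\<in>I. A i))"
proof -
  have "prob (\<Union>i\<in>I. A i) \<le> (\<Sum>i\<in>I. prob (A i))" using fin A by (intro finite_measure_subadditive_finite) auto
  also have "\<dots> \<le> (\<Sum>i\<in>I. b)" by (intro sum_mono b)
  finally have "prob (\<Union>i\<in>I. A i) \<le> real (card I) * b" by simp
  moreover have "prob (space M - (\<Union>i\<in>I. A i)) = 1 - prob (\<Union>i\<in>I. A i)"
    using fin A by (intro prob_compl) auto
  ultimately show ?thesis by simp
qed

section \<open>Sample and population covariance\<close>

lemma sample_var_carrier [simp]: "sample_var m n h X \<in> carrier_mat m m"
  by (simp add: sample_var_def)

lemma sample_var_transpose: "(sample_var m n h X)\<^sup>T = sample_var m n h X"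
  by (intro eq_matI) (auto simp: sample_var_def mult.commute)

lemma var_mat_carrier [simp]: "var_mat m P h \<in> carrier_mat m m"
  by (simp add: var_mat_def)

lemma var_mat_transpose: "(var_mat m P h)\<^sup>T = var_mat m P h"
  by (intro eq_matI) (auto simp: var_mat_def mult.commute)

text \<open>A covariance is invariant under shifts.  The weight matrix is the sample covariance of the moments
  at an estimated parameter, which differ from the moments z at \<theta>0 by a vector c that is random but
  the same for all observations; it drops out.\<close>
lemma sample_var_index:
  assumes n: "0 < n" and kl: "k < m" "l < m"
    and shift: "\<And>i. i < n \<Longrightarrow> h (D i \<omega>) $ k = z k (D i \<omega>) + c k" "\<And>i. i < n \<Longrightarrow> h (D i \<omega>) $ l = z l (D i \<omega>) + c l"
  shows "sample_var m n h (\<lambda>i. D i \<omega>) $$ (k, l) =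
    emp_mean n D (\<lambda>y. z k y * z l y) \<omega> - emp_mean n D (z k) \<omega> * emp_mean n D (z l) \<omega>"
proof -
  define Zk where "Zk = emp_mean n D (z k) \<omega>"
  define Zl where "Zl = emp_mean n D (z l) \<omega>"
  have "sample_mean m n h (\<lambda>i. D i \<omega>) $ k = Zk + c k" "sample_mean m n h (\<lambda>i. D i \<omega>) $ l = Zl + c l"
    using n kl shift by (simp_all add: sample_mean_def Zk_def Zl_def emp_mean_def sum.distrib add_divide_distrib)
  then have "sample_var m n h (\<lambda>i. D i \<omega>) $$ (k, l) = (\<Sum>i<n. (z k (D i \<omega>) - Zk) * (z l (D i \<omega>) - Zl)) / real n"
    using kl shift by (simp add: sample_var_def)
  also have "(\<Sum>i<n. (z k (D i \<omega>) - Zk) * (z l (D i \<omega>) - Zl)) =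
     (\<Sum>i<n. z k (D i \<omega>) * z l (D i \<omega>)) - Zk * (\<Sum>i<n. z l (D i \<omega>)) - Zl * (\<Sum>i<n. z k (D i \<omega>)) + real n * Zk * Zl"
    by (simp add: algebra_simps sum.distrib sum_subtractf sum_distrib_left)
  also have "(\<Sum>i<n. z k (D i \<omega>)) = real n * Zk" using n by (simp add: Zk_def emp_mean_def)
  also have "(\<Sum>i<n. z l (D i \<omega>)) = real n * Zl" using n by (simp add: Zl_def emp_mean_def)
  also have "(\<Sum>i<n. z k (D i \<omega>) * z l (D i \<omega>)) = real n * emp_mean n D (\<lambda>y. z k y * z l y) \<omega>"
    using n by (simp add: emp_mean_def)
  also have "real n * emp_mean n D (\<lambda>y. z k y * z l y) \<omega> - Zk * (real n * Zl) - Zl * (real n * Zk) + real n * Zk * Zl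
     = real n * (emp_mean n D (\<lambda>y. z k y * z l y) \<omega> - Zk * Zl)" by (simp add: algebra_simps)
  finally show ?thesis using n by (simp add: Zk_def Zl_def)
qed

text \<open>An entrywise error d has operator norm at most p^2 d, by the crude comparison of norms.\<close>
lemma form_bounds_perturb:
  assumes fb: "form_bounds p V lo hi" and W: "W \<in> carrier_mat p p" "W\<^sup>T = W"
    and d: "\<And>k l. k < p \<Longrightarrow> l < p \<Longrightarrow> \<bar>W $$ (k, l) - V $$ (k, l)\<bar> \<le> d" and d0: "0 \<le> d"
  shows "form_bounds p W (lo - real p * real p * d) (hi + real p * real p * d)"
    and "0 < p \<Longrightarrow> opnorm (W - V) \<le> real p * real p * d"
proof -
  note V = form_boundsD(1)[OF fb]
  have op: "vnorm ((W - V) *\<^sub>v v) \<le> real p * real p * d * vnorm v" if v: "v \<in> carrier_vec p" for v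
  proof -
    have "\<bar>((W - V) *\<^sub>v v) $ k\<bar> \<le> real p * (d * vnorm v)" if k: "k < p" for k
    proof -
      have "\<bar>((W - V) *\<^sub>v v) $ k\<bar> = \<bar>\<Sum>l<p. (W $$ (k, l) - V $$ (k, l)) * v $ l\<bar>"
        using k v V W(1) by (auto simp: scalar_prod_def lessThan_atLeast0 intro!: arg_cong[where f=abs] sum.cong)
      also have "\<dots> \<le> (\<Sum>l<p. d * vnorm v)"
      proof (intro order_trans[OF sum_abs] sum_mono)
        fix l assume "l \<in> {..<p}"
        then show "\<bar>(W $$ (k, l) - V $$ (k, l)) * v $ l\<bar> \<le> d * vnorm v"
          using d[OF k, of l] abs_index_le_vnorm[of l v] v d0 unfolding abs_mult by (intro mult_mono) auto
      qed
      finally show ?thesis by simp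
    qed
    then have "vnorm ((W - V) *\<^sub>v v) \<le> real (dim_vec ((W - V) *\<^sub>v v)) * (real p * (d * vnorm v))"
      using V by (intro vnorm_le_card) auto
    then show ?thesis using V by (simp add: mult_ac)
  qed
  show "opnorm (W - V) \<le> real p * real p * d" if p: "0 < p"
    unfolding opnorm_def
  proof (rule cSUP_least)
    have "unit_vec p 0 \<in> unit_sphere (dim_col (W - V))"
      using p V by (auto simp: unit_sphere_def vnorm_def)
    then show "unit_sphere (dim_col (W - V)) \<noteq> {}" by blast
    fix v assume "v \<in> unit_sphere (dim_col (W - V))"
    then have "v \<in> carrier_vec p" "vnorm v = 1" using V by (auto simp: unit_sphere_def)
    then show "vnorm ((W - V) *\<^sub>v v) \<le> real p * real p * d" using op[of v] by simp
  qed
  have "(lo - real p * real p * d) * (v \<bullet> v) \<le> v \<bullet> (W *\<^sub>v v) \<and> v \<bullet> (W *\<^sub>v v) \<le> (hi + real p * real p * d) * (v \<bullet> v)"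
    if v: "v \<in> carrier_vec p" for v
  proof -
    have "v \<bullet> ((W - V) *\<^sub>v v) = v \<bullet> (W *\<^sub>v v) - v \<bullet> (V *\<^sub>v v)"
      using v W(1) V by (simp add: minus_mult_distrib_mat_vec[of W p p] scalar_prod_minus_distrib[of v p])
    moreover have "\<bar>v \<bullet> ((W - V) *\<^sub>v v)\<bar> \<le> vnorm v * (real p * real p * d * vnorm v)"
      using abs_sprod_le[of v "(W - V) *\<^sub>v v"] mult_left_mono[OF op[OF v] vnorm_nonneg[of v]] v V by auto
    moreover have "vnorm v * (real p * real p * d * vnorm v) = real p * real p * d * (v \<bullet> v)"
      by (simp add: vnorm_sq[symmetric] power2_eq_square)
    ultimately show ?thesis using form_boundsD(3,4)[OF fb v]
      unfolding left_diff_distrib distrib_right by linarith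
  qed
  then show "form_bounds p W (lo - real p * real p * d) (hi + real p * real p * d)"
    using W by (auto simp: form_bounds_def)
qed

lemma form_bounds_pos_def:
  assumes fb: "form_bounds p W lo hi" "0 < lo"
  shows "pos_def W"
proof -
  note W = form_boundsD(1,2)[OF fb(1)]
  have "0 < v \<bullet> (W *\<^sub>v v)" if v: "v \<in> carrier_vec p" "v \<noteq> 0\<^sub>v p" for v
  proof -
    have "v \<bullet> v \<noteq> 0" using vnorm_eq_0[of v p] v by (auto simp: vnorm_def)
    then have "0 < lo * (v \<bullet> v)" using sprod_self_nonneg[of v] fb(2) by simp
    then show ?thesis using form_boundsD(3)[OF fb(1) v(1)] by linarith
  qed
  then show ?thesis using W by (auto simp: pos_def_def)
qed

section \<open>Typical samples for the precision moments\<close>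

text \<open>By (u - v)^4 \<le> 8 u^4 + 8 v^4 and the inequality between arithmetic and geometric means, the fourth
  power of a component is at most 4 y_i^8 + 4 y_j^8 + 8 c^4.  It dominates the square of the
  component, up to the constant one, and the squares of products of two components.\<close>
lemma prec_moment_moments:
  assumes P: "prob_space P" and sets: "sets P = sets (Pi\<^sub>M {..<s} (\<lambda>_. borel))"
    and mom8: "\<And>j. j < s \<Longrightarrow> integrable P (\<lambda>y. y j ^ 8) \<and> (\<integral>y. y j ^ 8 \<partial>P) \<le> K"
    and c: "\<And>k. k < tri_dim s \<Longrightarrow> \<bar>prec_inv s \<theta> $$ (tri_row k, tri_col k)\<bar> \<le> c"
    and k: "k < tri_dim s" and l: "l < tri_dim s"
  shows "(\<lambda>y. prec_moment s y \<theta> $ k) \<in> borel_measurable P" (is "?z k \<in> _")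
    and "integrable P (\<lambda>y. (prec_moment s y \<theta> $ k)\<^sup>2)" "(\<integral>y. (prec_moment s y \<theta> $ k)\<^sup>2 \<partial>P) \<le> 1 + 8 * \<bar>K\<bar> + 8 * c ^ 4"
    and "integrable P (\<lambda>y. (prec_moment s y \<theta> $ k * prec_moment s y \<theta> $ l)\<^sup>2)"
      "(\<integral>y. (prec_moment s y \<theta> $ k * prec_moment s y \<theta> $ l)\<^sup>2 \<partial>P) \<le> 1 + 8 * \<bar>K\<bar> + 8 * c ^ 4"
proof -
  interpret prob_space P by fact
  have my: "(\<lambda>y. y i) \<in> borel_measurable P" if "i < s" for i
    using measurable_component_singleton[of i "{..<s}" "\<lambda>_. borel :: real measure"] that
    by (simp add: measurable_cong_sets[OF sets refl])
  have mz: "?z k \<in> borel_measurable P" if "k < tri_dim s" for k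
    using that my[OF tri_row_less[OF that]] my[OF tri_col_less[OF that]] by (simp add: prec_moment_def)
  define b where "b k y = 4 * y (tri_row k) ^ 8 + 4 * y (tri_col k) ^ 8 + 8 * c ^ 4" for k and y :: "nat \<Rightarrow> real"
  have b4: "?z k y ^ 4 \<le> b k y" if k: "k < tri_dim s" for k y
  proof -
    define u where "u = y (tri_row k)" define v where "v = y (tri_col k)"
    define t where "t = prec_inv s \<theta> $$ (tri_row k, tri_col k)"
    have "(u * v - t)\<^sup>2 \<le> 2 * (u * v)\<^sup>2 + 2 * t\<^sup>2"
      using zero_le_power2[of "u * v + t"] by (simp add: power2_eq_square algebra_simps)
    then have "((u * v - t)\<^sup>2)\<^sup>2 \<le> (2 * (u * v)\<^sup>2 + 2 * t\<^sup>2)\<^sup>2" by (intro power_mono) auto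
    also have "\<dots> \<le> 8 * ((u * v)\<^sup>2)\<^sup>2 + 8 * (t\<^sup>2)\<^sup>2"
      using zero_le_power2[of "(u * v)\<^sup>2 - t\<^sup>2"] by (simp add: power2_eq_square algebra_simps)
    also have "((u * v)\<^sup>2)\<^sup>2 = u ^ 4 * v ^ 4" by (simp add: power_mult_distrib)
    also have "8 * (u ^ 4 * v ^ 4) \<le> 4 * u ^ 8 + 4 * v ^ 8"
      using zero_le_power2[of "u ^ 4 - v ^ 4"] by (simp add: power2_diff power_mult[symmetric])
    also have "(t\<^sup>2)\<^sup>2 \<le> c ^ 4"
    proof -
      have "\<bar>t\<bar> ^ 4 \<le> c ^ 4" using c[OF k] by (intro power_mono) (auto simp: t_def)
      then show ?thesis by simp
    qed
    finally show ?thesis using k by (simp add: prec_moment_def b_def u_def v_def t_def)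
  qed
  have bi: "integrable P (b k)" and bI: "(\<integral>y. b k y \<partial>P) \<le> 8 * \<bar>K\<bar> + 8 * c ^ 4" if k: "k < tri_dim s" for k
    using mom8[OF tri_row_less[OF k]] mom8[OF tri_col_less[OF k]] unfolding b_def[abs_def] by (auto simp: prob_space)
  have dom: "integrable P f \<and> (\<integral>y. f y \<partial>P) \<le> B"
    if "f \<in> borel_measurable P" "integrable P g" "(\<integral>y. g y \<partial>P) \<le> B" "\<And>y. 0 \<le> f y" "\<And>y. f y \<le> g y" for f g :: "(nat \<Rightarrow> real) \<Rightarrow> real" and B
  proof -
    have gb: "norm (f y) \<le> norm (g y)" for y using that(4,5)[of y] by simp
    have "integrable P f" by (rule Bochner_Integration.integrable_bound[OF that(2,1)]) (rule AE_I2, rule gb)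
    then show ?thesis using integral_mono[of P f g] that by force
  qed
  show "?z k \<in> borel_measurable P" by (rule mz[OF k])
  have 2: "integrable P (\<lambda>y. (?z k y)\<^sup>2) \<and> (\<integral>y. (?z k y)\<^sup>2 \<partial>P) \<le> 1 + 8 * \<bar>K\<bar> + 8 * c ^ 4"
  proof (rule dom[of _ "\<lambda>y. 1 + b k y"])
    show "(\<integral>y. 1 + b k y \<partial>P) \<le> 1 + 8 * \<bar>K\<bar> + 8 * c ^ 4" using bi[OF k] bI[OF k] by (simp add: prob_space)
    show "(?z k y)\<^sup>2 \<le> 1 + b k y" for y
    proof -
      have w: "w \<le> 1 + w\<^sup>2" if "0 \<le> w" for w :: real
        using zero_le_power2[of "w - 1"] that unfolding power2_diff by simp
      have "(?z k y)\<^sup>2 \<le> 1 + ((?z k y)\<^sup>2)\<^sup>2" by (rule w) simp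
      then show ?thesis using b4[OF k, of y] by simp
    qed
  qed (use mz[OF k] bi[OF k] in auto)
  have 4: "integrable P (\<lambda>y. (?z k y * ?z l y)\<^sup>2) \<and> (\<integral>y. (?z k y * ?z l y)\<^sup>2 \<partial>P) \<le> 1 + 8 * \<bar>K\<bar> + 8 * c ^ 4"
  proof (rule dom[of _ "\<lambda>y. b k y / 2 + b l y / 2"])
    show "(\<integral>y. b k y / 2 + b l y / 2 \<partial>P) \<le> 1 + 8 * \<bar>K\<bar> + 8 * c ^ 4" using bi[OF k] bI[OF k] bi[OF l] bI[OF l] by simp
    show "(?z k y * ?z l y)\<^sup>2 \<le> b k y / 2 + b l y / 2" for y
      using b4[OF k, of y] b4[OF l, of y] zero_le_power2[of "(?z k y)\<^sup>2 - (?z l y)\<^sup>2"] by (simp add: power2_diff power_mult_distrib)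
  qed (use mz[OF k] mz[OF l] bi[OF k] bi[OF l] in auto)
  show "integrable P (\<lambda>y. (prec_moment s y \<theta> $ k)\<^sup>2)" "(\<integral>y. (prec_moment s y \<theta> $ k)\<^sup>2 \<partial>P) \<le> 1 + 8 * \<bar>K\<bar> + 8 * c ^ 4"
     "integrable P (\<lambda>y. (prec_moment s y \<theta> $ k * prec_moment s y \<theta> $ l)\<^sup>2)"
     "(\<integral>y. (prec_moment s y \<theta> $ k * prec_moment s y \<theta> $ l)\<^sup>2 \<partial>P) \<le> 1 + 8 * \<bar>K\<bar> + 8 * c ^ 4"
    using 2 4 by auto
qed

text \<open>All that the deterministic analysis uses of the sample: the size of the mean moments at the truth
  and the entrywise distance of the weight matrix W to the covariance matrix.\<close>
definition typical_sample :: "nat \<Rightarrow> nat \<Rightarrow> 'd measure \<Rightarrow> ('d \<Rightarrow> real vec) \<Rightarrow> real mat \<Rightarrow> real \<Rightarrow> real \<Rightarrow> (nat \<Rightarrow> 'd) \<Rightarrow> bool" where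
  "typical_sample m n P h W T \<delta> X \<longleftrightarrow> vnorm (sample_mean m n h X) \<le> T / sqrt (real n) \<and>
     (\<forall>k<m. \<forall>l<m. \<bar>W $$ (k, l) - var_mat m P h $$ (k, l)\<bar> \<le> \<delta>)"

text \<open>T is fixed before \<delta>: the mean moments are of order 1 / sqrt n, so T grows as \<eta> shrinks,
  while the error of the weight matrix tends to zero for any fixed T.\<close>
lemma prec_typical_sample_likely:
  assumes iid: "iid_sample Pr D PD" and p_eq: "\<And>n. p n = tri_dim (s n)" and S: "\<And>n. s n \<le> S"
    and sets: "\<And>n. sets (PD n) = sets (Pi\<^sub>M {..<s n} (\<lambda>_. borel))"
    and mom8: "\<And>n j. j < s n \<Longrightarrow> integrable (PD n) (\<lambda>y. y j ^ 8) \<and> (\<integral>y. y j ^ 8 \<partial>PD n) \<le> K"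
    and m0: "\<And>n. mean_vec (p n) (PD n) (\<lambda>y. prec_moment (s n) y (\<theta>0 n)) = 0\<^sub>v (p n)"
    and c: "\<And>n k. k < p n \<Longrightarrow> \<bar>prec_inv (s n) (\<theta>0 n) $$ (tri_row k, tri_col k)\<bar> \<le> c"
    and eta: "0 < \<eta>"
  shows "\<exists>T>0. \<forall>\<delta>>0. likely Pr \<eta> (\<lambda>n \<omega>. typical_sample (p n) n (PD n) (\<lambda>y. prec_moment (s n) y (\<theta>0 n))
     (prec_weight (s n) n (\<lambda>i. D n i \<omega>)) T \<delta> (\<lambda>i. D n i \<omega>))"
proof -
  define z where "z n k y = prec_moment (s n) y (\<theta>0 n) $ k" for n k y
  define B where "B = 1 + 8 * \<bar>K\<bar> + 8 * c ^ 4"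
  have B: "0 < B" by (simp add: B_def add_pos_nonneg)
  define P where "P = tri_dim S"
  have P: "p n \<le> P" for n using S tri_dim_mono by (simp add: p_eq P_def)
  \<comment> \<open>A bound on the number of exceptional events; each may have probability \<eta> / N.\<close>
  define N where "N = real (Suc P) * real (Suc P)"
  have N: "0 < N" by (simp add: N_def)
  define T where "T = sqrt (N * B / \<eta>)"
  have T: "0 < T" "T\<^sup>2 = N * B / \<eta>" using N B eta by (auto simp: T_def)
  have ps: "prob_space (Pr n)" "prob_space (PD n)" for n using iid by (auto simp: iid_sample_def)
  have zm: "z n k \<in> borel_measurable (PD n)" "integrable (PD n) (\<lambda>y. (z n k y)\<^sup>2)" "(\<integral>y. (z n k y)\<^sup>2 \<partial>PD n) \<le> B"
      "integrable (PD n) (\<lambda>y. (z n k y * z n l y)\<^sup>2)" "(\<integral>y. (z n k y * z n l y)\<^sup>2 \<partial>PD n) \<le> B"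
      if kl: "k < p n" "l < p n" for n k l
    unfolding z_def B_def
    by (rule prec_moment_moments[OF ps(2) sets mom8 c kl[unfolded p_eq]]; simp add: p_eq)+
  have z0: "(\<integral>y. z n k y \<partial>PD n) = 0" if "k < p n" for n k
    using arg_cong[OF m0[of n], of "\<lambda>v. v $ k"] that by (simp add: mean_vec_def z_def)
  have V: "var_mat (p n) (PD n) (\<lambda>y. prec_moment (s n) y (\<theta>0 n)) $$ (k, l) = (\<integral>y. z n k y * z n l y \<partial>PD n)"
    if "k < p n" "l < p n" for n k l
    using that m0[of n] by (simp add: var_mat_def z_def)
  have W: "prec_weight (s n) n (\<lambda>i. D n i \<omega>) $$ (k, l) = emp_mean n (D n) (\<lambda>y. z n k y * z n l y) \<omega>
       - emp_mean n (D n) (z n k) \<omega> * emp_mean n (D n) (z n l) \<omega>"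
    if "0 < n" "k < p n" "l < p n" for n k l \<omega>
    unfolding prec_weight_def Let_def
    by (rule sample_var_index[where c = "\<lambda>k. prec_inv (s n) (\<theta>0 n) $$ (tri_row k, tri_col k)
         - prec_inv (s n) (par_of_sym (s n) (minv (emp_cov (s n) n (\<lambda>i. D n i \<omega>)))) $$ (tri_row k, tri_col k)"])
      (use that in \<open>auto simp: z_def prec_moment_def p_eq\<close>)
  define h where "h n y = prec_moment (s n) y (\<theta>0 n)" for n y
  have main: "likely Pr \<eta> (\<lambda>n \<omega>. typical_sample (p n) n (PD n) (h n) (prec_weight (s n) n (\<lambda>i. D n i \<omega>)) (real (Suc P) * T) \<delta> (\<lambda>i. D n i \<omega>))"
    if d: "0 < \<delta>" for \<delta>
  proof -
    \<comment> \<open>The pair (k, p n) encodes a deviation of the k-th mean; the pairs (k, l) with l < p n deviations of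
      mean products.\<close>
    define A where "A n = (\<lambda>(k, l). if l = p n
       then {\<omega>\<in>space (Pr n). \<bar>emp_mean n (D n) (z n k) \<omega> - (\<integral>y. z n k y \<partial>PD n)\<bar> \<ge> T / sqrt (real n)}
       else {\<omega>\<in>space (Pr n). \<bar>emp_mean n (D n) (\<lambda>y. z n k y * z n l y) \<omega> - (\<integral>y. z n k y * z n l y \<partial>PD n)\<bar> \<ge> \<delta> / 2})" for n
    define I where "I n = {..<p n} \<times> {..p n}" for n
    define E where "E n = (if n = 0 then {} else space (Pr n) - (\<Union>i\<in>I n. A n i))" for n
    have em: "emp_mean n (D n) f \<in> borel_measurable (Pr n)"
      "measure (Pr n) {\<omega>\<in>space (Pr n). \<bar>emp_mean n (D n) f \<omega> - (\<integral>y. f y \<partial>PD n)\<bar> \<ge> a} \<le> B / (real n * a\<^sup>2)"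
      if "0 < n" "f \<in> borel_measurable (PD n)" "integrable (PD n) (\<lambda>y. (f y)\<^sup>2)" "(\<integral>y. (f y)\<^sup>2 \<partial>PD n) \<le> B" "0 < a" for n f a
    proof -
      have i: "prob_space.indep_vars (Pr n) (\<lambda>_. PD n) (D n) {..<n}"
        "\<And>i. i < n \<Longrightarrow> D n i \<in> measurable (Pr n) (PD n)" "\<And>i. i < n \<Longrightarrow> distr (Pr n) (PD n) (D n i) = PD n"
        using iid by (auto simp: iid_sample_def)
      show "emp_mean n (D n) f \<in> borel_measurable (Pr n)"
        "measure (Pr n) {\<omega>\<in>space (Pr n). \<bar>emp_mean n (D n) f \<omega> - (\<integral>y. f y \<partial>PD n)\<bar> \<ge> a} \<le> B / (real n * a\<^sup>2)"
        using iid_mean_Chebyshev[OF ps i that(2-4,1,5)] by auto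
    qed
    have AE: "A n i \<in> sets (Pr n)" and Ab: "measure (Pr n) (A n i) \<le> max (\<eta> / N) (B / (real n * (\<delta> / 2)\<^sup>2))"
      if n: "0 < n" and i: "i \<in> I n" for n i
    proof -
      obtain k l where kl: "i = (k, l)" "k < p n" "l \<le> p n" using i by (auto simp: I_def)
      have "A n i \<in> sets (Pr n) \<and> measure (Pr n) (A n i) \<le> max (\<eta> / N) (B / (real n * (\<delta> / 2)\<^sup>2))"
      proof (cases "l = p n")
        case True
        have Tn: "0 < T / sqrt (real n)" using T n by simp
        note e = em[OF n zm(1-3)[OF kl(2,2)] Tn]
        have "B / (real n * (T / sqrt (real n))\<^sup>2) = \<eta> / N"
          using n T N B eta by (simp add: power_divide)
        moreover have "A n i \<in> sets (Pr n)" unfolding A_def kl(1) using e(1) True by simp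
        ultimately show ?thesis using e(2) True by (simp add: A_def kl(1))
      next
        case False
        then have l: "l < p n" using kl by simp
        have m: "(\<lambda>y. z n k y * z n l y) \<in> borel_measurable (PD n)" using zm(1)[OF kl(2,2)] zm(1)[OF l l] by simp
        note e = em[OF n m zm(4,5)[OF kl(2) l], of "\<delta> / 2"]
        have "A n i \<in> sets (Pr n)" unfolding A_def kl(1) using e(1) d False by simp
        then show ?thesis using e(2) d False by (simp add: A_def kl(1))
      qed
      then show "A n i \<in> sets (Pr n)" "measure (Pr n) (A n i) \<le> max (\<eta> / N) (B / (real n * (\<delta> / 2)\<^sup>2))" by auto
    qed
    have fI: "finite (I n)" for n by (simp add: I_def)
    have cI: "real (card (I n)) \<le> N" for n
    proof -
      have "card (I n) = p n * Suc (p n)" by (simp add: I_def)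
      also have "\<dots> \<le> Suc P * Suc P" using P[of n] by (intro mult_le_mono) auto
      finally show ?thesis unfolding N_def of_nat_mult[symmetric] of_nat_le_iff .
    qed
    have "E n \<in> sets (Pr n)" for n unfolding E_def using AE fI[of n] by auto
    moreover have "\<forall>\<^sub>F n in sequentially. 1 - \<eta> \<le> measure (Pr n) (E n)"
    proof -
      have "(\<lambda>n. B / (real n * (\<delta> / 2)\<^sup>2)) \<longlonglongrightarrow> 0" using d by real_asymp
      then have "\<forall>\<^sub>F n in sequentially. B / (real n * (\<delta> / 2)\<^sup>2) < \<eta> / N" using eta N by (intro order_tendstoD) auto
      with eventually_gt_at_top[of 0] show ?thesis
      proof eventually_elim
        case (elim n)
        have b: "measure (Pr n) (A n i) \<le> \<eta> / N" if "i \<in> I n" for i using Ab[OF elim(1) that] elim(2) by simp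
        have "1 - real (card (I n)) * (\<eta> / N) \<le> measure (Pr n) (space (Pr n) - (\<Union>i\<in>I n. A n i))"
          by (rule prob_space.prob_finite_Inter_ge[OF ps(1) fI AE[OF elim(1)] b])
        moreover have "real (card (I n)) * (\<eta> / N) \<le> N * (\<eta> / N)" using cI eta N by (intro mult_right_mono) auto
        ultimately show ?case using N elim by (simp add: E_def)
      qed
    qed
    moreover have "\<forall>\<^sub>F n in sequentially. \<forall>\<omega>\<in>E n. typical_sample (p n) n (PD n) (h n)
        (prec_weight (s n) n (\<lambda>i. D n i \<omega>)) (real (Suc P) * T) \<delta> (\<lambda>i. D n i \<omega>)"
    proof -
      have "(\<lambda>n. T\<^sup>2 / real n) \<longlonglongrightarrow> 0" by real_asymp
      then have "\<forall>\<^sub>F n in sequentially. T\<^sup>2 / real n < \<delta> / 2" using d by (intro order_tendstoD) auto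
      with eventually_gt_at_top[of 0] show ?thesis
      proof eventually_elim
        case (elim n)
        show ?case unfolding typical_sample_def h_def
        proof (intro ballI conjI allI impI)
          fix \<omega> assume w: "\<omega> \<in> E n"
          have b1: "\<bar>emp_mean n (D n) (z n k) \<omega>\<bar> \<le> T / sqrt (real n)" if "k < p n" for k
          proof -
            have "(k, p n) \<in> I n" using that by (simp add: I_def)
            then have "\<omega> \<notin> A n (k, p n)" "\<omega> \<in> space (Pr n)" using w elim(1) by (auto simp: E_def)
            then show ?thesis using z0[OF that] by (simp add: A_def not_le)
          qed
          have "sample_mean (p n) n (\<lambda>y. prec_moment (s n) y (\<theta>0 n)) (\<lambda>i. D n i \<omega>) $ k = emp_mean n (D n) (z n k) \<omega>" if "k < p n" for k
            using that by (simp add: sample_mean_def emp_mean_def z_def)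
          then have "vnorm (sample_mean (p n) n (\<lambda>y. prec_moment (s n) y (\<theta>0 n)) (\<lambda>i. D n i \<omega>)) \<le> real (p n) * (T / sqrt (real n))"
            using vnorm_le_card[of "sample_mean (p n) n (\<lambda>y. prec_moment (s n) y (\<theta>0 n)) (\<lambda>i. D n i \<omega>)" "T / sqrt (real n)"] b1
            by (simp add: sample_mean_def)
          also have "\<dots> \<le> real (Suc P) * (T / sqrt (real n))" using P[of n] T by (intro mult_right_mono) auto
          finally show "vnorm (sample_mean (p n) n (\<lambda>y. prec_moment (s n) y (\<theta>0 n)) (\<lambda>i. D n i \<omega>)) \<le> real (Suc P) * T / sqrt (real n)" by simp
          fix k l assume kl: "k < p n" "l < p n"
          have "(k, l) \<in> I n" using kl by (simp add: I_def)
          then have "\<omega> \<notin> A n (k, l)" "\<omega> \<in> space (Pr n)" using w elim(1) by (auto simp: E_def)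
          then have "\<bar>emp_mean n (D n) (\<lambda>y. z n k y * z n l y) \<omega> - (\<integral>y. z n k y * z n l y \<partial>PD n)\<bar> < \<delta> / 2"
            using kl by (simp add: A_def not_le)
          moreover have "\<bar>emp_mean n (D n) (z n k) \<omega> * emp_mean n (D n) (z n l) \<omega>\<bar> \<le> T / sqrt (real n) * (T / sqrt (real n))"
            unfolding abs_mult using T by (intro mult_mono b1 kl) auto
          moreover have "T / sqrt (real n) * (T / sqrt (real n)) = T\<^sup>2 / real n" by (simp add: power2_eq_square)
          ultimately show "\<bar>prec_weight (s n) n (\<lambda>i. D n i \<omega>) $$ (k, l)
            - var_mat (p n) (PD n) (\<lambda>y. prec_moment (s n) y (\<theta>0 n)) $$ (k, l)\<bar> \<le> \<delta>"
            unfolding W[OF elim(1) kl] V[OF kl] using elim(2) by linarith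
        qed
      qed
    qed
    ultimately show ?thesis unfolding likely_def by blast
  qed
  show ?thesis
    using main T unfolding h_def by (intro exI[of _ "real (Suc P) * T"] conjI allI impI) auto
qed

text \<open>With the dimension bounded by P, entrywise convergence of the weight matrix is convergence in
  operator norm, and it carries the spectral bounds of V over to the weight matrix.\<close>
lemma prec_cond_A6:
  assumes ps: "\<And>n. prob_space (Pr n)" and p: "\<And>n. 1 \<le> p n" "\<And>n. p n \<le> P"
    and lo: "0 < lo" and fb: "\<And>n. form_bounds (p n) (var_mat (p n) (PD n) (\<lambda>y. g n y (\<theta>0 n))) lo hi"
    and W: "\<And>n \<omega>. Vn n (\<lambda>i. D n i \<omega>) \<in> carrier_mat (p n) (p n)" "\<And>n \<omega>. (Vn n (\<lambda>i. D n i \<omega>))\<^sup>T = Vn n (\<lambda>i. D n i \<omega>)"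
    and ev: "\<And>\<delta> \<eta>. 0 < \<delta> \<Longrightarrow> 0 < \<eta> \<Longrightarrow> likely Pr \<eta> (\<lambda>n \<omega>. \<forall>k<p n. \<forall>l<p n.
         \<bar>Vn n (\<lambda>i. D n i \<omega>) $$ (k, l) - var_mat (p n) (PD n) (\<lambda>y. g n y (\<theta>0 n)) $$ (k, l)\<bar> \<le> \<delta>)"
  shows "cond_A6 Pr D PD p g \<theta>0 Vn"
proof -
  let ?V = "\<lambda>n. var_mat (p n) (PD n) (\<lambda>y. g n y (\<theta>0 n))" and ?W = "\<lambda>n \<omega>. Vn n (\<lambda>i. D n i \<omega>)"
  have P0: "0 < real P" using p[of 0] by linarith
  then have P: "0 < real P * real P" by simp
  have main: "wpa1 Pr Q"
    if d: "0 < \<delta>" and Q: "\<And>n \<omega>. (\<And>k l. k < p n \<Longrightarrow> l < p n \<Longrightarrow> \<bar>?W n \<omega> $$ (k, l) - ?V n $$ (k, l)\<bar> \<le> \<delta>) \<Longrightarrow> Q n \<omega>" for Q \<delta>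
  proof (rule wpa1I[OF ps])
    fix \<eta> :: real assume "0 < \<eta>"
    from ev[OF d this] show "likely Pr \<eta> Q" by (rule likely_mono) (intro always_eventually allI impI Q, blast)
  qed
  have pp: "real (p n) * real (p n) * d \<le> real P * real P * d" if "0 \<le> d" for n d
    using p(2)[of n] that by (intro mult_right_mono mult_mono) auto
  \<comment> \<open>An entrywise error \<delta> changes quadratic forms by at most P^2 \<delta>, which equals lo / 2.\<close>
  define \<delta> where "\<delta> = lo / 2 / (real P * real P)"
  have \<delta>: "0 < \<delta>" "real P * real P * \<delta> = lo / 2" using lo P P0 by (auto simp: \<delta>_def)
  have fbW: "form_bounds (p n) (?W n \<omega>) (lo / 2) (hi + lo / 2)"
    if "\<And>k l. k < p n \<Longrightarrow> l < p n \<Longrightarrow> \<bar>?W n \<omega> $$ (k, l) - ?V n $$ (k, l)\<bar> \<le> \<delta>" for n \<omega>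
  proof -
    have f: "form_bounds (p n) (?W n \<omega>) (lo - real (p n) * real (p n) * \<delta>) (hi + real (p n) * real (p n) * \<delta>)"
      using \<delta> that by (intro form_bounds_perturb(1)[OF fb W]) auto
    have le: "real (p n) * real (p n) * \<delta> \<le> lo / 2" using pp[of \<delta> n] \<delta> by simp
    show ?thesis by (rule form_bounds_weaken[OF f]) (use le in auto)
  qed
  have 1: "wpa1 Pr (\<lambda>n \<omega>. pos_def (?W n \<omega>))"
    using lo by (intro main[OF \<delta>(1)] form_bounds_pos_def[OF fbW]) auto
  have 2: "wpa1 Pr (\<lambda>n \<omega>. opnorm (?W n \<omega> - ?V n) < e)" if e: "0 < e" for e
  proof (rule main[of "e / 2 / (real P * real P)"])
    let ?d = "e / 2 / (real P * real P)"
    show "0 < ?d" using e P by simp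
    fix n \<omega> assume a: "\<And>k l. k < p n \<Longrightarrow> l < p n \<Longrightarrow> \<bar>?W n \<omega> $$ (k, l) - ?V n $$ (k, l)\<bar> \<le> ?d"
    have "opnorm (?W n \<omega> - ?V n) \<le> real (p n) * real (p n) * ?d"
      using e P p(1)[of n] a by (intro form_bounds_perturb(2)[OF fb W]) auto
    also have "\<dots> \<le> real P * real P * ?d" using e P by (intro pp) auto
    also have "\<dots> = e / 2" using P P0 by simp
    finally show "opnorm (?W n \<omega> - ?V n) < e" using e by simp
  qed
  have 3: "wpa1 Pr (\<lambda>n \<omega>. eigenvalues_in (?W n \<omega>) {lo / 2..hi + lo / 2} \<and> eigenvalues_in (?V n) {lo / 2..hi + lo / 2})"
  proof (rule main[OF \<delta>(1)], intro conjI)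
    fix n \<omega>
    have "eigenvalues_in (?V n) {lo..hi}" by (rule form_bounds_eigenvalues[OF fb])
    then show "eigenvalues_in (?V n) {lo / 2..hi + lo / 2}" using lo by (force simp: eigenvalues_in_def)
  qed (rule form_bounds_eigenvalues[OF fbW])
  show ?thesis unfolding cond_A6_def Let_def
    using 1 2 3 lo by (intro conjI allI impI exI[of _ "lo / 2"] exI[of _ "hi + lo / 2"]) auto
qed

section \<open>Gaussian integrals\<close>

interpretation lb: product_sigma_finite "\<lambda>_ :: nat. lborel :: real measure"
  by (simp add: product_sigma_finite_def sigma_finite_lborel)

lemma nn_integral_gauss1:
  assumes a: "0 < a"
  shows "(\<integral>\<^sup>+ t. ennreal (exp (- (a * (t - m)\<^sup>2 / 2))) \<partial>lborel) = ennreal (sqrt (2 * pi / a))"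
proof -
  define \<sigma> where "\<sigma> = 1 / sqrt a"
  have s: "\<sigma>\<^sup>2 = 1 / a" "0 < \<sigma>" using a by (auto simp: \<sigma>_def power_divide)
  have eq: "exp (- (a * (t - m)\<^sup>2 / 2)) = sqrt (2 * pi / a) * normal_density m \<sigma> t" for t
    unfolding normal_density_def s(1) using a by (simp add: mult.commute)
  have "(\<integral>\<^sup>+ t. ennreal (exp (- (a * (t - m)\<^sup>2 / 2))) \<partial>lborel) = ennreal (\<integral>t. sqrt (2 * pi / a) * normal_density m \<sigma> t \<partial>lborel)"
    unfolding eq using s a by (intro nn_integral_eq_integral integrable_mult_right integrable_normal_density always_eventually allI) auto
  also have "\<dots> = ennreal (sqrt (2 * pi / a))" using s(2) by simp
  finally show ?thesis .
qed

definition qform :: "(nat \<Rightarrow> nat \<Rightarrow> real) \<Rightarrow> nat \<Rightarrow> (nat \<Rightarrow> real) \<Rightarrow> real" where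
  "qform f k x = (\<Sum>i<k. \<Sum>j<k. f i j * x i * x j)"

text \<open>Completing the square in the last variable leaves the Schur complement as the form of the others.\<close>
lemma qform_complete_square:
  assumes sym: "\<And>i j. f i j = f j i" and a: "f k k \<noteq> 0"
  shows "qform f (Suc k) x = qform (\<lambda>i j. f i j - f i k * f j k / f k k) k x
     + f k k * (x k + (\<Sum>i<k. f i k * x i) / f k k)\<^sup>2"
proof -
  define L where "L = (\<Sum>i<k. f i k * x i)"
  have 1: "qform f (Suc k) x = qform f k x + 2 * x k * L + f k k * (x k)\<^sup>2"
  proof -
    have "qform f (Suc k) x = (qform f k x + (\<Sum>i<k. f i k * x i * x k)) + ((\<Sum>j<k. f k j * x k * x j) + f k k * x k * x k)"
      unfolding qform_def by (simp add: sum.distrib)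
    moreover have "(\<Sum>i<k. f i k * x i * x k) = L * x k" by (simp add: L_def sum_distrib_right)
    moreover have "(\<Sum>j<k. f k j * x k * x j) = (\<Sum>j<k. (f j k * x j) * x k)"
      by (intro sum.cong refl) (subst sym, simp add: mult_ac)
    moreover have "\<dots> = L * x k" by (simp add: L_def sum_distrib_right)
    ultimately show ?thesis by (simp add: power2_eq_square)
  qed
  have 2: "qform (\<lambda>i j. f i j - f i k * f j k / f k k) k x = qform f k x - L\<^sup>2 / f k k"
  proof -
    have "qform (\<lambda>i j. f i j - f i k * f j k / f k k) k x
       = (\<Sum>i<k. \<Sum>j<k. f i j * x i * x j - (f i k * x i) * (f j k * x j) / f k k)"
      unfolding qform_def by (intro sum.cong refl) (simp add: algebra_simps)
    also have "\<dots> = qform f k x - (\<Sum>i<k. \<Sum>j<k. (f i k * x i) * (f j k * x j)) / f k k"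
      by (simp add: qform_def sum_subtractf sum_divide_distrib)
    also have "(\<Sum>i<k. \<Sum>j<k. (f i k * x i) * (f j k * x j)) = L\<^sup>2" by (simp add: L_def power2_eq_square sum_product)
    finally show ?thesis .
  qed
  show ?thesis unfolding 1 2 L_def[symmetric] using a by (simp add: power2_eq_square field_simps)
qed

text \<open>The matrix is the product of a block upper and a block lower triangular matrix with the Schur
  complement and the last diagonal entry on the diagonal of the first.\<close>
lemma det_Schur_last:
  fixes f :: "nat \<Rightarrow> nat \<Rightarrow> real"
  assumes sym: "\<And>i j. f i j = f j i" and a: "f k k \<noteq> 0"
  shows "det (mat (Suc k) (Suc k) (\<lambda>(i, j). f i j)) = f k k * det (mat k k (\<lambda>(i, j). f i j - f i k * f j k / f k k))"
proof -
  let ?S = "mat k k (\<lambda>(i, j). f i j - f i k * f j k / f k k)"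
  let ?C = "mat k 1 (\<lambda>(i, _). f i k)" and ?R = "mat 1 k (\<lambda>(_, j). f j k / f k k)" and ?a = "mat 1 1 (\<lambda>_. f k k)"
  let ?U = "four_block_mat ?S ?C (0\<^sub>m 1 k) ?a" and ?L = "four_block_mat (1\<^sub>m k) (0\<^sub>m k 1) ?R (1\<^sub>m 1)"
  have "?U * ?L = four_block_mat (?S * 1\<^sub>m k + ?C * ?R) (?S * 0\<^sub>m k 1 + ?C * 1\<^sub>m 1) (0\<^sub>m 1 k * 1\<^sub>m k + ?a * ?R) (0\<^sub>m 1 k * 0\<^sub>m k 1 + ?a * 1\<^sub>m 1)"
    by (intro mult_four_block_mat) auto
  also have "\<dots> = mat (Suc k) (Suc k) (\<lambda>(i, j). f i j)"
  proof (rule eq_matI)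
    fix i j assume "i < dim_row (mat (Suc k) (Suc k) (\<lambda>(i, j). f i j))" "j < dim_col (mat (Suc k) (Suc k) (\<lambda>(i, j). f i j))"
    then have ij: "i < Suc k" "j < Suc k" by auto
    then show "four_block_mat (?S * 1\<^sub>m k + ?C * ?R) (?S * 0\<^sub>m k 1 + ?C * 1\<^sub>m 1) (0\<^sub>m 1 k * 1\<^sub>m k + ?a * ?R) (0\<^sub>m 1 k * 0\<^sub>m k 1 + ?a * 1\<^sub>m 1) $$ (i, j) =
       mat (Suc k) (Suc k) (\<lambda>(i, j). f i j) $$ (i, j)"
      using a sym[of k j] by (cases "i < k"; cases "j < k") (auto simp: scalar_prod_def less_Suc_eq)
  qed auto
  finally have UL: "?U * ?L = mat (Suc k) (Suc k) (\<lambda>(i, j). f i j)" .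
  have "det (mat (Suc k) (Suc k) (\<lambda>(i, j). f i j)) = det ?U * det ?L"
  proof -
    have "?U \<in> carrier_mat (k + 1) (k + 1)" "?L \<in> carrier_mat (k + 1) (k + 1)"
      by (auto intro!: four_block_carrier_mat)
    from det_mult[OF this] show ?thesis using UL by simp
  qed
  moreover have "det ?U = det ?S * det ?a" by (intro det_four_block_mat_lower_left_zero[of _ k _ 1]) auto
  moreover have "det ?L = det (1\<^sub>m k) * det (1\<^sub>m 1 :: real mat)" by (intro det_four_block_mat_upper_right_zero[of _ k _ 1]) auto
  moreover have "det ?a = f k k" using det_single[of "?a"] by simp
  ultimately show ?thesis by simp
qed

lemma qform_measurable [measurable]:
  "(\<lambda>x. qform f k (\<lambda>i. x i - \<mu> i)) \<in> borel_measurable (Pi\<^sub>M {..<k} (\<lambda>_. lborel))"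
  unfolding qform_def by measurable

text \<open>Induction on the dimension.  The innermost integral is a one-dimensional Gaussian whose centre
  depends on the outer variables but whose value does not; what remains is the Gaussian integral of
  the Schur complement.  The determinants follow the same recursion.\<close>
lemma gauss_integral_qform:
  assumes "\<And>i j. f i j = f j i" "0 < lo" "\<And>x. lo * (\<Sum>i<k. (x i)\<^sup>2) \<le> qform f k x"
  shows "0 < det (mat k k (\<lambda>(i, j). f i j)) \<and>
    (\<integral>\<^sup>+ x. ennreal (exp (- (qform f k (\<lambda>i. x i - \<mu> i) / 2))) \<partial>Pi\<^sub>M {..<k} (\<lambda>_. lborel))
      = ennreal (sqrt ((2 * pi) ^ k / det (mat k k (\<lambda>(i, j). f i j))))"
  using assms
proof (induction k arbitrary: f)
  case 0
  show ?case by (simp add: qform_def PiM_empty)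
next
  case (Suc k)
  note sym = Suc.prems(1)
  let ?e = "\<lambda>i. if i = k then 1 else 0 :: real"
  have "(\<Sum>i<Suc k. (?e i)\<^sup>2) = 1" by simp
  moreover have "qform f (Suc k) ?e = f k k" by (simp add: qform_def)
  ultimately have a: "0 < f k k" using Suc.prems(3)[of ?e] Suc.prems(2) by simp
  define f2 where "f2 i j = f i j - f i k * f j k / f k k" for i j
  have cs: "qform f (Suc k) x = qform f2 k x + f k k * (x k + (\<Sum>i<k. f i k * x i) / f k k)\<^sup>2" for x
    using qform_complete_square[of f k x, OF sym] a by (simp add: f2_def[abs_def])
  have low: "lo * (\<Sum>i<k. (x i)\<^sup>2) \<le> qform f2 k x" for x
  proof -
    \<comment> \<open>The last coordinate that minimises the form, where the square added to the Schur complement vanishes.\<close>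
    define y where "y = x(k := - (\<Sum>i<k. f i k * x i) / f k k)"
    have yx: "y i = x i" if "i < k" for i using that by (simp add: y_def)
    have "(\<Sum>i<k. f i k * y i) = (\<Sum>i<k. f i k * x i)" using yx by simp
    then have "y k + (\<Sum>i<k. f i k * y i) / f k k = 0" by (simp add: y_def)
    then have "qform f (Suc k) y = qform f2 k y" unfolding cs by simp
    also have "\<dots> = qform f2 k x" using yx by (simp add: qform_def)
    finally have "lo * (\<Sum>i<Suc k. (y i)\<^sup>2) \<le> qform f2 k x" using Suc.prems(3)[of y] by simp
    moreover have "(\<Sum>i<Suc k. (y i)\<^sup>2) = (\<Sum>i<k. (x i)\<^sup>2) + (y k)\<^sup>2" using yx by simp
    moreover have "lo * (\<Sum>i<k. (x i)\<^sup>2) \<le> lo * ((\<Sum>i<k. (x i)\<^sup>2) + (y k)\<^sup>2)"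
      using Suc.prems(2) by (intro mult_left_mono) auto
    ultimately show ?thesis by simp
  qed
  have "f2 i j = f2 j i" for i j by (simp add: f2_def sym[of i j] mult.commute)
  from Suc.IH[of f2, OF this Suc.prems(2) low]
  have IH: "0 < det (mat k k (\<lambda>(i, j). f2 i j))"
    "(\<integral>\<^sup>+ x. ennreal (exp (- (qform f2 k (\<lambda>i. x i - \<mu> i) / 2))) \<partial>Pi\<^sub>M {..<k} (\<lambda>_. lborel))
      = ennreal (sqrt ((2 * pi) ^ k / det (mat k k (\<lambda>(i, j). f2 i j))))" by auto
  have d: "det (mat (Suc k) (Suc k) (\<lambda>(i, j). f i j)) = f k k * det (mat k k (\<lambda>(i, j). f2 i j))"
    using det_Schur_last[of f k, OF sym] a by (simp add: f2_def)
  have split: "exp (- (qform f (Suc k) (\<lambda>i. (x(k := y)) i - \<mu> i) / 2)) =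
      exp (- (qform f2 k (\<lambda>i. x i - \<mu> i) / 2)) * exp (- (f k k * (y - (\<mu> k - (\<Sum>i<k. f i k * (x i - \<mu> i)) / f k k))\<^sup>2 / 2))" for x y
  proof -
    have "qform f (Suc k) (\<lambda>i. (x(k := y)) i - \<mu> i) = qform f2 k (\<lambda>i. x i - \<mu> i) + f k k * (y - (\<mu> k - (\<Sum>i<k. f i k * (x i - \<mu> i)) / f k k))\<^sup>2"
      unfolding cs by (simp add: qform_def algebra_simps)
    then show ?thesis by (simp add: exp_add[symmetric] add_divide_distrib)
  qed
  have "(\<integral>\<^sup>+ x. ennreal (exp (- (qform f (Suc k) (\<lambda>i. x i - \<mu> i) / 2))) \<partial>Pi\<^sub>M {..<Suc k} (\<lambda>_. lborel)) =
    (\<integral>\<^sup>+ x. (\<integral>\<^sup>+ y. ennreal (exp (- (qform f (Suc k) (\<lambda>i. (x(k := y)) i - \<mu> i) / 2))) \<partial>lborel) \<partial>Pi\<^sub>M {..<k} (\<lambda>_. lborel))"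
    unfolding lessThan_Suc
    by (rule lb.product_nn_integral_insert) (auto simp: lessThan_Suc[symmetric])
  also have "\<dots> = (\<integral>\<^sup>+ x. ennreal (exp (- (qform f2 k (\<lambda>i. x i - \<mu> i) / 2))) * ennreal (sqrt (2 * pi / f k k)) \<partial>Pi\<^sub>M {..<k} (\<lambda>_. lborel))"
  proof (intro nn_integral_cong)
    fix x :: "nat \<Rightarrow> real"
    have "(\<integral>\<^sup>+ y. ennreal (exp (- (qform f (Suc k) (\<lambda>i. (x(k := y)) i - \<mu> i) / 2))) \<partial>lborel) =
      (\<integral>\<^sup>+ y. ennreal (exp (- (qform f2 k (\<lambda>i. x i - \<mu> i) / 2))) *
        ennreal (exp (- (f k k * (y - (\<mu> k - (\<Sum>i<k. f i k * (x i - \<mu> i)) / f k k))\<^sup>2 / 2))) \<partial>lborel)"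
      unfolding split by (simp add: ennreal_mult)
    also have "\<dots> = ennreal (exp (- (qform f2 k (\<lambda>i. x i - \<mu> i) / 2))) * ennreal (sqrt (2 * pi / f k k))"
      by (subst nn_integral_cmult) (auto simp: nn_integral_gauss1[OF a])
    finally show "(\<integral>\<^sup>+ y. ennreal (exp (- (qform f (Suc k) (\<lambda>i. (x(k := y)) i - \<mu> i) / 2))) \<partial>lborel) =
      ennreal (exp (- (qform f2 k (\<lambda>i. x i - \<mu> i) / 2))) * ennreal (sqrt (2 * pi / f k k))" .
  qed
  also have "\<dots> = ennreal (sqrt ((2 * pi) ^ k / det (mat k k (\<lambda>(i, j). f2 i j)))) * ennreal (sqrt (2 * pi / f k k))"
    by (subst nn_integral_multc) (auto simp: IH(2))
  also have "\<dots> = ennreal (sqrt ((2 * pi) ^ Suc k / det (mat (Suc k) (Suc k) (\<lambda>(i, j). f i j))))"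
    unfolding d using IH(1) a by (simp add: ennreal_mult[symmetric] real_sqrt_mult[symmetric] mult_ac)
  finally show ?case using d IH(1) a by simp
qed

section \<open>Lebesgue measure on the coordinates of a model\<close>

definition extend0 :: "nat set \<Rightarrow> (nat \<Rightarrow> real) \<Rightarrow> nat \<Rightarrow> real" where
  "extend0 M x = (\<lambda>k. if k \<in> M then x k else 0)"

lemma extend0_measurable [measurable]: "extend0 M \<in> borel_measurable (Pi\<^sub>M M (\<lambda>_. lborel))"
proof (rule measurable_coordinatewise_then_product)
  fix i show "(\<lambda>x. extend0 M x i) \<in> borel_measurable (Pi\<^sub>M M (\<lambda>_. lborel))"
    by (cases "i \<in> M") (auto simp: extend0_def)
qed

lemma leb_model_eq: "leb_model M = distr (Pi\<^sub>M M (\<lambda>_. lborel)) borel (extend0 M)"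
  by (simp add: leb_model_def extend0_def[abs_def])

lemma sets_leb_model [simp, measurable_cong]: "sets (leb_model M) = sets borel"
  and space_leb_model [simp]: "space (leb_model M) = UNIV"
  by (simp_all add: leb_model_def)

lemma nn_integral_leb_model:
  "f \<in> borel_measurable borel \<Longrightarrow> (\<integral>\<^sup>+ \<theta>. f \<theta> \<partial>leb_model M) = (\<integral>\<^sup>+ x. f (extend0 M x) \<partial>Pi\<^sub>M M (\<lambda>_. lborel))"
  unfolding leb_model_eq by (rule nn_integral_distr) auto

lemma AE_leb_model: "AE \<theta> in leb_model M. \<forall>k. k \<notin> M \<longrightarrow> \<theta> k = 0"
proof -
  have m: "{\<theta> :: nat \<Rightarrow> real. \<forall>k. k \<notin> M \<longrightarrow> \<theta> k = 0} \<in> sets borel"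
  proof -
    have "{\<theta> :: nat \<Rightarrow> real. \<forall>k. k \<notin> M \<longrightarrow> \<theta> k = 0} = (\<Inter>k\<in>- M. {\<theta>. \<theta> k = 0})" by auto
    moreover have "closed (\<Inter>k\<in>- M. {\<theta> :: nat \<Rightarrow> real. \<theta> k = 0})"
      by (intro closed_INT ballI closed_Collect_eq continuous_on_subset[OF continuous_on_product_coordinates] continuous_on_const) auto
    ultimately show ?thesis by auto
  qed
  show ?thesis unfolding leb_model_eq
    using m by (subst AE_distr_iff) (auto simp: extend0_def)
qed

lemma gauss_leb_model:
  assumes M: "finite M" and c: "0 < c"
  shows "(\<integral>\<^sup>+ \<theta>. ennreal (exp (- (c * (\<Sum>k\<in>M. (\<theta> k - a k)\<^sup>2)))) \<partial>leb_model M) = ennreal (sqrt (pi / c) ^ card M)"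
proof -
  have "(\<integral>\<^sup>+ \<theta>. ennreal (exp (- (c * (\<Sum>k\<in>M. (\<theta> k - a k)\<^sup>2)))) \<partial>leb_model M)
    = (\<integral>\<^sup>+ x. (\<Prod>k\<in>M. ennreal (exp (- (2 * c * (x k - a k)\<^sup>2 / 2)))) \<partial>Pi\<^sub>M M (\<lambda>_. lborel))"
  proof (subst nn_integral_leb_model)
    show "(\<lambda>\<theta>. ennreal (exp (- (c * (\<Sum>k\<in>M. (\<theta> k - a k)\<^sup>2))))) \<in> borel_measurable borel"
      by (intro measurable_compose[OF _ measurable_ennreal] borel_measurable_continuous_onI continuous_intros
        continuous_on_subset[OF continuous_on_product_coordinates]) auto
    have "exp (- (c * (\<Sum>k\<in>M. (extend0 M x k - a k)\<^sup>2))) = (\<Prod>k\<in>M. exp (- (2 * c * (x k - a k)\<^sup>2 / 2)))" for x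
      by (subst exp_sum[OF M, symmetric]) (simp add: sum_distrib_left sum_negf extend0_def)
    then show "(\<integral>\<^sup>+ x. ennreal (exp (- (c * (\<Sum>k\<in>M. (extend0 M x k - a k)\<^sup>2)))) \<partial>Pi\<^sub>M M (\<lambda>_. lborel)) =
      (\<integral>\<^sup>+ x. (\<Prod>k\<in>M. ennreal (exp (- (2 * c * (x k - a k)\<^sup>2 / 2)))) \<partial>Pi\<^sub>M M (\<lambda>_. lborel))"
      by (simp add: prod_ennreal)
  qed
  also have "\<dots> = (\<Prod>k\<in>M. \<integral>\<^sup>+ t. ennreal (exp (- (2 * c * (t - a k)\<^sup>2 / 2))) \<partial>lborel)"
    by (rule lb.product_nn_integral_prod[OF M]) simp
  also have "\<dots> = (\<Prod>k\<in>M. ennreal (sqrt (2 * pi / (2 * c))))"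
    using c by (intro prod.cong refl nn_integral_gauss1) simp
  also have "\<dots> = ennreal (sqrt (pi / c) ^ card M)" using c by (simp add: ennreal_power)
  finally show ?thesis .
qed

lemma pick_bij: assumes M: "finite M" shows "bij_betw (pick M) {..<card M} M"
proof -
  have sub: "M \<subseteq> pick M ` {..<card M}"
  proof
    fix i assume i: "i \<in> M"
    then have "card {a\<in>M. a < i} < card M" using M by (intro psubset_card_mono) auto
    then show "i \<in> pick M ` {..<card M}" using pick_card_in_set[OF i] by force
  qed
  have "card (pick M ` {..<card M}) \<le> card M" using card_image_le[of "{..<card M}" "pick M"] by simp
  then have eq: "M = pick M ` {..<card M}" using card_seteq[OF _ sub] by blast
  then have "inj_on (pick M) {..<card M}" by (intro eq_card_imp_inj_on) auto
  then show ?thesis using eq by (simp add: bij_betw_def)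
qed

text \<open>Densities are written in terms of subvectors indexed by 0, ..., card M - 1, the model measure in
  terms of coordinates in M; renumbering the coordinates preserves Lebesgue measure.\<close>
lemma distr_PiM_reindex_lborel:
  fixes M :: "nat set" and k :: nat
  assumes M: "finite M" and h: "bij_betw h {..<k} M"
  shows "distr (Pi\<^sub>M M (\<lambda>_. lborel)) (Pi\<^sub>M {..<k} (\<lambda>_. lborel)) (\<lambda>x. \<lambda>i\<in>{..<k}. x (h i)) = Pi\<^sub>M {..<k} (\<lambda>_. lborel :: real measure)"
proof (rule lb.PiM_eqI)
  fix A :: "nat \<Rightarrow> real set" assume A: "\<And>i. i \<in> {..<k} \<Longrightarrow> A i \<in> sets lborel"
  have hM: "h i \<in> M" if "i < k" for i using h that by (auto simp: bij_betw_def)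
  define g where "g = inv_into {..<k} h"
  have g: "g m < k" "h (g m) = m" if "m \<in> M" for m
    using that h unfolding g_def bij_betw_def by (auto intro: f_inv_into_f inv_into_into[of _ h "{..<k}", simplified])
  have gh: "g (h i) = i" if "i < k" for i using that h by (auto simp: g_def bij_betw_def)
  have mm: "(\<lambda>x. \<lambda>i\<in>{..<k}. x (h i)) \<in> measurable (Pi\<^sub>M M (\<lambda>_. lborel)) (Pi\<^sub>M {..<k} (\<lambda>_. lborel :: real measure))"
    using hM by (intro measurable_restrict measurable_component_singleton) auto
  have "(\<lambda>x. \<lambda>i\<in>{..<k}. x (h i)) -` Pi\<^sub>E {..<k} A \<inter> space (Pi\<^sub>M M (\<lambda>_. lborel)) = Pi\<^sub>E M (\<lambda>m. A (g m))"
  proof (rule Set.set_eqI)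
    fix x :: "nat \<Rightarrow> real"
    have "(\<forall>i<k. x (h i) \<in> A i) \<longleftrightarrow> (\<forall>m\<in>M. x m \<in> A (g m))"
      using g gh hM by metis
    then show "x \<in> (\<lambda>x. \<lambda>i\<in>{..<k}. x (h i)) -` Pi\<^sub>E {..<k} A \<inter> space (Pi\<^sub>M M (\<lambda>_. lborel)) \<longleftrightarrow> x \<in> Pi\<^sub>E M (\<lambda>m. A (g m))"
      by (auto simp: space_PiM PiE_iff)
  qed
  then have "emeasure (distr (Pi\<^sub>M M (\<lambda>_. lborel)) (Pi\<^sub>M {..<k} (\<lambda>_. lborel)) (\<lambda>x. \<lambda>i\<in>{..<k}. x (h i))) (Pi\<^sub>E {..<k} A)
     = emeasure (Pi\<^sub>M M (\<lambda>_. lborel)) (Pi\<^sub>E M (\<lambda>m. A (g m)))"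
    using A by (subst emeasure_distr[OF mm]) (auto intro!: sets_PiM_I_finite)
  also have "\<dots> = (\<Prod>m\<in>M. emeasure lborel (A (g m)))"
    using A g M by (intro lb.emeasure_PiM) auto
  also have "\<dots> = (\<Prod>i<k. emeasure lborel (A i))"
    using gh by (subst prod.reindex_bij_betw[OF h, symmetric]) (auto intro!: prod.cong)
  finally show "emeasure (distr (Pi\<^sub>M M (\<lambda>_. lborel)) (Pi\<^sub>M {..<k} (\<lambda>_. lborel)) (\<lambda>x. \<lambda>i\<in>{..<k}. x (h i))) (Pi\<^sub>E {..<k} A)
     = (\<Prod>i<k. emeasure lborel (A i))" .
qed auto

lemma subvec_dim [simp]: "subvec M \<theta> \<in> carrier_vec (card M)" "dim_vec (subvec M \<theta>) = card M"
  by (simp_all add: subvec_def)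

lemma vec_form_eq_qform:
  assumes A: "A \<in> carrier_mat k k"
  shows "vec k x \<bullet> (A *\<^sub>v vec k x) = qform (\<lambda>i j. A $$ (i, j)) k x"
proof -
  have "vec k x \<bullet> (A *\<^sub>v vec k x) = (\<Sum>i<k. x i * (\<Sum>j<k. A $$ (i, j) * x j))"
    unfolding scalar_prod_def lessThan_atLeast0 using A
    by (intro sum.cong) (auto simp: scalar_prod_def intro!: sum.cong)
  then show ?thesis by (simp add: qform_def sum_distrib_left mult_ac)
qed

text \<open>
  The normal law with covariance minv A / n.  Its density has the exponent - n / 2 times the form of
  A, so the Gaussian integral applies to the matrix n A.
\<close>
lemma mvn_density_props:
  assumes fb: "form_bounds (card M) A lo hi" and lo: "0 < lo" and M: "finite M"
    and \<mu>: "\<mu> \<in> carrier_vec (card M)" and n: "0 < n"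
  defines "S \<equiv> (1 / n) \<cdot>\<^sub>m minv A"
  defines "C \<equiv> sqrt (n ^ card M * det A / (2 * pi) ^ card M)"
  shows "\<And>x. x \<in> carrier_vec (card M) \<Longrightarrow> mvn_density \<mu> S x = C * exp (- (n * ((x - \<mu>) \<bullet> (A *\<^sub>v (x - \<mu>))) / 2))"
    and "(\<lambda>\<theta>. mvn_density \<mu> S (subvec M \<theta>)) \<in> borel_measurable borel"
    and "(\<integral>\<^sup>+ \<theta>. ennreal (mvn_density \<mu> S (subvec M \<theta>)) \<partial>leb_model M) = 1"
    and "0 < C"
proof -
  let ?k = "card M"
  note A = form_boundsD(1,2)[OF fb]
  note inv = form_bounds_minv[OF fb fb lo]
  define B where "B = n \<cdot>\<^sub>m A"
  have B: "B \<in> carrier_mat ?k ?k" using A by (simp add: B_def)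
  have S: "S \<in> carrier_mat ?k ?k" using inv by (simp add: S_def)
  have BS: "S * B = 1\<^sub>m ?k"
  proof -
    have "S * B = n \<cdot>\<^sub>m ((1 / n) \<cdot>\<^sub>m (minv A * A))"
      unfolding S_def B_def using inv A n
      by (simp add: mult_smult_distrib[of _ ?k ?k] mult_smult_assoc_mat[of _ ?k ?k])
    also have "\<dots> = 1\<^sub>m ?k" unfolding inv(3) using n by (intro eq_matI) auto
    finally show ?thesis .
  qed
  have minvS: "minv S = B" by (rule minv_eqI[OF S B BS])
  define f where "f i j = (if i < ?k \<and> j < ?k then B $$ (i, j) else 0)" for i j
  have fsym: "f i j = f j i" for i j
  proof -
    have "A $$ (i, j) = A $$ (j, i)" if "i < ?k" "j < ?k"
      using arg_cong[OF A(2), of "\<lambda>X. X $$ (j, i)"] A(1) that by simp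
    then show ?thesis using A(1) by (auto simp: f_def B_def)
  qed
  have qB: "vec ?k x \<bullet> (B *\<^sub>v vec ?k x) = qform f ?k x" for x
    unfolding vec_form_eq_qform[OF B] by (simp add: qform_def f_def)
  have qA: "v \<bullet> (B *\<^sub>v v) = n * (v \<bullet> (A *\<^sub>v v))" if "v \<in> carrier_vec ?k" for v
  proof -
    have "B *\<^sub>v v = n \<cdot>\<^sub>v (A *\<^sub>v v)" using that A by (intro eq_vecI) (auto simp: B_def)
    then show ?thesis using that A by simp
  qed
  have flow: "n * lo * (\<Sum>i<?k. (x i)\<^sup>2) \<le> qform f ?k x" for x
  proof -
    have "lo * (vec ?k x \<bullet> vec ?k x) \<le> vec ?k x \<bullet> (A *\<^sub>v vec ?k x)" by (rule form_boundsD(3)[OF fb]) simp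
    moreover have "vec ?k x \<bullet> vec ?k x = (\<Sum>i<?k. (x i)\<^sup>2)" by (simp add: scalar_prod_def lessThan_atLeast0 power2_eq_square)
    ultimately show ?thesis unfolding qB[symmetric] using n by (simp add: qA mult.assoc)
  qed
  have matf: "mat ?k ?k (\<lambda>(i, j). f i j) = B" using B by (intro eq_matI) (auto simp: f_def)
  have "0 < n * lo" using n lo by simp
  note gi = gauss_integral_qform[of f "n * lo" ?k, OF fsym this flow, unfolded matf]
  have dB: "det B = n ^ ?k * det A" using A by (simp add: B_def)
  have detB: "0 < det B" using gi by blast
  have detS: "det S = 1 / det B"
  proof -
    have "det S * det B = 1" using det_mult[OF S B] BS by simp
    then show ?thesis using detB by (simp add: field_simps)
  qed
  have C: "C = sqrt (det B / (2 * pi) ^ ?k)" by (simp add: C_def dB)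
  show C0: "0 < C" unfolding C using detB by simp
  have pw: "det ((2 * pi) \<cdot>\<^sub>m S) powr (- 1 / 2) = C"
  proof -
    have 1: "det ((2 * pi) \<cdot>\<^sub>m S) = inverse (det B / (2 * pi) ^ ?k)" using S detS by (simp add: field_simps)
    have 2: "inverse y powr (- 1 / 2) = sqrt y" if "0 < y" for y :: real
      using that by (simp add: powr_minus powr_half_sqrt[symmetric] powr_divide inverse_eq_divide)
    show ?thesis unfolding C 1 by (rule 2) (simp add: detB)
  qed
  show eq: "mvn_density \<mu> S x = C * exp (- (n * ((x - \<mu>) \<bullet> (A *\<^sub>v (x - \<mu>))) / 2))" if x: "x \<in> carrier_vec ?k" for x
    unfolding mvn_density_def minvS pw using x \<mu> by (simp add: qA)
  define m where "m i = \<mu> $ i" for i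
  have eq2: "mvn_density \<mu> S (vec ?k y) = C * exp (- (qform f ?k (\<lambda>i. y i - m i) / 2))" for y
  proof -
    have "vec ?k y - \<mu> = vec ?k (\<lambda>i. y i - m i)" using \<mu> by (intro eq_vecI) (auto simp: m_def)
    then show ?thesis using eq[of "vec ?k y"] by (simp add: qA[symmetric] qB)
  qed
  have eq3: "mvn_density \<mu> S (subvec M \<theta>) = C * exp (- (qform f ?k (\<lambda>i. \<theta> (pick M i) - m i) / 2))" for \<theta>
    unfolding subvec_def by (rule eq2)
  show meas: "(\<lambda>\<theta>. mvn_density \<mu> S (subvec M \<theta>)) \<in> borel_measurable borel"
    unfolding eq3 qform_def
    by (intro borel_measurable_continuous_onI continuous_intros continuous_on_subset[OF continuous_on_product_coordinates]) auto
  have pk: "pick M i \<in> M" if "i < ?k" for i using pick_bij[OF M] that by (auto simp: bij_betw_def)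
  have "(\<integral>\<^sup>+ \<theta>. ennreal (mvn_density \<mu> S (subvec M \<theta>)) \<partial>leb_model M)
     = (\<integral>\<^sup>+ x. ennreal (mvn_density \<mu> S (subvec M (extend0 M x))) \<partial>Pi\<^sub>M M (\<lambda>_. lborel))"
    using meas by (intro nn_integral_leb_model) simp
  also have "\<dots> = (\<integral>\<^sup>+ x. ennreal (C * exp (- (qform f ?k (\<lambda>i. (\<lambda>i\<in>{..<?k}. x (pick M i)) i - m i) / 2))) \<partial>Pi\<^sub>M M (\<lambda>_. lborel))"
    unfolding eq3 qform_def using pk by (intro nn_integral_cong) (simp add: extend0_def)
  also have "\<dots> = (\<integral>\<^sup>+ y. ennreal (C * exp (- (qform f ?k (\<lambda>i. y i - m i) / 2)))
      \<partial>distr (Pi\<^sub>M M (\<lambda>_. lborel)) (Pi\<^sub>M {..<?k} (\<lambda>_. lborel)) (\<lambda>x. \<lambda>i\<in>{..<?k}. x (pick M i)))"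
    using pk by (intro nn_integral_distr[symmetric] measurable_restrict measurable_component_singleton) auto
  also have "\<dots> = (\<integral>\<^sup>+ y. ennreal C * ennreal (exp (- (qform f ?k (\<lambda>i. y i - m i) / 2))) \<partial>Pi\<^sub>M {..<?k} (\<lambda>_. lborel))"
    unfolding distr_PiM_reindex_lborel[OF M pick_bij[OF M]] using C0 by (simp add: ennreal_mult)
  also have "\<dots> = ennreal C * ennreal (sqrt ((2 * pi) ^ ?k / det B))"
    using gi[of m] by (subst nn_integral_cmult) auto
  also have "\<dots> = 1"
    unfolding C using detB by (simp add: ennreal_mult[symmetric] real_sqrt_mult[symmetric])
  finally show "(\<integral>\<^sup>+ \<theta>. ennreal (mvn_density \<mu> S (subvec M \<theta>)) \<partial>leb_model M) = 1" .
qed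

section \<open>The quasi-likelihood for a given sample\<close>

text \<open>A fixed sample: b is the mean of the moments at \<theta>0, b + f \<theta> their mean at \<theta>, and V the realised
  weight matrix.  G is the Jacobian of f at \<theta>0.  All bounds derived below depend only on p and the
  numbers lo, hi, L, Kq, T, which makes them uniform over samples.\<close>
locale quasi_post =
  fixes n p :: nat and Par :: "(nat \<Rightarrow> real) set" and \<theta>0 :: "nat \<Rightarrow> real" and f :: "(nat \<Rightarrow> real) \<Rightarrow> real vec"
    and G V :: "real mat" and b :: "real vec" and lo hi L Kq T :: real
  assumes n: "0 < n" and Par: "Par \<subseteq> par_space p" "Par \<in> sets borel" and th0: "\<theta>0 \<in> Par"
    and V: "form_bounds p V lo hi" and lo: "0 < lo" and hi: "0 < hi" and L: "0 < L" and Kq: "0 \<le> Kq" and T: "0 \<le> T"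
    and f: "\<And>\<theta>. f \<theta> \<in> carrier_vec p" "\<And>\<theta>. \<theta> \<in> Par \<Longrightarrow> par_dist p \<theta> \<theta>0 \<le> L * vnorm (f \<theta>)"
    and fcont: "\<And>k. k < p \<Longrightarrow> continuous_on Par (\<lambda>\<theta>. f \<theta> $ k)"
    and G: "G \<in> carrier_mat p p" "\<And>v. v \<in> carrier_vec p \<Longrightarrow> vnorm v \<le> L * vnorm (G *\<^sub>v v)"
       "\<And>v. v \<in> carrier_vec p \<Longrightarrow> vnorm (G *\<^sub>v v) \<le> L * vnorm v"
    and quad: "\<And>\<theta>. \<theta> \<in> Par \<Longrightarrow> vnorm (f \<theta> - G *\<^sub>v (vec p \<theta> - vec p \<theta>0)) \<le> Kq * (par_dist p \<theta> \<theta>0)\<^sup>2"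
    and b: "b \<in> carrier_vec p" "vnorm b \<le> T / sqrt (real n)"
begin

definition Q where "Q x = x \<bullet> (minv V *\<^sub>v x)"
text \<open>The likelihood decays like exp (- 2 c n d^2).  One half of the exponent yields smallness away from
  \<theta>0, the other half stays integrable.\<close>
definition c where "c = 1 / (8 * hi * L\<^sup>2)"
definition CT where "CT = exp (T\<^sup>2 / (2 * hi))"
text \<open>The negative log-likelihood, up to the constant normalisation, and its version with f linearised
  at \<theta>0.\<close>
definition q where "q \<theta> = real n / 2 * Q (b + f \<theta>)"
definition q0 where "q0 \<theta> = real n / 2 * Q (b + G *\<^sub>v (vec p \<theta> - vec p \<theta>0))"

lemma c: "0 < c" using hi L by (simp add: c_def)

lemmas W = form_bounds_inverse(1)[OF V lo hi]
lemmas Wc = form_boundsD(1)[OF W]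

lemma Q_bounds: "x \<in> carrier_vec p \<Longrightarrow> (vnorm x)\<^sup>2 / hi \<le> Q x" "x \<in> carrier_vec p \<Longrightarrow> Q x \<le> (vnorm x)\<^sup>2 / lo"
  using form_boundsD(3,4)[OF W] by (auto simp: Q_def vnorm_sq)

lemma b_sq: "real n * (vnorm b)\<^sup>2 \<le> T\<^sup>2"
proof -
  have "(vnorm b)\<^sup>2 \<le> (T / sqrt (real n))\<^sup>2" using b(2) by (intro power_mono) auto
  then show ?thesis using n by (simp add: power_divide field_simps)
qed

lemma Q_b: "real n / 2 * Q b \<le> T\<^sup>2 / (2 * lo)"
proof -
  have "real n / 2 * Q b \<le> real n / 2 * ((vnorm b)\<^sup>2 / lo)" by (intro mult_left_mono Q_bounds b) auto
  also have "\<dots> = real n * (vnorm b)\<^sup>2 / (2 * lo)" by simp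
  also have "\<dots> \<le> T\<^sup>2 / (2 * lo)" using b_sq lo by (intro divide_right_mono) auto
  finally show ?thesis .
qed

text \<open>Since 2 norm (b + w)^2 \<ge> norm w^2 - 2 norm b^2, the random offset b costs only the constant factor CT.\<close>
lemma exp_Q_le:
  assumes w: "w \<in> carrier_vec p" and r: "0 \<le> r" "r \<le> L * vnorm w"
  shows "exp (- (real n / 2 * Q (b + w))) \<le> CT * exp (- (2 * c * real n * r\<^sup>2))"
proof -
  have bw: "b + w \<in> carrier_vec p" using b w by simp
  have 1: "(vnorm w)\<^sup>2 / 2 - (vnorm b)\<^sup>2 \<le> (vnorm (b + w))\<^sup>2"
  proof (cases "vnorm b \<le> vnorm w")
    case True
    have "vnorm w - vnorm b \<le> vnorm (b + w)"
      using vnorm_diff_ge[of w b] b w by (simp add: comm_add_vec[of b p w])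
    then have "(vnorm w - vnorm b)\<^sup>2 \<le> (vnorm (b + w))\<^sup>2" using True by (intro power_mono) auto
    moreover have "(vnorm w)\<^sup>2 / 2 - (vnorm b)\<^sup>2 \<le> (vnorm w - vnorm b)\<^sup>2"
      using zero_le_power2[of "vnorm w - 2 * vnorm b"] by (simp add: power2_eq_square algebra_simps)
    ultimately show ?thesis by linarith
  next
    case False
    then have "(vnorm w)\<^sup>2 \<le> (vnorm b)\<^sup>2" by (intro power_mono) auto
    then show ?thesis using zero_le_power2[of "vnorm (b + w)"] zero_le_power2[of "vnorm w"] by linarith
  qed
  have "r\<^sup>2 \<le> (L * vnorm w)\<^sup>2" using r by (intro power_mono) auto
  then have 2: "r\<^sup>2 / L\<^sup>2 \<le> (vnorm w)\<^sup>2" using L by (simp add: power_mult_distrib field_simps)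
  have "2 * c * real n * r\<^sup>2 - T\<^sup>2 / (2 * hi) \<le> real n / 2 * ((r\<^sup>2 / L\<^sup>2 / 2 - (vnorm b)\<^sup>2) / hi)"
  proof -
    have "2 * c * real n * r\<^sup>2 = real n / 2 * (r\<^sup>2 / L\<^sup>2 / 2 / hi)" using hi L by (simp add: c_def)
    moreover have "real n / 2 * ((vnorm b)\<^sup>2 / hi) \<le> T\<^sup>2 / (2 * hi)" using b_sq hi by (simp add: field_simps)
    ultimately show ?thesis by (simp add: diff_divide_distrib right_diff_distrib)
  qed
  also have "\<dots> \<le> real n / 2 * ((vnorm (b + w))\<^sup>2 / hi)"
    using 1 2 hi by (intro mult_left_mono divide_right_mono) auto
  also have "\<dots> \<le> real n / 2 * Q (b + w)" by (intro mult_left_mono Q_bounds bw) auto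
  finally have "- (real n / 2 * Q (b + w)) \<le> T\<^sup>2 / (2 * hi) + - (2 * c * real n * r\<^sup>2)" by simp
  then show ?thesis unfolding CT_def exp_add[symmetric] by simp
qed

lemma exp_q_le: "\<theta> \<in> Par \<Longrightarrow> exp (- q \<theta>) \<le> CT * exp (- (2 * c * real n * (par_dist p \<theta> \<theta>0)\<^sup>2))"
  unfolding q_def using f by (intro exp_Q_le) auto

lemma exp_q0_le: "exp (- q0 \<theta>) \<le> CT * exp (- (2 * c * real n * (par_dist p \<theta> \<theta>0)\<^sup>2))"
  unfolding q0_def using G by (intro exp_Q_le) (auto simp: par_dist_def)

text \<open>Polarisation: Q x - Q y is the bilinear form of x - y and x + y.\<close>
lemma Q_diff:
  assumes x: "x \<in> carrier_vec p" and y: "y \<in> carrier_vec p"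
  shows "\<bar>Q x - Q y\<bar> \<le> vnorm (x - y) * (vnorm x + vnorm y) / lo"
proof -
  have Wx: "minv V *\<^sub>v x \<in> carrier_vec p" "minv V *\<^sub>v y \<in> carrier_vec p" using Wc x y by auto
  have "(x - y) \<bullet> (minv V *\<^sub>v (x + y)) = (x - y) \<bullet> (minv V *\<^sub>v x) + (x - y) \<bullet> (minv V *\<^sub>v y)"
    using x y Wx by (simp add: mult_add_distrib_mat_vec[OF Wc] scalar_prod_add_distrib[of _ p])
  also have "\<dots> = Q x - y \<bullet> (minv V *\<^sub>v x) + (x \<bullet> (minv V *\<^sub>v y) - Q y)"
    using x y Wx by (simp add: minus_scalar_prod_distrib[of x p y] Q_def)
  also have "x \<bullet> (minv V *\<^sub>v y) = y \<bullet> (minv V *\<^sub>v x)" by (rule sym_form_commute[OF Wc form_boundsD(2)[OF W] x y])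
  finally have "\<bar>Q x - Q y\<bar> = \<bar>(x - y) \<bullet> (minv V *\<^sub>v (x + y))\<bar>" by simp
  also have "\<dots> \<le> vnorm (x - y) * vnorm (minv V *\<^sub>v (x + y))" using x y Wc by (intro abs_sprod_le) auto
  also have "\<dots> \<le> vnorm (x - y) * ((vnorm x + vnorm y) / lo)"
  proof (intro mult_left_mono)
    have "vnorm (minv V *\<^sub>v (x + y)) \<le> vnorm (x + y) / lo" using x y by (intro form_bounds_inverse(2)[OF V lo hi]) auto
    also have "\<dots> \<le> (vnorm x + vnorm y) / lo" using vnorm_triangle[of x y] x y lo by (intro divide_right_mono) auto
    finally show "vnorm (minv V *\<^sub>v (x + y)) \<le> (vnorm x + vnorm y) / lo" .
  qed simp
  finally show ?thesis by simp
qed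

text \<open>Within distance R / sqrt n the linearisation error is O(1 / n), the vectors themselves are
  O(1 / sqrt n), and n times the product of the two bounds is O(1 / sqrt n).\<close>
lemma q_near:
  assumes th: "\<theta> \<in> Par" and r: "sqrt (real n) * par_dist p \<theta> \<theta>0 \<le> R" and R: "0 \<le> R"
  shows "\<bar>q \<theta> - q0 \<theta>\<bar> \<le> Kq * R\<^sup>2 * (2 * T + 2 * L * R + Kq * R\<^sup>2) / (2 * lo) / sqrt (real n)"
proof -
  define d where "d = par_dist p \<theta> \<theta>0"
  define sn where "sn = sqrt (real n)"
  have sn: "1 \<le> sn" "sn * sn = real n" using n by (auto simp: sn_def)
  have d: "0 \<le> d" "d \<le> R / sn" using r sn by (auto simp: d_def sn_def field_simps)
  let ?u = "G *\<^sub>v (vec p \<theta> - vec p \<theta>0)"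
  have u: "?u \<in> carrier_vec p" using G by simp
  have d2: "d\<^sup>2 \<le> R\<^sup>2 / real n"
  proof -
    have "d\<^sup>2 \<le> (R / sn)\<^sup>2" using d by (intro power_mono) auto
    then show ?thesis using sn by (simp add: power_divide power2_eq_square)
  qed
  have diff: "vnorm ((b + f \<theta>) - (b + ?u)) \<le> Kq * (R\<^sup>2 / real n)"
  proof -
    have "(b + f \<theta>) - (b + ?u) = f \<theta> - ?u"
      using b(1) f(1)[of \<theta>] G(1) by (intro eq_vecI) auto
    then show ?thesis using quad[OF th] mult_left_mono[OF d2 Kq] by (simp add: d_def)
  qed
  have vb: "vnorm b \<le> T / sn" using b by (simp add: sn_def)
  have vu: "vnorm ?u \<le> L * R / sn"
    using G(3)[of "vec p \<theta> - vec p \<theta>0"] mult_left_mono[OF d(2), of L] L by (simp add: d_def par_dist_def)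
  have vf: "vnorm (f \<theta>) \<le> L * R / sn + Kq * R\<^sup>2 / sn"
  proof -
    have "f \<theta> = ?u + (f \<theta> - ?u)" using f(1)[of \<theta>] G(1) by (intro eq_vecI) auto
    then have "vnorm (f \<theta>) \<le> vnorm ?u + vnorm (f \<theta> - ?u)" using vnorm_triangle[of ?u "f \<theta> - ?u"] u by simp
    moreover have "vnorm (f \<theta> - ?u) \<le> Kq * (R\<^sup>2 / real n)" using quad[OF th] mult_left_mono[OF d2 Kq] by (simp add: d_def)
    moreover have "Kq * (R\<^sup>2 / real n) \<le> Kq * (R\<^sup>2 / sn)"
      using Kq sn n mult_left_mono[of 1 sn sn] by (intro mult_left_mono divide_left_mono) (auto simp: sn(2)[symmetric])
    ultimately show ?thesis using vu by simp
  qed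
  have sum: "vnorm (b + f \<theta>) + vnorm (b + ?u) \<le> (2 * T + 2 * L * R + Kq * R\<^sup>2) / sn"
  proof -
    have "vnorm (b + f \<theta>) \<le> vnorm b + vnorm (f \<theta>)" by (rule vnorm_triangle) (use b(1) f(1)[of \<theta>] in auto)
    moreover have "vnorm (b + ?u) \<le> vnorm b + vnorm ?u" by (rule vnorm_triangle) (use b(1) G(1) in auto)
    ultimately have "vnorm (b + f \<theta>) + vnorm (b + ?u) \<le> 2 * (T / sn) + 2 * (L * R / sn) + Kq * R\<^sup>2 / sn"
      using vb vu vf by linarith
    then show ?thesis by (simp add: add_divide_distrib)
  qed
  have "\<bar>q \<theta> - q0 \<theta>\<bar> = real n / 2 * \<bar>Q (b + f \<theta>) - Q (b + ?u)\<bar>"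
    unfolding q_def q0_def right_diff_distrib[symmetric] abs_mult by simp
  also have "\<dots> \<le> real n / 2 * (vnorm ((b + f \<theta>) - (b + ?u)) * (vnorm (b + f \<theta>) + vnorm (b + ?u)) / lo)"
    using b f(1)[of \<theta>] u by (intro mult_left_mono Q_diff) auto
  also have "\<dots> \<le> real n / 2 * ((Kq * (R\<^sup>2 / real n)) * ((2 * T + 2 * L * R + Kq * R\<^sup>2) / sn) / lo)"
    using lo Kq by (intro mult_left_mono divide_right_mono mult_mono diff sum) auto
  also have "\<dots> = Kq * R\<^sup>2 * (2 * T + 2 * L * R + Kq * R\<^sup>2) / (2 * lo) / sn" using n by (simp add: mult_ac)
  finally show ?thesis by (simp add: sn_def)
qed

lemma exp_q_measurable: "(\<lambda>\<theta>. indicator Par \<theta> * exp (- q \<theta>)) \<in> borel_measurable borel"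
proof -
  have "Q (b + f \<theta>) = (\<Sum>i<p. (b $ i + f \<theta> $ i) * (\<Sum>j<p. minv V $$ (i, j) * (b $ j + f \<theta> $ j)))" for \<theta>
    unfolding Q_def scalar_prod_def lessThan_atLeast0 using b f(1)[of \<theta>] Wc
    by (intro sum.cong) (auto simp: scalar_prod_def intro!: sum.cong)
  then have "continuous_on Par (\<lambda>\<theta>. exp (- q \<theta>))"
    unfolding q_def using fcont by (auto intro!: continuous_intros)
  from borel_measurable_continuous_on_indicator[OF Par(2) this] show ?thesis by simp
qed

end

lemma abs_exp_minus_one_le:
  fixes a :: real assumes "\<bar>a\<bar> \<le> 1" shows "\<bar>exp a - 1\<bar> \<le> 2 * \<bar>a\<bar>"
proof (cases "0 \<le> a")
  case True
  then have "exp a \<le> 1 + a + a\<^sup>2" using assms by (intro exp_bound) auto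
  moreover have "a\<^sup>2 \<le> a" using True assms by (simp add: power2_eq_square mult_left_le)
  moreover have "1 \<le> exp a" using True by simp
  ultimately show ?thesis using True by simp
next
  case False
  then have "\<bar>exp a - 1\<bar> = 1 - exp a" "\<bar>a\<bar> = - a" by auto
  then show ?thesis using exp_ge_add_one_self[of a] False by linarith
qed

locale quasi_post_model = quasi_post +
  fixes M0 :: "nat set"
  assumes M0: "M0 \<subseteq> {..<p}" "\<And>k. k \<notin> M0 \<Longrightarrow> \<theta>0 k = 0"
begin

definition G0 where "G0 = submatrix G UNIV M0"
definition A where "A = G0\<^sup>T * minv V * G0"
definition \<mu> where "\<mu> = subvec M0 \<theta>0 - minv A *\<^sub>v (G0\<^sup>T *\<^sub>v (minv V *\<^sub>v b))"
definition \<phi> where "\<phi> \<theta> = mvn_density \<mu> ((1 / real n) \<cdot>\<^sub>m minv A) (subvec M0 \<theta>)"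

lemma fin: "finite M0" using M0(1) finite_subset by blast

lemma M0_eq: "{j. j < p \<and> j \<in> M0} = M0" using M0 by auto

lemma G0: "G0 \<in> carrier_mat p (card M0)"
proof
  have d: "dim_row G = p" "dim_col G = p" using G(1) by auto
  show "dim_row G0 = p" unfolding G0_def dim_submatrix d by simp
  show "dim_col G0 = card M0" unfolding G0_def dim_submatrix d M0_eq by (rule refl)
qed

lemma pick_M0: "i < card M0 \<Longrightarrow> pick M0 i \<in> M0"
  using pick_bij[OF fin] by (auto simp: bij_betw_def)

lemma card_below_pick:
  assumes i: "i < card M0"
  shows "card {a\<in>M0. a < pick M0 i} = i"
proof -
  have pM: "pick M0 i \<in> M0" by (rule pick_M0[OF i])
  have "card {a\<in>M0. a < pick M0 i} < card M0" using fin pM by (intro psubset_card_mono) auto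
  moreover have "pick M0 (card {a\<in>M0. a < pick M0 i}) = pick M0 i" by (rule pick_card_in_set[OF pM])
  ultimately show ?thesis using pick_bij[OF fin] i by (auto simp: bij_betw_def inj_on_def)
qed

lemma G0_index: "i < p \<Longrightarrow> j < card M0 \<Longrightarrow> G0 $$ (i, j) = G $$ (i, pick M0 j)"
proof -
  assume ij: "i < p" "j < card M0"
  have d: "dim_row G = p" "dim_col G = p" using G(1) by auto
  have "i < card {i. i < dim_row G \<and> i \<in> UNIV}" using ij by (simp add: d)
  moreover have "j < card {j. j < dim_col G \<and> j \<in> M0}" unfolding d M0_eq by (rule ij)
  ultimately show ?thesis unfolding G0_def by (simp only: submatrix_index pick_UNIV)
qed

lemma G0_mult:
  assumes "\<And>k. k \<notin> M0 \<Longrightarrow> x k = 0"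
  shows "G0 *\<^sub>v subvec M0 x = G *\<^sub>v vec p x"
proof (rule eq_vecI)
  fix i assume "i < dim_vec (G *\<^sub>v vec p x)"
  then have i: "i < p" using G by simp
  have "(G0 *\<^sub>v subvec M0 x) $ i = (\<Sum>j<card M0. G $$ (i, pick M0 j) * x (pick M0 j))"
    using i G0 by (auto simp: scalar_prod_def subvec_def G0_index lessThan_atLeast0 intro!: sum.cong)
  also have "\<dots> = (\<Sum>m\<in>M0. G $$ (i, m) * x m)" by (rule sum.reindex_bij_betw[OF pick_bij[OF fin]])
  also have "\<dots> = (\<Sum>m<p. G $$ (i, m) * x m)" using M0 assms by (intro sum.mono_neutral_left) auto
  also have "\<dots> = (G *\<^sub>v vec p x) $ i" using i G by (auto simp: scalar_prod_def lessThan_atLeast0 intro!: sum.cong)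
  finally show "(G0 *\<^sub>v subvec M0 x) $ i = (G *\<^sub>v vec p x) $ i" .
qed (use G G0 in auto)

lemma subvec_norm:
  assumes "\<And>k. k \<notin> M0 \<Longrightarrow> x k = 0"
  shows "vnorm (subvec M0 x) = vnorm (vec p x)"
proof -
  have "subvec M0 x \<bullet> subvec M0 x = (\<Sum>j<card M0. x (pick M0 j) * x (pick M0 j))"
    by (simp add: scalar_prod_def subvec_def lessThan_atLeast0)
  also have "\<dots> = (\<Sum>m\<in>M0. x m * x m)" by (rule sum.reindex_bij_betw[OF pick_bij[OF fin]])
  also have "\<dots> = (\<Sum>m<p. x m * x m)" using M0 assms by (intro sum.mono_neutral_left) auto
  also have "\<dots> = vec p x \<bullet> vec p x" by (simp add: scalar_prod_def lessThan_atLeast0)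
  finally show ?thesis by (simp add: vnorm_def)
qed

text \<open>The form of A factors through G0; together with G0_mult and subvec_norm this bounds the spectrum of A.\<close>
lemma A_form: "v \<in> carrier_vec (card M0) \<Longrightarrow> u \<in> carrier_vec (card M0) \<Longrightarrow> v \<bullet> (A *\<^sub>v u) = (G0 *\<^sub>v v) \<bullet> (minv V *\<^sub>v (G0 *\<^sub>v u))"
proof -
  assume v: "v \<in> carrier_vec (card M0)" and u: "u \<in> carrier_vec (card M0)"
  have GT: "G0\<^sup>T \<in> carrier_mat (card M0) p" using G0 by simp
  have GW: "G0\<^sup>T * minv V \<in> carrier_mat (card M0) p" using GT Wc by simp
  have Gu: "G0 *\<^sub>v u \<in> carrier_vec p" using G0 u by simp
  have WGu: "minv V *\<^sub>v (G0 *\<^sub>v u) \<in> carrier_vec p" using Wc Gu by simp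
  have "A *\<^sub>v u = G0\<^sup>T * minv V *\<^sub>v (G0 *\<^sub>v u)" unfolding A_def by (rule assoc_mult_mat_vec[OF GW G0 u])
  also have "\<dots> = G0\<^sup>T *\<^sub>v (minv V *\<^sub>v (G0 *\<^sub>v u))" by (rule assoc_mult_mat_vec[OF GT Wc Gu])
  finally have "v \<bullet> (A *\<^sub>v u) = (G0\<^sup>T *\<^sub>v (minv V *\<^sub>v (G0 *\<^sub>v u))) \<bullet> v"
    using v GT WGu by (simp add: comm_scalar_prod[of v "card M0"])
  also have "\<dots> = (minv V *\<^sub>v (G0 *\<^sub>v u)) \<bullet> (G0 *\<^sub>v v)" by (rule transpose_vec_mult_scalar[OF G0 v WGu])
  also have "\<dots> = (G0 *\<^sub>v v) \<bullet> (minv V *\<^sub>v (G0 *\<^sub>v u))" using WGu G0 v by (intro comm_scalar_prod[of _ p]) auto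
  finally show ?thesis .
qed

lemma A: "form_bounds (card M0) A (1 / (hi * L\<^sup>2)) (L\<^sup>2 / lo)"
  unfolding form_bounds_def
proof (intro conjI ballI)
  have GT: "G0\<^sup>T \<in> carrier_mat (card M0) p" using G0 by simp
  have GW: "G0\<^sup>T * minv V \<in> carrier_mat (card M0) p" using GT Wc by simp
  show "A \<in> carrier_mat (card M0) (card M0)" unfolding A_def using GW G0 by simp
  have "A\<^sup>T = G0\<^sup>T * (G0\<^sup>T * minv V)\<^sup>T" unfolding A_def by (rule transpose_mult[OF GW G0])
  also have "(G0\<^sup>T * minv V)\<^sup>T = minv V * G0" using transpose_mult[OF GT Wc] form_boundsD(2)[OF W] by simp
  also have "G0\<^sup>T * (minv V * G0) = A" unfolding A_def by (rule assoc_mult_mat[symmetric, OF GT Wc G0])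
  finally show "A\<^sup>T = A" .
  fix v :: "real vec" assume v: "v \<in> carrier_vec (card M0)"
  define x where "x m = (if m \<in> M0 then v $ (card {a\<in>M0. a < m}) else 0)" for m
  have vx: "v = subvec M0 x" using v pick_M0 by (intro eq_vecI) (auto simp: subvec_def x_def card_below_pick)
  have x0: "\<And>k. k \<notin> M0 \<Longrightarrow> x k = 0" by (simp add: x_def)
  have Gv: "G0 *\<^sub>v v = G *\<^sub>v vec p x" unfolding vx by (rule G0_mult[OF x0])
  have nv: "vnorm v = vnorm (vec p x)" unfolding vx by (rule subvec_norm[OF x0])
  have cG: "G0 *\<^sub>v v \<in> carrier_vec p" using G0 v by simp
  have 1: "vnorm v \<le> L * vnorm (G0 *\<^sub>v v)" "vnorm (G0 *\<^sub>v v) \<le> L * vnorm v"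
    unfolding Gv nv using G(2,3)[of "vec p x"] by auto
  have 2: "(vnorm v)\<^sup>2 \<le> (L * vnorm (G0 *\<^sub>v v))\<^sup>2" "(vnorm (G0 *\<^sub>v v))\<^sup>2 \<le> (L * vnorm v)\<^sup>2"
    using 1 by (auto intro!: power_mono)
  have 3: "v \<bullet> (A *\<^sub>v v) = Q (G0 *\<^sub>v v)" using A_form[OF v v] by (simp add: Q_def)
  have "1 / (hi * L\<^sup>2) * (v \<bullet> v) \<le> (vnorm (G0 *\<^sub>v v))\<^sup>2 / hi"
    using 2(1) hi L by (simp add: vnorm_sq power_mult_distrib field_simps)
  then show "1 / (hi * L\<^sup>2) * (v \<bullet> v) \<le> v \<bullet> (A *\<^sub>v v)" unfolding 3 using Q_bounds(1)[OF cG] by linarith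
  have "(vnorm (G0 *\<^sub>v v))\<^sup>2 / lo \<le> L\<^sup>2 / lo * (v \<bullet> v)"
    using 2(2) lo by (simp add: vnorm_sq power_mult_distrib field_simps)
  then show "v \<bullet> (A *\<^sub>v v) \<le> L\<^sup>2 / lo * (v \<bullet> v)" unfolding 3 using Q_bounds(2)[OF cG] by linarith
qed

lemma A_lo: "0 < 1 / (hi * L\<^sup>2)" and A_hi: "0 < L\<^sup>2 / lo" using hi L lo by auto

definition hvec where "hvec = G0\<^sup>T *\<^sub>v (minv V *\<^sub>v b)"
text \<open>The minimum of q0 over the true model when constraints are ignored: the constant left over by
  completing the square.  C\<phi> is the normalising constant of the limiting normal density.\<close>
definition qmin where "qmin = real n / 2 * (Q b - hvec \<bullet> (minv A *\<^sub>v hvec))"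
definition C\<phi> where "C\<phi> = sqrt (real n ^ card M0 * det A / (2 * pi) ^ card M0)"

lemma hvec: "hvec \<in> carrier_vec (card M0)"
  unfolding hvec_def using G0 Wc b by (intro mult_mat_vec_carrier[of _ _ p] mult_mat_vec_carrier[of _ p p]) auto

lemmas SA = form_bounds_inverse(1)[OF A A_lo A_hi]

lemma mu: "\<mu> \<in> carrier_vec (card M0)"
  using form_boundsD(1)[OF SA] hvec by (simp add: \<mu>_def hvec_def)

lemma qmin_le: "qmin \<le> T\<^sup>2 / (2 * lo)"
proof -
  have "0 \<le> 1 / (L\<^sup>2 / lo) * (hvec \<bullet> hvec)" using L lo sprod_self_nonneg[of hvec] by simp
  then have "0 \<le> hvec \<bullet> (minv A *\<^sub>v hvec)" using form_boundsD(3)[OF SA hvec] by linarith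
  then have "qmin \<le> real n / 2 * Q b" unfolding qmin_def by (intro mult_left_mono) auto
  then show ?thesis using Q_b by linarith
qed

text \<open>q0 is quadratic on the true model; its minimiser is the centre \<mu> of the limiting normal density,
  which is the one-step estimator \<theta>0 - minv A hvec.\<close>
lemma complete_square:
  assumes th: "\<And>k. k \<notin> M0 \<Longrightarrow> \<theta> k = 0"
  shows "q0 \<theta> = qmin + real n / 2 * ((subvec M0 \<theta> - \<mu>) \<bullet> (A *\<^sub>v (subvec M0 \<theta> - \<mu>)))"
proof -
  define v where "v = subvec M0 (\<lambda>k. \<theta> k - \<theta>0 k)"
  have v: "v \<in> carrier_vec (card M0)" by (simp add: v_def)
  note S = form_bounds_minv[OF A A A_lo]
  define s where "s = minv A *\<^sub>v hvec"
  have s: "s \<in> carrier_vec (card M0)" using S hvec by (simp add: s_def)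
  have As: "A *\<^sub>v s = hvec"
    unfolding s_def using S form_boundsD(1)[OF A] hvec by (simp flip: assoc_mult_mat_vec)
  have vs: "subvec M0 \<theta> - \<mu> = v + 1 \<cdot>\<^sub>v s"
    unfolding \<mu>_def hvec_def[symmetric] s_def[symmetric] using s by (intro eq_vecI) (auto simp: v_def subvec_def)
  have Gv: "G *\<^sub>v (vec p \<theta> - vec p \<theta>0) = G0 *\<^sub>v v"
  proof -
    have "vec p \<theta> - vec p \<theta>0 = vec p (\<lambda>k. \<theta> k - \<theta>0 k)" by (intro eq_vecI) auto
    then show ?thesis unfolding v_def using th M0(2) by (simp add: G0_mult)
  qed
  have cG: "G0 *\<^sub>v v \<in> carrier_vec p" using G0 v by simp
  have Wb: "minv V *\<^sub>v b \<in> carrier_vec p" using Wc b by simp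
  have vh: "v \<bullet> hvec = (G0 *\<^sub>v v) \<bullet> (minv V *\<^sub>v b)"
  proof -
    have "v \<bullet> hvec = hvec \<bullet> v" by (rule comm_scalar_prod[OF v hvec])
    also have "\<dots> = (minv V *\<^sub>v b) \<bullet> (G0 *\<^sub>v v)" unfolding hvec_def by (rule transpose_vec_mult_scalar[OF G0 v Wb])
    also have "\<dots> = (G0 *\<^sub>v v) \<bullet> (minv V *\<^sub>v b)" by (rule comm_scalar_prod[OF Wb cG])
    finally show ?thesis .
  qed
  have "Q (b + 1 \<cdot>\<^sub>v (G0 *\<^sub>v v)) = Q b + 2 * 1 * (b \<bullet> (minv V *\<^sub>v (G0 *\<^sub>v v))) + 1\<^sup>2 * Q (G0 *\<^sub>v v)"
    unfolding Q_def by (rule form_add_smult[OF Wc form_boundsD(2)[OF W] b(1) cG])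
  also have "b \<bullet> (minv V *\<^sub>v (G0 *\<^sub>v v)) = v \<bullet> hvec"
    unfolding vh by (rule sym_form_commute[OF Wc form_boundsD(2)[OF W] b(1) cG])
  also have "Q (G0 *\<^sub>v v) = v \<bullet> (A *\<^sub>v v)" using A_form[OF v v] by (simp add: Q_def)
  finally have 1: "Q (b + G *\<^sub>v (vec p \<theta> - vec p \<theta>0)) = Q b + 2 * (v \<bullet> hvec) + v \<bullet> (A *\<^sub>v v)"
    unfolding Gv using cG by simp
  have "(v + 1 \<cdot>\<^sub>v s) \<bullet> (A *\<^sub>v (v + 1 \<cdot>\<^sub>v s)) = v \<bullet> (A *\<^sub>v v) + 2 * 1 * (v \<bullet> (A *\<^sub>v s)) + 1\<^sup>2 * (s \<bullet> (A *\<^sub>v s))"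
    by (rule form_add_smult[OF form_boundsD(1,2)[OF A] v s])
  also have "s \<bullet> (A *\<^sub>v s) = hvec \<bullet> s" unfolding As by (rule comm_scalar_prod[OF s hvec])
  finally have 2: "(subvec M0 \<theta> - \<mu>) \<bullet> (A *\<^sub>v (subvec M0 \<theta> - \<mu>)) = v \<bullet> (A *\<^sub>v v) + 2 * (v \<bullet> hvec) + hvec \<bullet> s"
    unfolding vs As by simp
  show ?thesis unfolding q0_def qmin_def 1 2 s_def[symmetric] by (simp add: algebra_simps)
qed

lemma n_pos: "0 < real n" using n by simp

lemmas mvn = mvn_density_props[OF A A_lo fin mu n_pos, folded C\<phi>_def]

lemma phi_eq:
  assumes "\<And>k. k \<notin> M0 \<Longrightarrow> \<theta> k = 0"
  shows "\<phi> \<theta> = C\<phi> * exp (qmin - q0 \<theta>)"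
  unfolding \<phi>_def using mvn(1)[of "subvec M0 \<theta>"] complete_square[OF assms] by simp

lemma phi_measurable: "\<phi> \<in> borel_measurable borel" and phi_integral: "(\<integral>\<^sup>+ \<theta>. ennreal (\<phi> \<theta>) \<partial>leb_model M0) = 1"
  unfolding \<phi>_def[abs_def] using mvn(2,3) by auto

lemma C\<phi>_pos: "0 < C\<phi>" by (rule mvn(4))

text \<open>
  The normal density dominates C\<phi> times a spherical Gaussian of the largest precision, and it
  integrates to one.  This bounds C\<phi> without reference to the eigenvalues of A.
\<close>
lemma C\<phi>_le: "C\<phi> \<le> sqrt (real n) ^ card M0 * sqrt (L\<^sup>2 / lo / (2 * pi)) ^ card M0"
proof -
  define h where "h = real n * (L\<^sup>2 / lo) / 2"
  have h: "0 < h" using n L lo by (simp add: h_def)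
  define a where "a k = \<mu> $ (card {a\<in>M0. a < k})" for k
  have le: "ennreal C\<phi> * ennreal (exp (- (h * (\<Sum>k\<in>M0. (\<theta> k - a k)\<^sup>2)))) \<le> ennreal (\<phi> \<theta>)" for \<theta>
  proof -
    let ?v = "subvec M0 \<theta> - \<mu>"
    have v: "?v \<in> carrier_vec (card M0)" using mu by simp
    have "?v \<bullet> ?v = (\<Sum>j<card M0. (\<theta> (pick M0 j) - a (pick M0 j))\<^sup>2)"
      using mu by (auto simp: scalar_prod_def subvec_def a_def card_below_pick power2_eq_square lessThan_atLeast0 intro!: sum.cong)
    also have "\<dots> = (\<Sum>k\<in>M0. (\<theta> k - a k)\<^sup>2)" by (rule sum.reindex_bij_betw[OF pick_bij[OF fin]])
    finally have "real n * (?v \<bullet> (A *\<^sub>v ?v)) / 2 \<le> h * (\<Sum>k\<in>M0. (\<theta> k - a k)\<^sup>2)"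
      using mult_left_mono[OF form_boundsD(4)[OF A v], of "real n / 2"] by (simp add: h_def mult_ac)
    then have "C\<phi> * exp (- (h * (\<Sum>k\<in>M0. (\<theta> k - a k)\<^sup>2))) \<le> \<phi> \<theta>"
      unfolding \<phi>_def using mvn(1)[of "subvec M0 \<theta>"] C\<phi>_pos by (simp add: mult_left_mono)
    then show ?thesis using C\<phi>_pos by (simp add: ennreal_mult[symmetric] ennreal_leI)
  qed
  have m: "(\<lambda>\<theta>. ennreal (exp (- (h * (\<Sum>k\<in>M0. (\<theta> k - a k)\<^sup>2))))) \<in> borel_measurable (leb_model M0)"
    unfolding measurable_cong_sets[OF sets_leb_model refl]
    by (intro measurable_compose[OF _ measurable_ennreal] borel_measurable_continuous_onI continuous_intros
        continuous_on_subset[OF continuous_on_product_coordinates]) auto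
  have "ennreal C\<phi> * ennreal (sqrt (pi / h) ^ card M0) = (\<integral>\<^sup>+ \<theta>. ennreal C\<phi> * ennreal (exp (- (h * (\<Sum>k\<in>M0. (\<theta> k - a k)\<^sup>2)))) \<partial>leb_model M0)"
    by (simp add: nn_integral_cmult[OF m] gauss_leb_model[OF fin h])
  also have "\<dots> \<le> (\<integral>\<^sup>+ \<theta>. ennreal (\<phi> \<theta>) \<partial>leb_model M0)" by (intro nn_integral_mono le)
  also have "\<dots> = ennreal 1" by (simp add: phi_integral)
  finally have 1: "C\<phi> * sqrt (pi / h) ^ card M0 \<le> 1" using C\<phi>_pos h by (simp add: ennreal_mult[symmetric])
  define X where "X = sqrt (real n) ^ card M0 * sqrt (L\<^sup>2 / lo / (2 * pi)) ^ card M0"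
  have X: "0 \<le> X" using L lo by (simp add: X_def)
  have "pi / h * (real n * (L\<^sup>2 / lo / (2 * pi))) = 1" using n L lo by (simp add: h_def)
  then have "sqrt (pi / h * (real n * (L\<^sup>2 / lo / (2 * pi)))) ^ card M0 = 1" by (simp only: real_sqrt_one power_one)
  then have sX: "sqrt (pi / h) ^ card M0 * X = 1" by (simp only: X_def power_mult_distrib real_sqrt_mult)
  have "C\<phi> = C\<phi> * sqrt (pi / h) ^ card M0 * X" by (simp add: mult.assoc sX)
  also have "\<dots> \<le> 1 * X" by (rule mult_right_mono[OF 1 X])
  finally show ?thesis by (simp add: X_def)
qed

end


section \<open>Comparison of the quasi-posterior with the normal density\<close>

context quasi_post_model begin

text \<open>
  Laplace's approximation to the integral of hfun over the true model, so that hfun divided by it is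
  comparable with the normalised density \<phi>.
\<close>
definition \<kappa> :: "real \<Rightarrow> real" where "\<kappa> \<pi>0 = \<pi>0 * exp (- qmin) / C\<phi>"

text \<open>The contribution of one model to the posterior, without the factor of the likelihood that all
  models share.\<close>
definition hfun :: "((nat \<Rightarrow> real) \<Rightarrow> real) \<Rightarrow> (nat \<Rightarrow> real) \<Rightarrow> real" where
  "hfun \<pi> \<theta> = indicator Par \<theta> * exp (- q \<theta>) * \<pi> \<theta>"

lemma kappa_pos: "0 < \<pi>0 \<Longrightarrow> 0 < \<kappa> \<pi>0" using C\<phi>_pos by (simp add: \<kappa>_def)

lemma hfun_nonneg: "0 \<le> \<pi> \<theta> \<Longrightarrow> 0 \<le> hfun \<pi> \<theta>" by (simp add: hfun_def)

lemma hfun_measurable: "\<pi> \<in> borel_measurable borel \<Longrightarrow> hfun \<pi> \<in> borel_measurable borel"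
  unfolding hfun_def[abs_def] using exp_q_measurable by simp

lemma CT_pos: "0 < CT" by (simp add: CT_def)

text \<open>Within distance R / sqrt n of \<theta>0 both the exponent and the log-prior are within \<epsilon> of their
  approximations.  Outside, both densities are at most a constant times exp (- 2 c n d^2), and half
  of this exponent is at least c R^2.\<close>
lemma pointwise_bound:
  fixes \<pi> :: "(nat \<Rightarrow> real) \<Rightarrow> real"
  assumes eps: "0 \<le> \<epsilon>" "\<epsilon> \<le> 1 / 2" and R: "0 \<le> R"
    and \<pi>: "0 < \<pi> \<theta>0" "\<And>\<theta>. 0 \<le> \<pi> \<theta>" "\<And>\<theta>. \<pi> \<theta> \<le> c\<rho> * \<pi> \<theta>0" and cr: "0 \<le> c\<rho>"
    and near: "\<And>\<theta>. (\<And>k. k \<notin> M0 \<Longrightarrow> \<theta> k = 0) \<Longrightarrow> sqrt (real n) * par_dist p \<theta> \<theta>0 \<le> R \<Longrightarrow>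
       \<theta> \<in> Par \<and> 0 < \<pi> \<theta> \<and> \<bar>ln (\<pi> \<theta>) - ln (\<pi> \<theta>0)\<bar> \<le> \<epsilon>"
    and qn: "Kq * R\<^sup>2 * (2 * T + 2 * L * R + Kq * R\<^sup>2) / (2 * lo) / sqrt (real n) \<le> \<epsilon>"
    and th: "\<And>k. k \<notin> M0 \<Longrightarrow> \<theta> k = 0"
  shows "\<bar>hfun \<pi> \<theta> / \<kappa> (\<pi> \<theta>0) - \<phi> \<theta>\<bar> \<le>
     C\<phi> * exp qmin * (CT * (4 * \<epsilon> + (1 + c\<rho>) * exp (- (c * R\<^sup>2)))) * exp (- (c * real n * (par_dist p \<theta> \<theta>0)\<^sup>2))"
proof -
  define d where "d = par_dist p \<theta> \<theta>0"
  define D where "D = exp (- (c * real n * d\<^sup>2))"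
  define \<rho> where "\<rho> = \<pi> \<theta> / \<pi> \<theta>0"
  have D2: "exp (- (2 * c * real n * d\<^sup>2)) = D * D" unfolding D_def exp_add[symmetric] by simp
  have D01: "0 < D" "D \<le> 1" using c by (auto simp: D_def)
  have DD: "D * D \<le> D" using D01 by (simp add: mult_left_le)
  have rho: "0 \<le> \<rho>" "\<rho> \<le> c\<rho>" using \<pi> by (auto simp: \<rho>_def field_simps)
  have eq0: "exp (- q0 \<theta>) \<le> CT * (D * D)" using exp_q0_le[of \<theta>] by (simp add: d_def D2[unfolded d_def])
  define X where "X = indicator Par \<theta> * exp (- q \<theta>) * \<rho> - exp (- q0 \<theta>)"
  have eq: "hfun \<pi> \<theta> / \<kappa> (\<pi> \<theta>0) - \<phi> \<theta> = C\<phi> * exp qmin * X"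
  proof -
    have ph: "\<phi> \<theta> = C\<phi> * exp (qmin - q0 \<theta>)" by (rule phi_eq[OF th])
    show ?thesis
      unfolding ph hfun_def \<kappa>_def \<rho>_def X_def using C\<phi>_pos \<pi>(1)
      by (simp add: exp_minus exp_diff field_simps)
  qed
  have "\<bar>X\<bar> \<le> CT * (4 * \<epsilon> + (1 + c\<rho>) * exp (- (c * R\<^sup>2))) * D"
  proof (cases "sqrt (real n) * d \<le> R")
    case True
    then have nr: "\<theta> \<in> Par" "0 < \<pi> \<theta>" "\<bar>ln (\<pi> \<theta>) - ln (\<pi> \<theta>0)\<bar> \<le> \<epsilon>" using near[OF th] by (auto simp: d_def)
    have qq: "\<bar>q \<theta> - q0 \<theta>\<bar> \<le> \<epsilon>" using q_near[OF nr(1) _ R] True qn by (simp add: d_def)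
    define a where "a = q0 \<theta> - q \<theta> + (ln (\<pi> \<theta>) - ln (\<pi> \<theta>0))"
    have a: "\<bar>a\<bar> \<le> 2 * \<epsilon>" using qq nr(3) unfolding a_def by linarith
    have "X = exp (- q0 \<theta>) * (exp a - 1)"
      using nr \<pi>(1) by (simp add: X_def a_def \<rho>_def exp_add exp_diff exp_minus field_simps)
    then have "\<bar>X\<bar> = exp (- q0 \<theta>) * \<bar>exp a - 1\<bar>" by (simp add: abs_mult)
    also have "\<dots> \<le> (CT * (D * D)) * (4 * \<epsilon>)"
      using a eps abs_exp_minus_one_le[of a] CT_pos D01 by (intro mult_mono eq0) auto
    also have "\<dots> \<le> (CT * D) * (4 * \<epsilon>)" using DD CT_pos eps by (intro mult_right_mono mult_left_mono) auto
    also have "\<dots> \<le> CT * (4 * \<epsilon> + (1 + c\<rho>) * exp (- (c * R\<^sup>2))) * D"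
      using CT_pos D01 cr by (simp add: algebra_simps)
    finally show ?thesis .
  next
    case False
    have "R\<^sup>2 \<le> (sqrt (real n) * d)\<^sup>2" using False R by (intro power_mono) auto
    then have "c * R\<^sup>2 \<le> c * real n * d\<^sup>2" using c by (simp add: power_mult_distrib)
    then have DR: "D \<le> exp (- (c * R\<^sup>2))" by (simp add: D_def)
    have "0 \<le> indicator Par \<theta> * exp (- q \<theta>) * \<rho>" using rho by simp
    moreover have "indicator Par \<theta> * exp (- q \<theta>) * \<rho> \<le> CT * (D * D) * c\<rho>"
    proof (cases "\<theta> \<in> Par")
      case True
      then show ?thesis using exp_q_le[OF True] rho CT_pos D01
        by (simp add: d_def[symmetric] D2) (intro mult_mono, auto)
    qed (use CT_pos D01 cr in simp)
    ultimately have "\<bar>X\<bar> \<le> CT * (D * D) * c\<rho> + CT * (D * D)"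
      using eq0 exp_gt_zero[of "- q0 \<theta>"] unfolding X_def abs_le_iff by linarith
    also have "\<dots> = (CT * (1 + c\<rho>) * D) * D" by (simp add: algebra_simps)
    also have "\<dots> \<le> (CT * (1 + c\<rho>) * exp (- (c * R\<^sup>2))) * D"
      using CT_pos cr D01 DR by (intro mult_right_mono mult_left_mono) auto
    also have "\<dots> \<le> CT * (4 * \<epsilon> + (1 + c\<rho>) * exp (- (c * R\<^sup>2))) * D"
      using CT_pos D01 eps by (simp add: algebra_simps)
    finally show ?thesis .
  qed
  then show ?thesis unfolding eq D_def d_def using C\<phi>_pos
    by (simp add: abs_mult mult.assoc mult_left_mono)
qed

lemma dist_sq_model:
  assumes M: "M0 \<subseteq> M" "M \<subseteq> {..<p}" and th: "\<And>k. k \<notin> M \<Longrightarrow> \<theta> k = 0"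
  shows "(par_dist p \<theta> \<theta>0)\<^sup>2 = (\<Sum>k\<in>M. (\<theta> k - \<theta>0 k)\<^sup>2)"
  unfolding par_dist_sq using M th M0(2) by (intro sum.mono_neutral_right) auto

lemma gauss_model_integrable:
  assumes M: "M \<subseteq> {..<p}" and a: "0 < a"
  defines "g \<equiv> \<lambda>\<theta>. exp (- (a * (\<Sum>k\<in>M. (\<theta> k - \<theta>0 k)\<^sup>2)))"
  shows "integrable (leb_model M) g" "(\<integral>\<theta>. g \<theta> \<partial>leb_model M) = sqrt (pi / a) ^ card M"
proof -
  have fM: "finite M" using M finite_subset by blast
  have m: "g \<in> borel_measurable (leb_model M)"
    unfolding measurable_cong_sets[OF sets_leb_model refl] g_def
    by (intro borel_measurable_continuous_onI continuous_intros continuous_on_subset[OF continuous_on_product_coordinates]) auto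
  have nn: "(\<integral>\<^sup>+ \<theta>. ennreal (g \<theta>) \<partial>leb_model M) = ennreal (sqrt (pi / a) ^ card M)"
    unfolding g_def by (rule gauss_leb_model[OF fM a])
  show "integrable (leb_model M) g"
    using m nn by (intro integrableI_nonneg) (auto simp: g_def)
  show "(\<integral>\<theta>. g \<theta> \<partial>leb_model M) = sqrt (pi / a) ^ card M"
  proof -
    have "(\<integral>\<theta>. g \<theta> \<partial>leb_model M) = enn2real (\<integral>\<^sup>+ \<theta>. ennreal (g \<theta>) \<partial>leb_model M)"
      by (rule integral_eq_nn_integral[OF m]) (simp add: g_def)
    then show ?thesis unfolding nn using a by simp
  qed
qed

text \<open>
  The distance to \<theta>0 involves all coordinates of M because M contains M0, so the Gaussian bound on
  the likelihood integrates to the power card M of a number of order 1 / sqrt n.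
\<close>
lemma superset_model_bound:
  assumes M: "M0 \<subseteq> M" "M \<subseteq> {..<p}"
    and \<pi>: "\<pi> \<in> borel_measurable borel" "\<And>\<theta>. 0 \<le> \<pi> \<theta>" "\<And>\<theta>. \<pi> \<theta> \<le> c\<pi>"
  shows "integrable (leb_model M) (hfun \<pi>)"
    and "(\<integral>\<theta>. hfun \<pi> \<theta> \<partial>leb_model M) \<le> c\<pi> * CT * sqrt (pi / (2 * c * real n)) ^ card M"
proof -
  have a: "0 < 2 * c * real n" using c n by simp
  note gi = gauss_model_integrable[OF M(2) a]
  have c0: "0 \<le> c\<pi>" using \<pi>(2,3) order_trans by blast
  have le: "AE \<theta> in leb_model M. hfun \<pi> \<theta> \<le> c\<pi> * CT * exp (- (2 * c * real n * (\<Sum>k\<in>M. (\<theta> k - \<theta>0 k)\<^sup>2)))"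
    using AE_leb_model[of M]
  proof eventually_elim
    case (elim \<theta>)
    have "indicator Par \<theta> * exp (- q \<theta>) \<le> CT * exp (- (2 * c * real n * (par_dist p \<theta> \<theta>0)\<^sup>2))"
      using exp_q_le[of \<theta>] CT_pos by (cases "\<theta> \<in> Par") auto
    then have "hfun \<pi> \<theta> \<le> (CT * exp (- (2 * c * real n * (par_dist p \<theta> \<theta>0)\<^sup>2))) * c\<pi>"
      unfolding hfun_def by (rule mult_mono) (use \<pi>(2,3) CT_pos in auto)
    then show ?case using dist_sq_model[OF M, of \<theta>] elim by (simp add: mult_ac)
  qed
  have int: "integrable (leb_model M) (\<lambda>\<theta>. c\<pi> * CT * exp (- (2 * c * real n * (\<Sum>k\<in>M. (\<theta> k - \<theta>0 k)\<^sup>2))))"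
    using gi(1) by simp
  show hi: "integrable (leb_model M) (hfun \<pi>)"
  proof (rule Bochner_Integration.integrable_bound[OF int])
    show "hfun \<pi> \<in> borel_measurable (leb_model M)"
      using hfun_measurable[OF \<pi>(1)] by (simp add: measurable_cong_sets[OF sets_leb_model refl])
    show "AE \<theta> in leb_model M. norm (hfun \<pi> \<theta>) \<le> norm (c\<pi> * CT * exp (- (2 * c * real n * (\<Sum>k\<in>M. (\<theta> k - \<theta>0 k)\<^sup>2))))"
      using le
    proof eventually_elim
      case (elim \<theta>)
      then show ?case using hfun_nonneg[of \<pi> \<theta>, OF \<pi>(2)] by simp
    qed
  qed
  have "(\<integral>\<theta>. hfun \<pi> \<theta> \<partial>leb_model M) \<le> (\<integral>\<theta>. c\<pi> * CT * exp (- (2 * c * real n * (\<Sum>k\<in>M. (\<theta> k - \<theta>0 k)\<^sup>2))) \<partial>leb_model M)"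
    by (rule integral_mono_AE[OF hi int le])
  also have "\<dots> = c\<pi> * CT * sqrt (pi / (2 * c * real n)) ^ card M" using gi(2) by simp
  finally show "(\<integral>\<theta>. hfun \<pi> \<theta> \<partial>leb_model M) \<le> c\<pi> * CT * sqrt (pi / (2 * c * real n)) ^ card M" .
qed

text \<open>
  No integration against Lebesgue measure is needed: the likelihood is uniformly small on the
  model, and the prior is a probability density.
\<close>
lemma other_model_bound:
  assumes \<pi>: "\<pi> \<in> borel_measurable borel" "\<And>\<theta>. 0 \<le> \<pi> \<theta>" "\<And>\<theta>. \<theta> \<notin> par_model Par M \<Longrightarrow> \<pi> \<theta> = 0"
    and int: "integrable (leb_model M) \<pi>" "(\<integral>\<theta>. \<pi> \<theta> \<partial>leb_model M) = 1"
    and r: "0 \<le> r" "\<And>\<theta>. \<theta> \<in> par_model Par M \<Longrightarrow> r \<le> par_dist p \<theta> \<theta>0"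
  shows "integrable (leb_model M) (hfun \<pi>)"
    and "(\<integral>\<theta>. hfun \<pi> \<theta> \<partial>leb_model M) \<le> CT * exp (- (2 * c * real n * r\<^sup>2))"
proof -
  let ?B = "CT * exp (- (2 * c * real n * r\<^sup>2))"
  have le: "hfun \<pi> \<theta> \<le> ?B * \<pi> \<theta>" for \<theta>
  proof (cases "\<theta> \<in> par_model Par M")
    case True
    then have P: "\<theta> \<in> Par" by (simp add: par_model_def)
    have "r\<^sup>2 \<le> (par_dist p \<theta> \<theta>0)\<^sup>2" using r True by (intro power_mono) auto
    then have "2 * c * real n * r\<^sup>2 \<le> 2 * c * real n * (par_dist p \<theta> \<theta>0)\<^sup>2" using c by (intro mult_left_mono) auto
    then have "CT * exp (- (2 * c * real n * (par_dist p \<theta> \<theta>0)\<^sup>2)) \<le> ?B" using CT_pos by simp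
    then have "exp (- q \<theta>) \<le> ?B" using exp_q_le[OF P] by linarith
    then show ?thesis using P \<pi>(2) by (simp add: hfun_def mult_right_mono)
  qed (simp add: \<pi> hfun_def)
  have iB: "integrable (leb_model M) (\<lambda>\<theta>. ?B * \<pi> \<theta>)" using int by simp
  show hi: "integrable (leb_model M) (hfun \<pi>)"
  proof (rule Bochner_Integration.integrable_bound[OF iB])
    show "hfun \<pi> \<in> borel_measurable (leb_model M)"
      using hfun_measurable[OF \<pi>(1)] by (simp add: measurable_cong_sets[OF sets_leb_model refl])
    have "norm (hfun \<pi> \<theta>) \<le> norm (?B * \<pi> \<theta>)" for \<theta> using le[of \<theta>] hfun_nonneg[of \<pi> \<theta>, OF \<pi>(2)] by simp
    then show "AE \<theta> in leb_model M. norm (hfun \<pi> \<theta>) \<le> norm (?B * \<pi> \<theta>)" by (rule AE_I2)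
  qed
  have "(\<integral>\<theta>. hfun \<pi> \<theta> \<partial>leb_model M) \<le> (\<integral>\<theta>. ?B * \<pi> \<theta> \<partial>leb_model M)" by (intro integral_mono hi iB le)
  then show "(\<integral>\<theta>. hfun \<pi> \<theta> \<partial>leb_model M) \<le> ?B" using int by simp
qed

lemma phi_nonneg: "(\<And>k. k \<notin> M0 \<Longrightarrow> \<theta> k = 0) \<Longrightarrow> 0 \<le> \<phi> \<theta>"
  using C\<phi>_pos by (simp add: phi_eq)

lemma phi_integrable: "integrable (leb_model M0) \<phi>" and phi_integral_eq_1: "(\<integral>\<theta>. \<phi> \<theta> \<partial>leb_model M0) = 1"
proof -
  have m: "\<phi> \<in> borel_measurable (leb_model M0)" using phi_measurable by (simp add: measurable_cong_sets[OF sets_leb_model refl])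
  have nn: "AE \<theta> in leb_model M0. 0 \<le> \<phi> \<theta>" using AE_leb_model[of M0] by eventually_elim (simp add: phi_nonneg)
  show "integrable (leb_model M0) \<phi>" using m nn by (intro integrableI_nonneg) (auto simp: phi_integral)
  show "(\<integral>\<theta>. \<phi> \<theta> \<partial>leb_model M0) = 1" using integral_eq_nn_integral[OF m nn] by (simp add: phi_integral)
qed

definition TV :: "real \<Rightarrow> real \<Rightarrow> real \<Rightarrow> real" where
  "TV \<epsilon> R c\<rho> = sqrt (L\<^sup>2 / lo / (2 * pi)) ^ card M0 * sqrt (pi / c) ^ card M0 * exp (T\<^sup>2 / (2 * lo)) *
     (CT * (4 * \<epsilon> + (1 + c\<rho>) * exp (- (c * R\<^sup>2))))"

text \<open>Integration of the pointwise bound.  The powers of sqrt n in C\<phi> and in the Gaussian integral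
  cancel, so the bound does not depend on n.\<close>
lemma total_variation_bound:
  fixes \<pi> :: "(nat \<Rightarrow> real) \<Rightarrow> real"
  assumes eps: "0 \<le> \<epsilon>" "\<epsilon> \<le> 1 / 2" and R: "0 \<le> R" and mpi: "\<pi> \<in> borel_measurable borel"
    and \<pi>: "0 < \<pi> \<theta>0" "\<And>\<theta>. 0 \<le> \<pi> \<theta>" "\<And>\<theta>. \<pi> \<theta> \<le> c\<rho> * \<pi> \<theta>0" and cr: "0 \<le> c\<rho>"
    and near: "\<And>\<theta>. (\<And>k. k \<notin> M0 \<Longrightarrow> \<theta> k = 0) \<Longrightarrow> sqrt (real n) * par_dist p \<theta> \<theta>0 \<le> R \<Longrightarrow>
       \<theta> \<in> Par \<and> 0 < \<pi> \<theta> \<and> \<bar>ln (\<pi> \<theta>) - ln (\<pi> \<theta>0)\<bar> \<le> \<epsilon>"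
    and qn: "Kq * R\<^sup>2 * (2 * T + 2 * L * R + Kq * R\<^sup>2) / (2 * lo) / sqrt (real n) \<le> \<epsilon>"
    and B: "B \<in> sets borel"
  shows "\<bar>(\<integral>\<theta>. indicator B \<theta> * hfun \<pi> \<theta> \<partial>leb_model M0) / \<kappa> (\<pi> \<theta>0) - (\<integral>\<theta>. indicator B \<theta> * \<phi> \<theta> \<partial>leb_model M0)\<bar> \<le> TV \<epsilon> R c\<rho>"
proof -
  define K where "K = CT * (4 * \<epsilon> + (1 + c\<rho>) * exp (- (c * R\<^sup>2)))"
  have K: "0 \<le> K" using CT_pos eps cr by (simp add: K_def)
  have a: "0 < c * real n" using c n by simp
  note gi = gauss_model_integrable[OF M0(1) a]
  let ?g = "\<lambda>\<theta>. C\<phi> * exp qmin * K * exp (- (c * real n * (\<Sum>k\<in>M0. (\<theta> k - \<theta>0 k)\<^sup>2)))"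
  have pw: "AE \<theta> in leb_model M0. \<bar>indicator B \<theta> * hfun \<pi> \<theta> / \<kappa> (\<pi> \<theta>0) - indicator B \<theta> * \<phi> \<theta>\<bar> \<le> ?g \<theta>"
    using AE_leb_model[of M0]
  proof eventually_elim
    case (elim \<theta>)
    then have th: "\<And>k. k \<notin> M0 \<Longrightarrow> \<theta> k = 0" by blast
    have "\<bar>hfun \<pi> \<theta> / \<kappa> (\<pi> \<theta>0) - \<phi> \<theta>\<bar> \<le> ?g \<theta>"
    proof -
      have "(\<Sum>k\<in>M0. (\<theta> k - \<theta>0 k)\<^sup>2) = (par_dist p \<theta> \<theta>0)\<^sup>2"
        by (rule dist_sq_model[OF order_refl M0(1) th, symmetric])
      then show ?thesis using pointwise_bound[OF eps R \<pi> cr near qn th] by (simp add: K_def)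
    qed
    moreover have "0 \<le> ?g \<theta>" using C\<phi>_pos K by simp
    ultimately show ?case by (cases "\<theta> \<in> B") auto
  qed
  have hI: "integrable (leb_model M0) (hfun \<pi>)"
    by (rule superset_model_bound(1)[OF order_refl M0(1) mpi \<pi>(2,3)])
  have i1: "integrable (leb_model M0) (\<lambda>\<theta>. indicator B \<theta> * hfun \<pi> \<theta>)"
    using integrable_mult_indicator[OF _ hI, of B] B by simp
  have i2: "integrable (leb_model M0) (\<lambda>\<theta>. indicator B \<theta> * \<phi> \<theta>)"
    using integrable_mult_indicator[OF _ phi_integrable, of B] B by simp
  have ig: "integrable (leb_model M0) ?g" using gi(1) by simp
  have eq: "(\<integral>\<theta>. indicator B \<theta> * hfun \<pi> \<theta> \<partial>leb_model M0) / \<kappa> (\<pi> \<theta>0) - (\<integral>\<theta>. indicator B \<theta> * \<phi> \<theta> \<partial>leb_model M0)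
    = (\<integral>\<theta>. indicator B \<theta> * hfun \<pi> \<theta> / \<kappa> (\<pi> \<theta>0) - indicator B \<theta> * \<phi> \<theta> \<partial>leb_model M0)"
    using i1 i2 by simp
  have "\<bar>(\<integral>\<theta>. indicator B \<theta> * hfun \<pi> \<theta> \<partial>leb_model M0) / \<kappa> (\<pi> \<theta>0) - (\<integral>\<theta>. indicator B \<theta> * \<phi> \<theta> \<partial>leb_model M0)\<bar>
      \<le> (\<integral>\<theta>. \<bar>indicator B \<theta> * hfun \<pi> \<theta> / \<kappa> (\<pi> \<theta>0) - indicator B \<theta> * \<phi> \<theta>\<bar> \<partial>leb_model M0)"
    unfolding eq by (rule integral_abs_bound)
  also have "\<dots> \<le> (\<integral>\<theta>. ?g \<theta> \<partial>leb_model M0)"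
    using i1 i2 by (intro integral_mono_AE[OF _ ig pw]) auto
  also have "\<dots> = C\<phi> * exp qmin * K * sqrt (pi / (c * real n)) ^ card M0" using gi(2) by simp
  also have "\<dots> \<le> (sqrt (real n) ^ card M0 * sqrt (L\<^sup>2 / lo / (2 * pi)) ^ card M0) * exp (T\<^sup>2 / (2 * lo)) * K * sqrt (pi / (c * real n)) ^ card M0"
    using C\<phi>_le qmin_le C\<phi>_pos K c by (intro mult_right_mono mult_mono) auto
  also have "\<dots> = sqrt (L\<^sup>2 / lo / (2 * pi)) ^ card M0 * (sqrt (real n) * sqrt (pi / (c * real n))) ^ card M0 * exp (T\<^sup>2 / (2 * lo)) * K"
    by (simp add: power_mult_distrib mult_ac)
  also have "sqrt (real n) * sqrt (pi / (c * real n)) = sqrt (pi / c)" unfolding real_sqrt_mult[symmetric] using n by simp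
  finally show ?thesis by (simp add: TV_def K_def)
qed

lemma kappa_lower:
  assumes "0 < \<pi>0"
  shows "\<pi>0 * exp (- (T\<^sup>2 / (2 * lo))) / (sqrt (real n) ^ card M0 * sqrt (L\<^sup>2 / lo / (2 * pi)) ^ card M0) \<le> \<kappa> \<pi>0"
  unfolding \<kappa>_def using assms qmin_le C\<phi>_pos C\<phi>_le by (intro frac_le mult_mono) auto

end

text \<open>
  Here H0 and HA are the masses of the whole true model and of a set within it, and s and sA are the
  contributions of all other models.  After division by w0 \<kappa> the denominator is at least 1 / 2, so
  normalisation at most doubles errors.
\<close>
lemma posterior_ratio_bounds:
  fixes H0 HA \<kappa> \<Phi> E s sA cV w0 \<rho> :: real
  assumes w0: "0 < w0" and \<kappa>: "0 < \<kappa>" and cV: "0 < cV" and E: "E \<le> 1 / 2"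
    and H0: "\<bar>H0 / \<kappa> - 1\<bar> \<le> E" and HA: "\<bar>HA / \<kappa> - \<Phi>\<bar> \<le> E" "0 \<le> HA" "HA \<le> H0"
    and s: "0 \<le> sA" "sA \<le> s" "s \<le> \<rho> * (w0 * \<kappa>)"
  shows "\<bar>w0 * (cV * H0) / (w0 * (cV * H0) + cV * s) - 1\<bar> \<le> 2 * \<rho>"
    and "\<bar>(w0 * (cV * HA) + cV * sA) / (w0 * (cV * H0) + cV * s) - \<Phi>\<bar> \<le> 4 * E + 5 * \<rho>"
proof -
  define x y where "x = HA / \<kappa>" and "y = H0 / \<kappa>"
  define t u where "t = s / (w0 * \<kappa>)" and "u = sA / (w0 * \<kappa>)"
  have wk: "0 < w0 * \<kappa>" using w0 \<kappa> by simp
  have eqs: "H0 = \<kappa> * y" "HA = \<kappa> * x" "s = w0 * \<kappa> * t" "sA = w0 * \<kappa> * u"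
    using w0 \<kappa> by (auto simp: x_def y_def t_def u_def)
  have y: "1 / 2 \<le> y" "y \<le> 3 / 2" using H0 E unfolding y_def abs_le_iff by linarith+
  have x: "0 \<le> x" "x \<le> y" using HA \<kappa> by (auto simp: x_def y_def divide_right_mono)
  have t: "0 \<le> t" "t \<le> \<rho>" "0 \<le> u" "u \<le> t" using s wk by (auto simp: t_def u_def field_simps)
  have yt: "1 / 2 \<le> y + t" using y t by simp
  have r: "w0 * (cV * H0) = cV * (w0 * \<kappa>) * y" "w0 * (cV * HA) = cV * (w0 * \<kappa>) * x"
     "cV * s = cV * (w0 * \<kappa>) * t" "cV * sA = cV * (w0 * \<kappa>) * u" by (simp_all add: eqs)
  have nz: "cV * (w0 * \<kappa>) \<noteq> 0" using cV w0 \<kappa> by simp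
  have f1: "w0 * (cV * H0) / (w0 * (cV * H0) + cV * s) = y / (y + t)"
    unfolding r distrib_left[symmetric] by (rule mult_divide_mult_cancel_left[OF nz])
  have f2: "(w0 * (cV * HA) + cV * sA) / (w0 * (cV * H0) + cV * s) = (x + u) / (y + t)"
    unfolding r distrib_left[symmetric] by (rule mult_divide_mult_cancel_left[OF nz])
  have inv: "a / (y + t) \<le> 2 * a" if "0 \<le> a" for a
    using yt that mult_left_mono[of "1/2" "y + t" "2 * a"] by (simp add: field_simps)
  have "y / (y + t) - 1 = - (t / (y + t))" using yt by (simp add: field_simps)
  then have "\<bar>y / (y + t) - 1\<bar> = t / (y + t)" using yt t by simp
  also have "\<dots> \<le> 2 * \<rho>" using inv[OF t(1)] t by simp
  finally show "\<bar>w0 * (cV * H0) / (w0 * (cV * H0) + cV * s) - 1\<bar> \<le> 2 * \<rho>" unfolding f1 .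
  have E0: "0 \<le> E" "0 \<le> \<rho>" using H0 t by auto
  have "(x + u) / (y + t) - x = (u + x * (1 - y) - x * t) / (y + t)" using yt by (simp add: field_simps)
  then have "\<bar>(x + u) / (y + t) - x\<bar> = \<bar>u + x * (1 - y) - x * t\<bar> / (y + t)" using yt by (simp add: abs_divide)
  also have "\<dots> \<le> 2 * \<bar>u + x * (1 - y) - x * t\<bar>" by (rule inv) simp
  also have "\<bar>u + x * (1 - y) - x * t\<bar> \<le> \<rho> + 3 / 2 * E + 3 / 2 * \<rho>"
  proof -
    have y1: "\<bar>1 - y\<bar> \<le> E" using H0 by (simp add: y_def abs_minus_commute)
    have x1: "\<bar>x\<bar> \<le> 3 / 2" using x y by simp
    have "\<bar>x * (1 - y)\<bar> \<le> 3 / 2 * E" unfolding abs_mult using y1 x1 by (intro mult_mono) auto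
    moreover have "\<bar>x * t\<bar> \<le> 3 / 2 * \<rho>" unfolding abs_mult using x1 t by (intro mult_mono) auto
    ultimately show ?thesis using t by linarith
  qed
  finally have "\<bar>(x + u) / (y + t) - x\<bar> \<le> 3 * E + 5 * \<rho>" by simp
  then show "\<bar>(w0 * (cV * HA) + cV * sA) / (w0 * (cV * H0) + cV * s) - \<Phi>\<bar> \<le> 4 * E + 5 * \<rho>"
    unfolding f2 using HA(1) unfolding x_def[symmetric] by linarith
qed

context quasi_post_model begin

definition lik :: "(nat \<Rightarrow> real) \<Rightarrow> real" where "lik \<theta> = quasi_lik n V (b + f \<theta>)"
definition cV :: real where "cV = det ((2 * pi / real n) \<cdot>\<^sub>m V) powr (-1/2)"

lemma cV_pos: "0 < cV"
  using form_bounds_det[OF V lo] n by (simp add: cV_def)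

lemma lik_eq: "lik \<theta> = cV * exp (- q \<theta>)"
  by (simp add: lik_def quasi_lik_def cV_def q_def Q_def)

lemma model_integral_eq:
  fixes A :: "(nat \<Rightarrow> real) set"
  assumes "\<And>\<theta>. \<theta> \<notin> par_model Par M \<Longrightarrow> \<pi> \<theta> = 0"
  shows "(LINT \<theta>:A \<inter> par_model Par M|leb_model M. lik \<theta> * \<pi> \<theta>) = cV * (\<integral>\<theta>. indicator A \<theta> * hfun \<pi> \<theta> \<partial>leb_model M)"
proof -
  have "indicator (A \<inter> par_model Par M) \<theta> *\<^sub>R (lik \<theta> * \<pi> \<theta>) = cV * (indicator A \<theta> * hfun \<pi> \<theta>)" for \<theta>
    using assms[of \<theta>] by (cases "\<theta> \<in> par_model Par M") (auto simp: lik_eq hfun_def par_model_def indicator_def)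
  then show ?thesis by (simp add: set_lebesgue_integral_def)
qed

text \<open>If every other model has at most the fraction r of the approximate mass of the true model, then
  together they have at most the fraction 2^p r, and posterior_ratio_bounds applies.\<close>
lemma oracle_single:
  assumes prior: "is_prior p Par w \<pi>" and w0: "0 < w M0" and \<pi>0: "0 < \<pi> M0 \<theta>0"
    and tv: "\<And>B. B \<in> sets borel \<Longrightarrow>
      \<bar>(\<integral>\<theta>. indicator B \<theta> * hfun (\<pi> M0) \<theta> \<partial>leb_model M0) / \<kappa> (\<pi> M0 \<theta>0) - (\<integral>\<theta>. indicator B \<theta> * \<phi> \<theta> \<partial>leb_model M0)\<bar> \<le> E"
    and E: "E \<le> 1 / 2" and I0: "integrable (leb_model M0) (hfun (\<pi> M0))"
    and rest: "\<And>M. M \<subseteq> {..<p} \<Longrightarrow> M \<noteq> M0 \<Longrightarrow> 0 < w M \<Longrightarrow> integrable (leb_model M) (hfun (\<pi> M)) \<and>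
       w M * (\<integral>\<theta>. hfun (\<pi> M) \<theta> \<partial>leb_model M) \<le> r * (w M0 * \<kappa> (\<pi> M0 \<theta>0))" and r: "0 \<le> r"
  shows "\<bar>model_post p Par lik w \<pi> M0 - 1\<bar> \<le> 2 * (2 ^ p * r)"
    and "\<And>A. A \<in> sets borel \<Longrightarrow> A \<subseteq> Par \<Longrightarrow>
      \<bar>par_post p Par lik w \<pi> A - (LINT \<theta>:A \<inter> par_model Par M0|leb_model M0. \<phi> \<theta>)\<bar> \<le> 4 * E + 5 * (2 ^ p * r)"
proof -
  let ?I = "\<lambda>M. \<integral>\<theta>. hfun (\<pi> M) \<theta> \<partial>leb_model M" and ?J = "\<lambda>A M. \<integral>\<theta>. indicator A \<theta> * hfun (\<pi> M) \<theta> \<partial>leb_model M"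
  have pr: "0 \<le> w M" "\<pi> M \<in> borel_measurable borel" "0 \<le> \<pi> M \<theta>" "\<theta> \<notin> par_model Par M \<Longrightarrow> \<pi> M \<theta> = 0" if "M \<subseteq> {..<p}" for M \<theta>
    using prior that by (auto simp: is_prior_def)
  have lint: "(LINT \<theta>:A \<inter> par_model Par M|leb_model M. lik \<theta> * \<pi> M \<theta>) = cV * ?J A M" if "M \<subseteq> {..<p}" for A M
    by (rule model_integral_eq[OF pr(4)[OF that]])
  have ml: "model_lik Par lik \<pi> M = cV * ?I M" if "M \<subseteq> {..<p}" for M
    using lint[OF that, of UNIV] by (simp add: model_lik_def)
  have J: "0 \<le> ?J A M" "w M * ?J A M \<le> w M * ?I M" if M: "M \<subseteq> {..<p}" and A: "A \<in> sets borel" for A M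
  proof -
    show "0 \<le> ?J A M" by (rule Bochner_Integration.integral_nonneg) (simp add: hfun_nonneg pr[OF M])
    show "w M * ?J A M \<le> w M * ?I M"
    proof (cases "w M = 0")
      case False
      then have "0 < w M" using pr(1)[OF M] by simp
      then have i: "integrable (leb_model M) (hfun (\<pi> M))" using rest[OF M] I0 by (cases "M = M0") auto
      have "?J A M \<le> ?I M"
      proof (rule integral_mono[OF _ i])
        show "integrable (leb_model M) (\<lambda>\<theta>. indicator A \<theta> * hfun (\<pi> M) \<theta>)"
          using integrable_mult_indicator[OF _ i, of A] A by simp
        show "indicator A \<theta> * hfun (\<pi> M) \<theta> \<le> hfun (\<pi> M) \<theta>" for \<theta>
          using hfun_nonneg[of "\<pi> M" \<theta>, OF pr(3)[OF M]] by (simp add: indicator_def)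
      qed
      then show ?thesis using pr(1)[OF M] by (rule mult_left_mono)
    qed simp
  qed
  define s where "s = (\<Sum>M\<in>Pow {..<p} - {M0}. w M * ?I M)"
  define sA where "sA A = (\<Sum>M\<in>Pow {..<p} - {M0}. w M * ?J A M)" for A
  have PM0: "M0 \<in> Pow {..<p}" using M0 by simp
  have split: "(\<Sum>M\<in>Pow {..<p}. w M * (cV * F M)) = w M0 * (cV * F M0) + cV * (\<Sum>M\<in>Pow {..<p} - {M0}. w M * F M)" for F :: "nat set \<Rightarrow> real"
    by (subst sum.remove[OF _ PM0]) (auto simp: sum_distrib_left mult_ac)
  have den: "(\<Sum>M\<in>Pow {..<p}. w M * model_lik Par lik \<pi> M) = w M0 * (cV * ?I M0) + cV * s"
    unfolding s_def by (rule trans[OF _ split[of ?I]]) (intro sum.cong refl, simp add: ml)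
  have num: "(\<Sum>M\<in>Pow {..<p}. w M * (LINT \<theta>:A \<inter> par_model Par M|leb_model M. lik \<theta> * \<pi> M \<theta>)) = w M0 * (cV * ?J A M0) + cV * sA A" for A
    unfolding sA_def by (rule trans[OF _ split[of "?J A"]]) (intro sum.cong refl, simp add: lint)
  have sAb: "0 \<le> sA A" "sA A \<le> s" if "A \<in> sets borel" for A
    unfolding sA_def s_def using J[OF _ that] pr by (auto intro!: sum_nonneg sum_mono mult_nonneg_nonneg)
  have K: "0 < \<kappa> (\<pi> M0 \<theta>0)" by (rule kappa_pos[OF \<pi>0])
  have sb: "s \<le> 2 ^ p * r * (w M0 * \<kappa> (\<pi> M0 \<theta>0))"
  proof -
    have t0: "0 \<le> r * (w M0 * \<kappa> (\<pi> M0 \<theta>0))" using r w0 K by simp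
    have "s \<le> (\<Sum>M\<in>Pow {..<p} - {M0}. r * (w M0 * \<kappa> (\<pi> M0 \<theta>0)))"
      unfolding s_def
    proof (rule sum_mono)
      fix M assume M: "M \<in> Pow {..<p} - {M0}"
      show "w M * ?I M \<le> r * (w M0 * \<kappa> (\<pi> M0 \<theta>0))"
        using rest[of M] M t0 pr(1)[of M] by (cases "w M = 0") auto
    qed
    also have "\<dots> \<le> (\<Sum>M\<in>Pow {..<p}. r * (w M0 * \<kappa> (\<pi> M0 \<theta>0)))"
      using t0 by (intro sum_mono2) auto
    also have "\<dots> = 2 ^ p * r * (w M0 * \<kappa> (\<pi> M0 \<theta>0))" by (simp add: card_Pow)
    finally show ?thesis .
  qed
  have U: "\<bar>?I M0 / \<kappa> (\<pi> M0 \<theta>0) - 1\<bar> \<le> E" using tv[of UNIV] by (simp add: phi_integral_eq_1)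
  have JI: "?J A M0 \<le> ?I M0" if "A \<in> sets borel" for A using J(2)[OF M0(1) that] w0 by simp
  have fin: "\<bar>w M0 * (cV * ?I M0) / (w M0 * (cV * ?I M0) + cV * s) - 1\<bar> \<le> 2 * (2 ^ p * r)"
    "\<bar>(w M0 * (cV * ?J A M0) + cV * sA A) / (w M0 * (cV * ?I M0) + cV * s) - (\<integral>\<theta>. indicator A \<theta> * \<phi> \<theta> \<partial>leb_model M0)\<bar> \<le> 4 * E + 5 * (2 ^ p * r)"
    if A: "A \<in> sets borel" for A
    using posterior_ratio_bounds[OF w0 K cV_pos E U tv[OF A] J(1)[OF M0(1) A] JI[OF A] sAb[OF A] sb] by auto
  show "\<bar>model_post p Par lik w \<pi> M0 - 1\<bar> \<le> 2 * (2 ^ p * r)"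
    unfolding model_post_def den ml[OF M0(1)] using fin(1)[of UNIV] by simp
  fix A assume A: "A \<in> sets borel" "A \<subseteq> Par"
  have "(LINT \<theta>:A \<inter> par_model Par M0|leb_model M0. \<phi> \<theta>) = (\<integral>\<theta>. indicator A \<theta> * \<phi> \<theta> \<partial>leb_model M0)"
    unfolding set_lebesgue_integral_def
  proof (rule integral_cong_AE)
    have m: "\<phi> \<in> borel_measurable (leb_model M0)" using phi_measurable by (simp add: measurable_cong_sets[OF sets_leb_model refl])
    show "(\<lambda>\<theta>. indicator A \<theta> * \<phi> \<theta>) \<in> borel_measurable (leb_model M0)" using m A by simp
    have "par_model Par M0 \<in> sets borel"
    proof -
      have "closed (\<Inter>k\<in>- M0. {\<theta> :: nat \<Rightarrow> real. \<theta> k = 0})"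
        by (intro closed_INT ballI closed_Collect_eq continuous_on_subset[OF continuous_on_product_coordinates] continuous_on_const) auto
      moreover have "par_model Par M0 = Par \<inter> (\<Inter>k\<in>- M0. {\<theta>. \<theta> k = 0})" by (auto simp: par_model_def)
      ultimately show ?thesis using Par(2) by auto
    qed
    then show "(\<lambda>\<theta>. indicator (A \<inter> par_model Par M0) \<theta> *\<^sub>R \<phi> \<theta>) \<in> borel_measurable (leb_model M0)" using m A by simp
    show "AE \<theta> in leb_model M0. indicator (A \<inter> par_model Par M0) \<theta> *\<^sub>R \<phi> \<theta> = indicator A \<theta> * \<phi> \<theta>"
      using AE_leb_model[of M0] by eventually_elim (use A in \<open>auto simp: par_model_def indicator_def\<close>)
  qed
  then show "\<bar>par_post p Par lik w \<pi> A - (LINT \<theta>:A \<inter> par_model Par M0|leb_model M0. \<phi> \<theta>)\<bar> \<le> 4 * E + 5 * (2 ^ p * r)"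
    unfolding par_post_def den num using fin(2)[OF A(1)] by simp
qed

end

section \<open>Bounded dimension\<close>

text \<open>
  A density bounded by c\<pi> and supported in the ball of radius R lies below the Gaussian
  c\<pi> exp (4 pi R^2) exp (- 4 pi norm \<theta>^2), whose integral over k coordinates carries the factor
  2^(-k); the factor 4 pi in the exponent is chosen for this.
\<close>
lemma bounded_prior_model_size:
  assumes M: "M \<subseteq> {..<p}" and prior: "is_prior p Par w \<pi>" and w: "0 < w M"
    and c\<pi>: "\<And>\<theta>. \<pi> M \<theta> \<le> c\<pi>" and R: "\<And>\<theta>. \<theta> \<in> Par \<Longrightarrow> vnorm (vec p \<theta>) \<le> R" and R0: "0 \<le> R"
  shows "2 ^ card M \<le> c\<pi> * exp (4 * pi * R\<^sup>2)"
proof -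
  have fM: "finite M" using M finite_subset by blast
  have pr: "\<pi> M \<in> borel_measurable borel" "\<And>\<theta>. 0 \<le> \<pi> M \<theta>" "\<And>\<theta>. \<theta> \<notin> par_model Par M \<Longrightarrow> \<pi> M \<theta> = 0"
    "integrable (leb_model M) (\<pi> M)" "(\<integral>\<theta>. \<pi> M \<theta> \<partial>leb_model M) = 1"
    using prior M w by (auto simp: is_prior_def)
  have c0: "0 \<le> c\<pi>" using c\<pi> pr(2) order_trans by blast
  let ?g = "\<lambda>\<theta>. exp (- (4 * pi * (\<Sum>k\<in>M. (\<theta> k - 0)\<^sup>2)))"
  have le: "\<pi> M \<theta> \<le> c\<pi> * exp (4 * pi * R\<^sup>2) * ?g \<theta>" for \<theta>
  proof (cases "\<theta> \<in> par_model Par M")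
    case True
    have "(\<Sum>k\<in>M. (\<theta> k - 0)\<^sup>2) \<le> (\<Sum>k<p. (\<theta> k)\<^sup>2)" using M by (auto intro!: sum_mono2)
    also have "\<dots> = (vnorm (vec p \<theta>))\<^sup>2" unfolding vnorm_sq by (simp add: scalar_prod_def power2_eq_square lessThan_atLeast0)
    also have "\<dots> \<le> R\<^sup>2" using True R by (intro power_mono) (auto simp: par_model_def)
    finally have "1 \<le> exp (4 * pi * R\<^sup>2) * ?g \<theta>" unfolding exp_add[symmetric] by simp
    then have "c\<pi> * 1 \<le> c\<pi> * (exp (4 * pi * R\<^sup>2) * ?g \<theta>)" using c0 by (rule mult_left_mono)
    then show ?thesis using c\<pi>[of \<theta>] by (simp add: mult.assoc)
  qed (use pr c0 in simp)
  have "ennreal 1 = (\<integral>\<^sup>+ \<theta>. ennreal (\<pi> M \<theta>) \<partial>leb_model M)"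
    using nn_integral_eq_integral[OF pr(4)] pr(2,5) by simp
  also have "\<dots> \<le> (\<integral>\<^sup>+ \<theta>. ennreal (c\<pi> * exp (4 * pi * R\<^sup>2)) * ennreal (?g \<theta>) \<partial>leb_model M)"
    using le c0 by (intro nn_integral_mono) (simp add: ennreal_mult[symmetric] ennreal_leI)
  also have "\<dots> = ennreal (c\<pi> * exp (4 * pi * R\<^sup>2)) * (\<integral>\<^sup>+ \<theta>. ennreal (?g \<theta>) \<partial>leb_model M)"
  proof (rule nn_integral_cmult)
    show "(\<lambda>\<theta>. ennreal (?g \<theta>)) \<in> borel_measurable (leb_model M)"
      unfolding measurable_cong_sets[OF sets_leb_model refl]
      by (intro measurable_compose[OF _ measurable_ennreal] borel_measurable_continuous_onI continuous_intros
        continuous_on_subset[OF continuous_on_product_coordinates]) auto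
  qed
  also have "(\<integral>\<^sup>+ \<theta>. ennreal (?g \<theta>) \<partial>leb_model M) = ennreal ((1 / 2) ^ card M)"
    using gauss_leb_model[OF fM, of "4 * pi" "\<lambda>_. 0"] by (simp add: real_sqrt_divide)
  finally have "1 \<le> c\<pi> * exp (4 * pi * R\<^sup>2) * (1 / 2) ^ card M" using c0 by (simp add: ennreal_mult[symmetric])
  then show ?thesis by (simp add: power_divide field_simps)
qed

text \<open>A positive definite matrix has nonzero diagonal entries, and there are s of them.\<close>
lemma prec_dim_le_model_size:
  assumes ok: "prec_ok s lo hi \<theta>"
  shows "s \<le> card (true_model (tri_dim s) \<theta>)"
proof -
  from ok have fb: "form_bounds s (sym_of_par s \<theta>) lo hi" "0 < lo" by (auto simp: prec_ok_def)
  have inj: "inj_on (\<lambda>i. tri_index i i) {..<s}"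
    by (rule inj_on_inverseI[of _ tri_row]) (simp add: tri_row_index)
  have "(\<lambda>i. tri_index i i) ` {..<s} \<subseteq> true_model (tri_dim s) \<theta>"
  proof (clarsimp simp: true_model_def tri_index_less)
    fix i assume i: "i < s" and z: "\<theta> (tri_index i i) = 0"
    let ?e = "unit_vec s i :: real vec"
    have "lo * (?e \<bullet> ?e) \<le> ?e \<bullet> (sym_of_par s \<theta> *\<^sub>v ?e)" by (rule form_boundsD(3)[OF fb(1)]) simp
    moreover have "?e \<bullet> (sym_of_par s \<theta> *\<^sub>v ?e) = (sym_of_par s \<theta> *\<^sub>v ?e) $ i"
      using i by (intro scalar_prod_left_unit[of _ s] mult_mat_vec_carrier[of _ s s]) auto
    moreover have "(sym_of_par s \<theta> *\<^sub>v ?e) $ i = 0" using i z by (simp add: sym_of_par_def)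
    ultimately show False using i fb(2) by simp
  qed
  from card_mono[OF _ this] show ?thesis using card_image[OF inj] by (simp add: true_model_def)
qed

text \<open>Continuity refers to the product topology on sequences, in which the distance over finitely many
  coordinates is continuous; the Lipschitz bound does the rest.\<close>
lemma prec_map_continuous:
  assumes ok: "\<And>\<theta>. \<theta> \<in> Par \<Longrightarrow> prec_ok s lo hi \<theta>" and k: "k < tri_dim s"
  shows "continuous_on Par (\<lambda>\<theta>. prec_map s \<theta>0 \<theta> $ k)"
  unfolding continuous_on_def
proof
  fix \<theta> assume th: "\<theta> \<in> Par"
  let ?L = "lip_const s lo hi"
  have "continuous_on UNIV (\<lambda>\<theta>'. ?L * sqrt (\<Sum>k<tri_dim s. (\<theta>' k - \<theta> k)\<^sup>2))"
    by (intro continuous_intros continuous_on_subset[OF continuous_on_product_coordinates]) auto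
  then have "((\<lambda>\<theta>'. ?L * sqrt (\<Sum>k<tri_dim s. (\<theta>' k - \<theta> k)\<^sup>2)) \<longlongrightarrow> ?L * sqrt (\<Sum>k<tri_dim s. (\<theta> k - \<theta> k)\<^sup>2)) (at \<theta> within UNIV)"
    unfolding continuous_on_def by blast
  then have lim: "((\<lambda>\<theta>'. ?L * sqrt (\<Sum>k<tri_dim s. (\<theta>' k - \<theta> k)\<^sup>2)) \<longlongrightarrow> 0) (at \<theta> within Par)"
    by (auto intro: tendsto_within_subset)
  have "((\<lambda>\<theta>'. prec_map s \<theta>0 \<theta>' $ k - prec_map s \<theta>0 \<theta> $ k) \<longlongrightarrow> 0) (at \<theta> within Par)"
  proof (rule Lim_null_comparison[OF _ lim])
    show "\<forall>\<^sub>F \<theta>' in at \<theta> within Par. norm (prec_map s \<theta>0 \<theta>' $ k - prec_map s \<theta>0 \<theta> $ k) \<le> ?L * sqrt (\<Sum>k<tri_dim s. (\<theta>' k - \<theta> k)\<^sup>2)"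
      unfolding eventually_at_topological
    proof (intro exI[of _ UNIV] conjI ballI impI)
      fix \<theta>' assume "\<theta>' \<in> Par"
      have "prec_map s \<theta>0 \<theta>' $ k - prec_map s \<theta>0 \<theta> $ k = prec_map s \<theta> \<theta>' $ k"
        using k by (simp add: prec_map_def)
      moreover have "\<bar>prec_map s \<theta> \<theta>' $ k\<bar> \<le> vnorm (prec_map s \<theta> \<theta>')" using k by (intro abs_index_le_vnorm) simp
      moreover have "vnorm (prec_map s \<theta> \<theta>') \<le> ?L * par_dist (tri_dim s) \<theta>' \<theta>"
        by (rule prec_map_upper[OF ok[OF \<open>\<theta>' \<in> Par\<close>] ok[OF th]])
      moreover have "par_dist (tri_dim s) \<theta>' \<theta> = sqrt (\<Sum>k<tri_dim s. (\<theta>' k - \<theta> k)\<^sup>2)"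
        unfolding par_dist_sq[symmetric] by simp
      ultimately show "norm (prec_map s \<theta>0 \<theta>' $ k - prec_map s \<theta>0 \<theta> $ k) \<le> ?L * sqrt (\<Sum>k<tri_dim s. (\<theta>' k - \<theta> k)\<^sup>2)" by simp
    qed auto
  qed
  then show "((\<lambda>\<theta>'. prec_map s \<theta>0 \<theta>' $ k) \<longlongrightarrow> prec_map s \<theta>0 \<theta> $ k) (at \<theta> within Par)" by (rule LIM_zero_cancel)
qed


section \<open>The oracle property for large samples\<close>

text \<open>The limiting normal density as a function of the weight matrix and the mean moments, outside of the locale.\<close>
definition post_density :: "nat \<Rightarrow> real mat \<Rightarrow> real mat \<Rightarrow> real vec \<Rightarrow> (nat \<Rightarrow> real) \<Rightarrow> nat set \<Rightarrow> (nat \<Rightarrow> real) \<Rightarrow> real" where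
  "post_density n G V b \<theta>0 M \<theta> = (let G0 = submatrix G UNIV M; S = minv (G0\<^sup>T * minv V * G0) in
     mvn_density (subvec M \<theta>0 - S *\<^sub>v (G0\<^sup>T *\<^sub>v (minv V *\<^sub>v b))) ((1 / real n) \<cdot>\<^sub>m S) (subvec M \<theta>))"

text \<open>All constants are chosen before the quantification over V and b, so the threshold for n does not
  depend on the sample.\<close>
lemma oracle_eventually:
  fixes P :: nat and p :: "nat \<Rightarrow> nat"
  assumes loc: "\<And>n V b. 0 < n \<Longrightarrow> form_bounds (p n) V lo hi \<Longrightarrow> b \<in> carrier_vec (p n) \<Longrightarrow> vnorm b \<le> T / sqrt (real n) \<Longrightarrow>
       quasi_post_model n (p n) (Par n) (\<theta>0 n) (f n) (G n) V b lo hi L Kq T (true_model (p n) (\<theta>0 n))"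
    and lo: "0 < lo" and hi: "0 < hi" and L: "0 < L" and p: "\<And>n. 1 \<le> p n" "\<And>n. p n \<le> P"
    and A3: "cond_A3 p \<theta>0" and A7: "cond_A7 p Par \<theta>0 pM pT" and A8: "cond_A8 p \<theta>0 pM"
    and r0: "0 < r0" "\<And>n \<theta>. \<theta> \<in> par_space (p n) \<Longrightarrow> par_dist (p n) \<theta> (\<theta>0 n) < r0 \<Longrightarrow> \<theta> \<in> Par n"
    and e: "0 < e"
  defines "M0 \<equiv> \<lambda>n. true_model (p n) (\<theta>0 n)"
  shows "\<forall>\<^sub>F n in sequentially. \<forall>V b. form_bounds (p n) V lo hi \<longrightarrow> b \<in> carrier_vec (p n) \<longrightarrow> vnorm b \<le> T / sqrt (real n) \<longrightarrow>
     \<bar>model_post (p n) (Par n) (\<lambda>\<theta>. quasi_lik n V (b + f n \<theta>)) (pM n) (pT n) (M0 n) - 1\<bar> < e \<and>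
     (\<forall>A\<in>sets borel. A \<subseteq> Par n \<longrightarrow>
       \<bar>par_post (p n) (Par n) (\<lambda>\<theta>. quasi_lik n V (b + f n \<theta>)) (pM n) (pT n) A
         - (LINT \<theta>:A \<inter> par_model (Par n) (M0 n)|leb_model (M0 n). post_density n (G n) V b (\<theta>0 n) (M0 n) \<theta>)\<bar> \<le> 3 / 4 * e)"
proof -
  have M0p: "M0 n \<subseteq> {..<p n}" for n by (auto simp: M0_def true_model_def)
  have cardP: "card M \<le> P" if "M \<subseteq> {..<p n}" for M n
    using card_mono[OF _ that] p(2)[of n] by simp
  have prior: "is_prior (p n) (Par n) (pM n) (pT n)" for n
    using A7 by (simp add: cond_A7_def Let_def)
  have "\<exists>c\<pi>::real. \<forall>n. \<forall>M\<subseteq>{..<p n}. \<forall>\<theta>. pT n M \<theta> \<le> c\<pi>"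
    using A7 unfolding cond_A7_def Let_def by (elim conjE)
  then obtain c\<pi> where c\<pi>: "\<And>n M \<theta>. M \<subseteq> {..<p n} \<Longrightarrow> pT n M \<theta> \<le> c\<pi>" by blast
  have A7ii: "\<forall>C>0. \<forall>e>0. \<forall>\<^sub>F n in sequentially. \<forall>M. M0 n \<subseteq> M \<and> M \<subseteq> {..<p n} \<longrightarrow>
         (\<forall>\<theta>\<in>par_model (Par n) M \<inter> par_ball (p n) (Par n) (\<theta>0 n) (C * eps p n).
            0 < pT n M \<theta> \<and> \<bar>ln (pT n M \<theta>) - ln (pT n M (\<theta>0 n))\<bar> < e)"
    using A7 unfolding cond_A7_def Let_def M0_def by (elim conjE)
  have "\<exists>c0>0. \<exists>c1>0. \<forall>n M. M0 n \<subseteq> M \<and> M \<subseteq> {..<p n} \<longrightarrow> exp (- c0 * real (card M)) \<le> pT n M (\<theta>0 n) \<and>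
         \<bar>ln (pT n M (\<theta>0 n)) - ln (pT n (M0 n) (\<theta>0 n))\<bar> \<le> c1 * (real (card M) - real (card (M0 n)))"
    using A7 unfolding cond_A7_def Let_def M0_def by (elim conjE)
  then obtain c0 c1 where c0': "0 < c0" and h: "\<forall>n M. M0 n \<subseteq> M \<and> M \<subseteq> {..<p n} \<longrightarrow> exp (- c0 * real (card M)) \<le> pT n M (\<theta>0 n) \<and>
         \<bar>ln (pT n M (\<theta>0 n)) - ln (pT n (M0 n) (\<theta>0 n))\<bar> \<le> c1 * (real (card M) - real (card (M0 n)))"
    by (elim exE conjE)
  have c0: "0 < c0" "\<And>n. exp (- c0 * real (card (M0 n))) \<le> pT n (M0 n) (\<theta>0 n)"
    using c0' h[rule_format, OF conjI[OF order_refl M0p]] by auto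
  have pM0: "\<And>n. 0 < pM n (M0 n)" using A8 by (simp add: cond_A8_def Let_def M0_def)
  have c\<pi>0: "0 \<le> c\<pi>"
    using c\<pi>[OF M0p] c0(2) exp_gt_zero by (meson less_le_trans less_imp_le)
  define cc where "cc = 1 / (8 * hi * L\<^sup>2)"
  have cc: "0 < cc" using hi L by (simp add: cc_def)
  define CC where "CC = exp (T\<^sup>2 / (2 * hi))"
  define x where "x = L\<^sup>2 / lo / (2 * pi)"
  have x: "0 < x" using L lo by (simp add: x_def)
  obtain B1 where B1: "0 < B1" "\<And>k. k \<le> P \<Longrightarrow> sqrt x ^ k * sqrt (pi / cc) ^ k * exp (T\<^sup>2 / (2 * lo)) * CC \<le> B1"
    using bounded_on_initial_segment[of P "\<lambda>k. sqrt x ^ k * sqrt (pi / cc) ^ k * exp (T\<^sup>2 / (2 * lo)) * CC"] by blast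
  obtain B2 where B2: "0 < B2" "\<And>k. k \<le> P \<Longrightarrow> sqrt x ^ k \<le> B2"
    using bounded_on_initial_segment[of P "\<lambda>k. sqrt x ^ k"] by blast
  obtain B3 where B3: "0 < B3" "\<And>k. k \<le> P \<Longrightarrow> c\<pi> * CC * sqrt (pi / (2 * cc)) ^ k \<le> B3"
    using bounded_on_initial_segment[of P "\<lambda>k. c\<pi> * CC * sqrt (pi / (2 * cc)) ^ k"] by blast
  \<comment> \<open>The total error is at most 4 e1 + 5 e1, below 3 / 4 e.\<close>
  define e1 where "e1 = min (1 / 2) (e / 16)"
  have e1: "0 < e1" "e1 \<le> 1 / 2" "e1 \<le> e / 16" using e by (auto simp: e1_def)
  \<comment> \<open>A bound for the ratio of the prior density to its value at \<theta>0, as that value is at least exp (- c0 P).\<close>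
  define c\<rho> where "c\<rho> = c\<pi> * exp (c0 * real P)"
  have c\<rho>: "0 \<le> c\<rho>" using c\<pi>0 by (simp add: c\<rho>_def)
  \<comment> \<open>One half of e1 is spent on the neighbourhood of \<theta>0, the other half on the tails beyond R / sqrt n.\<close>
  define \<epsilon> where "\<epsilon> = min (1 / 2) (e1 / (8 * B1))"
  have \<epsilon>: "0 < \<epsilon>" "\<epsilon> \<le> 1 / 2" "B1 * (4 * \<epsilon>) \<le> e1 / 2"
  proof -
    show "0 < \<epsilon>" "\<epsilon> \<le> 1 / 2" using e1 B1 by (auto simp: \<epsilon>_def)
    have "B1 * (4 * \<epsilon>) \<le> B1 * (4 * (e1 / (8 * B1)))" using B1 by (intro mult_left_mono) (auto simp: \<epsilon>_def)
    then show "B1 * (4 * \<epsilon>) \<le> e1 / 2" using B1 by simp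
  qed
  define \<tau> where "\<tau> = e1 / (2 * B1 * (1 + c\<rho>))"
  have \<tau>: "0 < \<tau>" "B1 * ((1 + c\<rho>) * \<tau>) = e1 / 2" using e1 B1 c\<rho> by (auto simp: \<tau>_def)
  have "((\<lambda>R::real. exp (- (cc * R\<^sup>2))) \<longlongrightarrow> 0) at_top" using cc by real_asymp
  then have "\<forall>\<^sub>F R in at_top. exp (- (cc * R\<^sup>2)) < \<tau>" using \<tau>(1) by (rule order_tendstoD)
  then have "\<forall>\<^sub>F R in at_top. exp (- (cc * R\<^sup>2)) < \<tau> \<and> (0::real) \<le> R"
    using eventually_ge_at_top[of "0::real"] by eventually_elim simp
  then obtain R where R: "0 \<le> R" "exp (- (cc * R\<^sup>2)) < \<tau>"
    by (auto simp: eventually_at_top_linorder)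
  \<comment> \<open>A lower bound for sqrt n to the power card M0 times the approximate mass of the true model.\<close>
  define m where "m = exp (- c0 * real P) * exp (- (T\<^sup>2 / (2 * lo))) / B2"
  have m: "0 < m" using B2 by (simp add: m_def)
  \<comment> \<open>The fraction allowed to each of the at most 2^P other models.\<close>
  define r where "r = e1 / 2 ^ P"
  have r: "0 < r" using e1 by (simp add: r_def)
  have r2: "2 ^ p n * r \<le> e1" for n
  proof -
    have "(2::real) ^ p n * r \<le> 2 ^ P * r" using p(2)[of n] r by (intro mult_right_mono power_increasing) auto
    then show ?thesis by (simp add: r_def)
  qed
  define \<tau>2 where "\<tau>2 = r * m / B3"
  have \<tau>2: "0 < \<tau>2" "\<tau>2 * B3 = r * m" using r m B3 by (auto simp: \<tau>2_def)
  have F2: "\<forall>\<^sub>F n in sequentially. R / sqrt (real n) < r0"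
  proof -
    have "(\<lambda>n. R / sqrt (real n)) \<longlonglongrightarrow> 0" by real_asymp
    then show ?thesis using r0(1) by (rule order_tendstoD)
  qed
  have F3: "\<forall>\<^sub>F n in sequentially. Kq * R\<^sup>2 * (2 * T + 2 * L * R + Kq * R\<^sup>2) / (2 * lo) / sqrt (real n) < \<epsilon>"
  proof -
    have "(\<lambda>n. Kq * R\<^sup>2 * (2 * T + 2 * L * R + Kq * R\<^sup>2) / (2 * lo) / sqrt (real n)) \<longlonglongrightarrow> 0" by real_asymp
    then show ?thesis using \<epsilon>(1) by (rule order_tendstoD)
  qed
  \<comment> \<open>The prior condition concerns balls with radius of order eps, which is at least 1 / sqrt n; they
    are open, hence R + 1.\<close>
  have F4: "\<forall>\<^sub>F n in sequentially. \<forall>M. M0 n \<subseteq> M \<and> M \<subseteq> {..<p n} \<longrightarrow>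
         (\<forall>\<theta>\<in>par_model (Par n) M \<inter> par_ball (p n) (Par n) (\<theta>0 n) ((R + 1) * eps p n).
            0 < pT n M \<theta> \<and> \<bar>ln (pT n M \<theta>) - ln (pT n M (\<theta>0 n))\<bar> < \<epsilon>)"
    using R \<epsilon> by (intro A7ii[THEN spec, THEN mp, THEN spec, THEN mp]) auto
  have F5: "\<forall>\<^sub>F n in sequentially. \<forall>M. M0 n \<subset> M \<and> M \<subseteq> {..<p n} \<longrightarrow>
      pM n M / pM n (M0 n) * (real (p n) / sqrt (real n)) ^ (card M - card (M0 n)) \<le> \<tau>2"
  proof -
    have "(\<lambda>n. SUP M\<in>{M. M0 n \<subset> M \<and> M \<subseteq> {..<p n}}.
         ennreal (pM n M / pM n (M0 n) * (real (p n) / sqrt (real n)) ^ (card M - card (M0 n)))) \<longlonglongrightarrow> 0"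
      using A8 by (simp add: cond_A8_def Let_def M0_def)
    then have "\<forall>\<^sub>F n in sequentially. (SUP M\<in>{M. M0 n \<subset> M \<and> M \<subseteq> {..<p n}}.
         ennreal (pM n M / pM n (M0 n) * (real (p n) / sqrt (real n)) ^ (card M - card (M0 n)))) < ennreal \<tau>2"
      using \<tau>2 by (intro order_tendstoD) auto
    then show ?thesis
    proof eventually_elim
      case (elim n)
      show ?case
      proof (intro allI impI)
        fix M assume "M0 n \<subset> M \<and> M \<subseteq> {..<p n}"
        then have "ennreal (pM n M / pM n (M0 n) * (real (p n) / sqrt (real n)) ^ (card M - card (M0 n))) < ennreal \<tau>2"
          by (intro le_less_trans[OF SUP_upper elim]) auto
        then show "pM n M / pM n (M0 n) * (real (p n) / sqrt (real n)) ^ (card M - card (M0 n)) \<le> \<tau>2"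
          by (meson ennreal_leI linorder_not_le less_imp_le)
      qed
    qed
  qed
  obtain r1 K where r1: "0 < r1" and F6: "\<forall>\<^sub>F n in sequentially. \<forall>M\<subseteq>{..<p n}. M0 n - M \<noteq> {} \<longrightarrow>
         pM n M / pM n (M0 n) \<le> K * exp (r1 * real (p n) * ln (real n))"
    using A8 unfolding cond_A8_def Let_def M0_def by blast
  \<comment> \<open>In the exponent of n, the term r1 P outweighs the prior odds, P outweighs the mass of the true
    model, which is of order n^(- card M0 / 2), and 1 is left over as decay.\<close>
  define a where "a = r1 * real P + real P + 1"
  have a: "0 < a" using r1 by (simp add: a_def add_nonneg_pos)
  \<comment> \<open>Chosen such that 2 cc n \<theta>min^2 \<ge> a ln n as soon as sqrt (ln n) eps \<le> \<gamma> \<theta>min.\<close>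
  define \<gamma> where "\<gamma> = sqrt (2 * cc / a)"
  have \<gamma>: "0 < \<gamma>" "\<gamma>\<^sup>2 = 2 * cc / a" using cc a by (auto simp: \<gamma>_def)
  define \<theta>min where "\<theta>min n = Min ((\<lambda>j. \<bar>\<theta>0 n j\<bar>) ` M0 n)" for n
  have F7: "\<forall>\<^sub>F n in sequentially. norm (sqrt (ln (real n)) * eps p n) \<le> \<gamma> * norm (\<theta>min n)"
  proof -
    have "(\<lambda>n. sqrt (ln (real n)) * eps p n) \<in> o(\<theta>min)"
      using A3 by (simp add: cond_A3_def Let_def \<theta>min_def[abs_def] M0_def)
    from landau_o.smallD[OF this \<gamma>(1)] show ?thesis .
  qed
  have F8: "\<forall>\<^sub>F n in sequentially. \<bar>K\<bar> * CC / real n < r * m"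
  proof -
    have "(\<lambda>n. \<bar>K\<bar> * CC / real n) \<longlonglongrightarrow> 0" by real_asymp
    then show ?thesis using mult_pos_pos[OF r m] by (rule order_tendstoD)
  qed
  show ?thesis
    using eventually_gt_at_top[of 0] F2 F3 F4 F5 F6 F7 F8
  proof eventually_elim
    case (elim n)
    note n = elim(1)
    show ?case
    proof (intro allI impI)
      fix V b assume Vb: "form_bounds (p n) V lo hi" "b \<in> carrier_vec (p n)" "vnorm b \<le> T / sqrt (real n)"
      interpret Q: quasi_post_model n "p n" "Par n" "\<theta>0 n" "f n" "G n" V b lo hi L Kq T "M0 n"
        unfolding M0_def by (rule loc[OF n Vb])
      have Qc: "Q.c = cc" "Q.CT = CC" by (simp_all add: Q.c_def cc_def Q.CT_def CC_def)
      have sn: "1 \<le> sqrt (real n)" "0 < sqrt (real n)" using n by auto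
      have pr: "0 \<le> pM n M" "pT n M \<in> borel_measurable borel" "0 \<le> pT n M \<theta>" "\<theta> \<notin> par_model (Par n) M \<Longrightarrow> pT n M \<theta> = 0"
        "0 < pM n M \<Longrightarrow> integrable (leb_model M) (pT n M)" "0 < pM n M \<Longrightarrow> (\<integral>\<theta>. pT n M \<theta> \<partial>leb_model M) = 1"
        if "M \<subseteq> {..<p n}" for M \<theta>
        using prior[of n] that by (auto simp: is_prior_def)
      have \<pi>0: "exp (- c0 * real P) \<le> pT n (M0 n) (\<theta>0 n)"
      proof -
        have "exp (- c0 * real P) \<le> exp (- c0 * real (card (M0 n)))" using c0(1) cardP[OF M0p, of n] by simp
        then show ?thesis using c0(2)[of n] by linarith
      qed
      then have \<pi>0p: "0 < pT n (M0 n) (\<theta>0 n)" using exp_gt_zero less_le_trans by blast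
      have crho: "pT n (M0 n) \<theta> \<le> c\<rho> * pT n (M0 n) (\<theta>0 n)" for \<theta>
      proof -
        have "c\<pi> = c\<rho> * exp (- c0 * real P)" by (simp add: c\<rho>_def exp_add[symmetric] mult.assoc)
        also have "\<dots> \<le> c\<rho> * pT n (M0 n) (\<theta>0 n)" using \<pi>0 c\<rho> by (intro mult_left_mono)
        finally show ?thesis using c\<pi>[OF M0p, of n \<theta>] by linarith
      qed
      have near: "\<theta> \<in> Par n \<and> 0 < pT n (M0 n) \<theta> \<and> \<bar>ln (pT n (M0 n) \<theta>) - ln (pT n (M0 n) (\<theta>0 n))\<bar> \<le> \<epsilon>"
        if th: "\<And>k. k \<notin> M0 n \<Longrightarrow> \<theta> k = 0" and d: "sqrt (real n) * par_dist (p n) \<theta> (\<theta>0 n) \<le> R" for \<theta>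
      proof -
        have d': "par_dist (p n) \<theta> (\<theta>0 n) \<le> R / sqrt (real n)" using d sn by (simp add: field_simps)
        have "k \<notin> M0 n" if "p n \<le> k" for k using M0p[of n] that by auto
        then have sp: "\<theta> \<in> par_space (p n)" using th by (simp add: par_space_def)
        have P1: "\<theta> \<in> Par n" using d' elim(2) by (intro r0(2)[OF sp]) linarith
        have "R / sqrt (real n) < (R + 1) / sqrt (real n)" using sn by (simp add: divide_strict_right_mono)
        also have "\<dots> \<le> (R + 1) * eps p n"
        proof -
          have "1 / sqrt (real n) \<le> eps p n"
            unfolding eps_def real_sqrt_divide using p(1)[of n] by (intro divide_right_mono) auto
          from mult_left_mono[OF this, of "R + 1"] R show ?thesis by simp
        qed
        finally have "\<theta> \<in> par_model (Par n) (M0 n) \<inter> par_ball (p n) (Par n) (\<theta>0 n) ((R + 1) * eps p n)"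
          using d' P1 th by (auto simp: par_model_def par_ball_def)
        from elim(4)[rule_format, OF conjI[OF order_refl M0p] this] show ?thesis using P1 by auto
      qed
      have tvE: "Q.TV \<epsilon> R c\<rho> \<le> e1"
      proof -
        have "Q.TV \<epsilon> R c\<rho> = (sqrt x ^ card (M0 n) * sqrt (pi / cc) ^ card (M0 n) * exp (T\<^sup>2 / (2 * lo)) * CC) * (4 * \<epsilon> + (1 + c\<rho>) * exp (- (cc * R\<^sup>2)))"
          by (simp add: Q.TV_def Qc x_def)
        also have "\<dots> \<le> B1 * (4 * \<epsilon> + (1 + c\<rho>) * \<tau>)"
          using B1(2)[OF cardP[OF M0p, of n]] R(2) c\<rho> \<epsilon>(1) B1(1) by (intro mult_mono add_left_mono mult_left_mono) auto
        also have "\<dots> = B1 * (4 * \<epsilon>) + B1 * ((1 + c\<rho>) * \<tau>)" by (simp add: distrib_left)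
        also have "\<dots> \<le> e1" using \<epsilon>(3) \<tau>(2) by linarith
        finally show ?thesis .
      qed
      have tv: "\<bar>(\<integral>\<theta>. indicator B \<theta> * Q.hfun (pT n (M0 n)) \<theta> \<partial>leb_model (M0 n)) / Q.\<kappa> (pT n (M0 n) (\<theta>0 n)) - (\<integral>\<theta>. indicator B \<theta> * Q.\<phi> \<theta> \<partial>leb_model (M0 n))\<bar> \<le> e1"
        if "B \<in> sets borel" for B
        by (rule order_trans[OF Q.total_variation_bound[of \<epsilon> R "pT n (M0 n)" c\<rho> B, OF less_imp_le[OF \<epsilon>(1)] \<epsilon>(2) R(1) pr(2)[OF M0p] \<pi>0p pr(3)[OF M0p] crho c\<rho> near less_imp_le[OF elim(3)] that] tvE]; simp)
      let ?k = "card (M0 n)"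
      have kap: "m / sqrt (real n) ^ ?k \<le> Q.\<kappa> (pT n (M0 n) (\<theta>0 n))"
      proof -
        have "m / sqrt (real n) ^ ?k = exp (- c0 * real P) * exp (- (T\<^sup>2 / (2 * lo))) / (sqrt (real n) ^ ?k * B2)" by (simp add: m_def mult.commute)
        also have "\<dots> \<le> pT n (M0 n) (\<theta>0 n) * exp (- (T\<^sup>2 / (2 * lo))) / (sqrt (real n) ^ ?k * sqrt x ^ ?k)"
          using \<pi>0 \<pi>0p B2(2)[OF cardP[OF M0p, of n]] sn x by (intro frac_le mult_right_mono mult_left_mono) auto
        also have "\<dots> \<le> Q.\<kappa> (pT n (M0 n) (\<theta>0 n))" using Q.kappa_lower[OF \<pi>0p] by (simp add: x_def)
        finally show ?thesis .
      qed
      have goal: "u \<le> r * (pM n (M0 n) * Q.\<kappa> (pT n (M0 n) (\<theta>0 n)))" if "u \<le> r * m * pM n (M0 n) / sqrt (real n) ^ ?k" for u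
      proof -
        have "r * pM n (M0 n) * (m / sqrt (real n) ^ ?k) \<le> r * pM n (M0 n) * Q.\<kappa> (pT n (M0 n) (\<theta>0 n))"
          using r pM0[of n] by (intro mult_left_mono kap) auto
        then show ?thesis using that by (simp add: mult_ac)
      qed
      have rest: "integrable (leb_model M) (Q.hfun (pT n M)) \<and>
         pM n M * (\<integral>\<theta>. Q.hfun (pT n M) \<theta> \<partial>leb_model M) \<le> r * (pM n (M0 n) * Q.\<kappa> (pT n (M0 n) (\<theta>0 n)))"
        if M: "M \<subseteq> {..<p n}" "M \<noteq> M0 n" "0 < pM n M" for M
      proof (cases "M0 n \<subseteq> M")
        case True
        then have ps: "M0 n \<subset> M" using M by blast
        note sb = Q.superset_model_bound[OF True M(1) pr(2)[OF M(1)] pr(3)[OF M(1)] c\<pi>[OF M(1)]]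
        define \<delta> where "\<delta> = card M - ?k"
        have cM: "card M = ?k + \<delta>"
          using card_mono[OF _ True] M(1) finite_subset[OF M(1)] by (simp add: \<delta>_def)
        have "(\<integral>\<theta>. Q.hfun (pT n M) \<theta> \<partial>leb_model M) \<le> c\<pi> * CC * sqrt (pi / (2 * cc * real n)) ^ card M" using sb(2) by (simp add: Qc)
        also have "sqrt (pi / (2 * cc * real n)) = sqrt (pi / (2 * cc)) / sqrt (real n)" by (simp add: real_sqrt_divide real_sqrt_mult)
        also have "c\<pi> * CC * (sqrt (pi / (2 * cc)) / sqrt (real n)) ^ card M = (c\<pi> * CC * sqrt (pi / (2 * cc)) ^ card M) / sqrt (real n) ^ card M"
          by (simp add: power_divide)
        also have "\<dots> \<le> B3 / sqrt (real n) ^ card M" using B3(2)[OF cardP[OF M(1)]] sn by (intro divide_right_mono) auto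
        finally have I: "(\<integral>\<theta>. Q.hfun (pT n M) \<theta> \<partial>leb_model M) \<le> B3 / sqrt (real n) ^ card M" .
        have w: "pM n M * (1 / sqrt (real n)) ^ \<delta> \<le> \<tau>2 * pM n (M0 n)"
        proof -
          have "(1 / sqrt (real n)) ^ \<delta> \<le> (real (p n) / sqrt (real n)) ^ \<delta>"
            using p(1)[of n] sn by (intro power_mono divide_right_mono) auto
          then have "pM n M * (1 / sqrt (real n)) ^ \<delta> \<le> pM n M * (real (p n) / sqrt (real n)) ^ \<delta>" using M(3) by (intro mult_left_mono) auto
          also have "\<dots> = pM n M / pM n (M0 n) * (real (p n) / sqrt (real n)) ^ \<delta> * pM n (M0 n)" using pM0[of n] by simp
          also have "\<dots> \<le> \<tau>2 * pM n (M0 n)" using elim(5) ps M(1) pM0[of n] unfolding \<delta>_def by (intro mult_right_mono) auto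
          finally show ?thesis .
        qed
        have "pM n M * (\<integral>\<theta>. Q.hfun (pT n M) \<theta> \<partial>leb_model M) \<le> pM n M * (B3 / sqrt (real n) ^ card M)"
          using M(3) by (intro mult_left_mono I) auto
        also have "\<dots> = (pM n M * (1 / sqrt (real n)) ^ \<delta>) * (B3 / sqrt (real n) ^ ?k)" by (simp add: cM power_add power_divide)
        also have "\<dots> \<le> (\<tau>2 * pM n (M0 n)) * (B3 / sqrt (real n) ^ ?k)" using w B3 sn by (intro mult_right_mono) auto
        also have "\<dots> = (\<tau>2 * B3) * pM n (M0 n) / sqrt (real n) ^ ?k" by simp
        finally show ?thesis using sb(1) goal unfolding \<tau>2(2) by blast
      next
        case False
        then obtain j where j: "j \<in> M0 n" "j \<notin> M" by blast
        have jp: "j < p n" using j M0p by blast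
        have fin: "finite (M0 n)" using M0p finite_subset by blast
        have tmin: "0 \<le> \<theta>min n" "\<theta>min n \<le> \<bar>\<theta>0 n j\<bar>"
        proof -
          have "M0 n \<noteq> {}" using j by blast
          then show "0 \<le> \<theta>min n" unfolding \<theta>min_def using fin by (subst Min_ge_iff) auto
          show "\<theta>min n \<le> \<bar>\<theta>0 n j\<bar>" unfolding \<theta>min_def using fin j by (intro Min_le) auto
        qed
        have dist: "\<theta>min n \<le> par_dist (p n) \<theta> (\<theta>0 n)" if "\<theta> \<in> par_model (Par n) M" for \<theta>
        proof -
          have "\<bar>\<theta>0 n j\<bar> = \<bar>(vec (p n) \<theta> - vec (p n) (\<theta>0 n)) $ j\<bar>" using that j jp by (simp add: par_model_def)
          also have "\<dots> \<le> par_dist (p n) \<theta> (\<theta>0 n)" unfolding par_dist_def using jp by (intro abs_index_le_vnorm) simp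
          finally show ?thesis using tmin by linarith
        qed
        note ob = Q.other_model_bound[OF pr(2)[OF M(1)] pr(3)[OF M(1)] pr(4)[OF M(1)] pr(5)[OF M(1,3)] pr(6)[OF M(1,3)] tmin(1) dist]
        have ln0: "0 \<le> ln (real n)" using n by simp
        have al: "a * ln (real n) \<le> 2 * cc * real n * (\<theta>min n)\<^sup>2"
        proof -
          have "(sqrt (ln (real n)) * eps p n)\<^sup>2 \<le> (\<gamma> * \<theta>min n)\<^sup>2"
            using elim(7) tmin ln0 by (intro power_mono) (auto simp: eps_def)
          then have "ln (real n) * (real (p n) / real n) \<le> 2 * cc / a * (\<theta>min n)\<^sup>2"
            using ln0 by (simp add: power_mult_distrib eps_def \<gamma>(2))
          then have "ln (real n) * real (p n) \<le> 2 * cc / a * (\<theta>min n)\<^sup>2 * real n" using n by (simp add: field_simps)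
          moreover have "ln (real n) \<le> ln (real n) * real (p n)" using ln0 p(1)[of n] mult_left_mono[of 1 "real (p n)" "ln (real n)"] by simp
          ultimately have "ln (real n) \<le> 2 * cc / a * (\<theta>min n)\<^sup>2 * real n" by linarith
          then show ?thesis using a by (simp add: field_simps)
        qed
        have I: "(\<integral>\<theta>. Q.hfun (pT n M) \<theta> \<partial>leb_model M) \<le> CC * exp (- (a * ln (real n)))"
        proof -
          have "CC * exp (- (2 * cc * real n * (\<theta>min n)\<^sup>2)) \<le> CC * exp (- (a * ln (real n)))" using al by (simp add: CC_def)
          then show ?thesis using ob(2) unfolding Qc by linarith
        qed
        have w: "pM n M \<le> pM n (M0 n) * (\<bar>K\<bar> * exp (r1 * real P * ln (real n)))"
        proof -
          have "pM n M / pM n (M0 n) \<le> K * exp (r1 * real (p n) * ln (real n))" using elim(6) M(1) j by blast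
          also have "\<dots> \<le> \<bar>K\<bar> * exp (r1 * real P * ln (real n))"
            using r1 p(2)[of n] ln0 by (intro mult_mono) (auto intro!: mult_right_mono)
          finally show ?thesis using pM0[of n] by (simp add: field_simps)
        qed
        have en: "exp (r1 * real P * ln (real n)) * exp (- (a * ln (real n))) = 1 / (real n * real n ^ P)"
        proof -
          have "exp (r1 * real P * ln (real n)) * exp (- (a * ln (real n))) = exp (- (real (Suc P) * ln (real n)))"
            unfolding exp_add[symmetric] by (simp add: a_def algebra_simps)
          also have "\<dots> = 1 / exp (ln (real n)) ^ Suc P" unfolding exp_of_nat_mult[symmetric] by (simp add: exp_minus inverse_eq_divide)
          finally show ?thesis using n by simp
        qed
        have "pM n M * (\<integral>\<theta>. Q.hfun (pT n M) \<theta> \<partial>leb_model M) \<le> pM n (M0 n) * (\<bar>K\<bar> * exp (r1 * real P * ln (real n))) * (CC * exp (- (a * ln (real n))))"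
          using w I M(3) pM0[of n] Q.hfun_nonneg[of "pT n M", OF pr(3)[OF M(1)]]
          by (intro mult_mono[OF w I]) (auto intro!: Bochner_Integration.integral_nonneg)
        also have "\<dots> = pM n (M0 n) * (\<bar>K\<bar> * CC) * (exp (r1 * real P * ln (real n)) * exp (- (a * ln (real n))))" by (simp add: mult_ac)
        also have "\<dots> = pM n (M0 n) * (\<bar>K\<bar> * CC / real n) / real n ^ P" unfolding en by simp
        also have "\<dots> \<le> pM n (M0 n) * (r * m) / sqrt (real n) ^ ?k"
        proof (rule frac_le)
          show "pM n (M0 n) * (\<bar>K\<bar> * CC / real n) \<le> pM n (M0 n) * (r * m)"
            using elim(8) pM0[of n] by (intro mult_left_mono) auto
          have "sqrt (real n) ^ ?k \<le> sqrt (real n) ^ P" using sn cardP[OF M0p, of n] by (intro power_increasing) auto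
          also have "\<dots> \<le> real n ^ P" using sn mult_left_mono[of 1 "sqrt (real n)" "sqrt (real n)"] by (intro power_mono) auto
          finally show "sqrt (real n) ^ ?k \<le> real n ^ P" .
        qed (use pM0[of n] sn r m in auto)
        finally have "pM n M * (\<integral>\<theta>. Q.hfun (pT n M) \<theta> \<partial>leb_model M) \<le> r * m * pM n (M0 n) / sqrt (real n) ^ ?k" by (simp add: mult_ac)
        then show ?thesis using ob(1) goal by blast
      qed
      have I0: "integrable (leb_model (M0 n)) (Q.hfun (pT n (M0 n)))"
        by (rule Q.superset_model_bound(1)[OF order_refl M0p pr(2)[OF M0p] pr(3)[OF M0p] c\<pi>[OF M0p]])
      note os = Q.oracle_single[OF prior pM0 \<pi>0p tv e1(2) I0 rest less_imp_le[OF r]]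
      have lik: "Q.lik = (\<lambda>\<theta>. quasi_lik n V (b + f n \<theta>))" by (rule ext) (simp add: Q.lik_def)
      have phi: "Q.\<phi> = post_density n (G n) V b (\<theta>0 n) (M0 n)"
        by (rule ext) (simp add: Q.\<phi>_def post_density_def Q.\<mu>_def Q.A_def Q.G0_def Let_def)
      show "\<bar>model_post (p n) (Par n) (\<lambda>\<theta>. quasi_lik n V (b + f n \<theta>)) (pM n) (pT n) (M0 n) - 1\<bar> < e \<and>
        (\<forall>A\<in>sets borel. A \<subseteq> Par n \<longrightarrow>
         \<bar>par_post (p n) (Par n) (\<lambda>\<theta>. quasi_lik n V (b + f n \<theta>)) (pM n) (pT n) A
         - (LINT \<theta>:A \<inter> par_model (Par n) (M0 n)|leb_model (M0 n). post_density n (G n) V b (\<theta>0 n) (M0 n) \<theta>)\<bar> \<le> 3 / 4 * e)"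
        using os[unfolded lik phi] r2[of n] e1 by fastforce
    qed
  qed
qed

lemma compact_norm_bounded:
  assumes "compact Par" "\<theta> \<in> Par"
  shows "vnorm (vec p \<theta>) \<le> (SUP \<theta>\<in>Par. vnorm (vec p \<theta>))"
proof (rule cSUP_upper[OF assms(2)])
  have eq: "vnorm (vec p \<theta>) = sqrt (\<Sum>k<p. (\<theta> k)\<^sup>2)" for \<theta>
    by (simp add: vnorm_def scalar_prod_def power2_eq_square lessThan_atLeast0)
  have "continuous_on Par (\<lambda>\<theta>. vnorm (vec p \<theta>))"
    unfolding eq by (intro continuous_intros continuous_on_subset[OF continuous_on_product_coordinates]) auto
  then have "compact ((\<lambda>\<theta>. vnorm (vec p \<theta>)) ` Par)" using assms(1) by (rule compact_continuous_image)
  then show "bdd_above ((\<lambda>\<theta>. vnorm (vec p \<theta>)) ` Par)" by (intro bounded_imp_bdd_above compact_imp_bounded)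
qed

lemma sample_mean_prec_moment:
  assumes "0 < n"
  shows "sample_mean (tri_dim s) n (\<lambda>y. prec_moment s y \<theta>) X = sample_mean (tri_dim s) n (\<lambda>y. prec_moment s y \<theta>0) X + prec_map s \<theta>0 \<theta>"
proof (rule eq_vecI)
  fix k assume "k < dim_vec (sample_mean (tri_dim s) n (\<lambda>y. prec_moment s y \<theta>0) X + prec_map s \<theta>0 \<theta>)"
  then have k: "k < tri_dim s" by simp
  have "prec_moment s y \<theta> $ k = prec_moment s y \<theta>0 $ k + prec_map s \<theta>0 \<theta> $ k" for y
    using k by (simp add: prec_moment_def prec_map_def tri_vec_index)
  then show "sample_mean (tri_dim s) n (\<lambda>y. prec_moment s y \<theta>) X $ k = (sample_mean (tri_dim s) n (\<lambda>y. prec_moment s y \<theta>0) X + prec_map s \<theta>0 \<theta>) $ k"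
    using k assms by (simp add: sample_mean_def sum.distrib add_divide_distrib)
qed (simp add: sample_mean_def)


section \<open>Sparse precision matrices\<close>

theorem theoremS3:
  fixes s :: "nat \<Rightarrow> nat"
    and p :: "nat \<Rightarrow> nat"
    and Pr :: "nat \<Rightarrow> 'w measure"
    and D :: "nat \<Rightarrow> nat \<Rightarrow> 'w \<Rightarrow> (nat \<Rightarrow> real)"
    and PD :: "nat \<Rightarrow> (nat \<Rightarrow> real) measure"
    and Par :: "nat \<Rightarrow> (nat \<Rightarrow> real) set"
    and \<theta>0 :: "nat \<Rightarrow> (nat \<Rightarrow> real)"
    and \<Sigma>0 \<Omega>0 :: "nat \<Rightarrow> real mat"
    and g :: "nat \<Rightarrow> (nat \<Rightarrow> real) \<Rightarrow> (nat \<Rightarrow> real) \<Rightarrow> real vec"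
    and Vn :: "nat \<Rightarrow> (nat \<Rightarrow> nat \<Rightarrow> real) \<Rightarrow> real mat"
    and pM :: "nat \<Rightarrow> nat set \<Rightarrow> real"
    and pT :: "nat \<Rightarrow> nat set \<Rightarrow> (nat \<Rightarrow> real) \<Rightarrow> real"
  assumes s_pos: "\<And>n. 1 \<le> s n"
    and p_eq: "\<And>n. p n = tri_dim (s n)"
    and g_eq: "\<And>n. g n = prec_moment (s n)"
    and Vn_eq: "\<And>n. Vn n = prec_weight (s n) n"
    and Y_space: "\<And>n. sets (PD n) = sets (Pi\<^sub>M {..<s n} (\<lambda>_. borel))"
    and Y_mean: "\<And>n i. i < s n \<Longrightarrow> integrable (PD n) (\<lambda>y. y i) \<and> (\<integral>y. y i \<partial>PD n) = 0"
    and Y_cov: "\<And>n. \<Sigma>0 n = var_mat (s n) (PD n) (\<lambda>y. vec (s n) y)"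
    and prec: "\<And>n. invertible_mat (\<Sigma>0 n) \<and> \<Omega>0 n = minv (\<Sigma>0 n)"
    and true_par: "\<And>n. \<theta>0 n = par_of_sym (s n) (\<Omega>0 n)"
    and A1: "cond_A1 Pr D PD p p g Par \<theta>0"
    and A2: "cond_A2 1 p p"
    and A3: "cond_A3 p \<theta>0"
    and A7: "cond_A7 p Par \<theta>0 pM pT"
    and A8: "cond_A8 p \<theta>0 pM"
    and eig_\<Omega>: "\<exists>lo>0. \<exists>hi. \<forall>n. \<forall>\<theta>\<in>Par n. eigenvalues_in (sym_of_par (s n) \<theta>) {lo..hi}"
    and mom8: "\<exists>K. \<forall>n. \<forall>j<s n. integrable (PD n) (\<lambda>y. y j ^ 8) \<and> (\<integral>y. y j ^ 8 \<partial>PD n) \<le> K"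
    and eig_V: "\<exists>lo>0. \<exists>hi. \<forall>n.
      eigenvalues_in (var_mat (p n) (PD n) (\<lambda>y. g n y (\<theta>0 n))) {lo..hi}"
  shows "cond_A4 1 PD p p g Par \<theta>0 \<and>
         cond_A5 PD p p g Par \<theta>0 \<and>
         cond_A6 Pr D PD p g \<theta>0 Vn \<and>
         bayesian_oracle Pr D PD p p g Par \<theta>0 Vn pM pT"
proof -
  have iid: "iid_sample Pr D PD" using A1 by (simp add: cond_A1_def)
  have par: "Par n \<subseteq> par_space (p n)" "\<theta>0 n \<in> Par n" "compact (Par n)"
    "k < p n \<Longrightarrow> integrable (PD n) (\<lambda>y. prec_moment (s n) y (\<theta>0 n) $ k)"
    "mean_vec (p n) (PD n) (\<lambda>y. prec_moment (s n) y (\<theta>0 n)) = 0\<^sub>v (p n)" for n k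
    using A1 by (auto simp: cond_A1_def g_eq)
  have ps: "prob_space (Pr n)" "prob_space (PD n)" for n using iid by (auto simp: iid_sample_def)
  have "\<exists>R>0. \<forall>n. (SUP \<theta>\<in>Par n. vnorm (vec (p n) \<theta>)) = R" using A1 by (simp add: cond_A1_def)
  then obtain R where R: "0 < R" "\<And>n. (SUP \<theta>\<in>Par n. vnorm (vec (p n) \<theta>)) = R" by auto
  have norm_le: "vnorm (vec (p n) \<theta>) \<le> R" if "\<theta> \<in> Par n" for n \<theta>
    using compact_norm_bounded[OF par(3) that, of "p n"] R(2)[of n] by simp
  have "\<exists>r>0. \<forall>n. {\<theta>\<in>par_space (p n). par_dist (p n) \<theta> (\<theta>0 n) < r} \<subseteq> Par n" using A1 by (simp add: cond_A1_def)
  then obtain r0 where r0: "0 < r0" "\<And>n \<theta>. \<theta> \<in> par_space (p n) \<Longrightarrow> par_dist (p n) \<theta> (\<theta>0 n) < r0 \<Longrightarrow> \<theta> \<in> Par n" by blast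
  from eig_\<Omega> obtain lo\<Omega> hi0 where eig: "0 < lo\<Omega>" "\<And>n \<theta>. \<theta> \<in> Par n \<Longrightarrow> eigenvalues_in (sym_of_par (s n) \<theta>) {lo\<Omega>..hi0}" by blast
  \<comment> \<open>The maximum makes the upper bound positive, as prec_ok demands.\<close>
  define hi\<Omega> where "hi\<Omega> = max hi0 1"
  have ok: "prec_ok (s n) lo\<Omega> hi\<Omega> \<theta>" if "\<theta> \<in> Par n" for n \<theta>
  proof -
    have "eigenvalues_in (sym_of_par (s n) \<theta>) {lo\<Omega>..hi\<Omega>}" using eig(2)[OF that] by (auto simp: eigenvalues_in_def hi\<Omega>_def le_max_iff_disj)
    then have "form_bounds (s n) (sym_of_par (s n) \<theta>) lo\<Omega> hi\<Omega>"
      by (rule eigenvalues_form_bounds[OF sym_of_par_carrier sym_of_par_transpose])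
    then show ?thesis using eig(1) by (simp add: prec_ok_def hi\<Omega>_def)
  qed

  have p1: "1 \<le> p n" for n using le_tri_dim[of "s n"] s_pos[of n] by (simp add: p_eq)
  have "\<exists>S. \<forall>n. s n \<le> S"
  proof -
    have prior: "is_prior (p n) (Par n) (pM n) (pT n)" for n using A7 by (simp add: cond_A7_def Let_def)
    have pM0: "0 < pM n (true_model (p n) (\<theta>0 n))" for n using A8 by (simp add: cond_A8_def Let_def)
    have "\<exists>c\<pi>::real. \<forall>n. \<forall>M\<subseteq>{..<p n}. \<forall>\<theta>. pT n M \<theta> \<le> c\<pi>"
      using A7 unfolding cond_A7_def Let_def by (elim conjE)
    then obtain c\<pi> where c\<pi>: "\<And>n M \<theta>. M \<subseteq> {..<p n} \<Longrightarrow> pT n M \<theta> \<le> c\<pi>" by blast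
    have "s n \<le> nat \<lceil>c\<pi> * exp (4 * pi * R\<^sup>2)\<rceil>" for n
    proof -
      have sub: "true_model (p n) (\<theta>0 n) \<subseteq> {..<p n}" by (auto simp: true_model_def)
      have "2 ^ card (true_model (p n) (\<theta>0 n)) \<le> c\<pi> * exp (4 * pi * R\<^sup>2)"
        using bounded_prior_model_size[OF sub prior pM0 c\<pi>[OF sub] norm_le less_imp_le[OF R(1)]] .
      moreover have "real (s n) \<le> real (card (true_model (p n) (\<theta>0 n)))"
        using prec_dim_le_model_size[OF ok[OF par(2)], of n] by (simp add: p_eq)
      moreover have "real (card (true_model (p n) (\<theta>0 n))) \<le> 2 ^ card (true_model (p n) (\<theta>0 n))"
        using of_nat_less_two_power[of "card (true_model (p n) (\<theta>0 n))", where 'a = real] by linarith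
      ultimately show ?thesis by linarith
    qed
    then show ?thesis by blast
  qed
  then obtain S where S: "\<And>n. s n \<le> S" by blast
  define P where "P = tri_dim S"
  have P: "p n \<le> P" for n using S tri_dim_mono by (simp add: p_eq P_def)

  have diam: "par_dist (p n) \<theta> (\<theta>0 n) \<le> 2 * R" if "\<theta> \<in> Par n" for n \<theta>
  proof -
    have "vec (p n) \<theta> - vec (p n) (\<theta>0 n) = vec (p n) \<theta> + - vec (p n) (\<theta>0 n)" by (intro eq_vecI) auto
    then show ?thesis
      using vnorm_triangle[of "vec (p n) \<theta>" "- vec (p n) (\<theta>0 n)"] norm_le[OF that] norm_le[OF par(2)[of n]]
      by (simp add: par_dist_def vnorm_uminus)
  qed
  have Eg: "mean_vec (p n) (PD n) (\<lambda>y. g n y \<theta>) = prec_map (s n) (\<theta>0 n) \<theta>" for n \<theta>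
    unfolding g_eq p_eq using par(4)[of _ n] par(5)[of n] by (intro mean_prec_moment ps) (auto simp: p_eq)
  have A4: "cond_A4 1 PD p p g Par \<theta>0"
    by (rule prec_cond_A4[OF ps(2) p_eq s_pos g_eq ok par(2) diam S])
  note A5jac = prec_cond_A5[where g = g and PD = PD and S = S, OF p_eq s_pos Eg par(1) ok par(2) r0 S]
  from eig_V obtain loV hiV where eV: "0 < loV" "\<And>n. eigenvalues_in (var_mat (p n) (PD n) (\<lambda>y. g n y (\<theta>0 n))) {loV..hiV}" by blast
  have fbV: "form_bounds (p n) (var_mat (p n) (PD n) (\<lambda>y. g n y (\<theta>0 n))) loV hiV" for n
    by (rule eigenvalues_form_bounds[OF var_mat_carrier var_mat_transpose eV(2)])
  have Wc: "Vn n X \<in> carrier_mat (p n) (p n)" "(Vn n X)\<^sup>T = Vn n X" for n X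
    by (simp_all add: Vn_eq prec_weight_def Let_def p_eq sample_var_transpose)
  from mom8 obtain K where K: "\<And>n j. j < s n \<Longrightarrow> integrable (PD n) (\<lambda>y. y j ^ 8) \<and> (\<integral>y. y j ^ 8 \<partial>PD n) \<le> K" by blast
  obtain ci where ci: "\<And>s. s \<le> S \<Longrightarrow> prec_const s lo\<Omega> hi\<Omega> \<le> ci"
    using bounded_on_initial_segment[of S "\<lambda>s. prec_const s lo\<Omega> hi\<Omega>"] by blast
  have cib: "\<bar>prec_inv (s n) (\<theta>0 n) $$ (tri_row k, tri_col k)\<bar> \<le> ci" if "k < p n" for n k
  proof -
    note X = prec_ok_props(1,6)[OF ok[OF par(2)], of n]
    have "\<bar>prec_inv (s n) (\<theta>0 n) $$ (tri_row k, tri_col k)\<bar> \<le> mnorm1 (prec_inv (s n) (\<theta>0 n))"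
      using X(1) that tri_row_less[of k "s n"] tri_col_less[of k "s n"] by (intro abs_index_le_mnorm1) (auto simp: p_eq)
    then show ?thesis using X(2) ci[OF S, of n] by linarith
  qed
  define tame where "tame T \<delta> n \<omega> \<longleftrightarrow> typical_sample (p n) n (PD n) (\<lambda>y. g n y (\<theta>0 n)) (Vn n (\<lambda>i. D n i \<omega>)) T \<delta> (\<lambda>i. D n i \<omega>)" for T \<delta> n \<omega>
  have good: "\<exists>T>0. \<forall>\<delta>>0. likely Pr \<eta> (tame T \<delta>)" if "0 < \<eta>" for \<eta>
    unfolding tame_def[abs_def] g_eq Vn_eq
    by (rule prec_typical_sample_likely[OF iid p_eq S Y_space K par(5) cib that]; assumption)
  have A6: "cond_A6 Pr D PD p g \<theta>0 Vn"
  proof (rule prec_cond_A6[where Vn = Vn and D = D and p = p and g = g and PD = PD and ?\<theta>0.0 = \<theta>0, OF ps(1) p1 P eV(1) fbV Wc])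
    fix \<delta> \<eta> :: real assume d: "0 < \<delta>" and eta: "0 < \<eta>"
    from good[OF eta] d obtain T where "likely Pr \<eta> (tame T \<delta>)" by blast
    then show "likely Pr \<eta> (\<lambda>n \<omega>. \<forall>k<p n. \<forall>l<p n.
         \<bar>Vn n (\<lambda>i. D n i \<omega>) $$ (k, l) - var_mat (p n) (PD n) (\<lambda>y. g n y (\<theta>0 n)) $$ (k, l)\<bar> \<le> \<delta>)"
      by (rule likely_mono) (simp add: tame_def typical_sample_def)
  qed

  obtain L where L: "0 < L" "\<And>s. s \<le> S \<Longrightarrow> lip_const s lo\<Omega> hi\<Omega> \<le> L"
    using bounded_on_initial_segment[of S "\<lambda>s. lip_const s lo\<Omega> hi\<Omega>"] by blast
  obtain Kq where Kq: "0 < Kq" "\<And>s. s \<le> S \<Longrightarrow> quad_const s lo\<Omega> hi\<Omega> \<le> Kq"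
    using bounded_on_initial_segment[of S "\<lambda>s. quad_const s lo\<Omega> hi\<Omega>"] by blast
  have Ln: "u \<le> L * v" if "u \<le> lip_const (s n) lo\<Omega> hi\<Omega> * v" "0 \<le> v" for u v n
    using that mult_right_mono[OF L(2)[OF S[of n]], of v] by linarith
  \<comment> \<open>Spectral bounds for weight matrices of typical samples: those of V, relaxed by loV / 2 or more.\<close>
  define lo where "lo = loV / 2"
  define hi where "hi = max hiV 0 + loV"
  have lohi: "0 < lo" "0 < hi" using eV(1) by (auto simp: lo_def hi_def)
  have loc: "quasi_post_model n (p n) (Par n) (\<theta>0 n) (prec_map (s n) (\<theta>0 n)) (prec_jac (s n) (\<theta>0 n)) V b lo hi L Kq T (true_model (p n) (\<theta>0 n))"
    if T: "0 \<le> T" and n: "0 < n" and V: "form_bounds (p n) V lo hi" and b: "b \<in> carrier_vec (p n)" "vnorm b \<le> T / sqrt (real n)" for n V b T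
  proof unfold_locales
    show "Par n \<in> sets borel" using par(3) by (intro borel_closed compact_imp_closed)
    show "par_dist (p n) \<theta> (\<theta>0 n) \<le> L * vnorm (prec_map (s n) (\<theta>0 n) \<theta>)" if "\<theta> \<in> Par n" for \<theta>
      using prec_map_lower[OF ok[OF that] ok[OF par(2)]] by (intro Ln[of _ n]) (auto simp: p_eq)
    show "continuous_on (Par n) (\<lambda>\<theta>. prec_map (s n) (\<theta>0 n) \<theta> $ k)" if "k < p n" for k
      by (rule prec_map_continuous[OF ok]) (use that p_eq in auto)
    show "vnorm v \<le> L * vnorm (prec_jac (s n) (\<theta>0 n) *\<^sub>v v)" "vnorm (prec_jac (s n) (\<theta>0 n) *\<^sub>v v) \<le> L * vnorm v"
      if "v \<in> carrier_vec (p n)" for v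
    proof -
      have vv: "v = vec (tri_dim (s n)) (\<lambda>k. v $ k)" using that p_eq by auto
      show "vnorm v \<le> L * vnorm (prec_jac (s n) (\<theta>0 n) *\<^sub>v v)" "vnorm (prec_jac (s n) (\<theta>0 n) *\<^sub>v v) \<le> L * vnorm v"
        using prec_jac_upper[OF ok[OF par(2)], of n "\<lambda>k. v $ k"] prec_jac_lower[OF ok[OF par(2)], of n "\<lambda>k. v $ k"] vv
        by (auto intro!: Ln[of _ n])
    qed
    show "vnorm (prec_map (s n) (\<theta>0 n) \<theta> - prec_jac (s n) (\<theta>0 n) *\<^sub>v (vec (p n) \<theta> - vec (p n) (\<theta>0 n))) \<le> Kq * (par_dist (p n) \<theta> (\<theta>0 n))\<^sup>2"
      if "\<theta> \<in> Par n" for \<theta>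
    proof -
      have "prec_map (s n) (\<theta>0 n) \<theta> - prec_map (s n) (\<theta>0 n) (\<theta>0 n) = prec_map (s n) (\<theta>0 n) \<theta>"
        by (intro eq_vecI) (auto simp: prec_map_def)
      then have "vnorm (prec_map (s n) (\<theta>0 n) \<theta> - prec_jac (s n) (\<theta>0 n) *\<^sub>v (vec (p n) \<theta> - vec (p n) (\<theta>0 n)))
         \<le> quad_const (s n) lo\<Omega> hi\<Omega> * (par_dist (p n) \<theta> (\<theta>0 n))\<^sup>2"
        using prec_map_quadratic[OF ok[OF that] ok[OF par(2)], of "\<theta>0 n"] by (simp add: p_eq)
      also have "\<dots> \<le> Kq * (par_dist (p n) \<theta> (\<theta>0 n))\<^sup>2" by (intro mult_right_mono Kq S) simp
      finally show ?thesis .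
    qed
    show "\<theta>0 n k = 0" if "k \<notin> true_model (p n) (\<theta>0 n)" for k
      using that par(1,2)[of n] by (cases "k < p n") (auto simp: true_model_def par_space_def)
  qed (use n V b T par lohi L Kq in \<open>auto simp: p_eq true_model_def\<close>)

  define b where "b n \<omega> = sample_mean (p n) n (\<lambda>y. g n y (\<theta>0 n)) (\<lambda>i. D n i \<omega>)" for n \<omega>
  have bc: "b n \<omega> \<in> carrier_vec (p n)" for n \<omega> by (simp add: b_def sample_mean_def)
  define M0 where "M0 n = true_model (p n) (\<theta>0 n)" for n
  define post_M0 where "post_M0 n V b = model_post (p n) (Par n) (\<lambda>\<theta>. quasi_lik n V (b + prec_map (s n) (\<theta>0 n) \<theta>)) (pM n) (pT n) (M0 n)" for n V b
  define dev where "dev n V b A = \<bar>par_post (p n) (Par n) (\<lambda>\<theta>. quasi_lik n V (b + prec_map (s n) (\<theta>0 n) \<theta>)) (pM n) (pT n) A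
      - (LINT \<theta>:A \<inter> par_model (Par n) (M0 n)|leb_model (M0 n). post_density n (prec_jac (s n) (\<theta>0 n)) V b (\<theta>0 n) (M0 n) \<theta>)\<bar>" for n V b A
  \<comment> \<open>The factor 3 / 4 leaves room for the supremum over A, which has to be strictly below e.\<close>
  have post: "wpa1 Pr Q"
    if e: "0 < e" and Q: "\<And>n \<omega>. 0 < n \<Longrightarrow> \<bar>post_M0 n (Vn n (\<lambda>i. D n i \<omega>)) (b n \<omega>) - 1\<bar> < e \<Longrightarrow>
      (\<And>A. A \<in> sets borel \<Longrightarrow> A \<subseteq> Par n \<Longrightarrow> dev n (Vn n (\<lambda>i. D n i \<omega>)) (b n \<omega>) A \<le> 3 / 4 * e) \<Longrightarrow> Q n \<omega>"
    for e Q
  proof (rule wpa1I[OF ps(1)])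
    fix \<eta> :: real assume eta: "0 < \<eta>"
    from good[OF eta] obtain T where T: "0 < T" and gd: "\<forall>\<delta>>0. likely Pr \<eta> (tame T \<delta>)" by blast
    have P0: "0 < real P" using p1[of 0] P[of 0] by linarith
    define \<delta> where "\<delta> = loV / 2 / (real P * real P)"
    have \<delta>: "0 < \<delta>" "real P * real P * \<delta> = loV / 2" using eV(1) P0 by (auto simp: \<delta>_def)
    have ev: "\<forall>\<^sub>F n in sequentially. \<forall>V b. form_bounds (p n) V lo hi \<longrightarrow> b \<in> carrier_vec (p n) \<longrightarrow> vnorm b \<le> T / sqrt (real n) \<longrightarrow>
      \<bar>post_M0 n V b - 1\<bar> < e \<and> (\<forall>A\<in>sets borel. A \<subseteq> Par n \<longrightarrow> dev n V b A \<le> 3 / 4 * e)"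
      unfolding post_M0_def dev_def M0_def
      by (rule oracle_eventually[OF loc[OF less_imp_le[OF T]] lohi L(1) p1 P A3 A7 A8 r0 e])
    show "likely Pr \<eta> Q"
    proof (rule likely_mono[OF gd[rule_format, OF \<delta>(1)]])
      show "\<forall>\<^sub>F n in sequentially. \<forall>\<omega>. tame T \<delta> n \<omega> \<longrightarrow> Q n \<omega>"
        using ev eventually_gt_at_top[of 0]
      proof eventually_elim
        case (elim n)
        show ?case
        proof (intro allI impI)
          fix \<omega> assume w: "tame T \<delta> n \<omega>"
          let ?V = "Vn n (\<lambda>i. D n i \<omega>)"
          have fb: "form_bounds (p n) ?V (loV - real (p n) * real (p n) * \<delta>) (hiV + real (p n) * real (p n) * \<delta>)"
            using w \<delta>(1) by (intro form_bounds_perturb(1)[OF fbV Wc]) (auto simp: tame_def typical_sample_def)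
          have "real (p n) * real (p n) * \<delta> \<le> real P * real P * \<delta>" using P[of n] \<delta>(1) by (intro mult_right_mono mult_mono) auto
          then have "lo \<le> loV - real (p n) * real (p n) * \<delta>" "hiV + real (p n) * real (p n) * \<delta> \<le> hi"
            using \<delta>(2) eV(1) by (auto simp: lo_def hi_def)
          then have fb2: "form_bounds (p n) ?V lo hi" by (rule form_bounds_weaken[OF fb])
          have vb: "vnorm (b n \<omega>) \<le> T / sqrt (real n)" using w by (simp add: tame_def typical_sample_def b_def)
          note c = elim(1)[rule_format, OF fb2 bc vb]
          show "Q n \<omega>" by (rule Q[OF elim(2)]) (use c in auto)
        qed
      qed
    qed
  qed
  have gbar: "sample_mean (p n) n (\<lambda>y. g n y \<theta>) (\<lambda>i. D n i \<omega>) = b n \<omega> + prec_map (s n) (\<theta>0 n) \<theta>" if "0 < n" for n \<omega> \<theta>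
    unfolding b_def g_eq p_eq by (rule sample_mean_prec_moment[OF that])
  have jac: "jacobian (p n) (p n) (\<lambda>\<theta>. mean_vec (p n) (PD n) (\<lambda>y. g n y \<theta>)) (\<theta>0 n) = prec_jac (s n) (\<theta>0 n)" for n
    unfolding Eg by (rule A5jac(2))
  have O: "bayesian_oracle Pr D PD p p g Par \<theta>0 Vn pM pT"
    unfolding bayesian_oracle_def Let_def jac b_def[symmetric] M0_def[symmetric]
  proof (intro conjI allI impI; rule post)
    fix e :: real and n \<omega>
    assume n: "0 < n" and e: "0 < e"
      and h: "\<And>A. A \<in> sets borel \<Longrightarrow> A \<subseteq> Par n \<Longrightarrow> dev n (Vn n (\<lambda>i. D n i \<omega>)) (b n \<omega>) A \<le> 3 / 4 * e"
    have "(SUP A\<in>{A \<in> sets borel. A \<subseteq> Par n}. ennreal (dev n (Vn n (\<lambda>i. D n i \<omega>)) (b n \<omega>) A)) \<le> ennreal (3 / 4 * e)"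
      using h by (intro SUP_least ennreal_leI) auto
    also have "\<dots> < ennreal e" using e by (simp add: ennreal_less_iff)
    finally show "(SUP A\<in>{A \<in> sets borel. A \<subseteq> Par n}. ennreal
            \<bar>par_post (p n) (Par n) (\<lambda>\<theta>. quasi_lik n (Vn n (\<lambda>i. D n i \<omega>)) (sample_mean (p n) n (\<lambda>y. g n y \<theta>) (\<lambda>i. D n i \<omega>))) (pM n) (pT n) A
             - (LINT \<theta>:A \<inter> par_model (Par n) (M0 n)|leb_model (M0 n).
                  mvn_density (subvec (M0 n) (\<theta>0 n)
                  - minv ((submatrix (prec_jac (s n) (\<theta>0 n)) UNIV (M0 n))\<^sup>T * minv (Vn n (\<lambda>i. D n i \<omega>)) * submatrix (prec_jac (s n) (\<theta>0 n)) UNIV (M0 n)) *\<^sub>v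
                    ((submatrix (prec_jac (s n) (\<theta>0 n)) UNIV (M0 n))\<^sup>T *\<^sub>v (minv (Vn n (\<lambda>i. D n i \<omega>)) *\<^sub>v b n \<omega>)))
                  ((1 / real n) \<cdot>\<^sub>m minv ((submatrix (prec_jac (s n) (\<theta>0 n)) UNIV (M0 n))\<^sup>T * minv (Vn n (\<lambda>i. D n i \<omega>)) * submatrix (prec_jac (s n) (\<theta>0 n)) UNIV (M0 n)))
                  (subvec (M0 n) \<theta>))\<bar>) < ennreal e"
      by (simp only: gbar[OF n] dev_def post_density_def Let_def)
  qed (simp_all add: post_M0_def gbar)
  show ?thesis using A4 A5jac(1) A6 O by blast
qed

end
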